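(* Assume the sampling-design, moment, smoothness, stability, identifiability, nondegeneracy and moment-fitting conditions (A1)--(A7) listed in the context. Then, as $n\to\infty$, $$\hat u_n = u_n+\hat b_n[\hat w_n]+o_p(1),$$ where $\hat b_n\in\mathbb{R}^q\otimes\mathbb{R}^{p_\gamma}$ is defined by $$\hat b_n=-\Big(\frac1{nh_n}\sum_{j=1}^n\zeta(\hat\delta_j)\Big)\otimes\Big(\frac1n\sum_{j=1}^n\frac{\partial_\gamma \hat c_{t_{j-1}}}{\hat c_{t_{j-1}}}\Big),\qquad \zeta(z):=z\,\partial\varphi(z),$$ and $\hat b_n[\hat w_n]$ denotes the matrix $\hat b_n$ applied to the vector $\hat w_n$.
   Context: Setting. On a complete filtered probability space $(\Omega,\mathcal F,(\mathcal F_t)_{t\ge0},\mathbb P)$ let $J$ be a one-dimensional $(\mathcal F_t)$-adapted pure-jump Lévy process (no Wiener part) with Lévy measure $\nu_0$, independent of the $\mathcal F_0$-measurable initial variable $X_0$. The process $X$ solves $dX_t=a(X_t,\alpha)dt+c(X_{t-},\gamma)dJ_t$ with true parameter value $\theta_0=(\alpha_0,\gamma_0)\in\Theta:=\Theta_\alpha\times\Theta_\gamma$, where $\Theta_\alpha\subset\mathbb R^{p_\alpha}$, $\Theta_\gamma\subset\mathbb R^{p_\gamma}$ are bounded convex domains, $p=p_\alpha+p_\gamma$, $\theta=(\alpha,\gamma)$, and $a:\mathbb R\times\Theta_\alpha\to\mathbb R$, $c:\mathbb R\times\Theta_\gamma\to\mathbb R$ are known. $P_0$ and $E_0$ denote the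 probability and expectation under $\theta_0$; $o_p(1)$ is under $P_0$. $X$ is observed at $t_j=jh_n$, $0\le j\le n$, $h_n>0$. Notation. $\Delta_jZ=Z_{t_j}-Z_{t_{j-1}}$. For a function $f$ on $\mathbb R\times\Theta$: $f_s(\theta)=f(X_s,\theta)$, $f_s=f(X_s,\theta_0)$, $\hat f_s=f(X_s,\hat\theta_n)$ (and $\partial_\gamma\hat c_s=(\partial_\gamma c)(X_s,\hat\gamma_n)$, etc.). $x^{\otimes2}=xx^T$. $\nu_0(\varphi)=\int\varphi(z)\nu_0(dz)$. Estimator. With $M(x,\theta)=\partial_\alpha a(x,\alpha)c^{-2}(x,\gamma)$ put $G_n^\alpha(\theta)=\frac1{nh_n}\sum_{j=1}^nM_{t_{j-1}}(\theta)(\Delta_jX-h_na_{t_{j-1}}(\alpha))$, $G_n^\gamma(\theta)=\frac1{nh_n}\sum_{j=1}^n\{[-\partial_\gamma c_{t_{j-1}}^{-2}(\gamma)](\Delta_jX-h_na_{t_{j-1}}(\alpha))^2-h_n\frac{\partial_\gamma c^2_{t_{j-1}}(\gamma)}{c^2_{t_{j-1}}(\gamma)}\}$, and $\hat\theta_n=(\hat\alpha_n,\hat\gamma_n)\in\operatorname{argmin}_{\theta\in\bar\Theta}|(G_n^\alpha(\theta),G_n^\gamma(\theta))|$ ($\bar\Theta$ the closure of $\Theta$, $|\cdot|$ Euclidean norm). Let $\hat w_n=\sqrt{nh_n}(\hat\gamma_n-\gamma_0)$, $\hat\delta_j=\hat c_{t_{j-1}}^{-1}(\Delta_jX-h_n\hat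 a_{t_{j-1}})$, $u_n=\sqrt{nh_n}\big(\frac1{nh_n}\sum_{j=1}^n\varphi(\Delta_jJ)-\nu_0(\varphi)\big)$, $\hat u_n=\sqrt{nh_n}\big(\frac1{nh_n}\sum_{j=1}^n\varphi(\hat\delta_j)-\nu_0(\varphi)\big)$. (A1) Sampling design: $nh_n^2\to0$ and $nh_n^{1+\epsilon_0}\to\infty$ for some $\epsilon_0\in(0,1)$. (A2) Moments: $E[J_1]=0$, $E[J_1^2]=1$, $E[|J_1|^q]<\infty$ for all $q>0$. (A3) Smoothness: $a(\cdot,\alpha_0)$ and $c(\cdot,\gamma_0)$ are Lipschitz; for each $i\in\{0,1,2\}$, $k\in\{0,\dots,5\}$ the partial derivatives $\partial_x^i\partial_\alpha^ka$, $\partial_x^i\partial_\gamma^kc$ exist, for each $x$ the maps $\alpha\mapsto\partial_x^i\partial_\alpha^ka(x,\alpha)$ and $\gamma\mapsto\partial_x^i\partial_\gamma^kc(x,\gamma)$ extend continuously to the boundary of the parameter domain, and there is $C_{(i,k)}\ge0$ with $\sup_{(x,\alpha,\gamma)}\frac1{1+|x|^{C_{(i,k)}}}\{|\partial_x^i\partial_\alpha^ka(x,\alpha)|+|\partial_x^i\partial_\gamma^kc(x,\gamma)|+|c^{-1}(x,\gamma)|\}<\infty$ (sup over $\mathbb R\times\Theta_\alpha\times\Theta_\gamma$). (A4) Stability: there is a probability measure $\pi_0$ such that for every $q>0$ there are constants $\kappa,K>0$ with $\sup_{t\ge0}e^{\kappa t}\|P_t(x,\cdot)-\pi_0\|_g\le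 Kg(x)$ for all $x\in\mathbb R$, where $g(x)=1+|x|^q$, $P_t$ is the transition probability of $X$ (under $\theta_0$), and $\|m\|_g=\sup\{|m(f)|: f\ \text{real measurable},\ |f|\le g\}$; moreover $\sup_{t\ge0}E_0[|X_t|^q]<\infty$ for all $q>0$. (A5) Identifiability: there are positive constants $\chi_\alpha,\chi_\gamma$ with $|G^\alpha_\infty(\theta)|\ge\chi_\alpha|\alpha-\alpha_0|$ and $|G^\gamma_\infty(\theta)|\ge\chi_\gamma|\gamma-\gamma_0|$ for all $\theta$, where $G_\infty^\alpha(\theta)=\int\frac{\partial_\alpha a(x,\alpha)}{c^2(x,\gamma)}(a(x,\alpha_0)-a(x,\alpha))\pi_0(dx)$, $G_\infty^\gamma(\theta)=2\int\frac{\partial_\gamma c(x,\gamma)}{c^3(x,\gamma)}(c^2(x,\gamma_0)-c^2(x,\gamma))\pi_0(dx)$. (A6) Nondegeneracy: $\mathcal I^\alpha(\theta_0)=\int\frac{(\partial_\alpha a(x,\alpha_0))^{\otimes2}}{c^2(x,\gamma_0)}\pi_0(dx)$ and $\mathcal I^\gamma(\theta_0)=4\int\frac{(\partial_\gamma c(x,\gamma_0))^{\otimes2}}{c^2(x,\gamma_0)}\pi_0(dx)$ are invertible. (A7) Moment-fitting function: $\varphi\in\mathcal K$. Here $q$ is a fixed positive integer, $\rho$ is a fixed constant with $\rho>(1-\epsilon_0)\vee\beta$, $\beta=\inf\{r\ge0:\int_{|z|\le1}|z|^r\nu_0(dz)<\infty\}$ is the Blumenthal--Getoor index of $J$, and $\mathcal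 K$ is the set of five times differentiable $f:\mathbb R\to\mathbb R^q$ for which there are constants $C_i\ge0$ ($0\le i\le5$) with $\limsup_{z\to0}\{|z|^{-\rho}|f(z)|+|z|^{-1}|\partial f(z)|\}<\infty$, $\limsup_{z\to\infty}\{\frac{|f(z)|}{1+|z|^{C_0}}+\frac{|\partial f(z)|}{|z|^{1+C_1}}\}<\infty$, $\sup_{z\in\mathbb R}\frac{|\partial^if(z)|}{1+|z|^{C_i}}<\infty$ for $i\in\{2,3,4,5\}$. *)

theory Defs
  imports "HOL-Probability.Probability"
begin

section \<open>Stochastic background\<close>

text \<open>Convergence to 0 in probability. Measurability is part of the notion, because
  \<^const>\<open>measure\<close> is 0 on non-measurable sets.\<close>

definition small_in_prob :: "'w measure \<Rightarrow> (nat \<Rightarrow> 'w \<Rightarrow> 'v::real_normed_vector) \<Rightarrow> bool" where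
  "small_in_prob M R \<longleftrightarrow>
     (\<forall>n. R n \<in> borel_measurable M) \<and>
     (\<forall>e>0. (\<lambda>n. measure M {\<omega> \<in> space M. norm (R n \<omega>) > e}) \<longlonglongrightarrow> 0)"

text \<open>Processes are indexed by \<^typ>\<open>real\<close>; only times \<open>t \<ge> 0\<close> are ever constrained.\<close>

definition complete_filtered_prob_space :: "'w measure \<Rightarrow> (real \<Rightarrow> 'w measure) \<Rightarrow> bool" where
  "complete_filtered_prob_space M F \<longleftrightarrow>
     prob_space M \<and> complete_measure M \<and>
     (\<forall>t\<ge>0. subalgebra M (F t)) \<and>
     (\<forall>s t. 0 \<le> s \<and> s \<le> t \<longrightarrow> sets (F s) \<subseteq> sets (F t)) \<and>
     null_sets M \<subseteq> sets (F 0)"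

definition adapted :: "(real \<Rightarrow> 'w measure) \<Rightarrow> (real \<Rightarrow> 'w \<Rightarrow> real) \<Rightarrow> bool" where
  "adapted F Y \<longleftrightarrow> (\<forall>t\<ge>0. Y t \<in> borel_measurable (F t))"

definition cadlag :: "(real \<Rightarrow> real) \<Rightarrow> bool" where
  "cadlag f \<longleftrightarrow>
     (\<forall>t\<ge>0. (f \<longlongrightarrow> f t) (at_right t)) \<and> (\<forall>t>0. \<exists>l. (f \<longlongrightarrow> l) (at_left t))"

definition levy_process ::
  "'w measure \<Rightarrow> (real \<Rightarrow> 'w measure) \<Rightarrow> (real \<Rightarrow> 'w \<Rightarrow> real) \<Rightarrow> bool" where
  "levy_process M F J \<longleftrightarrow>
     adapted F J \<and> (AE \<omega> in M. J 0 \<omega> = 0) \<and> (AE \<omega> in M. cadlag (\<lambda>t. J t \<omega>)) \<and>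
     (\<forall>s t. 0 \<le> s \<and> s \<le> t \<longrightarrow>
        prob_space.indep_set M (sets (F s))
          (sets (vimage_algebra (space M) (\<lambda>\<omega>. J t \<omega> - J s \<omega>) borel)) \<and>
        distr M borel (\<lambda>\<omega>. J t \<omega> - J s \<omega>) = distr M borel (J (t - s)))"

definition is_levy_measure :: "real measure \<Rightarrow> bool" where
  "is_levy_measure \<nu> \<longleftrightarrow>
     sets \<nu> = sets borel \<and> emeasure \<nu> {0} = 0 \<and> (\<integral>\<^sup>+z. ennreal (min 1 (z\<^sup>2)) \<partial>\<nu>) < \<infinity>"

text \<open>No Wiener part and Levy measure \<open>\<nu>\<close>: the Levy-Khintchine triplet of \<open>J\<close> is \<open>(b, 0, \<nu>)\<close>
  for some drift \<open>b\<close> (with respect to the truncation \<open>z \<cdot> 1(\<bar>z\<bar> \<le> 1)\<close>).\<close>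

definition pure_jump_levy_process ::
  "'w measure \<Rightarrow> (real \<Rightarrow> 'w measure) \<Rightarrow> real measure \<Rightarrow> (real \<Rightarrow> 'w \<Rightarrow> real) \<Rightarrow> bool" where
  "pure_jump_levy_process M F \<nu> J \<longleftrightarrow>
     levy_process M F J \<and> is_levy_measure \<nu> \<and>
     (\<exists>b. \<forall>t\<ge>0. \<forall>u. char (distr M borel (J t)) u =
        exp (complex_of_real t * (\<i> * complex_of_real (b * u) +
          (CLINT z|\<nu>. iexp (u * z) - 1 - \<i> * complex_of_real (u * z * indicator {-1..1} z)))))"

definition process_indep_var ::
  "'w measure \<Rightarrow> (real \<Rightarrow> 'w \<Rightarrow> real) \<Rightarrow> ('w \<Rightarrow> real) \<Rightarrow> bool" where
  "process_indep_var M J Y \<longleftrightarrow>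
     prob_space.indep_set M
       (sets (vimage_algebra (space M) (\<lambda>\<omega>. \<lambda>t\<in>{0..}. J t \<omega>) (PiM {0..} (\<lambda>_. borel))))
       (sets (vimage_algebra (space M) Y borel))"

text \<open>Ito integral over \<open>(0,T]\<close> against a square-integrable martingale \<open>J\<close> with
  \<open>\<langle>J\<rangle>\<^sub>t = t\<close>. A simple predictable integrand is a finite list of triples \<open>(s, t, \<xi>)\<close> standing
  for \<open>\<xi> \<cdot> 1((s,t])\<close>; the integral of a general \<open>H\<close> is the limit in probability of the
  integrals of simple integrands that approximate \<open>H\<close> in \<open>L\<^sup>2([0,T])\<close>, in probability.\<close>

definition simple_integrand ::
  "(real \<Rightarrow> 'w measure) \<Rightarrow> (real \<times> real \<times> ('w \<Rightarrow> real)) list \<Rightarrow> bool" where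
  "simple_integrand F S \<longleftrightarrow>
     (\<forall>(s, t, \<xi>) \<in> set S. 0 \<le> s \<and> s \<le> t \<and> \<xi> \<in> borel_measurable (F s) \<and>
        (\<exists>B. \<forall>\<omega> \<in> space (F s). \<bar>\<xi> \<omega>\<bar> \<le> B))"

definition simple_value ::
  "(real \<times> real \<times> ('w \<Rightarrow> real)) list \<Rightarrow> real \<Rightarrow> 'w \<Rightarrow> real" where
  "simple_value S r \<omega> = (\<Sum>(s, t, \<xi>)\<leftarrow>S. \<xi> \<omega> * indicator {s<..t} r)"

definition simple_integral ::
  "(real \<Rightarrow> 'w \<Rightarrow> real) \<Rightarrow> (real \<times> real \<times> ('w \<Rightarrow> real)) list \<Rightarrow> real \<Rightarrow> 'w \<Rightarrow> real" where
  "simple_integral J S T \<omega> = (\<Sum>(s, t, \<xi>)\<leftarrow>S. \<xi> \<omega> * (J (min t T) \<omega> - J (min s T) \<omega>))"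

definition has_ito_integral ::
  "'w measure \<Rightarrow> (real \<Rightarrow> 'w measure) \<Rightarrow> (real \<Rightarrow> 'w \<Rightarrow> real) \<Rightarrow> real \<Rightarrow>
   (real \<Rightarrow> 'w \<Rightarrow> real) \<Rightarrow> ('w \<Rightarrow> real) \<Rightarrow> bool" where
  "has_ito_integral M F J T H I \<longleftrightarrow>
     (AE \<omega> in M. set_integrable lborel {0..T} (\<lambda>s. (H s \<omega>)\<^sup>2)) \<and>
     (\<exists>S. (\<forall>k. simple_integrand F (S k)) \<and>
        small_in_prob M (\<lambda>k \<omega>. LBINT s:{0..T}. (simple_value (S k) s \<omega> - H s \<omega>)\<^sup>2) \<and>
        small_in_prob M (\<lambda>k \<omega>. simple_integral J (S k) T \<omega> - I \<omega>))"

text \<open>\<open>dX\<^sub>t = f(X\<^sub>t) dt + g(X\<^sub>t\<^sub>-) dJ\<^sub>t\<close>. The value at \<open>s = 0\<close> of the left-limit process is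
  irrelevant, since the time integral in \<^const>\<open>has_ito_integral\<close> ignores single points.\<close>

definition sde_solution ::
  "'w measure \<Rightarrow> (real \<Rightarrow> 'w measure) \<Rightarrow> (real \<Rightarrow> 'w \<Rightarrow> real) \<Rightarrow>
   (real \<Rightarrow> real) \<Rightarrow> (real \<Rightarrow> real) \<Rightarrow> (real \<Rightarrow> 'w \<Rightarrow> real) \<Rightarrow> bool" where
  "sde_solution M F J f g X \<longleftrightarrow>
     adapted F X \<and> (AE \<omega> in M. cadlag (\<lambda>t. X t \<omega>)) \<and>
     (\<forall>t\<ge>0. \<exists>I. has_ito_integral M F J t (\<lambda>s \<omega>. g (Lim (at_left s) (\<lambda>r. X r \<omega>))) I \<and>
        (AE \<omega> in M. X t \<omega> = X 0 \<omega> + (LBINT s:{0..t}. f (X s \<omega>)) + I \<omega>))"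

definition is_transition_probability ::
  "'w measure \<Rightarrow> (real \<Rightarrow> 'w measure) \<Rightarrow> (real \<Rightarrow> 'w \<Rightarrow> real) \<Rightarrow>
   (real \<Rightarrow> real \<Rightarrow> real measure) \<Rightarrow> bool" where
  "is_transition_probability M F X P \<longleftrightarrow>
     (\<forall>t\<ge>0. P t \<in> borel \<rightarrow>\<^sub>M prob_algebra borel) \<and>
     (\<forall>x. P 0 x = return borel x) \<and>
     (\<forall>s\<ge>0. \<forall>t\<ge>0. \<forall>x. P (s + t) x = bind (P s x) (P t)) \<and>
     (\<forall>s\<ge>0. \<forall>t\<ge>0. \<forall>A \<in> sets borel. AE \<omega> in M.
        real_cond_exp M (F s) (\<lambda>\<omega>'. indicator A (X (s + t) \<omega>')) \<omega> = measure (P t (X s \<omega>)) A)"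

text \<open>\<open>\<parallel>\<mu> - \<mu>'\<parallel>\<^sub>g\<close>; it is set to \<open>\<infinity>\<close> unless both measures integrate \<open>g\<close>, as
  otherwise the Bochner integrals below would default to 0.\<close>

definition weighted_dist :: "(real \<Rightarrow> real) \<Rightarrow> real measure \<Rightarrow> real measure \<Rightarrow> ennreal" where
  "weighted_dist g \<mu> \<mu>' =
     (if integrable \<mu> g \<and> integrable \<mu>' g
      then (SUP f \<in> {f \<in> borel_measurable borel. \<forall>x. \<bar>f x\<bar> \<le> g x}.
              ennreal \<bar>(LINT x|\<mu>. f x) - (LINT x|\<mu>'. f x)\<bar>)
      else \<infinity>)"

definition blumenthal_getoor :: "real measure \<Rightarrow> real" where
  "blumenthal_getoor \<nu> =
     Inf {r. r \<ge> 0 \<and> (\<integral>\<^sup>+z \<in> {-1..1}. ennreal (\<bar>z\<bar> powr r) \<partial>\<nu>) < \<infinity>}"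

section \<open>Derivatives in the parameter, and boundary values\<close>

text \<open>\<open>partials [i\<^sub>1, \<dots>, i\<^sub>k] f\<close> is the iterated coordinate derivative
  \<open>\<partial>\<^sub>i\<^sub>1 \<dots> \<partial>\<^sub>i\<^sub>k f\<close>.\<close>

primrec partials :: "'n list \<Rightarrow> (real ^ 'n \<Rightarrow> real) \<Rightarrow> real ^ 'n::finite \<Rightarrow> real" where
  "partials [] f = f"
| "partials (i # is) f = (\<lambda>\<theta>. deriv (\<lambda>s. partials is f (\<theta> + s *\<^sub>R axis i 1)) 0)"

definition mixed_partial ::
  "nat \<Rightarrow> 'n list \<Rightarrow> (real \<Rightarrow> real ^ 'n \<Rightarrow> real) \<Rightarrow> real \<Rightarrow> real ^ 'n::finite \<Rightarrow> real" where
  "mixed_partial i is f x \<theta> = (deriv ^^ i) (\<lambda>y. partials is (f y) \<theta>) x"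

text \<open>Euclidean norm of the tensor \<open>\<partial>\<^sub>x\<^sup>i \<partial>\<^sub>\<theta>\<^sup>k f\<close>.\<close>

definition mixed_norm ::
  "nat \<Rightarrow> nat \<Rightarrow> (real \<Rightarrow> real ^ 'n \<Rightarrow> real) \<Rightarrow> real \<Rightarrow> real ^ 'n::finite \<Rightarrow> real" where
  "mixed_norm i k f x \<theta> = L2_set (\<lambda>is. mixed_partial i is f x \<theta>) {is. length is = k}"

definition mixed_partials_exist ::
  "nat \<Rightarrow> nat \<Rightarrow> (real ^ 'n) set \<Rightarrow> (real \<Rightarrow> real ^ 'n::finite \<Rightarrow> real) \<Rightarrow> bool" where
  "mixed_partials_exist m k S f \<longleftrightarrow>
     (\<forall>is j x. \<forall>\<theta>\<in>S. length is < k \<longrightarrow>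
        (\<lambda>s. partials is (f x) (\<theta> + s *\<^sub>R axis j 1)) differentiable (at 0)) \<and>
     (\<forall>i is x. \<forall>\<theta>\<in>S. i < m \<and> length is \<le> k \<longrightarrow>
        (\<lambda>y. mixed_partial i is f y \<theta>) differentiable (at x))"

definition extends_to_closure :: "(real ^ 'n) set \<Rightarrow> (real ^ 'n::finite \<Rightarrow> real) \<Rightarrow> bool" where
  "extends_to_closure S f \<longleftrightarrow> (\<exists>g. continuous_on (closure S) g \<and> (\<forall>\<theta>\<in>S. g \<theta> = f \<theta>))"

text \<open>The coefficients are given on the open parameter sets; the estimator ranges over the
  closure, where they and their derivatives take the boundary values \<open>bval\<close>.\<close>

definition bval :: "'n set \<Rightarrow> ('n::topological_space \<Rightarrow> 'v::t2_space) \<Rightarrow> 'n \<Rightarrow> 'v" where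
  "bval S f \<theta> = (if \<theta> \<in> S then f \<theta> else Lim (at \<theta> within S) f)"

definition gradient :: "(real ^ 'n \<Rightarrow> real) \<Rightarrow> real ^ 'n \<Rightarrow> real ^ 'n::finite" where
  "gradient f \<theta> = (\<chi> i. partials [i] f \<theta>)"

definition outer :: "real ^ 'm \<Rightarrow> real ^ 'n \<Rightarrow> real ^ 'n ^ 'm" where
  "outer u v = (\<chi> i j. u $ i * v $ j)"

section \<open>Conditions on the model\<close>

definition cond_smoothness ::
  "(real ^ 'pa::finite) set \<Rightarrow> (real ^ 'pg::finite) set \<Rightarrow> (real \<Rightarrow> real ^ 'pa \<Rightarrow> real) \<Rightarrow>
   (real \<Rightarrow> real ^ 'pg \<Rightarrow> real) \<Rightarrow> real ^ 'pa \<Rightarrow> real ^ 'pg \<Rightarrow> bool" where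
  "cond_smoothness \<Theta>\<^sub>\<alpha> \<Theta>\<^sub>\<gamma> a c \<alpha>0 \<gamma>0 \<longleftrightarrow>
     (\<exists>L. L-lipschitz_on UNIV (\<lambda>x. a x \<alpha>0)) \<and> (\<exists>L. L-lipschitz_on UNIV (\<lambda>x. c x \<gamma>0)) \<and>
     mixed_partials_exist 2 5 \<Theta>\<^sub>\<alpha> a \<and> mixed_partials_exist 2 5 \<Theta>\<^sub>\<gamma> c \<and>
     (\<forall>i\<le>2. \<forall>is x. length is \<le> 5 \<longrightarrow> extends_to_closure \<Theta>\<^sub>\<alpha> (mixed_partial i is a x)) \<and>
     (\<forall>i\<le>2. \<forall>is x. length is \<le> 5 \<longrightarrow> extends_to_closure \<Theta>\<^sub>\<gamma> (mixed_partial i is c x)) \<and>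
     (\<forall>x. \<forall>\<gamma>\<in>\<Theta>\<^sub>\<gamma>. c x \<gamma> \<noteq> 0) \<and>
     (\<forall>i\<le>2. \<forall>k\<le>5. \<exists>C\<ge>0.
        (SUP (x, \<alpha>, \<gamma>) \<in> UNIV \<times> \<Theta>\<^sub>\<alpha> \<times> \<Theta>\<^sub>\<gamma>. ereal (1 / (1 + \<bar>x\<bar> powr C) *
           (mixed_norm i k a x \<alpha> + mixed_norm i k c x \<gamma> + \<bar>inverse (c x \<gamma>)\<bar>))) < \<infinity>)"

definition cond_stability ::
  "'w measure \<Rightarrow> (real \<Rightarrow> 'w \<Rightarrow> real) \<Rightarrow> (real \<Rightarrow> real \<Rightarrow> real measure) \<Rightarrow> real measure \<Rightarrow> bool" where
  "cond_stability M X P \<pi>0 \<longleftrightarrow>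
     prob_space \<pi>0 \<and> sets \<pi>0 = sets borel \<and>
     (\<forall>q>0. \<exists>\<kappa>>0. \<exists>K>0. \<forall>x.
        (SUP t \<in> {0..}. ennreal (exp (\<kappa> * t)) * weighted_dist (\<lambda>y. 1 + \<bar>y\<bar> powr q) (P t x) \<pi>0)
          \<le> ennreal (K * (1 + \<bar>x\<bar> powr q))) \<and>
     (\<forall>q>0. (SUP t \<in> {0..}. \<integral>\<^sup>+\<omega>. ennreal (\<bar>X t \<omega>\<bar> powr q) \<partial>M) < \<infinity>)"

definition G_inf_alpha ::
  "(real \<Rightarrow> real ^ 'pa::finite \<Rightarrow> real) \<Rightarrow> (real \<Rightarrow> real ^ 'pg::finite \<Rightarrow> real) \<Rightarrow>
   real measure \<Rightarrow> real ^ 'pa \<Rightarrow> real ^ 'pa \<Rightarrow> real ^ 'pg \<Rightarrow> real ^ 'pa" where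
  "G_inf_alpha a c \<pi>0 \<alpha>0 \<alpha> \<gamma> =
     (LINT x|\<pi>0. ((a x \<alpha>0 - a x \<alpha>) / (c x \<gamma>)\<^sup>2) *\<^sub>R gradient (a x) \<alpha>)"

definition G_inf_gamma ::
  "(real \<Rightarrow> real ^ 'pg::finite \<Rightarrow> real) \<Rightarrow> real measure \<Rightarrow> real ^ 'pg \<Rightarrow> real ^ 'pg \<Rightarrow> real ^ 'pg" where
  "G_inf_gamma c \<pi>0 \<gamma>0 \<gamma> =
     2 *\<^sub>R (LINT x|\<pi>0. (((c x \<gamma>0)\<^sup>2 - (c x \<gamma>)\<^sup>2) / (c x \<gamma>) ^ 3) *\<^sub>R gradient (c x) \<gamma>)"

definition cond_identifiability ::
  "(real ^ 'pa::finite) set \<Rightarrow> (real ^ 'pg::finite) set \<Rightarrow> (real \<Rightarrow> real ^ 'pa \<Rightarrow> real) \<Rightarrow>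
   (real \<Rightarrow> real ^ 'pg \<Rightarrow> real) \<Rightarrow> real measure \<Rightarrow> real ^ 'pa \<Rightarrow> real ^ 'pg \<Rightarrow> bool" where
  "cond_identifiability \<Theta>\<^sub>\<alpha> \<Theta>\<^sub>\<gamma> a c \<pi>0 \<alpha>0 \<gamma>0 \<longleftrightarrow>
     (\<exists>\<chi>\<^sub>\<alpha>>0. \<exists>\<chi>\<^sub>\<gamma>>0. \<forall>\<alpha>\<in>\<Theta>\<^sub>\<alpha>. \<forall>\<gamma>\<in>\<Theta>\<^sub>\<gamma>.
        norm (G_inf_alpha a c \<pi>0 \<alpha>0 \<alpha> \<gamma>) \<ge> \<chi>\<^sub>\<alpha> * norm (\<alpha> - \<alpha>0) \<and>
        norm (G_inf_gamma c \<pi>0 \<gamma>0 \<gamma>) \<ge> \<chi>\<^sub>\<gamma> * norm (\<gamma> - \<gamma>0))"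

definition info_alpha ::
  "(real \<Rightarrow> real ^ 'pa::finite \<Rightarrow> real) \<Rightarrow> (real \<Rightarrow> real ^ 'pg::finite \<Rightarrow> real) \<Rightarrow>
   real measure \<Rightarrow> real ^ 'pa \<Rightarrow> real ^ 'pg \<Rightarrow> real ^ 'pa ^ 'pa" where
  "info_alpha a c \<pi>0 \<alpha>0 \<gamma>0 =
     (LINT x|\<pi>0. (1 / (c x \<gamma>0)\<^sup>2) *\<^sub>R outer (gradient (a x) \<alpha>0) (gradient (a x) \<alpha>0))"

definition info_gamma ::
  "(real \<Rightarrow> real ^ 'pg::finite \<Rightarrow> real) \<Rightarrow> real measure \<Rightarrow> real ^ 'pg \<Rightarrow> real ^ 'pg ^ 'pg" where
  "info_gamma c \<pi>0 \<gamma>0 =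
     4 *\<^sub>R (LINT x|\<pi>0. (1 / (c x \<gamma>0)\<^sup>2) *\<^sub>R outer (gradient (c x) \<gamma>0) (gradient (c x) \<gamma>0))"

definition vderiv :: "(real \<Rightarrow> 'v::real_normed_vector) \<Rightarrow> real \<Rightarrow> 'v" where
  "vderiv f z = vector_derivative f (at z)"

text \<open>The limit \<open>z \<longrightarrow> \<infinity>\<close> is two-sided, \<open>\<bar>z\<bar> \<longrightarrow> \<infinity>\<close>.\<close>

definition moment_fitting_class :: "real \<Rightarrow> (real \<Rightarrow> 'v::real_normed_vector) set" where
  "moment_fitting_class \<rho> = {f.
     (\<forall>i<5. \<forall>z. ((vderiv ^^ i) f) differentiable (at z)) \<and>
     (\<exists>C :: nat \<Rightarrow> real. (\<forall>i\<le>5. C i \<ge> 0) \<and>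
        Limsup (at 0) (\<lambda>z. ereal (\<bar>z\<bar> powr (- \<rho>) * norm (f z) + norm (vderiv f z) / \<bar>z\<bar>)) < \<infinity> \<and>
        Limsup at_infinity (\<lambda>z. ereal (norm (f z) / (1 + \<bar>z\<bar> powr C 0) +
          norm (vderiv f z) / \<bar>z\<bar> powr (1 + C 1))) < \<infinity> \<and>
        (\<forall>i\<in>{2..5}. (SUP z. ereal (norm ((vderiv ^^ i) f z) / (1 + \<bar>z\<bar> powr C i))) < \<infinity>))}"

section \<open>Estimating functions and residuals\<close>

text \<open>Here \<open>x j\<close> is the observation at time \<open>j h\<close>, for \<open>j \<le> n\<close>, and \<open>h\<close> is the step size
  for the given \<open>n\<close>.\<close>

definition drift_increment ::
  "(real ^ 'pa::finite) set \<Rightarrow> (real \<Rightarrow> real ^ 'pa \<Rightarrow> real) \<Rightarrow> real \<Rightarrow> (nat \<Rightarrow> real) \<Rightarrow>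
   real ^ 'pa \<Rightarrow> nat \<Rightarrow> real" where
  "drift_increment \<Theta>\<^sub>\<alpha> a h x \<alpha> j = x j - x (j - 1) - h * bval \<Theta>\<^sub>\<alpha> (a (x (j - 1))) \<alpha>"

definition G_alpha ::
  "(real ^ 'pa::finite) set \<Rightarrow> (real ^ 'pg::finite) set \<Rightarrow> (real \<Rightarrow> real ^ 'pa \<Rightarrow> real) \<Rightarrow>
   (real \<Rightarrow> real ^ 'pg \<Rightarrow> real) \<Rightarrow> nat \<Rightarrow> real \<Rightarrow> (nat \<Rightarrow> real) \<Rightarrow> real ^ 'pa \<Rightarrow> real ^ 'pg \<Rightarrow>
   real ^ 'pa" where
  "G_alpha \<Theta>\<^sub>\<alpha> \<Theta>\<^sub>\<gamma> a c n h x \<alpha> \<gamma> = (1 / (real n * h)) *\<^sub>R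
     (\<Sum>j=1..n. (drift_increment \<Theta>\<^sub>\<alpha> a h x \<alpha> j / (bval \<Theta>\<^sub>\<gamma> (c (x (j - 1))) \<gamma>)\<^sup>2) *\<^sub>R
        bval \<Theta>\<^sub>\<alpha> (gradient (a (x (j - 1)))) \<alpha>)"

definition G_gamma ::
  "(real ^ 'pa::finite) set \<Rightarrow> (real ^ 'pg::finite) set \<Rightarrow> (real \<Rightarrow> real ^ 'pa \<Rightarrow> real) \<Rightarrow>
   (real \<Rightarrow> real ^ 'pg \<Rightarrow> real) \<Rightarrow> nat \<Rightarrow> real \<Rightarrow> (nat \<Rightarrow> real) \<Rightarrow> real ^ 'pa \<Rightarrow> real ^ 'pg \<Rightarrow>
   real ^ 'pg" where
  "G_gamma \<Theta>\<^sub>\<alpha> \<Theta>\<^sub>\<gamma> a c n h x \<alpha> \<gamma> = (1 / (real n * h)) *\<^sub>R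
     (\<Sum>j=1..n.
        (drift_increment \<Theta>\<^sub>\<alpha> a h x \<alpha> j)\<^sup>2 *\<^sub>R
          (- bval \<Theta>\<^sub>\<gamma> (gradient (\<lambda>\<gamma>'. 1 / (c (x (j - 1)) \<gamma>')\<^sup>2)) \<gamma>)
        - (h / (bval \<Theta>\<^sub>\<gamma> (c (x (j - 1))) \<gamma>)\<^sup>2) *\<^sub>R
          bval \<Theta>\<^sub>\<gamma> (gradient (\<lambda>\<gamma>'. (c (x (j - 1)) \<gamma>')\<^sup>2)) \<gamma>)"

definition residual ::
  "(real ^ 'pa::finite) set \<Rightarrow> (real ^ 'pg::finite) set \<Rightarrow> (real \<Rightarrow> real ^ 'pa \<Rightarrow> real) \<Rightarrow>
   (real \<Rightarrow> real ^ 'pg \<Rightarrow> real) \<Rightarrow> real \<Rightarrow> (nat \<Rightarrow> real) \<Rightarrow> real ^ 'pa \<Rightarrow> real ^ 'pg \<Rightarrow> nat \<Rightarrow> real" where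
  "residual \<Theta>\<^sub>\<alpha> \<Theta>\<^sub>\<gamma> a c h x \<alpha> \<gamma> j =
     drift_increment \<Theta>\<^sub>\<alpha> a h x \<alpha> j / bval \<Theta>\<^sub>\<gamma> (c (x (j - 1))) \<gamma>"

text \<open>\<open>u\<^sub>n\<close> when \<open>y j\<close> is the \<open>j\<close>-th increment of \<open>J\<close>, and the estimated statistic when \<open>y j\<close> is
  the \<open>j\<close>-th residual.\<close>

definition u_stat ::
  "(real \<Rightarrow> real ^ 'q::finite) \<Rightarrow> real measure \<Rightarrow> nat \<Rightarrow> real \<Rightarrow> (nat \<Rightarrow> real) \<Rightarrow> real ^ 'q" where
  "u_stat \<phi> \<nu> n h y = sqrt (real n * h) *\<^sub>R
     ((1 / (real n * h)) *\<^sub>R (\<Sum>j=1..n. \<phi> (y j)) - (LINT z|\<nu>. \<phi> z))"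

definition b_hat ::
  "(real ^ 'pa::finite) set \<Rightarrow> (real ^ 'pg::finite) set \<Rightarrow> (real \<Rightarrow> real ^ 'pa \<Rightarrow> real) \<Rightarrow>
   (real \<Rightarrow> real ^ 'pg \<Rightarrow> real) \<Rightarrow> (real \<Rightarrow> real ^ 'q::finite) \<Rightarrow> nat \<Rightarrow> real \<Rightarrow> (nat \<Rightarrow> real) \<Rightarrow>
   real ^ 'pa \<Rightarrow> real ^ 'pg \<Rightarrow> real ^ 'pg ^ 'q" where
  "b_hat \<Theta>\<^sub>\<alpha> \<Theta>\<^sub>\<gamma> a c \<phi> n h x \<alpha> \<gamma> =
     - outer
        ((1 / (real n * h)) *\<^sub>R (\<Sum>j=1..n. let z = residual \<Theta>\<^sub>\<alpha> \<Theta>\<^sub>\<gamma> a c h x \<alpha> \<gamma> j in z *\<^sub>R vderiv \<phi> z))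
        ((1 / real n) *\<^sub>R (\<Sum>j=1..n. (1 / bval \<Theta>\<^sub>\<gamma> (c (x (j - 1))) \<gamma>) *\<^sub>R
            bval \<Theta>\<^sub>\<gamma> (gradient (c (x (j - 1)))) \<gamma>))"

end

theory Submission
 imports Defs
begin

text \<open>Write \<open>\<delta>\<^sub>j\<close> for the residuals and \<open>N = n h\<close>. Up to an Euler remainder, \<open>\<delta>\<^sub>j\<close> is the true increment \<open>\<Delta>\<^sub>jJ\<close>
 times \<open>c(X, \<gamma>\<^sub>0) / c(X, \<gamma>\<^sub>n)\<close>, so a second-order expansion of \<open>\<phi>\<close> gives the linear term
 \<open>- \<zeta>(\<Delta>\<^sub>jJ) (\<partial>c/c)(X) [\<gamma>\<^sub>n - \<gamma>\<^sub>0]\<close>. The Euler remainder has second moment \<open>O(h^2)\<close>, by the isometry for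
 stochastic sums, and is negligible because \<open>n h\<^sup>2 \<rightarrow> 0\<close>; the quadratic term is negligible once
 \<open>\<surd>N (\<gamma>\<^sub>n - \<gamma>\<^sub>0)\<close> is bounded in probability. The mean of the products \<open>\<zeta>(\<Delta>\<^sub>jJ) (\<partial>c/c)(X)\<close> splits into the
 product of the two means, since \<open>\<Delta>\<^sub>jJ\<close> is independent of the past: the centred noise sums have
 orthogonal terms and are \<open>O(\<surd>N)\<close>.

 For the rate, the estimating function at the estimator is dominated by its value at the true parameter,
 which is \<open>O(1/\<surd>N)\<close>. By identifiability it remains to compare the estimating function with its limit.
 Their difference is a fluctuation that is linear in the integrand and whose second moment is \<open>O(1/N)\<close>,
 by orthogonality of the noise and by exponential decay of the covariances of \<open>X\<close>. A finite net in the
 parameter set gives consistency, and a first-order expansion at \<open>\<gamma>\<^sub>0\<close> then gives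
 \<open>O(1/\<surd>N) + o(|\<gamma>\<^sub>n - \<gamma>\<^sub>0|)\<close>, whose second part is absorbed.\<close>

text \<open>Every estimate is brought to one shape: a power of
  \<open>U = 1 + |x| + |w| + |r|\<close> (state, increment of \<open>J\<close>, Euler remainder)
  times one of the small quantities \<open>w^2\<close>, \<open>r^2\<close>, \<open>h^2\<close>,
  \<open>|w| (|r| + h)\<close>. The weight is random and not independent of \<open>r\<close>;
  Cauchy-Schwarz therefore turns the order \<open>h^2\<close> of \<open>r^2\<close> into
  \<open>h^(3/2)\<close> once a weight is attached. A sum of \<open>n\<close> such terms divided by
  \<open>sqrt (n h)\<close> is of order \<open>sqrt (n h^2)\<close>, which is exactly what the
  sampling design sends to 0. The drift estimator enters only through \<open>h\<close> times a
  polynomially bounded difference, so a rate is proved for the scale estimator alone. The estimators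
  are arbitrary minimisers, possibly on the boundary of the parameter set. Hence the coefficients
  are extended continuously to the closure with the same Lipschitz and Taylor bounds. A random
  parameter can be inserted pathwise because each fluctuation is dominated, for all functions at
  once, by the size of the function times a sequence bounded in probability.\<close>

section \<open>Stochastic order symbols\<close>

text \<open>Both notions are formulated with outer probability, so that they apply to functions
 of the estimator without measurability considerations.\<close>

definition likely :: "'w measure => real => ('w => bool) => bool" where
 "likely M e P \<longleftrightarrow> (EX A:sets M. measure M (space M - A) <= e & (ALL w:A. P w))"

definition bounded_in_prob :: "'w measure => (nat => 'w => real) => bool" where
 "bounded_in_prob M Y \<longleftrightarrow> (\<forall>e>0. EX K. \<forall>\<^sub>F n in sequentially. likely M e (%w. abs (Y n w) <= K))"

definition vanish_in_prob :: "'w measure => (nat => 'w => real) => bool" where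
 "vanish_in_prob M Y \<longleftrightarrow> (\<forall>e>0. \<forall>\<^sub>F n in sequentially. likely M e (%w. abs (Y n w) <= e))"

context prob_space
begin

lemma likely_mono:
 assumes "likely M e P" "e <= d" "!!w. w : space M ==> P w ==> Q w"
 shows "likely M d Q"
proof -
 obtain A where A: "A : sets M" "measure M (space M - A) <= e" "ALL w:A. P w" using assms(1) unfolding likely_def by blast
 with assms show ?thesis using sets.sets_into_space[OF A(1)] unfolding likely_def by (intro bexI[of _ A]) auto
qed

lemma likely_conj:
 assumes "likely M e P" "likely M d Q"
 shows "likely M (e + d) (%w. P w & Q w)"
proof -
 obtain A B where A: "A : sets M" "measure M (space M - A) <= e" "ALL w:A. P w"
  and B: "B : sets M" "measure M (space M - B) <= d" "ALL w:B. Q w" using assms unfolding likely_def by blast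
 have "space M - A \<inter> B = (space M - A) \<union> (space M - B)" by auto
 then have "measure M (space M - A \<inter> B) <= e + d" using measure_Un_le[of "space M - A" M "space M - B"] A B by auto
 then show ?thesis using A B unfolding likely_def by (intro bexI[of _ "A \<inter> B"]) auto
qed

lemma likely_all: "0 <= e ==> (!!w. w : space M ==> P w) ==> likely M e P"
 unfolding likely_def by (intro bexI[of _ "space M"]) auto

lemma markov_likely:
 fixes Y :: "'a => real"
 assumes "integrable M Y" "e > 0" "(LINT w|M. abs (Y w)) <= c"
 shows "likely M (c / e) (%w. abs (Y w) <= e)"
 unfolding likely_def
proof (intro bexI conjI ballI)
 let ?A = "{w\<in>space M. abs (Y w) <= e}"
 have [measurable]: "Y : borel_measurable M" using assms by auto
 show "?A : sets M" by measurable
 have "measure M (space M - ?A) <= measure M {w\<in>space M. abs (Y w) >= e}" by (rule finite_measure_mono) auto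
 also have "... <= (LINT w|M. abs (Y w)) / e" using assms by (intro integral_Markov_inequality_measure[where A="{}"]) auto
 also have "... <= c / e" using assms by (simp add: divide_right_mono)
 finally show "measure M (space M - ?A) <= c / e" .
qed auto

text \<open>Sums, products and comparisons of bounded sequences all reduce to this transfer: an
  implication between pathwise bounds is applied on the intersection of two likely events, each
  spending half of the error probability.\<close>

lemma bounded_in_prob_map2:
 assumes Y: "bounded_in_prob M Y" and Z: "bounded_in_prob M Z"
  and H: "!!K. EX B. \<forall>\<^sub>F n in sequentially. ALL w:space M. abs (Y n w) <= K --> abs (Z n w) <= K --> abs (W n w) <= B"
 shows "bounded_in_prob M W"
 unfolding bounded_in_prob_def
proof (intro allI impI)
 fix e :: real assume "e > 0"
 then have "e / 2 > 0" by simp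
 then obtain K L where KL: "\<forall>\<^sub>F n in sequentially. likely M (e / 2) (%w. abs (Y n w) <= K)" "\<forall>\<^sub>F n in sequentially. likely M (e / 2) (%w. abs (Z n w) <= L)"
  using Y Z unfolding bounded_in_prob_def by meson
 obtain B where B: "\<forall>\<^sub>F n in sequentially. ALL w:space M. abs (Y n w) <= max K L --> abs (Z n w) <= max K L --> abs (W n w) <= B" using H by blast
 show "EX K. \<forall>\<^sub>F n in sequentially. likely M e (%w. abs (W n w) <= K)"
  by (intro exI[of _ B], use KL B in eventually_elim) (rule likely_mono[OF likely_conj], assumption+, auto)
qed

text \<open>A continuous mapping principle with one bounded and one vanishing argument. The bound
  \<open>K\<close> of the first is fixed before the threshold \<open>d\<close> of the second, so
  \<open>d\<close> may depend on \<open>K\<close>.\<close>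

lemma vanish_in_prob_map2:
 assumes Y: "bounded_in_prob M Y" and Z: "vanish_in_prob M Z"
  and H: "!!K e. e > 0 ==> \<exists>d>0. \<forall>\<^sub>F n in sequentially. ALL w:space M. abs (Y n w) <= K --> abs (Z n w) <= d --> abs (W n w) <= e"
 shows "vanish_in_prob M W"
 unfolding vanish_in_prob_def
proof (intro allI impI)
 fix e :: real assume e: "e > 0"
 then have "e / 2 > 0" by simp
 then obtain K where K: "\<forall>\<^sub>F n in sequentially. likely M (e / 2) (%w. abs (Y n w) <= K)" using Y unfolding bounded_in_prob_def by meson
 obtain d where d: "d > 0" "\<forall>\<^sub>F n in sequentially. ALL w:space M. abs (Y n w) <= K --> abs (Z n w) <= d --> abs (W n w) <= e" using H[OF e] by blast
 \<comment> \<open>In \<open>vanish_in_prob\<close> one number is both threshold and error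
   probability, so it has to meet \<open>d\<close> and \<open>e / 2\<close> at the same
   time.\<close>
 have "min d (e / 2) > 0" using d e by simp
 then have "\<forall>\<^sub>F n in sequentially. likely M (min d (e / 2)) (%w. abs (Z n w) <= min d (e / 2))" using Z unfolding vanish_in_prob_def by blast
 then show "\<forall>\<^sub>F n in sequentially. likely M e (%w. abs (W n w) <= e)"
  using K d(2) by eventually_elim (rule likely_mono[OF likely_conj], assumption+, auto)
qed

lemma bounded_in_prob_mono:
 assumes "bounded_in_prob M Z" "\<forall>\<^sub>F n in sequentially. ALL w:space M. abs (Y n w) <= abs (Z n w)"
 shows "bounded_in_prob M Y"
proof (rule bounded_in_prob_map2[OF assms(1,1)])
 show "EX B. \<forall>\<^sub>F n in sequentially. ALL w:space M. abs (Z n w) <= K --> abs (Z n w) <= K --> abs (Y n w) <= B" for K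
  by (rule exI[of _ K]) (use assms(2) in "eventually_elim, force")
qed

lemma bounded_in_prob_const: "bounded_in_prob M (%n w. c)"
 unfolding bounded_in_prob_def by (intro allI impI exI[of _ "abs c"] always_eventually likely_all) auto

lemma vanish_in_prob_mono:
 assumes "vanish_in_prob M Z" "\<forall>\<^sub>F n in sequentially. ALL w:space M. abs (Y n w) <= abs (Z n w)"
 shows "vanish_in_prob M Y"
proof (rule vanish_in_prob_map2[OF bounded_in_prob_const[of 0] assms(1)])
 fix K e :: real assume "e > 0"
 then show "\<exists>d>0. \<forall>\<^sub>F n in sequentially. ALL w:space M. abs (0 :: real) <= K --> abs (Z n w) <= d --> abs (Y n w) <= e"
  by (intro exI[of _ e] conjI, assumption) (use assms(2) in "eventually_elim, force")
qed

lemma bounded_in_prob_add: "bounded_in_prob M Y ==> bounded_in_prob M Z ==> bounded_in_prob M (%n w. Y n w + Z n w)"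
 by (erule bounded_in_prob_map2, assumption, rule_tac x="K + K" in exI) (auto intro!: always_eventually)

lemma bounded_in_prob_mult: "bounded_in_prob M Y ==> bounded_in_prob M Z ==> bounded_in_prob M (%n w. Y n w * Z n w)"
 by (erule bounded_in_prob_map2, assumption, rule_tac x="K * K" in exI)
  (auto intro!: always_eventually mult_mono simp: abs_mult intro: order_trans[OF abs_ge_zero])

lemma vanish_in_prob_add:
 assumes "vanish_in_prob M Y" "vanish_in_prob M Z"
 shows "vanish_in_prob M (%n w. Y n w + Z n w)"
 unfolding vanish_in_prob_def
proof (intro allI impI)
 fix e :: real assume "e > 0"
 then have "e / 2 > 0" by simp
 then have "\<forall>\<^sub>F n in sequentially. likely M (e / 2) (%w. abs (Y n w) <= e / 2)" "\<forall>\<^sub>F n in sequentially. likely M (e / 2) (%w. abs (Z n w) <= e / 2)"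
  using assms unfolding vanish_in_prob_def by blast+
 then show "\<forall>\<^sub>F n in sequentially. likely M e (%w. abs (Y n w + Z n w) <= e)"
  by eventually_elim (rule likely_mono[OF likely_conj], assumption+, auto)
qed

lemma vanish_in_prob_mult:
 assumes "bounded_in_prob M Y" "vanish_in_prob M Z"
 shows "vanish_in_prob M (%n w. Y n w * Z n w)"
proof (rule vanish_in_prob_map2[OF assms])
 fix K e :: real assume e: "e > 0"
 have "abs (y * z) <= e" if "abs y <= K" "abs z <= e / (abs K + 1)" for y z
 proof -
  have "abs (y * z) <= abs K * (e / (abs K + 1))" unfolding abs_mult using that by (intro mult_mono) auto
  also have "... <= e" using e by (simp add: field_simps)
  finally show ?thesis .
 qed
 then show "\<exists>d>0. \<forall>\<^sub>F n in sequentially. ALL w:space M. abs (Y n w) <= K --> abs (Z n w) <= d --> abs (Y n w * Z n w) <= e"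
  using e by (intro exI[of _ "e / (abs K + 1)"]) (auto intro!: always_eventually)
qed

lemma vanish_in_prob_tendsto:
 assumes "c \<longlonglongrightarrow> 0"
 shows "vanish_in_prob M (%n w. c n)"
 unfolding vanish_in_prob_def
proof (intro allI impI)
 fix e :: real assume e: "e > 0"
 show "\<forall>\<^sub>F n in sequentially. likely M e (%w. abs (c n) <= e)"
  using tendstoD[OF assms e] by eventually_elim (use e in "auto intro!: likely_all")
qed

lemma vanish_imp_bounded_in_prob: "vanish_in_prob M Y ==> bounded_in_prob M Y"
 unfolding vanish_in_prob_def bounded_in_prob_def by blast

lemma bounded_in_prob_sum: "(!!i. i : I ==> bounded_in_prob M (Y i)) ==> bounded_in_prob M (%n w. \<Sum>i\<in>I. Y i n w)"
 by (induction I rule: infinite_finite_induct) (auto intro: bounded_in_prob_add bounded_in_prob_const)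

lemma vanish_in_prob_sum: "(!!i. i : I ==> vanish_in_prob M (Y i)) ==> vanish_in_prob M (%n w. \<Sum>i\<in>I. Y i n w)"
 by (induction I rule: infinite_finite_induct) (auto intro: vanish_in_prob_add vanish_in_prob_tendsto)

lemma vanish_in_prob_diff: "vanish_in_prob M Y ==> vanish_in_prob M Z ==> vanish_in_prob M (%n w. Y n w - Z n w)"
 using vanish_in_prob_add[of Y "%n w. - Z n w"] by (simp add: vanish_in_prob_def)

lemma bounded_in_prob_abs: "bounded_in_prob M Y ==> bounded_in_prob M (%n w. abs (Y n w))"
 and vanish_in_prob_abs: "vanish_in_prob M Y ==> vanish_in_prob M (%n w. abs (Y n w))"
 by (simp_all add: bounded_in_prob_def vanish_in_prob_def)

lemma bounded_in_prob_L1: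
 assumes "\<forall>\<^sub>F n in sequentially. integrable M (Y n) & (LINT w|M. abs (Y n w)) <= C"
 shows "bounded_in_prob M Y"
 unfolding bounded_in_prob_def
proof (intro allI impI)
 fix e :: real assume e: "e > 0"
 show "EX K. \<forall>\<^sub>F n in sequentially. likely M e (%w. abs (Y n w) <= K)"
  by (intro exI[of _ "max C 1 / e"], use assms in eventually_elim)
   (rule likely_mono[OF markov_likely[of _ "max C 1 / e" "max C 1"]], use e in "auto simp: max_def")
qed

lemma vanish_in_prob_L1:
 assumes "\<forall>\<^sub>F n in sequentially. integrable M (Y n) & (LINT w|M. abs (Y n w)) <= c n" "c \<longlonglongrightarrow> 0"
 shows "vanish_in_prob M Y"
 unfolding vanish_in_prob_def
proof (intro allI impI)
 fix e :: real assume e: "e > 0"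
 \<comment> \<open>Markov's inequality at level \<open>e\<close> gives probability
   \<open>c n / e\<close>, which must again be at most \<open>e\<close>.\<close>
 have "\<forall>\<^sub>F n in sequentially. abs (c n) < e * e" using tendstoD[OF assms(2), of "e * e"] e by simp
 with assms(1) show "\<forall>\<^sub>F n in sequentially. likely M e (%w. abs (Y n w) <= e)"
  by eventually_elim (rule likely_mono[OF markov_likely], use e in "auto simp: field_simps")
qed

text \<open>Way back from the outer notion to the one of the theorem; measurability has to be
  supplied only here, for the final remainder.\<close>

lemma small_in_probI:
 assumes "!!n. R n : borel_measurable M" "vanish_in_prob M (%n w. norm (R n w))"
 shows "small_in_prob M R"
 unfolding small_in_prob_def
proof (intro conjI allI impI)
 fix e :: real assume e: "e > 0"
 show "(%n. measure M {w : space M. norm (R n w) > e}) \<longlonglongrightarrow> 0"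
 proof (rule tendstoI)
  fix d :: real assume d: "d > 0"
  define b where "b = min e (d/2)"
  have b: "b > 0" "b <= e" "b < d" using e d by (auto simp: b_def)
  have "\<forall>\<^sub>F n in sequentially. likely M b (%w. abs (norm (R n w)) <= b)" using assms(2) b unfolding vanish_in_prob_def by blast
  then show "\<forall>\<^sub>F n in sequentially. dist (measure M {w : space M. norm (R n w) > e}) 0 < d"
  proof eventually_elim
   case (elim n)
   then obtain A where A: "A : sets M" "measure M (space M - A) <= b"
    "ALL w:A. abs (norm (R n w)) <= b" unfolding likely_def by blast
   have "measure M {w : space M. norm (R n w) > e} <= measure M (space M - A)"
    using A b by (intro finite_measure_mono) force+
   with A b show ?case by simp
  qed
 qed
qed (use assms in auto)

end

section \<open>Moment orders\<close>

definition moments_bounded :: "'w measure => 'i set => ('i => 'w => real) => bool" where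
 "moments_bounded M I Y \<longleftrightarrow> (ALL i:I. Y i : borel_measurable M) &
   (\<forall>q::nat. EX C. ALL i:I. integrable M (%w. abs (Y i w) ^ q) & (LINT w|M. abs (Y i w) ^ q) <= C)"

text \<open>A uniform big-O in mean. Integrability is part of it, since the integral of a
  non-integrable function is 0 by default and would make the bound void.\<close>

definition mean_order :: "'w measure => 'i set => ('i => real) => ('i => 'w => real) => bool" where
 "mean_order M I r Y \<longleftrightarrow> (EX C. ALL i:I. integrable M (Y i) & (LINT w|M. abs (Y i w)) <= C * r i)"

context prob_space
begin

lemma mean_order_mono:
 fixes Y Z :: "'i => 'a => real"
 assumes "mean_order M I r Z" "!!i. i : I ==> Y i : borel_measurable M"
  "!!i w. i : I ==> w : space M ==> abs (Y i w) <= K * abs (Z i w)"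
 shows "mean_order M I r Y"
proof -
 obtain C where C: "!!i. i : I ==> integrable M (Z i)" "!!i. i : I ==> (LINT w|M. abs (Z i w)) <= C * r i"
  using assms(1) unfolding mean_order_def by blast
 have *: "integrable M (Y i) & (LINT w|M. abs (Y i w)) <= (max K 0 * C) * r i" if i: "i : I" for i
 proof
  have le: "abs (Y i w) <= max K 0 * abs (Z i w)" if "w : space M" for w
   using assms(3)[OF i that] by (rule order_trans) (simp add: mult_right_mono)
  have iZ: "integrable M (%w. max K 0 * abs (Z i w))" using C(1)[OF i] by simp
  show iY: "integrable M (Y i)"
   by (rule Bochner_Integration.integrable_bound[OF iZ assms(2)[OF i]])
    (use le in "auto intro!: AE_I2")
  have "(LINT w|M. abs (Y i w)) <= (LINT w|M. max K 0 * abs (Z i w))"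
   using iY iZ le by (intro integral_mono) auto
  also have "... <= (max K 0 * C) * r i"
   using mult_left_mono[OF C(2)[OF i], of "max K 0"] by (simp add: mult_ac)
  finally show "(LINT w|M. abs (Y i w)) <= (max K 0 * C) * r i" .
 qed
 then show ?thesis unfolding mean_order_def by blast
qed

lemma mean_order_add:
 fixes Y Z :: "'i => 'a => real"
 assumes "mean_order M I r Y" "mean_order M I r Z"
 shows "mean_order M I r (%i w. Y i w + Z i w)"
proof -
 obtain C D where C: "!!i. i : I ==> integrable M (Z i)" "!!i. i : I ==> (LINT w|M. abs (Z i w)) <= C * r i"
  "!!i. i : I ==> integrable M (Y i)" "!!i. i : I ==> (LINT w|M. abs (Y i w)) <= D * r i"
  using assms unfolding mean_order_def by blast
 have "(LINT w|M. abs (Y i w + Z i w)) <= (D + C) * r i" if i: "i : I" for i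
 proof -
  have "(LINT w|M. abs (Y i w + Z i w)) <= (LINT w|M. abs (Y i w) + abs (Z i w))"
   using C i by (intro integral_mono) auto
  also have "... = (LINT w|M. abs (Y i w)) + (LINT w|M. abs (Z i w))"
   using C i by (intro Bochner_Integration.integral_add) auto
  also have "... <= (D + C) * r i" using C i by (simp add: distrib_right add_mono)
  finally show ?thesis .
 qed
 with C show ?thesis unfolding mean_order_def by (intro exI[of _ "D + C"]) auto
qed

text \<open>Cauchy-Schwarz, through \<open>2 (abs (y z)) <= (s/r) y\<^sup>2 + (r/s) z\<^sup>2\<close>.\<close>

lemma mean_order_mult:
 fixes Y Z :: "'i => 'a => real"
 assumes "mean_order M I (%i. (r i)^2) (%i w. (Y i w)^2)" "mean_order M I (%i. (s i)^2) (%i w. (Z i w)^2)"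
  and meas: "!!i. i : I ==> Y i : borel_measurable M" "!!i. i : I ==> Z i : borel_measurable M"
  and pos: "!!i. i : I ==> r i > 0" "!!i. i : I ==> s i > 0"
 shows "mean_order M I (%i. r i * s i) (%i w. Y i w * Z i w)"
proof -
 obtain C D where C: "!!i. i : I ==> integrable M (%w. (Y i w)^2)"
   "!!i. i : I ==> (LINT w|M. (Y i w)^2) <= C * (r i)^2"
  and D: "!!i. i : I ==> integrable M (%w. (Z i w)^2)"
   "!!i. i : I ==> (LINT w|M. (Z i w)^2) <= D * (s i)^2"
  using assms unfolding mean_order_def by (auto; blast)
 have *: "integrable M (%w. Y i w * Z i w) &
  (LINT w|M. abs (Y i w * Z i w)) <= (C/2 + D/2) * (r i * s i)" if i: "i : I" for i
 proof
  let ?l = "s i / r i"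
  have l: "?l > 0" using pos i by simp
  have le: "abs (Y i w * Z i w) <= (?l/2) * (Y i w)^2 + (1/(2 * ?l)) * (Z i w)^2" for w
  proof -
   have "0 <= (?l * abs (Y i w) - abs (Z i w))^2 / (2 * ?l)"
    using l by (intro divide_nonneg_nonneg) auto
   also have "... = (?l/2) * (Y i w)^2 + (1/(2 * ?l)) * (Z i w)^2 - abs (Y i w * Z i w)"
    using pos[OF i] by (simp add: power2_eq_square abs_mult field_simps)
   finally show ?thesis by simp
  qed
  have iR: "integrable M (%w. (?l/2) * (Y i w)^2 + (1/(2 * ?l)) * (Z i w)^2)"
   using C(1)[OF i] D(1)[OF i] by (intro Bochner_Integration.integrable_add integrable_mult_right)
  show iYZ: "integrable M (%w. Y i w * Z i w)"
  proof (rule Bochner_Integration.integrable_bound[OF iR])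
   show "AE w in M. norm (Y i w * Z i w) <= norm ((?l/2) * (Y i w)^2 + (1/(2 * ?l)) * (Z i w)^2)"
    unfolding real_norm_def by (intro AE_I2 order_trans[OF le abs_ge_self])
  qed (use meas i in auto)
  have "(LINT w|M. abs (Y i w * Z i w)) <= (LINT w|M. (?l/2) * (Y i w)^2 + (1/(2 * ?l)) * (Z i w)^2)"
   using iYZ iR le by (intro integral_mono) auto
  also have "... = (?l/2) * (LINT w|M. (Y i w)^2) + (1/(2 * ?l)) * (LINT w|M. (Z i w)^2)"
   using C(1)[OF i] D(1)[OF i]
   by (subst Bochner_Integration.integral_add) (auto intro!: integrable_divide_zero)
  also have "... <= (?l/2) * (C * (r i)^2) + (1/(2 * ?l)) * (D * (s i)^2)"
   using pos[OF i] by (intro add_mono mult_left_mono C(2)[OF i] D(2)[OF i]) auto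
  also have "... = (C/2 + D/2) * (r i * s i)"
   using pos[OF i] by (simp add: power2_eq_square field_simps)
  finally show "(LINT w|M. abs (Y i w * Z i w)) <= (C/2 + D/2) * (r i * s i)" .
 qed
 then show ?thesis unfolding mean_order_def by blast
qed

lemma moments_boundedD:
 "moments_bounded M I Y ==> i : I ==> Y i : borel_measurable M"
 by (simp add: moments_bounded_def)

lemma moments_bounded_mean_order:
 "moments_bounded M I Y ==> mean_order M I (%_. 1) (%i w. abs (Y i w) ^ q)"
 by (auto simp: moments_bounded_def mean_order_def power_abs)

lemma moments_bounded_iff_mean_order:
 "moments_bounded M I Y \<longleftrightarrow> (ALL i:I. Y i : borel_measurable M) &
   (\<forall>q::nat. mean_order M I (%_. 1) (%i w. abs (Y i w) ^ q))"
 by (auto simp: moments_bounded_def mean_order_def power_abs)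

lemma moments_bounded_mono:
 assumes "moments_bounded M I Z" "!!i. i : I ==> Y i : borel_measurable M"
  "!!i w. i : I ==> w : space M ==> abs (Y i w) <= K * abs (Z i w)"
 shows "moments_bounded M I Y"
 unfolding moments_bounded_iff_mean_order
proof (intro conjI ballI allI)
 fix q
 show "mean_order M I (%_. 1) (%i w. abs (Y i w) ^ q)"
 proof (rule mean_order_mono[OF moments_bounded_mean_order[OF assms(1), of q], where K="K ^ q"])
  fix i w assume "i : I" "w : space M"
  then show "abs (abs (Y i w) ^ q) <= K ^ q * abs (abs (Z i w) ^ q)"
   using power_mono[OF assms(3), of i w q] by (simp add: power_mult_distrib power_abs)
 qed (use assms(2) in auto)
qed (use assms(2) in auto)

lemma moments_bounded_add:
 assumes "moments_bounded M I Y" "moments_bounded M I Z"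
 shows "moments_bounded M I (%i w. Y i w + Z i w)"
 unfolding moments_bounded_iff_mean_order
proof (intro conjI ballI allI)
 fix q
 have "mean_order M I (%_. 1) (%i w. abs (Y i w) ^ q + abs (Z i w) ^ q)"
  using assms by (intro mean_order_add moments_bounded_mean_order)
 then show "mean_order M I (%_. 1) (%i w. abs (Y i w + Z i w) ^ q)"
 proof (rule mean_order_mono[where K="2 ^ q"])
  fix i w
  have "abs (Y i w + Z i w) ^ q <= (2 * max (abs (Y i w)) (abs (Z i w))) ^ q"
   by (intro power_mono) auto
  also have "... <= 2 ^ q * (abs (Y i w) ^ q + abs (Z i w) ^ q)"
   by (auto simp: power_mult_distrib max_def)
  finally show "abs (abs (Y i w + Z i w) ^ q) <= 2 ^ q * abs (abs (Y i w) ^ q + abs (Z i w) ^ q)"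
   by simp
 qed (use assms[THEN moments_boundedD] in auto)
qed (use assms[THEN moments_boundedD] in auto)

lemma moments_bounded_mult:
 assumes "moments_bounded M I Y" "moments_bounded M I Z"
 shows "moments_bounded M I (%i w. Y i w * Z i w)"
 unfolding moments_bounded_iff_mean_order
proof (intro conjI ballI allI)
 fix q
 have "mean_order M I (%_. 1 * 1) (%i w. abs (Y i w) ^ q * abs (Z i w) ^ q)"
  using moments_bounded_mean_order[OF assms(1), of "q * 2"] moments_bounded_mean_order[OF assms(2), of "q * 2"]
   assms[THEN moments_boundedD]
  by (intro mean_order_mult) (auto simp: power_mult)
 then show "mean_order M I (%_. 1) (%i w. abs (Y i w * Z i w) ^ q)"
  by (simp add: abs_mult power_mult_distrib)
qed (use assms[THEN moments_boundedD] in auto)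

lemma moments_bounded_const: "moments_bounded M I (%i w. c)"
 by (auto simp: moments_bounded_def prob_space)

lemma moments_bounded_power:
 "moments_bounded M I Y ==> moments_bounded M I (%i w. Y i w ^ k)"
 by (induction k) (auto intro: moments_bounded_const moments_bounded_mult)

lemma moments_bounded_abs:
 "moments_bounded M I Y ==> moments_bounded M I (%i w. abs (Y i w))"
 by (auto simp: moments_bounded_def)

lemma moments_bounded_diff:
 assumes "moments_bounded M I Y" "moments_bounded M I Z"
 shows "moments_bounded M I (%i w. Y i w - Z i w)"
 using moments_bounded_add[OF assms(1) moments_bounded_mult[OF moments_bounded_const[of I "-1"] assms(2)]]
 by simp

lemma moments_bounded_integrable:
 assumes "moments_bounded M I Y" "i : I"
 shows "integrable M (Y i)"
proof -
 have "integrable M (%w. abs (Y i w) ^ 1)"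
  using assms unfolding moments_bounded_def by blast
 then show ?thesis using integrable_abs_cancel[OF _ moments_boundedD[OF assms]] by simp
qed

lemma moments_bounded_mean:
 assumes "moments_bounded M I Y"
 shows "EX C. ALL i:I. integrable M (Y i) & (LINT w|M. abs (Y i w)) <= C"
proof -
 obtain C where "ALL i:I. integrable M (%w. abs (Y i w) ^ 1) & (LINT w|M. abs (Y i w) ^ 1) <= C"
  using assms unfolding moments_bounded_def by meson
 then show ?thesis using moments_bounded_integrable[OF assms] by (intro exI[of _ C]) auto
qed

text \<open>Origin of the exponent 3/2. Cauchy-Schwarz is used twice: on
  \<open>Y * (Y * W^2)\<close>, with mere moment bounds for the second factor, it gives order
  \<open>r\<close> for \<open>(Y * W)^2\<close>; on \<open>Y * (Y * W)\<close> it then gives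
  \<open>r * sqrt r\<close>. A single application would stop at order \<open>r\<close>.\<close>

lemma mean_order_square_weight:
 fixes Y W :: "'i => 'a => real"
 assumes Y2: "mean_order M I (%i. (r i)^2) (%i w. (Y i w)^2)"
  and Y: "moments_bounded M I Y" and W: "moments_bounded M I W"
  and pos: "!!i. i : I ==> r i > 0"
 shows "mean_order M I (%i. r i * sqrt (r i)) (%i w. (Y i w)^2 * W i w)"
proof -
 note [measurable] = moments_boundedD[OF Y] moments_boundedD[OF W]
 have 1: "mean_order M I (%i. r i * 1) (%i w. Y i w * (Y i w * (W i w)^2))"
 proof (rule mean_order_mult[OF Y2])
  have "moments_bounded M I (%i w. Y i w * (W i w)^2)"
   by (intro moments_bounded_mult moments_bounded_power Y W)
  from moments_bounded_mean_order[OF this, of 2]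
  show "mean_order M I (%i. 1^2) (%i w. (Y i w * (W i w)^2)^2)" by simp
 qed (use pos in auto)
 have "mean_order M I (%i. r i * sqrt (r i)) (%i w. Y i w * (Y i w * W i w))"
 proof (rule mean_order_mult[OF Y2])
  have "mean_order M I (%i. r i) (%i w. (Y i w * W i w)^2)"
   using 1 by (simp add: power2_eq_square mult_ac)
  then show "mean_order M I (%i. (sqrt (r i))^2) (%i w. (Y i w * W i w)^2)"
   unfolding mean_order_def using pos by (force simp: less_imp_le)
 qed (use pos in auto)
 then show ?thesis by (simp add: power2_eq_square mult_ac)
qed

lemma mean_order_cong_order:
 assumes "mean_order M I r Y" "!!i. i : I ==> r i = s i"
 shows "mean_order M I s Y"
 using assms unfolding mean_order_def by metis

lemma mean_order_weaken:
 assumes "mean_order M I r Y" "!!i. i : I ==> 0 <= r i" "!!i. i : I ==> r i <= K * s i"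
 shows "mean_order M I s Y"
proof -
 obtain C where C: "!!i. i : I ==> integrable M (Y i) & (LINT w|M. abs (Y i w)) <= C * r i"
  using assms(1) unfolding mean_order_def by blast
 have "C * r i <= (max C 0 * K) * s i" if "i : I" for i
 proof -
  have "C * r i <= max C 0 * r i" using assms(2)[OF that] by (simp add: mult_right_mono)
  also have "... <= max C 0 * (K * s i)" using assms(3)[OF that] by (simp add: mult_left_mono)
  finally show ?thesis by (simp add: mult_ac)
 qed
 with C show ?thesis unfolding mean_order_def
  by (intro exI[of _ "max C 0 * K"]) (blast intro: order_trans)
qed

section \<open>Sums over the rows of the observation array\<close>

definition rows :: "nat => (nat \<times> nat) set" where
 "rows n0 = {(n, j). n0 <= n & 1 <= j & j <= n}"

lemma rows_iff [simp]: "(n, j) : rows n0 \<longleftrightarrow> n0 <= n & 1 <= j & j <= n"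
 by (simp add: rows_def)

lemma mean_order_rows_sum:
 assumes "mean_order M (rows n0) (%i. r (fst i)) Y"
 shows "\<exists>C\<ge>0. \<forall>n\<ge>n0. integrable M (%w. k n * (\<Sum>j=1..n. Y (n, j) w)) &
      (LINT w|M. abs (k n * (\<Sum>j=1..n. Y (n, j) w))) <= C * abs (k n * (real n * r n))"
proof -
 obtain C where C: "!!i. i : rows n0 ==> integrable M (Y i)" "!!i. i : rows n0 ==> (LINT w|M. abs (Y i w)) <= C * r (fst i)"
  using assms unfolding mean_order_def by blast
 have "(LINT w|M. abs (k n * (\<Sum>j=1..n. Y (n, j) w))) <= abs C * abs (k n * (real n * r n))" if n: "n >= n0" for n
 proof -
  have "(LINT w|M. abs (\<Sum>j=1..n. Y (n, j) w)) <= (LINT w|M. (\<Sum>j=1..n. abs (Y (n, j) w)))"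
   using C(1) n by (intro integral_mono integrable_abs Bochner_Integration.integrable_sum) auto
  also have "... = (\<Sum>j=1..n. \<integral>w. abs (Y (n, j) w) \<partial>M)" using C(1) n by (intro Bochner_Integration.integral_sum) auto
  also have "... <= (\<Sum>j=1..n. C * r n)" using C(2) n by (intro sum_mono) force
  also have "... <= abs C * abs (real n * r n)" by (simp flip: abs_mult add: mult_ac)
  finally have "abs (k n) * (LINT w|M. abs (\<Sum>j=1..n. Y (n, j) w)) <= abs (k n) * (abs C * abs (real n * r n))" by (rule mult_left_mono) simp
  then show ?thesis by (simp add: abs_mult mult_ac)
 qed
 then show ?thesis using C(1) by (intro exI[of _ "abs C"]) (auto intro!: Bochner_Integration.integrable_sum)
qed

lemma bounded_in_prob_rows:
 assumes "mean_order M (rows n0) (%i. r (fst i)) Y" "\<forall>\<^sub>F n in sequentially. abs (k n * (real n * r n)) <= B"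
 shows "bounded_in_prob M (%n w. k n * (\<Sum>j=1..n. Y (n, j) w))"
proof -
 note C = mean_order_rows_sum[OF assms(1), of k]
 then obtain C where C: "C >= 0" "!!n. n >= n0 ==> integrable M (%w. k n * (\<Sum>j=1..n. Y (n, j) w)) &
      (LINT w|M. abs (k n * (\<Sum>j=1..n. Y (n, j) w))) <= C * abs (k n * (real n * r n))" by blast
 show ?thesis
  by (rule bounded_in_prob_L1[where C="C * B"], use assms(2) eventually_ge_at_top[of n0] in eventually_elim)
   (use C mult_left_mono[OF _ C(1)] in "blast intro: order_trans")
qed

lemma vanish_in_prob_rows:
 assumes "mean_order M (rows n0) (%i. r (fst i)) Y" "(%n. k n * (real n * r n)) \<longlonglongrightarrow> 0"
 shows "vanish_in_prob M (%n w. k n * (\<Sum>j=1..n. Y (n, j) w))"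
proof -
 obtain C where C: "!!n. n >= n0 ==> integrable M (%w. k n * (\<Sum>j=1..n. Y (n, j) w)) &
      (LINT w|M. abs (k n * (\<Sum>j=1..n. Y (n, j) w))) <= C * abs (k n * (real n * r n))"
  using mean_order_rows_sum[OF assms(1), of k] by blast
 show ?thesis
  by (rule vanish_in_prob_L1[OF eventually_mono[OF eventually_ge_at_top[of n0] C]])
   (use assms(2) in "auto intro: tendsto_mult_right_zero tendsto_rabs_zero")
qed

end

section \<open>Moments\<close>

definition all_moments :: "'w measure => ('w => real) => bool" where
 "all_moments M Y \<longleftrightarrow> Y : borel_measurable M & (\<forall>q::nat. integrable M (%w. abs (Y w) ^ q))"

context prob_space
begin

lemma all_moments_iff: "all_moments M Y \<longleftrightarrow> moments_bounded M (UNIV :: unit set) (%_. Y)"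
 by (auto simp: all_moments_def moments_bounded_def)

lemma moments_bounded_all_moments: "moments_bounded M I Y ==> i : I ==> all_moments M (Y i)"
 unfolding all_moments_def moments_bounded_def by blast

lemma all_moments_meas: "all_moments M Y ==> Y : borel_measurable M"
 by (simp add: all_moments_def)

lemma all_moments_add: "all_moments M Y ==> all_moments M Z ==> all_moments M (%w. Y w + Z w)"
 unfolding all_moments_iff by (rule moments_bounded_add)

lemma all_moments_diff: "all_moments M Y ==> all_moments M Z ==> all_moments M (%w. Y w - Z w)"
 unfolding all_moments_iff by (rule moments_bounded_diff)

lemma all_moments_mult: "all_moments M Y ==> all_moments M Z ==> all_moments M (%w. Y w * Z w)"
 unfolding all_moments_iff by (rule moments_bounded_mult)

lemma all_moments_const: "all_moments M (%w. c)"
 unfolding all_moments_iff by (rule moments_bounded_const)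

lemma all_moments_power: "all_moments M Y ==> all_moments M (%w. Y w ^ k)"
 unfolding all_moments_iff by (rule moments_bounded_power)

lemma all_moments_abs: "all_moments M Y ==> all_moments M (%w. abs (Y w))"
 unfolding all_moments_iff by (rule moments_bounded_abs)

lemma all_moments_sum:
 "(!!i. i : I ==> all_moments M (Y i)) ==> all_moments M (%w. \<Sum>i\<in>I. Y i w)"
 by (induction I rule: infinite_finite_induct) (auto intro: all_moments_const all_moments_add)

lemma all_moments_integrable: "all_moments M Y ==> integrable M Y"
 unfolding all_moments_iff by (rule moments_bounded_integrable) auto

lemma all_moments_bound:
 assumes "all_moments M Z" "Y : borel_measurable M" "!!w. w : space M ==> abs (Y w) <= abs (Z w)"
 shows "all_moments M Y"
 using assms moments_bounded_mono[of "UNIV :: unit set" "%_. Z" "%_. Y" 1]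
 unfolding all_moments_iff by simp

lemmas all_moments_intros = all_moments_add all_moments_diff all_moments_mult all_moments_const
 all_moments_power all_moments_abs all_moments_sum

end

text \<open>If \<open>t <= s\<close>, surplus powers of \<open>t\<close> are traded for powers of
  \<open>s\<close> down to exponent \<open>j\<close>; otherwise all powers of \<open>s\<close> are
  traded for powers of \<open>t\<close>. With \<open>s = 1\<close> it bounds a moment by a lower and
  a higher one.\<close>

lemma power_mult_interpolate:
 fixes s t :: real
 assumes "s >= 0" "t >= 0" "j <= i" "i <= r"
 shows "s ^ (r - i) * t ^ i <= s ^ (r - j) * t ^ j + t ^ r"
proof (cases "t <= s")
 case True
 have "s ^ (r - i) * t ^ i = s ^ (r - i) * (t ^ (i - j) * t ^ j)"
  using assms by (simp flip: power_add)
 also have "... <= s ^ (r - i) * (s ^ (i - j) * t ^ j)"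
  using assms True by (intro mult_left_mono mult_right_mono power_mono) auto
 also have "... = s ^ (r - j) * t ^ j" using assms by (simp flip: power_add mult.assoc)
 finally show ?thesis using assms by (simp add: add_increasing2)
next
 case False
 have "s ^ (r - i) * t ^ i <= t ^ (r - i) * t ^ i"
  using assms False by (intro mult_right_mono power_mono) auto
 also have "... = t ^ r" using assms by (simp flip: power_add)
 finally show ?thesis using assms by (simp add: add_increasing)
qed

section \<open>Moments of the noise\<close>

text \<open>Cauchy's functional equation. Non-negativity makes an additive function monotone, and a
  monotone one is squeezed between its values at rational points.\<close>

lemma additive_nonneg_linear:
 fixes f :: "real => real"
 assumes add: "!!s t. s >= 0 ==> t >= 0 ==> f (s + t) = f s + f t"
  and nonneg: "!!t. t >= 0 ==> f t >= 0" and t: "t >= 0"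
 shows "f t = t * f 1"
proof -
 have f0: "f 0 = 0" using add[of 0 0] by simp
 have mult: "f (real n * t) = real n * f t" if "t >= 0" for n t
 proof (induction n)
  case (Suc n)
  have "f (real (Suc n) * t) = f (real n * t + t)" by (simp add: algebra_simps)
  also have "... = f (real n * t) + f t" using that by (intro add) auto
  finally show ?case using Suc by (simp add: algebra_simps)
 qed (simp add: f0)
 have mono: "f s <= f t" if "0 <= s" "s <= t" for s t
  using add[of s "t - s"] nonneg[of "t - s"] that by simp
 have "abs (f t - t * f 1) <= f 1 * (1 / real (Suc n))" for n
 proof -
  define N where "N = Suc n"
  \<comment> \<open>Both \<open>N * f t\<close> and \<open>N * t * f 1\<close> lie between
    \<open>k * f 1\<close> and \<open>(k + 1) * f 1\<close>, so they differ by at most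
    \<open>f 1\<close>; division by \<open>N\<close> gives the claim.\<close>
  define k where "k = nat \<lfloor>real N * t\<rfloor>"
  have "0 <= real N * t" using t by simp
  then have k: "real k <= real N * t" "real N * t <= real (Suc k)" unfolding k_def by linarith+
  have "f (real k * 1) <= f (real N * t)" "f (real N * t) <= f (real (Suc k) * 1)"
   using k by (auto intro!: mono simp: t)
  then have 1: "real k * f 1 <= real N * f t" "real N * f t <= real (Suc k) * f 1"
   using mult[of 1 k] mult[of 1 "Suc k"] mult[OF t, of N] by auto
  have 2: "real k * f 1 <= real N * t * f 1" "real N * t * f 1 <= real (Suc k) * f 1"
   using k nonneg[of 1] by (auto intro!: mult_right_mono simp del: of_nat_Suc)
  define d where "d = f t - t * f 1"
  have "abs (real N * d) <= f 1"
   using 1 2 by (simp add: d_def algebra_simps abs_le_iff)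
  then have "real N * abs d <= f 1" by (simp add: abs_mult)
  moreover have "real N > 0" by (simp add: N_def)
  ultimately show ?thesis unfolding N_def[symmetric] d_def[symmetric]
   by (simp add: pos_le_divide_eq mult.commute)
 qed
 moreover have "(%n. f 1 * (1 / real (Suc n))) \<longlonglongrightarrow> f 1 * 0"
  by (intro tendsto_mult tendsto_const lim_1_over_n[THEN LIMSEQ_Suc])
 ultimately have "abs (f t - t * f 1) <= 0"
  by (intro tendsto_lowerbound[of "%n. f 1 * (1 / real (Suc n))"]) auto
 then show ?thesis by simp
qed

context prob_space
begin

text \<open>Lower semicontinuity of the second moment. The bounds may vary with \<open>n\<close>, so
  that a sequence of bounds tending to 0 forces the limit to vanish; the mean of the noise is
  treated in this way.\<close>

lemma fatou_square:
 fixes Y :: "nat => 'a => real"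
 assumes meas [measurable]: "!!n. Y n : borel_measurable M" "Z : borel_measurable M"
  and lim: "AE w in M. (%n. Y n w) \<longlonglongrightarrow> Z w"
  and le: "\<forall>\<^sub>F n in sequentially. integrable M (%w. (Y n w)^2) & (LINT w|M. (Y n w)^2) <= B n"
  and B: "B \<longlonglongrightarrow> b"
 shows "integrable M (%w. (Z w)^2)" "(LINT w|M. (Z w)^2) <= b"
proof -
 have "0 <= B n" if "(LINT w|M. (Y n w)^2) <= B n" for n
  using that by (rule order_trans[rotated]) (simp add: Bochner_Integration.integral_nonneg)
 then have b: "b >= 0"
  using le by (intro tendsto_lowerbound[OF B]) (auto elim: eventually_mono)
 have "(\<integral>\<^sup>+w. ennreal ((Z w)^2) \<partial>M) = (\<integral>\<^sup>+w. liminf (%n. ennreal ((Y n w)^2)) \<partial>M)"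
 proof (rule nn_integral_cong_AE, use lim in eventually_elim)
  case (elim w)
  then have "(%n. ennreal ((Y n w)^2)) \<longlonglongrightarrow> ennreal ((Z w)^2)"
   by (intro tendsto_ennrealI tendsto_power)
  from lim_imp_Liminf[OF _ this] show ?case by simp
 qed
 also have "... <= liminf (%n. \<integral>\<^sup>+w. ennreal ((Y n w)^2) \<partial>M)"
  by (intro nn_integral_liminf) measurable
 also have "... <= liminf (%n. ennreal (B n))"
  by (intro Liminf_mono, use le in eventually_elim) (auto simp: nn_integral_eq_integral ennreal_leI)
 also have "... = ennreal b" using B by (intro lim_imp_Liminf tendsto_ennrealI) auto
 finally have *: "(\<integral>\<^sup>+w. ennreal ((Z w)^2) \<partial>M) <= ennreal b" .
 show i: "integrable M (%w. (Z w)^2)"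
 proof (rule integrableI_nonneg)
  show "(\<integral>\<^sup>+w. ennreal ((Z w)^2) \<partial>M) < \<infinity>" using * by (rule le_less_trans) simp
 qed simp_all
 show "(LINT w|M. (Z w)^2) <= b"
 proof -
  have "(\<integral>\<^sup>+w. ennreal ((Z w)^2) \<partial>M) = ennreal (LINT w|M. (Z w)^2)"
   by (rule nn_integral_eq_integral[OF i]) simp
  then show ?thesis using * ennreal_le_iff[OF b] by simp
 qed
qed

end

section \<open>Independence and moments of the increments of the noise\<close>

locale levy_noise = prob_space M for M :: "'w measure" +
 fixes F :: "real => 'w measure" and J :: "real => 'w => real"
 assumes subalg: "!!t. 0 <= t ==> subalgebra M (F t)"
  and filtration: "!!s t. 0 <= s ==> s <= t ==> sets (F s) \<subseteq> sets (F t)"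
  and levy: "levy_process M F J"
  and J_mean: "(LINT w|M. J 1 w) = 0" and J_var: "(LINT w|M. (J 1 w)^2) = 1"
  and J_powr: "!!r. r > 0 ==> integrable M (%w. abs (J 1 w) powr r)"
begin

lemma F_meas: "0 <= t ==> f : borel_measurable (F t) ==> f : borel_measurable M"
 using measurable_from_subalg[OF subalg] .

lemma F_mono: "0 <= s ==> s <= t ==> f : borel_measurable (F s) ==> f : borel_measurable (F t)"
 by (rule measurable_from_subalg[of "F t" "F s"])
  (use subalg[of s] subalg[of t] filtration[of s t] in "simp_all add: subalgebra_def")

lemma F_space: "0 <= t ==> space (F t) = space M"
 using subalg by (simp add: subalgebra_def)

lemma J_F: "0 <= t ==> J t : borel_measurable (F t)"
 using levy by (simp add: levy_process_def adapted_def)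

lemma J_meas [measurable]: "0 <= t ==> J t : borel_measurable M"
 using F_meas J_F by blast

lemma J_zero: "AE w in M. J 0 w = 0"
 using levy by (simp add: levy_process_def)

lemma increment_distr:
 "0 <= s ==> s <= t ==> distr M borel (%w. J t w - J s w) = distr M borel (J (t - s))"
 using levy by (simp add: levy_process_def)

lemma increment_indep:
 fixes G :: "'w => real" and g :: "real => real"
 assumes s: "0 <= s" "s <= t" and G: "G : borel_measurable (F s)" and [measurable]: "g : borel_measurable borel"
 shows "indep_var borel G borel (%w. g (J t w - J s w))"
 unfolding indep_var_eq
proof (intro conjI)
 let ?D = "%w. J t w - J s w"
 have [measurable]: "?D : borel_measurable M" using J_meas[of s] J_meas[of t] s by auto
 show "random_variable borel G" using F_meas s G by blast
 show "random_variable borel (%w. g (?D w))" by measurable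
 have ind: "indep_set (sets (F s)) (sets (vimage_algebra (space M) ?D borel))"
  using levy s by (simp add: levy_process_def)
 have sub1: "sigma_sets (space M) {G -` A \<inter> space M |A. A : sets borel} \<subseteq> sets (F s)"
  using sets.sigma_sets_subset[of "{G -` A \<inter> space M |A. A : sets borel}" "F s"] measurable_sets[OF G] s
  by (force simp: F_space)
 have sub2: "sigma_sets (space M) {(%w. g (?D w)) -` A \<inter> space M |A. A : sets borel}
   \<subseteq> sets (vimage_algebra (space M) ?D borel)"
 proof -
  have "(%w. g (?D w)) : borel_measurable (vimage_algebra (space M) ?D borel)"
   by (rule measurable_compose[OF measurable_vimage_algebra1]) auto
  from measurable_sets[OF this] show ?thesis
   using sets.sigma_sets_subset[of "{(%w. g (?D w)) -` A \<inter> space M |A. A : sets borel}"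
     "vimage_algebra (space M) ?D borel"] by force
 qed
 show "indep_set (sigma_sets (space M) {G -` A \<inter> space M |A. A : sets borel})
   (sigma_sets (space M) {(%w. g (?D w)) -` A \<inter> space M |A. A : sets borel})"
  unfolding indep_set_def
  by (rule indep_sets_mono_sets[OF ind[unfolded indep_set_def]]) (use sub1 sub2 in "simp split: bool.splits")
qed

lemma increment_integral:
 assumes s: "0 <= s" "s <= t" and [measurable]: "g : borel_measurable borel"
 shows "(LINT w|M. g (J t w - J s w)) = (LINT w|M. (g (J (t - s) w) :: real))"
  "integrable M (%w. g (J t w - J s w)) \<longleftrightarrow> integrable M (%w. g (J (t - s) w))"
proof -
 have [measurable]: "(%w. J t w - J s w) : borel_measurable M" "J (t - s) : borel_measurable M"
  using s by auto
 show "(LINT w|M. g (J t w - J s w)) = (LINT w|M. g (J (t - s) w))"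
  using integral_distr[of "%w. J t w - J s w" M borel g] integral_distr[of "J (t - s)" M borel g]
   increment_distr[OF s] by simp
 show "integrable M (%w. g (J t w - J s w)) \<longleftrightarrow> integrable M (%w. g (J (t - s) w))"
  using integrable_distr_eq[of "%w. J t w - J s w" M borel g] integrable_distr_eq[of "J (t - s)" M borel g]
   increment_distr[OF s] by simp
qed

lemma increment_factor:
 fixes G :: "'w => real" and g :: "real => real"
 assumes s: "0 <= s" "s <= t" and G: "G : borel_measurable (F s)" "integrable M G"
  and g: "g : borel_measurable borel" "integrable M (%w. g (J (t - s) w))"
 shows "integrable M (%w. G w * g (J t w - J s w))"
  "(LINT w|M. G w * g (J t w - J s w)) = (LINT w|M. G w) * (LINT w|M. g (J (t - s) w))"
 using indep_var_integrable[OF increment_indep[OF s G(1) g(1)] G(2)]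
  indep_var_lebesgue_integral[OF increment_indep[OF s G(1) g(1)] G(2)]
  increment_integral[OF s g(1)] g(2) by auto

lemma all_moments_increment_iff:
 assumes "0 <= s" "s <= t"
 shows "all_moments M (%w. J t w - J s w) \<longleftrightarrow> all_moments M (J (t - s))"
 using increment_integral(2)[OF assms, of "%z. abs z ^ _"] assms by (auto simp: all_moments_def)

lemma all_moments_J1: "all_moments M (J 1)"
 unfolding all_moments_def
proof (intro conjI allI)
 fix q :: nat
 show "integrable M (%w. abs (J 1 w) ^ q)"
 proof (cases "q = 0")
  case False
  then have "abs (J 1 w) ^ q = abs (J 1 w) powr real q" for w
   by (cases "J 1 w = 0") (auto simp: powr_realpow)
  then show ?thesis using J_powr[of "real q"] False by simp
 qed simp
qed simp

lemma all_moments_J_nat: "all_moments M (J (real n))"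
proof (induction n)
 case 0
 have "integrable M (%w. abs (J 0 w) ^ q)" for q :: nat
 proof -
  have "integrable M (%w. abs (0 :: real) ^ q)" by simp
  then show ?thesis
   by (rule integrable_cong_AE_imp) (use J_zero in "auto elim: eventually_mono")
 qed
 then show ?case by (simp add: all_moments_def)
next
 case (Suc n)
 have "all_moments M (%w. J (real n) w + (J (real (Suc n)) w - J (real n) w))"
  using all_moments_increment_iff[of "real n" "real (Suc n)"] all_moments_J1
  by (intro all_moments_add Suc) auto
 then show ?case by (simp add: all_moments_def)
qed

text \<open>For fractional \<open>t\<close>, \<open>J t\<close> plus an independent increment equals
  \<open>J N\<close> with \<open>N\<close> an integer, whose moments exist. By Fubini some value
  \<open>y\<close> of the increment leaves \<open>|J t + y|^q\<close> integrable, and removing the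
  constant \<open>y\<close> costs a factor \<open>2 ^ q\<close>.\<close>

lemma all_moments_J:
 assumes t: "0 <= t"
 shows "all_moments M (J t)"
 unfolding all_moments_def
proof (intro conjI allI)
 fix q :: nat
 define N where "N = nat \<lceil>t\<rceil>"
 have N: "t <= real N" unfolding N_def by linarith
 let ?D = "%w. J (real N) w - J t w"
 have [measurable]: "J t : borel_measurable M" "?D : borel_measurable M" using t N by auto
 have ind: "indep_var borel (J t) borel ?D"
  using increment_indep[OF t N J_F[OF t], of "%x. x"] by simp
 interpret A: prob_space "distr M borel (J t)" by (rule prob_space_distr) measurable
 interpret B: prob_space "distr M borel ?D" by (rule prob_space_distr) measurable
 interpret AB: pair_sigma_finite "distr M borel (J t)" "distr M borel ?D" ..
 have "integrable M (%w. abs (J t w + ?D w) ^ q)"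
  using all_moments_J_nat[of N] by (simp add: all_moments_def)
 then have "integrable (distr M (borel \<Otimes>\<^sub>M borel) (%w. (J t w, ?D w))) (%(x, y). abs (x + y) ^ q)"
  by (subst integrable_distr_eq) auto
 then have "integrable (distr M borel (J t) \<Otimes>\<^sub>M distr M borel ?D) (%(x, y). abs (x + y) ^ q)"
  using ind unfolding indep_var_distribution_eq by simp
 then have "AE y in distr M borel ?D. integrable (distr M borel (J t)) (%x. abs (x + y) ^ q)"
  by (rule AB.AE_integrable_snd)
 then obtain y where "integrable (distr M borel (J t)) (%x. abs (x + y) ^ q)"
  using eventually_happens'[OF B.ae_filter_bot] by blast
 then have i: "integrable M (%w. abs (J t w + y) ^ q)"
  by (subst (asm) integrable_distr_eq) auto
 have "integrable M (%w. 2 ^ q * (abs (J t w + y) ^ q + abs y ^ q))"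
  using i by (intro integrable_mult_right Bochner_Integration.integrable_add) auto
 then show "integrable M (%w. abs (J t w) ^ q)"
 proof (rule Bochner_Integration.integrable_bound)
  have "abs x ^ q <= 2 ^ q * (abs (x + y) ^ q + abs y ^ q)" for x :: real
  proof -
   have "abs x <= abs (x + y) + abs y" by arith
   then have "abs x <= 2 * max (abs (x + y)) (abs y)" by (simp add: max_def split: if_splits)
   then have "abs x ^ q <= (2 * max (abs (x + y)) (abs y)) ^ q" by (intro power_mono) auto
   also have "... <= 2 ^ q * (abs (x + y) ^ q + abs y ^ q)" by (auto simp: power_mult_distrib max_def)
   finally show ?thesis .
  qed
  then show "AE w in M. norm (abs (J t w) ^ q) <= norm (2 ^ q * (abs (J t w + y) ^ q + abs y ^ q))"
   by (intro AE_I2) auto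
 qed measurable
qed (use t in simp)

lemma all_moments_increment: "0 <= s ==> s <= t ==> all_moments M (%w. J t w - J s w)"
 using all_moments_J by (intro all_moments_diff) auto

lemma J_integrable_power: "0 <= t ==> integrable M (%w. J t w ^ k)"
 by (intro all_moments_integrable all_moments_power all_moments_J)

lemma J_moment_add:
 assumes st: "0 <= s" "0 <= t"
 shows "(LINT w|M. J (s + t) w ^ k) =
  (\<Sum>i\<le>k. real (k choose i) * ((LINT w|M. J s w ^ i) * (LINT w|M. J t w ^ (k - i))))"
proof -
 let ?D = "%w. J (s + t) w - J s w"
 have f: "integrable M (%w. J s w ^ i * ?D w ^ j)"
  "(LINT w|M. J s w ^ i * ?D w ^ j) = (LINT w|M. J s w ^ i) * (LINT w|M. J t w ^ j)" for i j
  using increment_factor[of s "s + t" "%w. J s w ^ i" "%z. z ^ j"] st J_integrable_power J_F[of s]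
  by auto
 have "(LINT w|M. J (s + t) w ^ k) = (LINT w|M. (J s w + ?D w) ^ k)" by simp
 also have "... = (LINT w|M. (\<Sum>i\<le>k. real (k choose i) * (J s w ^ i * ?D w ^ (k - i))))"
  by (simp only: binomial_ring mult.assoc)
 also have "... = (\<Sum>i\<le>k. real (k choose i) * ((LINT w|M. J s w ^ i) * (LINT w|M. J t w ^ (k - i))))"
  using f by (subst Bochner_Integration.integral_sum) auto
 finally show ?thesis .
qed

lemma J_mean_add: "0 <= s ==> 0 <= t ==> (LINT w|M. J (s + t) w) = (LINT w|M. J s w) + (LINT w|M. J t w)"
 using J_moment_add[of s t 1] by (simp add: prob_space)

text \<open>The variance is additive over independent increments and non-negative, hence linear in
  time. The variance has to come before the second moment: that the mean vanishes at all times is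
  deduced from it.\<close>

lemma J_variance:
 assumes "0 <= t"
 shows "(LINT w|M. (J t w)^2) - (LINT w|M. J t w)^2 = t"
proof -
 let ?v = "%t. (LINT w|M. (J t w)^2) - (LINT w|M. J t w)^2"
 have "?v t = t * ?v 1"
 proof (rule additive_nonneg_linear[OF _ _ assms])
  fix s t :: real assume "0 <= s" "0 <= t"
  then show "?v (s + t) = ?v s + ?v t"
   using J_moment_add[of s t 2] J_mean_add[of s t]
   by (simp add: prob_space numeral_2_eq_2 algebra_simps power2_sum)
 next
  fix t :: real assume t: "0 <= t"
  have "variance (J t) = ?v t"
   using J_integrable_power[OF t, of 1] J_integrable_power[OF t, of 2] by (intro variance_eq) auto
  then show "?v t >= 0" using variance_positive[of "J t"] by simp
 qed
 then show ?thesis by (simp add: J_mean J_var)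
qed

lemma J_mean_zero:
 assumes t: "0 <= t"
 shows "(LINT w|M. J t w) = 0"
proof -
 define m where "m t = (LINT w|M. J t w)" for t
 have add: "m (s + t) = m s + m t" if "0 <= s" "0 <= t" for s t
  using J_mean_add that by (simp add: m_def)
 have mult: "m (real n * t) = real n * m t" if "t >= 0" for n t
 proof (induction n)
  case 0
  show ?case using add[of 0 0] by simp
 next
  case (Suc n)
  have "m (real (Suc n) * t) = m (real n * t + t)" by (simp add: algebra_simps)
  also have "... = m (real n * t) + m t" using that by (intro add) auto
  finally show ?case using Suc by (simp add: algebra_simps)
 qed
 define \<tau> where "\<tau> n = t - real (nat \<lfloor>real (Suc n) * t\<rfloor>) / real (Suc n)" for n
 have \<tau>: "0 <= \<tau> n" "\<tau> n <= 1 / real (Suc n)" for n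
 proof -
  define N where "N = real (Suc n)"
  define K where "K = real (nat \<lfloor>N * t\<rfloor>)"
  have "0 <= N * t" "N > 0" using t by (simp_all add: N_def)
  then have "K <= N * t" "N * t <= K + 1" unfolding K_def by linarith+
  with \<open>N > 0\<close> have "K / N <= t" "t <= (K + 1) / N"
   by (simp_all add: pos_divide_le_eq pos_le_divide_eq mult.commute)
  then show "0 <= \<tau> n" "\<tau> n <= 1 / real (Suc n)"
   unfolding \<tau>_def N_def[symmetric] K_def[symmetric] by (simp_all add: add_divide_distrib)
 qed
 have m\<tau>: "m t = m (\<tau> n)" for n
 proof -
  let ?k = "nat \<lfloor>real (Suc n) * t\<rfloor>"
  have "real (Suc n) * m (1 / real (Suc n)) = 0"
   using mult[of "1 / real (Suc n)" "Suc n"] J_mean by (simp add: m_def)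
  then have "m (1 / real (Suc n)) = 0" by simp
  then have "m (real ?k * (1 / real (Suc n))) = 0" using mult[of "1 / real (Suc n)" ?k] by simp
  moreover have "t = \<tau> n + real ?k * (1 / real (Suc n))" by (simp add: \<tau>_def)
  ultimately show ?thesis using add[OF \<tau>(1), of "real ?k * (1 / real (Suc n))" n] by simp
 qed
 have \<tau>0: "\<tau> \<longlonglongrightarrow> 0"
  by (rule tendsto_sandwich[of "%_. 0" _ _ "%n. 1 / real (Suc n)"])
   (use \<tau> LIMSEQ_inverse_real_of_nat in "auto simp: inverse_eq_divide")
 have [measurable]: "J (\<tau> n) : borel_measurable M" for n using \<tau> by simp
 have "AE w in M. cadlag (%t. J t w)" using levy by (simp add: levy_process_def)
 with J_zero have lim: "AE w in M. (%n. J (\<tau> n) w - m t) \<longlonglongrightarrow> - m t"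
 proof eventually_elim
  case (elim w)
  have right: "((%t. J t w) \<longlongrightarrow> 0) (at_right 0)" using elim unfolding cadlag_def by auto
  have "(%n. J (\<tau> n) w) \<longlonglongrightarrow> 0"
  proof (rule tendstoI)
   fix e :: real assume "e > 0"
   with right obtain b where b: "b > 0" "!!y. 0 < y ==> y < b ==> dist (J y w) 0 < e"
    unfolding tendsto_iff eventually_at_right_field by meson
   have "\<forall>\<^sub>F n in sequentially. \<tau> n < b" using order_tendstoD(2)[OF \<tau>0 b(1)] .
   then show "\<forall>\<^sub>F n in sequentially. dist (J (\<tau> n) w) 0 < e"
   proof eventually_elim
    fix n assume "\<tau> n < b"
    then show "dist (J (\<tau> n) w) 0 < e"
     using b(2)[of "\<tau> n"] \<tau>(1)[of n] elim(1) \<open>e > 0\<close> by (cases "\<tau> n = 0") auto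
   qed
  qed
  then show ?case using tendsto_diff[OF _ tendsto_const, of "%n. J (\<tau> n) w" 0 sequentially "m t"] by simp
 qed
 have "(LINT w|M. (- m t)^2) <= 0"
 proof (rule fatou_square(2)[OF _ _ lim _ \<tau>0])
  have "integrable M (%w. (J (\<tau> n) w - m t)^2)" for n
   by (intro all_moments_integrable all_moments_intros all_moments_J \<tau>)
  moreover have "(LINT w|M. (J (\<tau> n) w - m t)^2) = \<tau> n" for n
  proof -
   have "variance (J (\<tau> n)) = \<tau> n"
    using J_variance[OF \<tau>(1)[of n]] J_integrable_power[OF \<tau>(1), of n 1] J_integrable_power[OF \<tau>(1), of n 2]
    by (subst variance_eq) auto
   then show ?thesis using m\<tau>[of n] by (simp add: m_def)
  qed
  ultimately show "\<forall>\<^sub>F n in sequentially. integrable M (%w. (J (\<tau> n) w - m t)^2) &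
    (LINT w|M. (J (\<tau> n) w - m t)^2) <= \<tau> n" by simp
 qed auto
 then show ?thesis by (simp add: m_def prob_space)
qed

lemma J_second_moment: "0 <= t ==> (LINT w|M. (J t w)^2) = t"
 using J_variance J_mean_zero by simp

text \<open>The moments are superadditive in time up to an error \<open>O(s t)\<close>, because odd lowest-order
 terms vanish with the mean.\<close>

lemma J_even_moment: "m >= 1 ==> \<exists>C\<ge>0. ALL t. 0 <= t --> t <= 1 --> (LINT w|M. J t w ^ (2 * m)) <= C * t"
proof (induction m rule: less_induct)
 case (less m)
 show ?case
 proof (cases "m = 1")
  case True
  then show ?thesis by (intro exI[of _ 1]) (auto simp: J_second_moment)
 next
  case False
  with less.prems have m: "m >= 2" by simp
  define y where "y t = (LINT w|M. J t w ^ (2 * m))" for t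
  have y0: "y t >= 0" for t unfolding y_def by (intro Bochner_Integration.integral_nonneg) (simp add: zero_le_even_power)
  \<comment> \<open>The order \<open>2 m - 1\<close> is left out because the induction hypothesis
    does not reach it. In the binomial expansion it only occurs paired with the first moment, which
    is 0.\<close>
  have "\<exists>C\<ge>0. ALL t. 0 <= t --> t <= 1 --> abs (LINT w|M. J t w ^ j) <= C * t" if j: "1 <= j" "j <= 2 * m - 1" "j ~= 2 * m - 1" for j
  proof -
   consider "j = 1" | i where "j = 2 * i" "1 <= i" "i < m" | i where "j = 2 * i + 1" "1 <= i" "i + 1 < m"
   proof -
    have "j = 1 \<or> (EX i. j = 2 * i & 1 <= i & i < m) \<or> (EX i. j = 2 * i + 1 & 1 <= i & i + 1 < m)"
     using j by presburger
    then show thesis using that by blast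
   qed
   then show ?thesis
   proof cases
    case 1
    then show ?thesis by (intro exI[of _ 0]) (auto simp: J_mean_zero)
   next
    case 2
    obtain C where "C >= 0" "ALL t. 0 <= t --> t <= 1 --> (LINT w|M. J t w ^ (2 * i)) <= C * t"
     using less.IH 2 by blast
    then show ?thesis using 2
     by (intro exI[of _ C]) (auto simp: abs_of_nonneg Bochner_Integration.integral_nonneg zero_le_even_power)
   next
    case 3
    obtain C where C: "C >= 0" "!!t. 0 <= t ==> t <= 1 ==> (LINT w|M. J t w ^ (2 * i)) <= C * t"
     using less.IH[of i] 3 by auto
    obtain D where D: "D >= 0" "!!t. 0 <= t ==> t <= 1 ==> (LINT w|M. J t w ^ (2 * (i + 1))) <= D * t"
     using less.IH[of "i + 1"] 3 by auto
    have "abs (LINT w|M. J t w ^ j) <= (C + D) * t" if t: "0 <= t" "t <= 1" for t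
    proof -
     have "abs (LINT w|M. J t w ^ j) <= (LINT w|M. abs (J t w ^ j))" by (rule integral_abs_bound)
     also have "... <= (LINT w|M. J t w ^ (2 * i) + J t w ^ (2 * (i + 1)))"
     proof (intro integral_mono integrable_abs Bochner_Integration.integrable_add J_integrable_power t)
      fix w
      have "abs (J t w) ^ j <= abs (J t w) ^ (2 * i) + abs (J t w) ^ (2 * (i + 1))"
       using power_mult_interpolate[of 1 "abs (J t w)" "2 * i" j "2 * (i + 1)"] 3 by simp
      then show "abs (J t w ^ j) <= J t w ^ (2 * i) + J t w ^ (2 * (i + 1))"
       by (simp add: power_abs power_even_abs)
     qed
     also have "... = (LINT w|M. J t w ^ (2 * i)) + (LINT w|M. J t w ^ (2 * (i + 1)))"
      by (intro Bochner_Integration.integral_add J_integrable_power t)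
     also have "... <= (C + D) * t" using C(2)[OF t] D(2)[OF t] by (simp add: algebra_simps)
     finally show ?thesis .
    qed
    then show ?thesis using C D by (intro exI[of _ "C + D"]) auto
   qed
  qed
  then obtain C where C: "!!j. 1 <= j ==> j <= 2 * m - 1 ==> j ~= 2 * m - 1 ==> C j >= 0 & (ALL t. 0 <= t --> t <= 1 --> abs (LINT w|M. J t w ^ j) <= C j * t)"
   by metis
  define C0 where "C0 = (\<Sum>j\<in>{1..<2 * m - 1}. C j)"
  have C0: "C0 >= 0" unfolding C0_def by (intro sum_nonneg) (use C in auto)
  have CC: "abs (LINT w|M. J t w ^ j) <= C0 * t" if "1 <= j" "j < 2 * m - 1" "0 <= t" "t <= 1" for j t
  proof -
   have "C j <= C0" unfolding C0_def by (rule member_le_sum) (use C that in auto)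
   then show ?thesis using C[of j] that by (auto intro: order_trans mult_right_mono)
  qed
  \<comment> \<open>Each middle term of the expansion is at most its binomial coefficient times
    \<open>C0^2 s t\<close>, and the coefficients sum to at most \<open>2 ^ (2 m)\<close>.\<close>
  define B where "B = 4 ^ m * C0^2"
  have B0: "B >= 0" by (simp add: B_def)
  have sup: "y (s + t) >= y s + y t - B * (s * t)" if st: "0 <= s" "0 <= t" "s + t <= 1" for s t
  proof -
   let ?T = "%i. real (2 * m choose i) * ((LINT w|M. J s w ^ i) * (LINT w|M. J t w ^ (2 * m - i)))"
   have T: "?T i >= - (real (2 * m choose i) * (C0^2 * (s * t)))" if i: "1 <= i" "i <= 2 * m - 1" for i
   proof -
    have "abs ((LINT w|M. J s w ^ i) * (LINT w|M. J t w ^ (2 * m - i))) <= C0^2 * (s * t)"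
    proof (cases "i = 1 \<or> i = 2 * m - 1")
     case True
     then have z: "(LINT w|M. J s w ^ i) * (LINT w|M. J t w ^ (2 * m - i)) = 0"
      using J_mean_zero[OF st(1)] J_mean_zero[OF st(2)] m by auto
     show ?thesis unfolding z using st by simp
    next
     case False
     then have "abs (LINT w|M. J s w ^ i) * abs (LINT w|M. J t w ^ (2 * m - i)) <= (C0 * s) * (C0 * t)"
      using i st C0 by (intro mult_mono CC) auto
     then show ?thesis by (simp add: abs_mult power2_eq_square mult_ac)
    qed
    then have "real (2 * m choose i) * ((LINT w|M. J s w ^ i) * (LINT w|M. J t w ^ (2 * m - i))) >= real (2 * m choose i) * (- (C0^2 * (s * t)))"
     by (intro mult_left_mono) auto
    then show ?thesis by simp
   qed
   have split: "{..2 * m} = insert 0 (insert (2 * m) {1..2 * m - 1})" using m by auto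
   have "y (s + t) = (\<Sum>i\<le>2 * m. ?T i)" unfolding y_def by (rule J_moment_add[OF st(1,2)])
   also have "... = y t + y s + (\<Sum>i=1..2 * m - 1. ?T i)"
    unfolding split using m by (simp add: y_def prob_space)
   finally have "y (s + t) = y t + y s + (\<Sum>i=1..2 * m - 1. ?T i)" .
   moreover have "(\<Sum>i=1..2 * m - 1. ?T i) >= (\<Sum>i=1..2 * m - 1. - (real (2 * m choose i) * (C0^2 * (s * t))))"
    by (intro sum_mono T) auto
   moreover have "(\<Sum>i=1..2 * m - 1. real (2 * m choose i)) * (C0^2 * (s * t)) <= 4 ^ m * (C0^2 * (s * t))"
   proof (intro mult_right_mono)
    have "(\<Sum>i=1..2 * m - 1. real (2 * m choose i)) <= (\<Sum>i\<le>2 * m. real (2 * m choose i))"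
     by (intro sum_mono2) auto
    also have "... = 2 ^ (2 * m)" by (metis choose_row_sum of_nat_numeral of_nat_power of_nat_sum)
    also have "... = 4 ^ m" by (simp add: power_mult)
    finally show "(\<Sum>i=1..2 * m - 1. real (2 * m choose i)) <= 4 ^ m" .
   qed (use st in auto)
   moreover have "(\<Sum>i=1..2 * m - 1. - (real (2 * m choose i) * (C0^2 * (s * t)))) =
     - ((\<Sum>i=1..2 * m - 1. real (2 * m choose i)) * (C0^2 * (s * t)))"
    by (simp only: sum_negf sum_distrib_right)
   moreover have "B * (s * t) = 4 ^ m * (C0^2 * (s * t))" by (simp add: B_def)
   ultimately show ?thesis by linarith
  qed
  \<comment> \<open>Superadditivity at \<open>s\<close> and \<open>1 - s\<close> bounds the moment
    at every time up to 1 by the one at time 1.\<close>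
  define D where "D = y 1 + B"
  have yD: "y s <= D" if "0 <= s" "s <= 1" for s
  proof -
   have "s * (1 - s) <= 1 * 1" using that by (intro mult_mono) auto
   then have "B * (s * (1 - s)) <= B * 1" using B0 by (intro mult_left_mono) auto
   then show ?thesis using sup[of s "1 - s"] that y0[of "1 - s"] by (simp add: D_def)
  qed
  have D0: "D >= 0" using B0 y0 by (simp add: D_def)
  have "y t <= (B + 2 * D) * t" if t: "0 <= t" "t <= 1" for t
  proof (cases "t = 0")
   case True
   have "AE w in M. J 0 w ^ (2 * m) = 0" using J_zero by eventually_elim (use m in simp)
   then have "y 0 = 0" unfolding y_def by (rule integral_eq_zero_AE)
   then show ?thesis using True by simp
  next
   case False
   then have t: "0 < t" "t <= 1" using t by auto
   \<comment> \<open>Along the multiples of \<open>t\<close> each step loses at most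
     \<open>B t\<close>, because the accumulated time stays below 1. Comparison with the bound
     \<open>D\<close> at \<open>n\<close> about \<open>1 / t\<close> then yields linear
     order.\<close>
   have scale: "y (real n * t) >= real n * (y t - B * t)" if "real n * t <= 1" for n
    using that
   proof (induction n)
    case (Suc n)
    then have n1: "real n * t <= 1" "real n * t + t <= 1" using t by (auto simp: algebra_simps)
    have "real n * t * t <= 1 * t" using n1 t by (intro mult_right_mono) auto
    then have "B * (real n * t * t) <= B * t" using B0 by (intro mult_left_mono) auto
    then have "y (real n * t + t) >= y (real n * t) + y t - B * t"
     using sup[of "real n * t" t] t n1 by (simp add: mult_ac)
    then show ?case using Suc.IH[OF n1(1)] by (simp add: algebra_simps)
   qed (use y0 in simp)
   \<comment> \<open>For \<open>t <= 1\<close> the integer part of \<open>1 / t\<close> is at least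
     half of \<open>1 / t\<close>; this is the factor 2 in the constant.\<close>
   define n where "n = nat \<lfloor>1 / t\<rfloor>"
   have "1 / t >= 1" using t by simp
   then have "real n <= 1 / t" "1 / t < real n + 1" "n >= 1" unfolding n_def by linarith+
   then have n: "real n * t <= 1" "1 <= 2 * (real n * t)" and n1: "n >= 1"
   proof -
    assume a: "real n <= 1 / t" "1 / t < real n + 1" "n >= 1"
    show "real n * t <= 1" using a(1) t by (simp add: pos_le_divide_eq)
    have "1 < (real n + 1) * t" using a(2) t by (simp add: pos_divide_less_eq)
    moreover have "1 * t <= real n * t" using a(3) t by (intro mult_right_mono) auto
    ultimately show "1 <= 2 * (real n * t)" by (simp add: algebra_simps)
   qed
   have "real n * (y t - B * t) <= D" using scale[OF n(1)] yD[of "real n * t"] n(1) t by auto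
   also have "D <= D * (2 * (real n * t))" using mult_left_mono[OF n(2) D0] by simp
   finally have "real n * (y t - B * t) <= real n * (2 * D * t)" by (simp add: mult_ac)
   then have "y t - B * t <= 2 * D * t" using n1 by simp
   then show ?thesis by (simp add: algebra_simps)
  qed
  then show ?thesis using B0 D0 unfolding y_def by (intro exI[of _ "B + 2 * D"]) auto
 qed
qed

text \<open>The exponent \<open>q\<close> lies between 2 and the even number \<open>2 q\<close>, and
  both of those moments are of the order of the time step.\<close>

lemma increment_moment:
 assumes q: "q >= 2"
 shows "\<exists>C\<ge>0. ALL s t. 0 <= s --> s <= t --> t - s <= 1 --> (LINT w|M. abs (J t w - J s w) ^ q) <= C * (t - s)"
proof -
 obtain C where C: "C >= 0" "!!t. 0 <= t ==> t <= 1 ==> (LINT w|M. J t w ^ (2 * q)) <= C * t"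
  using J_even_moment[of q] q by auto
 have "(LINT w|M. abs (J t w - J s w) ^ q) <= (1 + C) * (t - s)" if st: "0 <= s" "s <= t" "t - s <= 1" for s t
 proof -
  have ts: "0 <= t - s" using st by simp
  have "(LINT w|M. abs (J t w - J s w) ^ q) = (LINT w|M. abs (J (t - s) w) ^ q)"
   using increment_integral(1)[OF st(1,2), of "%z. abs z ^ q"] by simp
  also have "... <= (LINT w|M. J (t - s) w ^ 2 + J (t - s) w ^ (2 * q))"
  proof (intro integral_mono Bochner_Integration.integrable_add J_integrable_power ts)
   show "integrable M (%w. abs (J (t - s) w) ^ q)"
    by (intro all_moments_integrable all_moments_intros all_moments_J ts)
   show "abs (J (t - s) w) ^ q <= J (t - s) w ^ 2 + J (t - s) w ^ (2 * q)" for w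
    using power_mult_interpolate[of 1 "abs (J (t - s) w)" 2 q "2 * q"] q by (simp add: power_even_abs)
  qed
  also have "... = (LINT w|M. J (t - s) w ^ 2) + (LINT w|M. J (t - s) w ^ (2 * q))"
   by (intro Bochner_Integration.integral_add J_integrable_power ts)
  also have "... <= (1 + C) * (t - s)"
   using C(2)[OF ts st(3)] J_second_moment[OF ts] by (simp add: algebra_simps)
  finally show ?thesis .
 qed
 then show ?thesis using C by (intro exI[of _ "1 + C"]) auto
qed

end

section \<open>Elementary stochastic integrals\<close>

context prob_space
begin

lemma small_in_prob_vanish:
 fixes R :: "nat => 'a => real"
 assumes "small_in_prob M R"
 shows "vanish_in_prob M R"
 unfolding vanish_in_prob_def likely_def
proof (intro allI impI)
 fix e :: real assume e: "e > 0"
 note [measurable] = assms[unfolded small_in_prob_def, THEN conjunct1, rule_format]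
 have "\<forall>\<^sub>F n in sequentially. measure M {w : space M. norm (R n w) > e} < e"
  using assms e unfolding small_in_prob_def by (auto dest!: order_tendstoD(2))
 then show "\<forall>\<^sub>F n in sequentially. EX A:sets M. measure M (space M - A) <= e & (ALL w:A. abs (R n w) <= e)"
 proof eventually_elim
  case (elim n)
  have "space M - {w : space M. abs (R n w) <= e} = {w : space M. norm (R n w) > e}" by auto
  with elim show ?case by (intro bexI[of _ "{w : space M. abs (R n w) <= e}"]) auto
 qed
qed

lemma vanish_in_prob_subseq:
 assumes "vanish_in_prob M Y" "strict_mono \<kappa>"
 shows "vanish_in_prob M (%l. Y (\<kappa> l))"
 using assms(1) eventually_subseq[OF assms(2)] unfolding vanish_in_prob_def likely_def by blast

lemma vanish_in_prob_AE_subseq: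
 assumes Y [measurable]: "!!n. Y n : borel_measurable M" and v: "vanish_in_prob M Y"
 obtains \<kappa> where "strict_mono \<kappa>" "AE w in M. (%l. Y (\<kappa> l) w) \<longlonglongrightarrow> 0"
proof -
 define P where "P l n \<longleftrightarrow> measure M {w\<in>space M. abs (Y n w) > (1/2) ^ l} <= (1/2) ^ l" for l n
 have ev: "\<forall>\<^sub>F n in sequentially. P l n" for l
 proof -
  have "\<forall>\<^sub>F n in sequentially. EX A:sets M. measure M (space M - A) <= (1/2) ^ l & (ALL w:A. abs (Y n w) <= (1/2) ^ l)"
   using v unfolding vanish_in_prob_def likely_def by (auto simp del: power_one_over)
  then show ?thesis
  proof eventually_elim
   case (elim n)
   then obtain A where A: "A : sets M" "measure M (space M - A) <= (1/2) ^ l" "ALL w:A. abs (Y n w) <= (1/2) ^ l"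
    by blast
   have "measure M {w\<in>space M. abs (Y n w) > (1/2) ^ l} <= measure M (space M - A)"
    using A by (intro finite_measure_mono) (auto simp: not_less[symmetric])
   with A show ?case by (simp add: P_def)
  qed
 qed
 have "\<exists>\<kappa> :: nat => nat. ALL l. P l (\<kappa> l) & \<kappa> l < \<kappa> (Suc l)"
 proof (rule dependent_nat_choice)
  show "EX n. P 0 n" using ev[of 0] by (auto simp: eventually_sequentially)
  show "EX n. P (Suc l) n & m < n" for m l
   using eventually_conj[OF ev[of "Suc l"] eventually_gt_at_top[of m]]
   by (auto simp: eventually_sequentially)
 qed
 then obtain \<kappa> :: "nat => nat" where \<kappa>: "!!l. P l (\<kappa> l)" "!!l. \<kappa> l < \<kappa> (Suc l)" by blast
 have "AE w in M. \<forall>\<^sub>F l in sequentially. w : space M - {w\<in>space M. abs (Y (\<kappa> l) w) > (1/2) ^ l}"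
 proof (rule borel_cantelli_AE1)
  show "summable (%l. measure M {w\<in>space M. abs (Y (\<kappa> l) w) > (1/2) ^ l})"
  proof (rule summable_comparison_test'[where N=0])
   show "summable (%l. (1/2 :: real) ^ l)" by (intro summable_geometric) simp
  qed (use \<kappa>(1) in "simp add: P_def")
 qed (auto simp: emeasure_eq_measure)
 then have "AE w in M. (%l. Y (\<kappa> l) w) \<longlonglongrightarrow> 0"
 proof eventually_elim
  case (elim w)
  show ?case
  proof (rule Lim_null_comparison)
   show "\<forall>\<^sub>F l in sequentially. norm (Y (\<kappa> l) w) <= (1/2) ^ l"
    using elim by eventually_elim auto
   show "(%l. (1/2 :: real) ^ l) \<longlonglongrightarrow> 0" by (intro LIMSEQ_power_zero) simp
  qed
 qed
 moreover have "strict_mono \<kappa>" using \<kappa>(2) by (simp add: strict_mono_Suc_iff)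
 ultimately show ?thesis using that by blast
qed

lemma vanish_in_prob_AE:
 assumes Y [measurable]: "!!n. Y n : borel_measurable M" and lim: "AE w in M. (%n. Y n w) \<longlonglongrightarrow> 0"
 shows "vanish_in_prob M Y"
 unfolding vanish_in_prob_def likely_def
proof (intro allI impI)
 fix e :: real assume e: "e > 0"
 let ?A = "%n. {w\<in>space M. abs (Y n w) > e}"
 have "(%n. \<integral>w. indicator (?A n) w \<partial>M) \<longlonglongrightarrow> (LINT w|M. (0::real))"
 proof (rule integral_dominated_convergence[where w="%_. 1"])
  show "AE w in M. (%n. indicator (?A n) w :: real) \<longlonglongrightarrow> 0"
   using lim
  proof eventually_elim
   case (elim w)
   have "\<forall>\<^sub>F n in sequentially. abs (Y n w) < e" using tendstoD[OF elim e] by simp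
   then have "\<forall>\<^sub>F n in sequentially. (indicator (?A n) w :: real) = 0" by eventually_elim auto
   then show ?case by (rule tendsto_eventually)
  qed
 qed (auto simp: indicator_def)
 then have "(%n. measure M (?A n)) \<longlonglongrightarrow> 0" by simp
 then have "\<forall>\<^sub>F n in sequentially. measure M (?A n) < e" using e by (auto dest: order_tendstoD(2))
 then show "\<forall>\<^sub>F n in sequentially. EX A:sets M. measure M (space M - A) <= e & (ALL w:A. abs (Y n w) <= e)"
 proof eventually_elim
  case (elim n)
  have "space M - {w : space M. abs (Y n w) <= e} = ?A n" by auto
  with elim show ?case by (intro bexI[of _ "{w : space M. abs (Y n w) <= e}"]) auto
 qed
qed

lemma fatou_square_prob:
 fixes Y :: "nat => 'a => real"
 assumes meas [measurable]: "!!n. Y n : borel_measurable M" "Z : borel_measurable M"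
  and lim: "vanish_in_prob M (%n w. Y n w - Z w)"
  and le: "\<forall>\<^sub>F n in sequentially. integrable M (%w. (Y n w)^2) & (LINT w|M. (Y n w)^2) <= b"
 shows "integrable M (%w. (Z w)^2)" "(LINT w|M. (Z w)^2) <= b"
proof -
 obtain \<kappa> where \<kappa>: "strict_mono \<kappa>" "AE w in M. (%l. Y (\<kappa> l) w - Z w) \<longlonglongrightarrow> 0"
  using vanish_in_prob_AE_subseq[OF _ lim] by auto
 have "AE w in M. (%l. Y (\<kappa> l) w) \<longlonglongrightarrow> Z w"
  using \<kappa>(2) by eventually_elim (simp add: LIM_zero_iff)
 note * = fatou_square[OF _ _ this eventually_subseq[OF \<kappa>(1) le] tendsto_const]
 show "integrable M (%w. (Z w)^2)" "(LINT w|M. (Z w)^2) <= b" by (rule *; measurable)+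
qed

end

section \<open>Step lists and partitions adapted to them\<close>

lemma simple_value_simps [simp]:
 "simple_value [] r w = 0"
 "simple_value ((s, t, \<xi>) # S) r w = \<xi> w * indicator {s<..t} r + simple_value S r w"
 "simple_value (S @ S') r w = simple_value S r w + simple_value S' r w"
 by (auto simp: simple_value_def)

lemma simple_value_measurable [measurable]: "(%r. simple_value S r w) : borel_measurable borel"
proof (induction S)
 case (Cons x S)
 then show ?case by (cases x) simp
qed simp

lemma simple_integral_simps [simp]:
 "simple_integral J [] T w = 0"
 "simple_integral J ((s, t, \<xi>) # S) T w = \<xi> w * (J (min t T) w - J (min s T) w) + simple_integral J S T w"
 "simple_integral J (S @ S') T w = simple_integral J S T w + simple_integral J S' T w"
 by (auto simp: simple_integral_def)

text \<open>This is \<open>simple_integrand\<close> without bounded coefficients. Riemann steps of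
  an unbounded process are not simple in the strict sense; moments of the coefficients take the
  place of boundedness.\<close>

definition step_list :: "(real => 'w measure) => (real \<times> real \<times> ('w => real)) list => bool" where
 "step_list F S \<longleftrightarrow> (\<forall>(s, t, \<xi>)\<in>set S. 0 <= s & s <= t & \<xi> : borel_measurable (F s))"

lemma step_list_simps [simp]:
 "step_list F []"
 "step_list F ((s, t, \<xi>) # S) \<longleftrightarrow> 0 <= s & s <= t & \<xi> : borel_measurable (F s) & step_list F S"
 "step_list F (S @ S') \<longleftrightarrow> step_list F S & step_list F S'"
 by (simp_all add: step_list_def ball_Un)

lemma simple_integrand_step_list: "simple_integrand F S ==> step_list F S"
 by (fastforce simp: step_list_def simple_integrand_def)

text \<open>Coefficient of a step list on a partition interval that starts at \<open>x\<close>.\<close>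

definition step_coeff :: "(real \<times> real \<times> ('w => real)) list => real => 'w => real" where
 "step_coeff S x w = (\<Sum>(s, t, \<xi>)\<leftarrow>S. if s <= x & x < t then \<xi> w else 0)"

lemma step_coeff_simps [simp]:
 "step_coeff [] x w = 0"
 "step_coeff ((s, t, \<xi>) # S) x w = (if s <= x & x < t then \<xi> w else 0) + step_coeff S x w"
 by (auto simp: step_coeff_def)

text \<open>Times in \<open>E\<close> beyond \<open>T\<close> are truncated, in agreement with the
  way \<open>simple_integral\<close> evaluates \<open>J\<close> at \<open>min t T\<close>.\<close>

definition partition_of :: "real => real set => (nat => real) => nat => bool" where
 "partition_of T E p m \<longleftrightarrow> p 0 = 0 & p m = T & (ALL i j. i < j --> j <= m --> p i < p j) &
   (ALL x:E. \<exists>k\<le>m. p k = min x T)"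

lemma partition_exists:
 assumes "finite E" "T >= 0" "!!x. x : E ==> x >= 0"
 shows "EX p m. partition_of T E p m"
proof -
 define A where "A = insert 0 (insert T ((%x. min x T) ` E))"
 define xs where "xs = sorted_list_of_set A"
 define p where "p i = xs ! i" for i
 define m where "m = length xs - 1"
 have A: "finite A" "A ~= {}" using assms by (auto simp: A_def)
 have xs: "set xs = A" "sorted_wrt (<) xs" "xs ~= []" using A by (auto simp: xs_def)
 have len: "length xs = Suc m" using xs(3) by (simp add: m_def)
 have mono: "p i < p j" if "i < j" "j <= m" for i j
  using sorted_wrt_nth_less[OF xs(2)] that len by (simp add: p_def)
 have mono': "p i <= p j" if "i <= j" "j <= m" for i j
  using mono[of i j] that by (cases "i = j") auto
 have idx: "\<exists>k\<le>m. p k = x" if "x : A" for x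
  using that len unfolding xs(1)[symmetric] in_set_conv_nth p_def by (auto simp: less_Suc_eq_le)
 have bnd: "0 <= p i" "p i <= T" if "i <= m" for i
 proof -
  have "p i : A" using that len nth_mem[of i xs] unfolding p_def xs(1)[symmetric] by simp
  then show "0 <= p i" "p i <= T" using assms by (auto simp: A_def)
 qed
 obtain k where "k <= m" "p k = 0" using idx[of 0] by (auto simp: A_def)
 then have "p 0 = 0" using mono'[of 0 k] bnd[of 0] by auto
 moreover obtain k where "k <= m" "p k = T" using idx[of T] by (auto simp: A_def)
 then have "p m = T" using mono'[of k m] bnd[of m] by auto
 ultimately show ?thesis
  unfolding partition_of_def using mono idx by (intro exI[of _ p] exI[of _ m]) (auto simp: A_def)
qed

context
 fixes T :: real and E p m
 assumes part: "partition_of T E p m"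
begin

lemma part_mono: "i < j ==> j <= m ==> p i < p j"
 using part by (auto simp: partition_of_def)

lemma part_le: "i <= j ==> j <= m ==> p i <= p j"
 using part_mono[of i j] by (cases "i = j") auto

lemma part_nonneg: "i <= m ==> 0 <= p i"
 using part_le[of 0 i] part by (auto simp: partition_of_def)

lemma part_le_T: "i <= m ==> p i <= T"
 using part_le[of i m] part by (auto simp: partition_of_def)

lemma part_less_iff: "i <= m ==> j <= m ==> p i < p j \<longleftrightarrow> i < j"
 using part_mono[of i j] part_le[of j i] by (cases "i < j") auto

lemma part_le_iff: "i <= m ==> j <= m ==> p i <= p j \<longleftrightarrow> i <= j"
 using part_less_iff[of j i] by (auto simp: not_less[symmetric])

text \<open>No end point of a step lies strictly inside a cell. Steps and cells are open on the
  left, so for \<open>r\<close> in a cell starting at \<open>p i\<close> the conditions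
  \<open>s < r\<close> and \<open>r <= t\<close> become \<open>s <= p i\<close> and
  \<open>p i < t\<close>.\<close>

lemma simple_value_step_coeff:
 assumes "!!s t \<xi>. (s, t, \<xi>) : set S ==> s : E & t : E" "i < m" "p i < r" "r <= p (Suc i)"
 shows "simple_value S r w = step_coeff S (p i) w"
 using assms(1)
proof (induction S)
 case (Cons x S)
 obtain s t \<xi> where x: "x = (s, t, \<xi>)" by (cases x)
 from Cons.prems[of s t \<xi>] x have E: "s : E" "t : E" by auto
 obtain k l where k: "k <= m" "p k = min s T" and l: "l <= m" "p l = min t T"
  using part E unfolding partition_of_def by meson
 have rT: "r <= T" using part_le_T[of "Suc i"] assms by simp
 have "s < r \<longleftrightarrow> s <= p i"
 proof
  assume "s < r"
  then have "p k < p (Suc i)" using k assms rT by auto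
  then have "k <= i" using part_less_iff[of k "Suc i"] k assms by auto
  then have "p k <= p i" using part_le assms by auto
  then show "s <= p i" using k part_mono[of i m] part assms \<open>s < r\<close> rT by (auto simp: min_def partition_of_def split: if_splits)
 qed (use assms in auto)
 moreover have "r <= t \<longleftrightarrow> p i < t"
 proof
  assume "p i < t"
  moreover have "p i < T" using part_mono[of i m] part assms by (auto simp: partition_of_def)
  ultimately have "p i < p l" using l by auto
  then have "Suc i <= l" using part_less_iff[of i l] l assms by auto
  then have "p (Suc i) <= p l" using l(1) by (rule part_le)
  then show "r <= t" using l assms by auto
 qed (use assms in auto)
 ultimately show ?case using Cons by (auto simp: x indicator_def)
qed simp

lemma simple_integral_step_coeff:
 assumes "!!s t \<xi>. (s, t, \<xi>) : set S ==> s <= t & s : E & t : E"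
 shows "simple_integral J S T w = (\<Sum>i<m. step_coeff S (p i) w * (J (p (Suc i)) w - J (p i) w))"
 using assms
proof (induction S)
 case (Cons x S)
 obtain s t \<xi> where x: "x = (s, t, \<xi>)" by (cases x)
 from Cons.prems[of s t \<xi>] x have E: "s : E" "t : E" "s <= t" by auto
 obtain k l where k: "k <= m" "p k = min s T" and l: "l <= m" "p l = min t T"
  using part E unfolding partition_of_def by meson
 have kl: "k <= l" using part_le_iff[of k l] k l E by auto
 have iff: "s <= p i & p i < t \<longleftrightarrow> k <= i & i < l" if "i < m" for i
 proof -
  have "p i < T" using part_mono[of i m] part that by (auto simp: partition_of_def)
  then have "s <= p i \<longleftrightarrow> p k <= p i" "p i < t \<longleftrightarrow> p i < p l" using k l by auto
  then show ?thesis using part_le_iff[of k i] part_less_iff[of i l] k l that by auto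
 qed
 have "(\<Sum>i<m. (if s <= p i & p i < t then \<xi> w else 0) * (J (p (Suc i)) w - J (p i) w))
   = (\<Sum>i<m. if k <= i & i < l then \<xi> w * (J (p (Suc i)) w - J (p i) w) else 0)"
  by (intro sum.cong refl) (use iff in auto)
 also have "... = (\<Sum>i\<in>{i\<in>{..<m}. k <= i & i < l}. \<xi> w * (J (p (Suc i)) w - J (p i) w))"
  by (rule sum.inter_filter[symmetric]) simp
 also have "{i\<in>{..<m}. k <= i & i < l} = {k..<l}" using l by auto
 also have "(\<Sum>i=k..<l. \<xi> w * (J (p (Suc i)) w - J (p i) w)) = \<xi> w * (J (p l) w - J (p k) w)"
  using sum_Suc_diff'[OF kl, of "%i. J (p i) w"] by (simp flip: sum_distrib_left)
 finally have "(\<Sum>i<m. (if s <= p i & p i < t then \<xi> w else 0) * (J (p (Suc i)) w - J (p i) w)) =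
   \<xi> w * (J (min t T) w - J (min s T) w)" by (simp only: k l)
 moreover have "simple_integral J S T w = (\<Sum>i<m. step_coeff S (p i) w * (J (p (Suc i)) w - J (p i) w))"
  by (rule Cons.IH) (use Cons.prems in auto)
 ultimately show ?case by (simp add: x distrib_right sum.distrib)
qed simp

lemma LBINT_step_coeff:
 assumes "!!s t \<xi>. (s, t, \<xi>) : set S ==> s : E & t : E"
 shows "(LBINT r:{0..T}. (simple_value S r w)^2) = (\<Sum>i<m. (step_coeff S (p i) w)^2 * (p (Suc i) - p i))"
proof -
 have "(LBINT r:{0..T}. (simple_value S r w)^2) =
   (LBINT r. (\<Sum>i<m. (step_coeff S (p i) w)^2 * indicator {p i<..p (Suc i)} r))"
  unfolding set_lebesgue_integral_def
 proof (rule integral_cong_AE)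
  \<comment> \<open>The left-open cells cover all of \<open>{0..T}\<close> except the point
    0.\<close>
  have "AE r in lborel. r ~= (0::real)" by (rule AE_lborel_singleton)
  then show "AE r in lborel. indicator {0..T} r *\<^sub>R (simple_value S r w)\<^sup>2 =
    (\<Sum>i<m. (step_coeff S (p i) w)^2 * indicator {p i<..p (Suc i)} r)"
  proof eventually_elim
   case (elim r)
   show ?case
   proof (cases "0 < r & r <= T")
    case False
    then have "r \<notin> {0..T}" using elim by auto
    moreover have "r \<notin> {p i<..p (Suc i)}" if "i < m" for i
     using False part_nonneg[of i] part_le_T[of "Suc i"] that by auto
    ultimately show ?thesis by (auto intro!: sum.neutral[symmetric])
   next
    case True
    define k where "k = (LEAST k. r <= p k)"
    have pm: "r <= p m" using True part by (simp add: partition_of_def)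
    have k: "r <= p k" "k <= m" unfolding k_def using pm by (auto intro: LeastI Least_le)
    have "k ~= 0" using k True part by (auto simp: partition_of_def intro!: gr0I)
    then obtain i where i: "k = Suc i" by (cases k) auto
    have "\<not> r <= p i" using not_less_Least[of i "%k. r <= p k"] i unfolding k_def by auto
    then have ri: "p i < r" "r <= p (Suc i)" "i < m" using k i by auto
    have other: "r \<notin> {p j<..p (Suc j)}" if "j < m" "j ~= i" for j
    proof (cases "j < i")
     case True
     then have "p (Suc j) <= p i" using ri by (intro part_le) auto
     then show ?thesis using ri by auto
    next
     case False
     then have "p (Suc i) <= p j" using that by (intro part_le) auto
     then show ?thesis using ri by auto
    qed
    have "(\<Sum>j<m. (step_coeff S (p j) w)^2 * indicator {p j<..p (Suc j)} r) = (step_coeff S (p i) w)^2"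
     using ri other by (subst sum.remove[of _ i]) (auto intro!: sum.neutral)
    then show ?thesis using True simple_value_step_coeff[OF assms ri(3,1,2), where w=w] by simp
   qed
  qed
 next
  show "(%r. indicator {0..T} r *\<^sub>R (simple_value S r w)\<^sup>2) : borel_measurable lborel"
   using simple_value_measurable[of S w] by simp
 qed measurable
 also have "... = (\<Sum>i<m. (step_coeff S (p i) w)^2 * (p (Suc i) - p i))"
 proof (subst Bochner_Integration.integral_sum)
  show "integrable lborel (%r. (step_coeff S (p i) w)^2 * indicator {p i<..p (Suc i)} r)" if "i : {..<m}" for i
   using that part_le[of i "Suc i"] by (intro integrable_mult_right integrable_real_indicator) auto
  show "(\<Sum>i<m. LBINT r. (step_coeff S (p i) w)^2 * indicator {p i<..p (Suc i)} r) = (\<Sum>i<m. (step_coeff S (p i) w)^2 * (p (Suc i) - p i))"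
   by (intro sum.cong refl) (use part_le in "auto simp: less_imp_le")
 qed
 finally show ?thesis .
qed

end

section \<open>Orthogonality of increments, isometry and Lenglart's inequality\<close>

context levy_noise
begin

lemma step_coeff_F:
 assumes "step_list F S" "0 <= x"
 shows "step_coeff S x : borel_measurable (F x)"
 using assms(1)
proof (induction S)
 case Nil
 then show ?case by (simp add: step_coeff_def)
next
 case (Cons y S)
 obtain s t \<xi> where y: "y = (s, t, \<xi>)" by (cases y)
 have "(%w. if s <= x & x < t then \<xi> w else 0) : borel_measurable (F x)"
  using Cons.prems F_mono[of s x \<xi>] by (cases "s <= x & x < t") (auto simp: y)
 moreover have "step_coeff S x : borel_measurable (F x)" using Cons by (simp add: y)
 ultimately show ?case
  using borel_measurable_add[of "%w. if s <= x & x < t then \<xi> w else 0" "F x" "step_coeff S x"]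
  by (simp add: y step_coeff_simps[abs_def] cong: measurable_cong)
qed

lemma step_coeff_all_moments:
 assumes "!!s t \<xi>. (s, t, \<xi>) : set S ==> all_moments M \<xi>"
 shows "all_moments M (step_coeff S x)"
 using assms
proof (induction S)
 case Nil
 then show ?case using all_moments_const[of 0] by (simp add: step_coeff_def[abs_def])
next
 case (Cons y S)
 obtain s t \<xi> where y: "y = (s, t, \<xi>)" by (cases y)
 have "all_moments M (%w. (if s <= x & x < t then \<xi> w else 0) + step_coeff S x w)"
  using Cons all_moments_const[of 0] by (intro all_moments_add) (cases "s <= x & x < t"; auto simp: y)+
 then show ?case by (simp add: y step_coeff_simps[abs_def])
qed

lemma simple_integral_meas:
 assumes "step_list F S" "0 <= T"
 shows "simple_integral J S T : borel_measurable M"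
 using assms(1)
proof (induction S)
 case Nil
 then show ?case by (simp add: simple_integral_def)
next
 case (Cons y S)
 obtain s t \<xi> where y: "y = (s, t, \<xi>)" by (cases y)
 have [measurable]: "\<xi> : borel_measurable M" "J (min t T) : borel_measurable M" "J (min s T) : borel_measurable M"
  "simple_integral J S T : borel_measurable M"
  using Cons F_meas[of s \<xi>] assms by (auto simp: y)
 show ?case by (simp add: y simple_integral_simps[abs_def])
qed

text \<open>When the square is expanded, the partial sum and the next coefficient are known at the
  left end point of the next increment, whose transform is centred; so the cross term vanishes. The
  transformations \<open>\<psi> i\<close> let the same computation serve the isometry, where they
  are the identity, and the centred noise sums.\<close>

lemma increment_orthogonality:
 fixes \<psi> :: "nat => real => real" and p :: "nat => real"
 defines "D \<equiv> %i w. \<psi> i (J (p (Suc i)) w - J (p i) w)" and "\<mu> \<equiv> %i k. \<integral>w. \<psi> i (J (p (Suc i) - p i) w) ^ k \<partial>M"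
 assumes p: "0 <= p 0" "!!i. i < m ==> p i <= p (Suc i)"
  and v: "!!i. i < m ==> v i : borel_measurable (F (p i))"
  and v2: "!!i. i < m ==> integrable M (%w. (v i w)^2)"
  and \<psi> [measurable]: "!!i. \<psi> i : borel_measurable borel"
  and \<psi>2: "!!i. i < m ==> integrable M (%w. (\<psi> i (J (p (Suc i) - p i) w))^2)" and \<psi>0: "!!i. i < m ==> \<mu> i 1 = 0"
 shows "integrable M (%w. (\<Sum>i<m. v i w * D i w)^2)"
  "(LINT w|M. (\<Sum>i<m. v i w * D i w)^2) = (\<Sum>i<m. (LINT w|M. (v i w)^2) * \<mu> i 2)"
proof -
 let ?I = "%m w. \<Sum>i<m. v i w * D i w"
 have pos: "0 <= p k" if "k <= m" for k
  using that by (induction k) (use p in "auto intro: order_trans")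
 have mono: "p i <= p k" if "i <= k" "k <= m" for i k
  using that by (induction k) (use p in "auto simp: le_Suc_eq intro: order_trans")
 have IF: "?I k : borel_measurable (F (p k))" if "k <= m" for k
 proof (intro borel_measurable_sum borel_measurable_times)
  fix i assume "i : {..<k}"
  then have i: "i < m" "p i <= p k" "p (Suc i) <= p k" "0 <= p i" "0 <= p (Suc i)"
   using that mono pos by auto
  show "v i : borel_measurable (F (p k))" using F_mono[OF _ _ v] i by auto
  have [measurable]: "J (p (Suc i)) : borel_measurable (F (p k))" "J (p i) : borel_measurable (F (p k))"
   using F_mono[OF _ _ J_F] i by auto
  show "D i : borel_measurable (F (p k))" unfolding D_def by measurable
 qed
 have "integrable M (%w. (?I k w)^2) & (LINT w|M. (?I k w)^2) = (\<Sum>i<k. (LINT w|M. (v i w)^2) * \<mu> i 2)" if "k <= m" for k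
  using that
 proof (induction k)
  case (Suc k)
  then have k: "k < m" "k <= m" by auto
  have pk: "0 <= p k" "p k <= p (Suc k)" using pos p k by auto
  note [measurable] = IF[OF k(2)] v[OF k(1)] F_meas[OF pk(1) IF[OF k(2)]] F_meas[OF pk(1) v[OF k(1)]]
  have IH: "integrable M (%w. (?I k w)^2)" using Suc k by simp
  have Iv: "integrable M (%w. ?I k w * v k w)"
  proof (rule Bochner_Integration.integrable_bound[OF Bochner_Integration.integrable_add[OF IH v2[OF k(1)]]])
   have "abs (a * b) <= abs (a^2 + b^2)" for a b :: real
    using sum_squares_bound[of "abs a" "abs b"] mult_nonneg_nonneg[OF abs_ge_zero abs_ge_zero, of a b] abs_ge_self[of "a^2 + b^2"] unfolding abs_mult power2_abs by linarith
   then show "AE w in M. norm (?I k w * v k w) <= norm ((?I k w)^2 + (v k w)^2)"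
    unfolding real_norm_def by (intro AE_I2)
  qed measurable
  have IvF: "(%w. ?I k w * v k w) : borel_measurable (F (p k))" "(%w. (v k w)^2) : borel_measurable (F (p k))"
   by measurable
  have d: "0 <= p (Suc k) - p k" using pk by simp
  then have [measurable]: "(%w. \<psi> k (J (p (Suc k) - p k) w)) : borel_measurable M" by measurable
  have i1: "integrable M (%w. \<psi> k (J (p (Suc k) - p k) w))"
   by (rule square_integrable_imp_integrable[OF _ \<psi>2[OF k(1)]]) measurable
  have f1: "integrable M (%w. ?I k w * v k w * D k w)" "(LINT w|M. ?I k w * v k w * D k w) = 0"
   using increment_factor[OF pk IvF(1) Iv \<psi> i1] \<psi>0[OF k(1)] by (simp_all add: D_def \<mu>_def)
  have f2: "integrable M (%w. (v k w)^2 * (D k w)^2)" "(LINT w|M. (v k w)^2 * (D k w)^2) = (LINT w|M. (v k w)^2) * \<mu> k 2"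
   using increment_factor[OF pk IvF(2) v2[OF k(1)], of "%z. (\<psi> k z)^2"] \<psi>2[OF k(1)] by (simp_all add: D_def \<mu>_def)
  have eq: "(?I (Suc k) w)^2 = (?I k w)^2 + (2 * (?I k w * v k w * D k w) + (v k w)^2 * (D k w)^2)" for w
   by (simp add: power2_sum power_mult_distrib)
  show ?case unfolding eq using Suc.IH[OF k(2)] f1 f2
   by (subst Bochner_Integration.integral_add; simp)
 qed (simp)
 from this[of m] show "integrable M (%w. (?I m w)^2)"
  "(LINT w|M. (?I m w)^2) = (\<Sum>i<m. (LINT w|M. (v i w)^2) * \<mu> i 2)" by auto
qed

lemma martingale_isometry:
 assumes p: "0 <= p 0" "!!i. i < m ==> p i <= p (Suc i)"
  and v: "!!i. i < m ==> v i : borel_measurable (F (p i))"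
  and v2: "!!i. i < m ==> integrable M (%w. (v i w)^2)"
 shows "integrable M (%w. (\<Sum>i<m. v i w * (J (p (Suc i)) w - J (p i) w))^2)"
  "(LINT w|M. (\<Sum>i<m. v i w * (J (p (Suc i)) w - J (p i) w))^2) =
   (\<Sum>i<m. (LINT w|M. (v i w)^2) * (p (Suc i) - p i))"
proof -
 note o = increment_orthogonality[where \<psi>="%_ z. z" and m=m, OF p v v2]
 have d: "0 <= p (Suc i) - p i" if "i < m" for i using p(2)[OF that] by simp
 note J = J_integrable_power[OF d, of _ 2] J_mean_zero[OF d] J_second_moment[OF d]
 show "integrable M (%w. (\<Sum>i<m. v i w * (J (p (Suc i)) w - J (p i) w))^2)" using o(1) J by simp
 show "(LINT w|M. (\<Sum>i<m. v i w * (J (p (Suc i)) w - J (p i) w))^2) = (\<Sum>i<m. (LINT w|M. (v i w)^2) * (p (Suc i) - p i))"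
  using o(2) J by simp
qed

text \<open>The isometry in the form needed for blocks: \<open>b\<close> bounds the second moment at
  each single time, and an integrand vanishing up to \<open>s\<close> contributes only the length
  \<open>T - s\<close>.\<close>

lemma simple_integral_second_moment:
 assumes S: "step_list F S" "!!s t \<xi>. (s, t, \<xi>) : set S ==> all_moments M \<xi>" and s: "0 <= s" "s <= T"
  and zero: "!!r w. 0 < r ==> r <= s ==> simple_value S r w = 0"
  and b: "!!r. s < r ==> r <= T ==> (LINT w|M. (simple_value S r w)^2) <= b"
 shows "integrable M (%w. (simple_integral J S T w)^2)" "(LINT w|M. (simple_integral J S T w)^2) <= b * (T - s)"
proof -
 define E where "E = insert s (fst ` set S \<union> (fst \<circ> snd) ` set S)"
 have E: "s' : E & t' : E" "s' <= t'" "0 <= s'" if "(s', t', \<xi>) : set S" for s' t' \<xi>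
 proof -
  show "s' : E & t' : E" using imageI[OF that, of fst] imageI[OF that, of "fst \<circ> snd"] by (simp add: E_def)
  show "s' <= t'" "0 <= s'" using S(1) that unfolding step_list_def by blast+
 qed
 have "EX p m. partition_of T E p m"
 proof (rule partition_exists)
  show "0 <= x" if "x : E" for x
   using that E(2,3) s(1) unfolding E_def by (auto dest: E(2,3)) (meson E(2,3) order_trans)
 qed (use s in "auto simp: E_def")
 then obtain p m where part: "partition_of T E p m" by blast
 let ?v = "%i. step_coeff S (p i)"
 have I: "simple_integral J S T w = (\<Sum>i<m. ?v i w * (J (p (Suc i)) w - J (p i) w))" for w
  using E by (intro simple_integral_step_coeff[OF part]) blast
 have p: "0 <= p 0" "!!i. i < m ==> p i <= p (Suc i)" "!!i. i < m ==> 0 <= p i"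
  using part_nonneg[OF part] part_le[OF part] by auto
 have vF: "?v i : borel_measurable (F (p i))" if "i < m" for i
  using step_coeff_F[OF S(1)] p that by auto
 have v2: "integrable M (%w. (?v i w)^2)" for i
  by (intro all_moments_integrable all_moments_power step_coeff_all_moments S)
 note iso = martingale_isometry[OF p(1,2) vF v2, of m]
 show "integrable M (%w. (simple_integral J S T w)^2)" unfolding I using iso(1) by simp
 obtain k where k: "k <= m" "p k = s"
  using part s unfolding partition_of_def E_def by (auto simp: min_def)
 \<comment> \<open>The hypotheses are about values at positive times. A left-open cell takes its
   value at its right end point, and that time is positive even for the first cell.\<close>
 have sv: "step_coeff S (p i) w = simple_value S (p (Suc i)) w" if "i < m" for i w
  using that E part_mono[OF part, of i "Suc i"]
  by (intro simple_value_step_coeff[OF part, symmetric]) auto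
 have "(LINT w|M. (simple_integral J S T w)^2) = (\<Sum>i<m. (LINT w|M. (?v i w)^2) * (p (Suc i) - p i))"
  unfolding I using iso(2) by simp
 also have "... <= (\<Sum>i<m. if k <= i then b * (p (Suc i) - p i) else 0)"
 proof (rule sum_mono)
  fix i assume i: "i : {..<m}"
  show "(LINT w|M. (?v i w)^2) * (p (Suc i) - p i) <= (if k <= i then b * (p (Suc i) - p i) else 0)"
  proof (cases "k <= i")
   case True
   have "s <= p i" "p i < p (Suc i)" "p (Suc i) <= T"
    using part_le[OF part, of k i] part_mono[OF part, of i "Suc i"] part_le_T[OF part, of "Suc i"] k i True by auto
   then have "(LINT w|M. (?v i w)^2) <= b" using b[of "p (Suc i)"] sv i by auto
   then show ?thesis using True p(2)[of i] i by (simp add: mult_right_mono)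
  next
   case False
   have "p (Suc i) <= s" "0 < p (Suc i)"
    using part_le[OF part, of "Suc i" k] part_mono[OF part, of i "Suc i"] p(3)[of i] k i False by auto
   then show ?thesis using False zero sv i by simp
  qed
 qed
 also have "... = (\<Sum>i\<in>{i\<in>{..<m}. k <= i}. b * (p (Suc i) - p i))"
  by (rule sum.inter_filter[symmetric]) simp
 also have "{i\<in>{..<m}. k <= i} = {k..<m}" by auto
 also have "(\<Sum>i=k..<m. b * (p (Suc i) - p i)) = b * (p m - p k)"
  using sum_Suc_diff'[OF k(1), of p] by (simp flip: sum_distrib_left)
 finally show "(LINT w|M. (simple_integral J S T w)^2) <= b * (T - s)"
  using k part by (simp add: partition_of_def)
qed

text \<open>Lenglart's inequality: stop the integrand once its quadratic variation exceeds \<open>\<eta>\<close>.\<close>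

lemma simple_integral_lenglart:
 assumes S: "step_list F S" and T: "0 <= T" and e: "\<epsilon> > 0" "\<eta> > 0"
 shows "(%w. LBINT r:{0..T}. (simple_value S r w)^2) : borel_measurable M"
  "measure M {w\<in>space M. abs (simple_integral J S T w) > \<epsilon>} <=
   measure M {w\<in>space M. (LBINT r:{0..T}. (simple_value S r w)^2) > \<eta>} + \<eta> / \<epsilon>^2"
proof -
 define E where "E = fst ` set S \<union> (fst \<circ> snd) ` set S"
 have E: "s' : E & t' : E" "s' <= t'" "0 <= s'" if "(s', t', \<xi>) : set S" for s' t' \<xi>
 proof -
  show "s' : E & t' : E" using imageI[OF that, of fst] imageI[OF that, of "fst \<circ> snd"] by (simp add: E_def)
  show "s' <= t'" "0 <= s'" using S that unfolding step_list_def by blast+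
 qed
 have "EX p m. partition_of T E p m"
 proof (rule partition_exists)
  show "0 <= x" if "x : E" for x
   using that E(2,3) unfolding E_def by (auto dest: E(2,3)) (meson E(2,3) order_trans)
 qed (use T in "auto simp: E_def")
 then obtain p m where part: "partition_of T E p m" by blast
 let ?v = "%i. step_coeff S (p i)"
 let ?d = "%i. p (Suc i) - p i"
 have I: "simple_integral J S T w = (\<Sum>i<m. ?v i w * (J (p (Suc i)) w - J (p i) w))" for w
  using E by (intro simple_integral_step_coeff[OF part]) blast
 have Q: "(LBINT r:{0..T}. (simple_value S r w)^2) = (\<Sum>i<m. (?v i w)^2 * ?d i)" for w
  using E by (intro LBINT_step_coeff[OF part]) blast
 have p: "0 <= p 0" "!!i. i < m ==> p i <= p (Suc i)" "!!i. i < m ==> 0 <= p i"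
  using part_nonneg[OF part] part_le[OF part] by auto
 have d: "?d i > 0" if "i < m" for i using part_mono[OF part, of i "Suc i"] that by simp
 have vF: "?v i : borel_measurable (F (p k))" if "i <= k" "k < m" for i k
  using F_mono[of "p i" "p k", OF _ _ step_coeff_F[OF S]] p part_le[OF part, of i k] that by auto
 have vM: "?v i : borel_measurable M" if "i < m" for i
  using F_meas[OF _ vF[of i i]] p that by auto
 have QM: "(%w. \<Sum>i<m. (?v i w)^2 * ?d i) : borel_measurable M"
  using vM by (intro borel_measurable_sum borel_measurable_times borel_measurable_power) auto
 then show QM': "(%w. LBINT r:{0..T}. (simple_value S r w)^2) : borel_measurable M" unfolding Q .
 \<comment> \<open>The sum includes the index \<open>i\<close> itself. This is still known at time
   \<open>p i\<close>, since the coefficient of the cell starting there is; so the stopped quadratic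
   variation never exceeds \<open>\<eta>\<close> and there is no overshoot to control.\<close>
 define wt where "wt i w = (if (\<Sum>l\<le>i. (?v l w)^2 * ?d l) <= \<eta> then ?v i w else 0)" for i w
 have wF: "wt i : borel_measurable (F (p i))" if "i < m" for i
 proof -
  have [measurable]: "(%w. \<Sum>l\<le>i. (?v l w)^2 * ?d l) : borel_measurable (F (p i))"
   using that by (intro borel_measurable_sum borel_measurable_times borel_measurable_power vF) auto
  have [measurable]: "?v i : borel_measurable (F (p i))" using vF that by auto
  show ?thesis unfolding wt_def by measurable
 qed
 have w_sum: "(\<Sum>i<k. (wt i w)^2 * ?d i) <= \<eta>" if "k <= m" for k w
  using that
 proof (induction k)
  case (Suc k)
  show ?case
  proof (cases "(\<Sum>l\<le>k. (?v l w)^2 * ?d l) <= \<eta>")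
   case True
   have "(\<Sum>i<Suc k. (wt i w)^2 * ?d i) <= (\<Sum>i<Suc k. (?v i w)^2 * ?d i)"
    using Suc d by (intro sum_mono) (auto simp: wt_def less_imp_le)
   with True show ?thesis by (simp add: lessThan_Suc_atMost)
  next
   case False
   then show ?thesis using Suc by (simp add: wt_def)
  qed
 qed (use e in simp)
 have w2: "(wt i w)^2 <= \<eta> / ?d i" if "i < m" for i w
 proof -
  have "(wt i w)^2 * ?d i <= (\<Sum>i<m. (wt i w)^2 * ?d i)"
   using that d by (intro member_le_sum) (auto simp: less_imp_le)
  then show ?thesis using w_sum[of m w] d[OF that] by (simp add: field_simps)
 qed
 have w2i: "integrable M (%w. (wt i w)^2)" if "i < m" for i
 proof (rule integrable_const_bound[of _ "\<eta> / ?d i"])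
  have "wt i : borel_measurable M" using F_meas[OF _ wF] p that by auto
  then show "(%w. (wt i w)^2) : borel_measurable M" by measurable
 qed (use w2 that in auto)
 let ?W = "%w. \<Sum>i<m. wt i w * (J (p (Suc i)) w - J (p i) w)"
 note iso = martingale_isometry[OF p(1,2) wF w2i, of m]
 have EW: "(LINT w|M. (?W w)^2) <= \<eta>"
 proof -
  have "(LINT w|M. (?W w)^2) = (\<Sum>i<m. \<integral>w. (wt i w)^2 * ?d i \<partial>M)" using iso(2) by simp
  also have "... = (LINT w|M. (\<Sum>i<m. (wt i w)^2 * ?d i))"
   using w2i by (intro Bochner_Integration.integral_sum[symmetric]) auto
  also have "... <= (LINT w|M. \<eta>)"
   using w2i w_sum by (intro integral_mono Bochner_Integration.integrable_sum integrable_mult_left) auto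
  finally show ?thesis by (simp add: prob_space)
 qed
 have WM: "?W : borel_measurable M"
  using F_meas[OF _ wF] p part_nonneg[OF part] by (intro borel_measurable_sum borel_measurable_times borel_measurable_diff J_meas) auto
 note [measurable] = WM QM
 have "{w\<in>space M. abs (simple_integral J S T w) > \<epsilon>} \<subseteq>
   {w\<in>space M. (LBINT r:{0..T}. (simple_value S r w)^2) > \<eta>} \<union> {w\<in>space M. (?W w)^2 >= \<epsilon>^2}"
 proof
  fix w assume w: "w : {w\<in>space M. abs (simple_integral J S T w) > \<epsilon>}"
  show "w : {w\<in>space M. (LBINT r:{0..T}. (simple_value S r w)^2) > \<eta>} \<union> {w\<in>space M. (?W w)^2 >= \<epsilon>^2}"
  proof (cases "(\<Sum>i<m. (?v i w)^2 * ?d i) <= \<eta>")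
   case True
   have "wt i w = ?v i w" if "i < m" for i
   proof -
    have "(\<Sum>l\<le>i. (?v l w)^2 * ?d l) <= (\<Sum>l<m. (?v l w)^2 * ?d l)"
     using that d by (intro sum_mono2) (auto simp: less_imp_le)
    then show ?thesis using True by (simp add: wt_def)
   qed
   then have "?W w = simple_integral J S T w" unfolding I by (intro sum.cong) auto
   then have "\<epsilon> <= abs (?W w)" using w by simp
   then have "\<epsilon>^2 <= (abs (?W w))^2" using e by (intro power_mono) auto
   then show ?thesis using w by simp
  next
   case False
   then show ?thesis using w Q by simp
  qed
 qed
 then have "measure M {w\<in>space M. abs (simple_integral J S T w) > \<epsilon>} <=
   measure M ({w\<in>space M. (LBINT r:{0..T}. (simple_value S r w)^2) > \<eta>} \<union> {w\<in>space M. (?W w)^2 >= \<epsilon>^2})"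
  using QM' by (intro finite_measure_mono) auto
 also have "... <= measure M {w\<in>space M. (LBINT r:{0..T}. (simple_value S r w)^2) > \<eta>} + measure M {w\<in>space M. (?W w)^2 >= \<epsilon>^2}"
  using QM' by (intro measure_Un_le) auto
 also have "measure M {w\<in>space M. (?W w)^2 >= \<epsilon>^2} <= (LINT w|M. (?W w)^2) / \<epsilon>^2"
  using iso(1) e by (intro integral_Markov_inequality_measure[where A="{}"]) auto
 also have "... <= \<eta> / \<epsilon>^2" using EW e by (intro divide_right_mono) auto
 finally show "measure M {w\<in>space M. abs (simple_integral J S T w) > \<epsilon>} <=
   measure M {w\<in>space M. (LBINT r:{0..T}. (simple_value S r w)^2) > \<eta>} + \<eta> / \<epsilon>^2" by simp
qed

lemma simple_integral_vanish:
 assumes S: "!!k. step_list F (S k)" and T: "0 <= T"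
  and lim: "AE w in M. (%k. LBINT r:{0..T}. (simple_value (S k) r w)^2) \<longlonglongrightarrow> 0"
 shows "vanish_in_prob M (%k w. simple_integral J (S k) T w)"
 unfolding vanish_in_prob_def likely_def
proof (intro allI impI)
 fix e :: real assume e: "e > 0"
 \<comment> \<open>With this choice \<open>\<eta> / e^2 = e / 2\<close>, half of the admissible
   probability.\<close>
 define \<eta> where "\<eta> = e^2 * (e / 2)"
 have \<eta>: "\<eta> > 0" "\<eta> / e^2 = e / 2" using e by (auto simp: \<eta>_def)
 define b where "b = min \<eta> (e / 2)"
 have b: "b > 0" "b <= \<eta>" "b <= e / 2" using \<eta> e by (auto simp: b_def)
 note [measurable] = simple_integral_lenglart(1)[OF S T e \<eta>(1)] simple_integral_meas[OF S T]
 have "vanish_in_prob M (%k w. LBINT r:{0..T}. (simple_value (S k) r w)^2)"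
  by (rule vanish_in_prob_AE[OF _ lim]) measurable
 then have "\<forall>\<^sub>F k in sequentially. EX A:sets M. measure M (space M - A) <= b &
   (ALL w:A. abs (LBINT r:{0..T}. (simple_value (S k) r w)^2) <= b)"
  using b unfolding vanish_in_prob_def likely_def by blast
 then show "\<forall>\<^sub>F k in sequentially. EX A:sets M. measure M (space M - A) <= e &
   (ALL w:A. abs (simple_integral J (S k) T w) <= e)"
 proof eventually_elim
  case (elim k)
  then obtain A where A: "A : sets M" "measure M (space M - A) <= b"
   "!!w. w : A ==> abs (LBINT r:{0..T}. (simple_value (S k) r w)^2) <= b" by blast
  have "measure M {w\<in>space M. (LBINT r:{0..T}. (simple_value (S k) r w)^2) > \<eta>} <= measure M (space M - A)"
   using A b by (intro finite_measure_mono) force+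
  then have "measure M {w\<in>space M. abs (simple_integral J (S k) T w) > e} <= e"
   using simple_integral_lenglart(2)[OF S T e \<eta>(1), of k] A b \<eta> by simp
  moreover have "space M - {w\<in>space M. abs (simple_integral J (S k) T w) <= e} = {w\<in>space M. abs (simple_integral J (S k) T w) > e}"
   by auto
  ultimately show ?case
   by (intro bexI[of _ "{w\<in>space M. abs (simple_integral J (S k) T w) <= e}"]) auto
 qed
qed

end

section \<open>Stochastic integrals of left limits\<close>

text \<open>The one-sided limits at \<open>t\<close> bound the path on a neighbourhood of
  \<open>t\<close>. Compactness leaves finitely many neighbourhoods, and the sum of the absolute
  values of their bounds dominates each of them.\<close>

lemma cadlag_bounded:
 assumes "cadlag f"
 shows "EX B. ALL t:{0..T}. abs (f t) <= B"
proof -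
 have "EX U B. open U & t : U & (ALL s:U \<inter> {0..T}. abs (f s) <= B)" if t: "t : {0..T}" for t
 proof -
  have "(f \<longlongrightarrow> f t) (at_right t)" using assms t by (simp add: cadlag_def)
  then obtain r where r: "t < r" "!!s. t < s ==> s < r ==> dist (f s) (f t) < 1"
   unfolding tendsto_iff eventually_at_right_field using zero_less_one by blast
  obtain l L where l: "l < t" "!!s. l < s ==> s < t ==> 0 <= s ==> dist (f s) L < 1"
  proof (cases "t > 0")
   case True
   then obtain L where "(f \<longlongrightarrow> L) (at_left t)" using assms by (auto simp: cadlag_def)
   then obtain l where "l < t" "!!s. l < s ==> s < t ==> dist (f s) L < 1"
    unfolding tendsto_iff eventually_at_left_field using zero_less_one by blast
   then show ?thesis using that by blast
  next
   case False
   then show ?thesis using that[of "t - 1"] t by auto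
  qed
  have "abs (f s) <= max (abs (f t) + 1) (abs L + 1)" if s: "s : {l<..<r} \<inter> {0..T}" for s
  proof -
   consider "s = t" | "s < t" | "t < s" by linarith
   then show ?thesis
   proof cases
    case 2
    then have "dist (f s) L < 1" using l s by auto
    then show ?thesis by (auto simp: dist_real_def)
   next
    case 3
    then have "dist (f s) (f t) < 1" using r s by auto
    then show ?thesis by (auto simp: dist_real_def)
   qed auto
  qed
  then show ?thesis using l r by (intro exI[of _ "{l<..<r}"] exI[of _ "max (abs (f t) + 1) (abs L + 1)"]) auto
 qed
 then obtain U B where UB: "!!t. t : {0..T} ==> open (U t) & t : U t & (ALL s:U t \<inter> {0..T}. abs (f s) <= B t)"
  by metis
 obtain C where C: "C \<subseteq> {0..T}" "finite C" "{0..T} \<subseteq> (\<Union>t\<in>C. U t)"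
  by (rule compactE_image[OF compact_Icc, of "{0..T}" U 0 T]) (use UB in blast)+
 have "abs (f s) <= (\<Sum>t\<in>C. abs (B t))" if s: "s : {0..T}" for s
 proof -
  obtain t where t: "t : C" "s : U t" using C s by blast
  have "t : {0..T}" using t C by blast
  then have "abs (f s) <= B t" using UB t s by blast
  then have "abs (f s) <= abs (B t)" by linarith
  also have "... <= (\<Sum>t\<in>C. abs (B t))" using t C by (intro member_le_sum) auto
  finally show ?thesis .
 qed
 then show ?thesis by blast
qed

text \<open>The largest dyadic number of level \<open>N\<close> that is strictly smaller than
  \<open>r\<close>. Strictness matters at dyadic \<open>r\<close>: the path is always sampled from
  the left, so the samples tend to the left limit.\<close>

definition left_grid :: "nat => real => real" where
 "left_grid N r = (real_of_int \<lceil>r * 2 ^ N\<rceil> - 1) / 2 ^ N"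

lemma left_grid:
 assumes "0 < r"
 shows "left_grid N r < r" "r - (1/2) ^ N <= left_grid N r" "0 <= left_grid N r"
proof -
 have "real_of_int \<lceil>r * 2 ^ N\<rceil> - 1 < r * 2 ^ N" "r * 2 ^ N <= real_of_int \<lceil>r * 2 ^ N\<rceil>" by linarith+
 then show "left_grid N r < r" "r - (1/2) ^ N <= left_grid N r"
  by (simp_all add: left_grid_def field_simps)
 have "0 < r * 2 ^ N" using assms by simp
 then have "\<lceil>r * 2 ^ N\<rceil> >= 1" by linarith
 then show "0 <= left_grid N r" by (simp add: left_grid_def)
qed

lemma left_grid_tendsto:
 assumes "0 < r"
 shows "(%N. left_grid N r) \<longlonglongrightarrow> r"
proof (rule tendsto_sandwich[of "%N. r - (1/2) ^ N"])
 have "(%N. r - (1/2 :: real) ^ N) \<longlonglongrightarrow> r - 0"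
  by (intro tendsto_diff tendsto_const LIMSEQ_power_zero) simp
 then show "(%N. r - (1/2) ^ N) \<longlonglongrightarrow> r" by simp
qed (use left_grid[OF assms] in "auto simp: less_imp_le")

lemma cadlag_left_grid:
 assumes "cadlag x" "0 < r"
 shows "(%N. x (left_grid N r)) \<longlonglongrightarrow> Lim (at_left r) x"
proof -
 obtain l where l: "(x \<longlongrightarrow> l) (at_left r)" using assms by (auto simp: cadlag_def)
 then have "Lim (at_left r) x = l" by (intro tendsto_Lim) auto
 moreover have "filterlim (%N. left_grid N r) (at_left r) sequentially"
  unfolding filterlim_at using left_grid(1)[OF assms(2)] left_grid_tendsto[OF assms(2)] by (auto simp: less_imp_neq)
 ultimately show ?thesis using filterlim_compose[OF l] by simp
qed

lemma set_integrable_bounded_Icc: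
 fixes f :: "real => real"
 assumes "(%r. indicator {s..t} r * f r) : borel_measurable borel" "!!r. s <= r ==> r <= t ==> abs (f r) <= B"
 shows "set_integrable lborel {s..t} f"
 unfolding set_integrable_def
proof (rule Bochner_Integration.integrable_bound)
 show "integrable lborel (%r. abs B * indicator {s..t} r)"
  by (intro integrable_mult_right integrable_real_indicator) (auto simp: emeasure_lborel_Icc_eq)
 show "AE r in lborel. norm (indicator {s..t} r *\<^sub>R f r) <= norm (abs B * indicator {s..t} r)"
  using assms(2) by (intro AE_I2) (fastforce simp: indicator_def)
qed (use assms(1) in simp)

lemma simple_value_bounded: "EX B. ALL r. abs (simple_value S r w) <= B"
proof (induction S)
 case (Cons x S)
 then obtain B where B: "abs (simple_value S r w) <= B" for r by blast
 obtain s t \<xi> where x: "x = (s, t, \<xi>)" by (cases x)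
 have "abs (simple_value (x # S) r w) <= abs (\<xi> w) + B" for r
  using B[of r] by (auto simp: x indicator_def)
 then show ?case by blast
qed (auto intro: exI[of _ 0])

definition clip :: "real => real => real => real" where
 "clip s t x = min (max x s) t"

text \<open>Restriction to the interval from \<open>s\<close> to \<open>t\<close> and multiplication
  by \<open>m\<close>. A step that starts at or after \<open>t\<close> is clipped to an empty one;
  its coefficient is set to 0 because it need not be measurable at the clipped time
  \<open>t\<close>.\<close>

definition restrict_steps :: "real => real => ('w => real) => (real \<times> real \<times> ('w => real)) list =>
  (real \<times> real \<times> ('w => real)) list" where
 "restrict_steps s t m S = map (%(a, b, \<xi>). (clip s t a, clip s t b, %w. if a < t then m w * \<xi> w else 0)) S"

lemma simple_value_restrict:
 assumes "s <= t"
 shows "simple_value (restrict_steps s t m S) r w = (if s < r & r <= t then m w * simple_value S r w else 0)"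
proof (induction S)
 case (Cons x S)
 obtain a b \<xi> where x: "x = (a, b, \<xi>)" by (cases x)
 show ?case using Cons assms unfolding restrict_steps_def
  by (auto simp: x indicator_def clip_def algebra_simps min_def max_def split: if_splits)
qed (simp add: restrict_steps_def)

lemma simple_integral_restrict:
 assumes "s <= t" "t <= T" "step_list F S"
 shows "simple_integral J (restrict_steps s t m S) T w = m w * (simple_integral J S t w - simple_integral J S s w)"
 using assms(3)
proof (induction S)
 case (Cons x S)
 obtain a b \<xi> where x: "x = (a, b, \<xi>)" by (cases x)
 have ab: "a <= b" using Cons.prems by (simp add: x)
 have 1: "J (min (clip s t z) T) w = J (min z t) w - J (min z s) w + J s w" for z
  using assms by (auto simp: clip_def min_def max_def)
 have "(if a < t then m w * \<xi> w else 0) * (J (min (clip s t b) T) w - J (min (clip s t a) T) w) =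
   m w * (\<xi> w * (J (min b t) w - J (min a t) w) - \<xi> w * (J (min b s) w - J (min a s) w))"
  unfolding 1 using ab assms by (auto simp: algebra_simps min_def)
 moreover have "simple_integral J (restrict_steps s t m S) T w = m w * (simple_integral J S t w - simple_integral J S s w)"
  using Cons by (simp add: x)
 ultimately show ?case by (simp add: restrict_steps_def x algebra_simps)
qed (simp add: restrict_steps_def)

lemma simple_value_concat: "simple_value (concat (map f xs)) r w = (\<Sum>x\<leftarrow>xs. simple_value (f x) r w)"
 by (induction xs) auto

lemma simple_integral_concat: "simple_integral J (concat (map f xs)) T w = (\<Sum>x\<leftarrow>xs. simple_integral J (f x) T w)"
 by (induction xs) auto

lemma simple_value_uminus: "simple_value (map (%(a, b, \<xi>). (a, b, %w. - \<xi> w)) S) r w = - simple_value S r w"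
 by (induction S) auto

lemma simple_integral_uminus:
 "simple_integral J (map (%(a, b, \<xi>). (a, b, %w. - \<xi> w)) S) T w = - simple_integral J S T w"
 by (induction S) (auto simp: algebra_simps)

lemma step_list_uminus: "step_list F S ==> step_list F (map (%(a, b, \<xi>). (a, b, %w. - \<xi> w)) S)"
 by (induction S) auto

section \<open>Riemann sums for the left-limit integrand\<close>

locale jump_process = levy_noise M F J
 for M :: "'w measure" and F :: "real => 'w measure" and J :: "real => 'w => real" +
 fixes X :: "real => 'w => real" and g :: "real => real" and L :: real
 assumes X_adapted: "adapted F X" and X_cadlag: "AE w in M. cadlag (%t. X t w)"
  and X_moments: "moments_bounded M {0..} X"
  and g_lipschitz: "L-lipschitz_on UNIV g"
begin

lemma X_F: "0 <= t ==> X t : borel_measurable (F t)"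
 using X_adapted by (simp add: adapted_def)

lemma X_meas [measurable]: "0 <= t ==> X t : borel_measurable M"
 using F_meas X_F by blast

lemma g_cont: "isCont g x"
 using lipschitz_on_continuous_on[OF g_lipschitz] by (simp add: continuous_on_eq_continuous_at)

lemma g_meas [measurable]: "g : borel_measurable borel"
 by (intro borel_measurable_continuous_onI lipschitz_on_continuous_on[OF g_lipschitz])

lemma L_nonneg: "L >= 0"
 using g_lipschitz by (simp add: lipschitz_on_def)

lemma g_diff_le: "abs (g x - g y) <= L * abs (x - y)"
 using lipschitz_onD[OF g_lipschitz, of x y] by (simp add: dist_real_def)

lemma gX_moments: "moments_bounded M {0..} (%t w. g (X t w))"
proof (rule moments_bounded_mono[where K=1])
 show "moments_bounded M {0..} (%t w. abs (g 0) + L * abs (X t w))"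
  by (intro moments_bounded_add moments_bounded_mult moments_bounded_const moments_bounded_abs X_moments)
 show "abs (g (X t w)) <= 1 * abs (abs (g 0) + L * abs (X t w))" for t w
  using g_diff_le[of "X t w" 0] by simp
qed measurable

lemma gX_all_moments: "0 <= t ==> all_moments M (%w. g (X t w))"
 by (rule moments_bounded_all_moments[OF gX_moments]) simp

lemma gX_F: "0 <= t ==> (%w. g (X t w)) : borel_measurable (F t)"
 using X_F by (intro measurable_compose[OF _ g_meas])

text \<open>Dyadic steps of mesh \<open>2 ^ -N\<close> up to time \<open>N\<close>: mesh and horizon
  are refined together, so that one sequence serves all end times.\<close>

definition riemann_steps :: "nat => (real \<times> real \<times> ('w => real)) list" where
 "riemann_steps N = map (%i. (real i / 2 ^ N, real (Suc i) / 2 ^ N, %w. g (X (real i / 2 ^ N) w))) [0..<N * 2 ^ N]"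

definition left_limit_integrand :: "real => 'w => real" where
 "left_limit_integrand s w = g (Lim (at_left s) (%r. X r w))"

lemma riemann_step_list: "step_list F (riemann_steps N)"
 unfolding riemann_steps_def step_list_def using gX_F by (auto simp: divide_right_mono)

lemma riemann_all_moments: "(s, t, \<xi>) : set (riemann_steps N) ==> all_moments M \<xi>"
 unfolding riemann_steps_def using gX_all_moments by auto

lemma riemann_value:
 assumes r: "0 < r" "r <= real N"
 shows "simple_value (riemann_steps N) r w = g (X (left_grid N r) w)"
proof -
 define k where "k = nat (\<lceil>r * 2 ^ N\<rceil> - 1)"
 have "0 < r * 2 ^ N" using r by simp
 then have c: "\<lceil>r * 2 ^ N\<rceil> >= 1" by linarith
 then have k: "real k = real_of_int \<lceil>r * 2 ^ N\<rceil> - 1" by (simp add: k_def)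
 have kr: "real k < r * 2 ^ N" "r * 2 ^ N <= real k + 1" unfolding k by linarith+
 have "r * 2 ^ N <= real N * 2 ^ N" using r by (intro mult_right_mono) auto
 with kr have "real k < real N * 2 ^ N" by linarith
 then have "real k < real (N * 2 ^ N)" by simp
 then have kN: "k < N * 2 ^ N" by (simp only: of_nat_less_iff)
 have ind: "r : {real i / 2 ^ N<..real (Suc i) / 2 ^ N} \<longleftrightarrow> i = k" for i
 proof -
  have "r : {real i / 2 ^ N<..real (Suc i) / 2 ^ N} \<longleftrightarrow> real i < r * 2 ^ N & r * 2 ^ N <= real i + 1"
   by (auto simp: field_simps)
  also have "... \<longleftrightarrow> i = k" using kr by linarith
  finally show ?thesis .
 qed
 have "simple_value (riemann_steps N) r w =
   (\<Sum>i\<in>{0..<N * 2 ^ N}. g (X (real i / 2 ^ N) w) * indicator {real i / 2 ^ N<..real (Suc i) / 2 ^ N} r)"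
  unfolding simple_value_def riemann_steps_def by (simp add: interv_sum_list_conv_sum_set_nat o_def)
 also have "... = (\<Sum>i\<in>{0..<N * 2 ^ N}. if i = k then g (X (real i / 2 ^ N) w) else 0)"
  by (intro sum.cong refl) (use ind in "auto simp: indicator_def simp del: greaterThanAtMost_iff")
 also have "... = g (X (real k / 2 ^ N) w)" using kN by (subst sum.delta) auto
 finally show ?thesis by (simp add: left_grid_def k)
qed

context
 fixes w :: 'w and T :: real
 assumes cad: "cadlag (%t. X t w)" and T: "0 <= T"
begin

lemma riemann_tendsto:
 assumes "0 < r"
 shows "(%N. simple_value (riemann_steps N) r w) \<longlonglongrightarrow> left_limit_integrand r w"
proof -
 have "(%N. g (X (left_grid N r) w)) \<longlonglongrightarrow> left_limit_integrand r w"
  unfolding left_limit_integrand_def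
  by (rule isCont_tendsto_compose[OF g_cont cadlag_left_grid[OF cad assms]])
 moreover have "\<forall>\<^sub>F N in sequentially. g (X (left_grid N r) w) = simple_value (riemann_steps N) r w"
  using eventually_ge_at_top[of "nat \<lceil>r\<rceil>"]
  by eventually_elim (subst riemann_value; use assms in "auto simp: nat_le_iff ceiling_le_iff")
 ultimately show ?thesis by (rule Lim_transform_eventually)
qed

lemma left_limit_meas: "(%r. indicator {0..T} r * left_limit_integrand r w) : borel_measurable borel"
proof -
 have "(%r. indicator {0<..T} r * left_limit_integrand r w) : borel_measurable borel"
 proof (rule borel_measurable_LIMSEQ_real)
  show "(%N. indicator {0<..T} r * simple_value (riemann_steps N) r w) \<longlonglongrightarrow> indicator {0<..T} r * left_limit_integrand r w" for r
   using riemann_tendsto[of r] by (cases "r : {0<..T}") (auto intro: tendsto_mult_left)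
 qed measurable
 \<comment> \<open>At 0 the left limit would involve negative times, on which nothing is assumed;
   its value is added as a single point.\<close>
 then have "(%r. indicator {0<..T} r * left_limit_integrand r w + indicator {0} r * left_limit_integrand 0 w) : borel_measurable borel"
  by measurable
 also have "(%r. indicator {0<..T} r * left_limit_integrand r w + indicator {0} r * left_limit_integrand 0 w) =
   (%r. indicator {0..T} r * left_limit_integrand r w)"
  using T by (auto simp: indicator_def)
 finally show ?thesis .
qed

lemma left_limit_bounded: "EX B. ALL N r. N >= nat \<lceil>T\<rceil> --> 0 < r --> r <= T -->
  abs (simple_value (riemann_steps N) r w) <= B & abs (left_limit_integrand r w) <= B"
proof -
 obtain B where B: "!!t. t : {0..T} ==> abs (X t w) <= B" using cadlag_bounded[OF cad] by blast
 define K where "K = abs (g 0) + L * B"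
 have gB: "abs (g (X t w)) <= K" if "t : {0..T}" for t
 proof -
  have "L * abs (X t w) <= L * B" using B[OF that] L_nonneg by (intro mult_left_mono)
  then show ?thesis using g_diff_le[of "X t w" 0] by (simp add: K_def)
 qed
 have sv: "abs (simple_value (riemann_steps N) r w) <= K" if "N >= nat \<lceil>T\<rceil>" "0 < r" "r <= T" for N r
 proof -
  have "r <= real N" using that by (auto simp: nat_le_iff ceiling_le_iff)
  then show ?thesis using that left_grid[of r N] by (subst riemann_value) (auto intro!: gB)
 qed
 have "abs (left_limit_integrand r w) <= K" if "0 < r" "r <= T" for r
  by (rule Lim_bounded[OF tendsto_rabs[OF riemann_tendsto[OF that(1)]], of "nat \<lceil>T\<rceil>"]) (use sv that in auto)
 with sv show ?thesis by blast
qed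

lemma left_limit_bounded': "EX B. ALL r. 0 <= r --> r <= T --> abs (left_limit_integrand r w) <= B"
proof -
 obtain B where B: "!!r. 0 < r ==> r <= T ==> abs (left_limit_integrand r w) <= B"
  using left_limit_bounded by blast
 have "abs (left_limit_integrand r w) <= max B (abs (left_limit_integrand 0 w))" if "0 <= r" "r <= T" for r
  using B[of r] that by (cases "r = 0") auto
 then show ?thesis by blast
qed

lemma simple_left_limit_integrable:
 "set_integrable lborel {0..T} (%r. (simple_value S r w - left_limit_integrand r w)^2)"
proof -
 obtain A where A: "!!r. abs (simple_value S r w) <= A" using simple_value_bounded[of S w] by blast
 obtain B where B: "!!r. 0 <= r ==> r <= T ==> abs (left_limit_integrand r w) <= B" using left_limit_bounded' by blast
 show ?thesis
 proof (rule set_integrable_bounded_Icc)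
  have "(%r. (indicator {0..T} r * simple_value S r w - indicator {0..T} r * left_limit_integrand r w)^2) : borel_measurable borel"
   using left_limit_meas by measurable
  also have "(%r. (indicator {0..T} r * simple_value S r w - indicator {0..T} r * left_limit_integrand r w)^2)
    = (%r. indicator {0..T} r * (simple_value S r w - left_limit_integrand r w)^2)"
   by (auto simp: indicator_def)
  finally show "(%r. indicator {0..T} r * (simple_value S r w - left_limit_integrand r w)^2) : borel_measurable borel" .
  fix r assume r: "0 <= r" "r <= T"
  have "abs (simple_value S r w - left_limit_integrand r w) <= A + B" using A[of r] B[OF r] by linarith
  then have "(abs (simple_value S r w - left_limit_integrand r w))^2 <= (A + B)^2" by (intro power_mono) auto
  then show "abs ((simple_value S r w - left_limit_integrand r w)^2) <= (A + B)^2" by simp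
 qed
qed

lemma riemann_L2:
 "(%N. LBINT r:{0..T}. (simple_value (riemann_steps N) r w - left_limit_integrand r w)^2) \<longlonglongrightarrow> 0"
proof -
 obtain B where B: "!!N r. N >= nat \<lceil>T\<rceil> ==> 0 < r ==> r <= T ==>
   abs (simple_value (riemann_steps N) r w) <= B & abs (left_limit_integrand r w) <= B"
  using left_limit_bounded by blast
 let ?f = "%N r. indicator {0..T} r *\<^sub>R (simple_value (riemann_steps N) r w - left_limit_integrand r w)\<^sup>2"
 have nz: "AE r in lborel. r ~= (0::real)" by (rule AE_lborel_singleton)
 have "(%N. LBINT r. ?f (N + nat \<lceil>T\<rceil>) r) \<longlonglongrightarrow> integral\<^sup>L lborel (%_ :: real. 0 :: real)"
 proof (rule Bochner_Integration.integral_dominated_convergence[where w="%r. (2 * B)^2 * indicator {0..T} r"])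
  show "integrable lborel (%r. (2 * B)^2 * indicator {0..T} r)"
   by (intro integrable_mult_right integrable_real_indicator) (auto simp: emeasure_lborel_Icc_eq)
  show "?f (N + nat \<lceil>T\<rceil>) : borel_measurable lborel" for N
   using borel_measurable_integrable[OF simple_left_limit_integrable[unfolded set_integrable_def]] .
  show "AE r in lborel. (%N. ?f (N + nat \<lceil>T\<rceil>) r) \<longlonglongrightarrow> 0"
   using nz
  proof eventually_elim
   case (elim r)
   show ?case
   proof (cases "r : {0..T}")
    case True
    then have "(%N. simple_value (riemann_steps N) r w - left_limit_integrand r w) \<longlonglongrightarrow> 0"
     using riemann_tendsto[of r] elim by (auto simp: LIM_zero)
    then have "(%N. (simple_value (riemann_steps N) r w - left_limit_integrand r w)^2) \<longlonglongrightarrow> 0^2"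
     by (intro tendsto_power)
    from LIMSEQ_ignore_initial_segment[OF this, of "nat \<lceil>T\<rceil>"] show ?thesis using True by simp
   qed simp
  qed
  show "AE r in lborel. norm (?f (N + nat \<lceil>T\<rceil>) r) <= (2 * B)^2 * indicator {0..T} r" for N
   using nz
  proof eventually_elim
   case (elim r)
   show ?case
   proof (cases "r : {0..T}")
    case True
    then have "abs (simple_value (riemann_steps (N + nat \<lceil>T\<rceil>)) r w - left_limit_integrand r w) <= 2 * B"
     using B[of "N + nat \<lceil>T\<rceil>" r] elim by auto
    then have "(abs (simple_value (riemann_steps (N + nat \<lceil>T\<rceil>)) r w - left_limit_integrand r w))^2 <= (2 * B)^2"
     by (intro power_mono) auto
    then show ?thesis using True by simp
   qed simp
  qed
 qed simp
 then have "(%N. LBINT r. ?f (N + nat \<lceil>T\<rceil>) r) \<longlonglongrightarrow> 0" by simp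
 from LIMSEQ_offset[OF this] show ?thesis unfolding set_lebesgue_integral_def .
qed

lemma LBINT_diff_le:
 "(LBINT r:{0..T}. (simple_value S r w - simple_value R r w)^2) <=
  2 * (LBINT r:{0..T}. (simple_value S r w - left_limit_integrand r w)^2) +
  2 * (LBINT r:{0..T}. (simple_value R r w - left_limit_integrand r w)^2)"
proof -
 let ?S = "%r. (simple_value S r w - left_limit_integrand r w)^2"
 let ?R = "%r. (simple_value R r w - left_limit_integrand r w)^2"
 note i = simple_left_limit_integrable[of S] simple_left_limit_integrable[of R]
 have i2: "set_integrable lborel {0..T} (%r. 2 * ?S r)" "set_integrable lborel {0..T} (%r. 2 * ?R r)"
  using i by (auto intro: set_integrable_mult_right)
 obtain A where A: "!!r. abs (simple_value S r w) <= A" using simple_value_bounded[of S w] by blast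
 obtain B where B: "!!r. abs (simple_value R r w) <= B" using simple_value_bounded[of R w] by blast
 have i3: "set_integrable lborel {0..T} (%r. (simple_value S r w - simple_value R r w)^2)"
 proof (rule set_integrable_bounded_Icc)
  fix r
  have "abs (simple_value S r w - simple_value R r w) <= A + B" using A[of r] B[of r] by linarith
  then have "(abs (simple_value S r w - simple_value R r w))^2 <= (A + B)^2" by (intro power_mono) auto
  then show "abs ((simple_value S r w - simple_value R r w)^2) <= (A + B)^2" by simp
 qed measurable
 have "(LBINT r:{0..T}. (simple_value S r w - simple_value R r w)^2) <= (LBINT r:{0..T}. 2 * ?S r + 2 * ?R r)"
 proof (rule set_integral_mono[OF i3 set_integral_add(1)[OF i2]])
  fix r
  have "0 <= ((simple_value S r w - left_limit_integrand r w) + (simple_value R r w - left_limit_integrand r w))^2" by simp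
  then show "(simple_value S r w - simple_value R r w)^2 <= 2 * ?S r + 2 * ?R r"
   by (simp add: power2_eq_square algebra_simps)
 qed
 also have "... = 2 * (LBINT r:{0..T}. ?S r) + 2 * (LBINT r:{0..T}. ?R r)"
  using set_integral_add(2)[OF i2] by simp
 finally show ?thesis .
qed

end

text \<open>Any approximating sequence of the definition agrees in the limit with the Riemann sums.\<close>

lemma ito_integral_riemann:
 assumes I: "has_ito_integral M F J T left_limit_integrand I" and T: "0 <= T"
 shows "I : borel_measurable M"
  "vanish_in_prob M (%N w. simple_integral J (riemann_steps N) T w - I w)"
proof -
 obtain S where S: "!!k. simple_integrand F (S k)"
  and S1: "small_in_prob M (%k w. LBINT s:{0..T}. (simple_value (S k) s w - left_limit_integrand s w)^2)"
  and S2: "small_in_prob M (%k w. simple_integral J (S k) T w - I w)"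
  using I unfolding has_ito_integral_def by blast
 have Sl: "step_list F (S k)" for k using S simple_integrand_step_list by blast
 have "(%w. simple_integral J (S 0) T w - I w) : borel_measurable M"
  using S2 by (simp add: small_in_prob_def)
 then have "(%w. simple_integral J (S 0) T w - (simple_integral J (S 0) T w - I w)) : borel_measurable M"
  by (rule borel_measurable_diff[OF simple_integral_meas[OF Sl T]])
 then show "I : borel_measurable M" by (subst (asm) measurable_cong[where g=I]) auto
 obtain \<kappa> where \<kappa>: "strict_mono \<kappa>"
  "AE w in M. (%l. LBINT s:{0..T}. (simple_value (S (\<kappa> l)) s w - left_limit_integrand s w)^2) \<longlonglongrightarrow> 0"
  using vanish_in_prob_AE_subseq[OF _ small_in_prob_vanish[OF S1]] S1[unfolded small_in_prob_def] by blast
 define D where "D l = S (\<kappa> l) @ map (%(a, b, \<xi>). (a, b, %w. - \<xi> w)) (riemann_steps l)" for l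
 have Dv: "simple_value (D l) r w = simple_value (S (\<kappa> l)) r w - simple_value (riemann_steps l) r w" for l r w
  by (simp add: D_def simple_value_uminus)
 have "vanish_in_prob M (%l w. simple_integral J (D l) T w)"
 proof (rule simple_integral_vanish[OF _ T])
  show "step_list F (D l)" for l
   unfolding D_def using Sl riemann_step_list by (simp add: step_list_uminus)
  show "AE w in M. (%l. LBINT r:{0..T}. (simple_value (D l) r w)^2) \<longlonglongrightarrow> 0"
   using \<kappa>(2) X_cadlag
  proof eventually_elim
   case (elim w)
   show ?case
   proof (rule Lim_null_comparison)
    show "\<forall>\<^sub>F l in sequentially. norm (LBINT r:{0..T}. (simple_value (D l) r w)^2) <=
      2 * (LBINT r:{0..T}. (simple_value (S (\<kappa> l)) r w - left_limit_integrand r w)^2) +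
      2 * (LBINT r:{0..T}. (simple_value (riemann_steps l) r w - left_limit_integrand r w)^2)"
    proof (intro always_eventually allI)
     fix l
     have "0 <= (LBINT r:{0..T}. (simple_value (D l) r w)^2)"
      unfolding set_lebesgue_integral_def by (intro Bochner_Integration.integral_nonneg) simp
     then show "norm (LBINT r:{0..T}. (simple_value (D l) r w)^2) <=
       2 * (LBINT r:{0..T}. (simple_value (S (\<kappa> l)) r w - left_limit_integrand r w)^2) +
       2 * (LBINT r:{0..T}. (simple_value (riemann_steps l) r w - left_limit_integrand r w)^2)"
      using LBINT_diff_le[OF elim(2) T, of "S (\<kappa> l)" "riemann_steps l"] unfolding Dv by simp
    qed
    have "(%l. 2 * (LBINT r:{0..T}. (simple_value (S (\<kappa> l)) r w - left_limit_integrand r w)^2) +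
      2 * (LBINT r:{0..T}. (simple_value (riemann_steps l) r w - left_limit_integrand r w)^2)) \<longlonglongrightarrow> 2 * 0 + 2 * 0"
     by (intro tendsto_add tendsto_mult tendsto_const elim(1) riemann_L2[OF elim(2) T])
    then show "(%l. 2 * (LBINT r:{0..T}. (simple_value (S (\<kappa> l)) r w - left_limit_integrand r w)^2) +
      2 * (LBINT r:{0..T}. (simple_value (riemann_steps l) r w - left_limit_integrand r w)^2)) \<longlonglongrightarrow> 0" by simp
   qed
  qed
 qed
 from vanish_in_prob_diff[OF vanish_in_prob_subseq[OF small_in_prob_vanish[OF S2] \<kappa>(1)] this]
 show "vanish_in_prob M (%N w. simple_integral J (riemann_steps N) T w - I w)"
  by (simp add: D_def simple_integral_uminus)
qed

lemma bounded_in_prob_variable: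
 assumes "all_moments M Y"
 shows "bounded_in_prob M (%n. Y)"
 by (rule bounded_in_prob_L1[where C="\<integral>w. abs (Y w) \<partial>M"]) (use all_moments_integrable[OF assms] in simp)

text \<open>Source of all bounds on stochastic integrals. A weighted sum of block integrals, each
  compared with a frozen coefficient \<open>wt j\<close>, is the limit in probability of integrals
  of one step list. The isometry bounds those integrals and Fatou's lemma carries the bound to the
  limit. Since the steps sample the process at \<open>left_grid\<close> points, \<open>b\<close> is
  required only there and only for large \<open>N\<close>.\<close>

lemma ito_block_second_moment:
 fixes m wt I :: "nat => 'w => real"
 assumes \<tau>: "0 <= \<tau> 0" "!!j. j < n ==> \<tau> j <= \<tau> (Suc j)"
  and I: "!!j. j <= n ==> has_ito_integral M F J (\<tau> j) left_limit_integrand (I j)"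
  and m: "!!j. j < n ==> m j : borel_measurable (F (\<tau> j))" "!!j. j < n ==> all_moments M (m j)"
  and wt: "!!j. j < n ==> wt j : borel_measurable (F (\<tau> j))" "!!j. j < n ==> all_moments M (wt j)"
  and b: "\<forall>\<^sub>F N in sequentially. \<forall>j<n. ALL r. \<tau> j < r --> r <= \<tau> (Suc j) -->
   (LINT w|M. (m j w * (g (X (left_grid N r) w) - wt j w))^2) <= b"
 defines "Z \<equiv> %w. \<Sum>j<n. m j w * (I (Suc j) w - I j w - wt j w * (J (\<tau> (Suc j)) w - J (\<tau> j) w))"
 shows "integrable M (%w. (Z w)^2) & (LINT w|M. (Z w)^2) <= b * (\<tau> n - \<tau> 0) & Z : borel_measurable M"
proof -
 have \<tau>_mono: "\<tau> i <= \<tau> j" if "i <= j" "j <= n" for i j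
  using that by (induction j) (use \<tau> in "auto simp: le_Suc_eq intro: order_trans")
 have \<tau>0: "0 <= \<tau> j" if "j <= n" for j using \<tau>_mono[of 0 j] \<tau> that by simp
 define B where "B N j = restrict_steps (\<tau> j) (\<tau> (Suc j)) (m j) (riemann_steps N) @ [(\<tau> j, \<tau> (Suc j), %w. - (m j w * wt j w))]" for N j
 define S where "S N = concat (map (B N) [0..<n])" for N
 have Bv: "simple_value (B N j) r w = (if \<tau> j < r & r <= \<tau> (Suc j) then m j w * (simple_value (riemann_steps N) r w - wt j w) else 0)"
  if "j < n" for N j r w
  using simple_value_restrict[OF \<tau>(2)[OF that], of "m j"] by (auto simp: B_def indicator_def algebra_simps)
 have BI: "simple_integral J (B N j) (\<tau> n) w = m j w * ((simple_integral J (riemann_steps N) (\<tau> (Suc j)) w - simple_integral J (riemann_steps N) (\<tau> j) w)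
   - wt j w * (J (\<tau> (Suc j)) w - J (\<tau> j) w))" if "j < n" for N j w
  using simple_integral_restrict[OF \<tau>(2)[OF that] _ riemann_step_list, of "\<tau> n" J "m j" N w] \<tau>_mono[of "Suc j" n] \<tau>_mono[of j n] that
  by (simp add: B_def min_absorb1 algebra_simps)
 have BS: "step_list F (B N j) & (ALL s t \<xi>. (s, t, \<xi>) : set (B N j) --> all_moments M \<xi>)" if j: "j < n" for N j
 proof -
  have mw: "(%w. - (m j w * wt j w)) : borel_measurable (F (\<tau> j))" using m wt j by measurable
  have mw2: "all_moments M (%w. - (m j w * wt j w))"
   using all_moments_diff[OF all_moments_const[of 0] all_moments_mult[OF m(2)[OF j] wt(2)[OF j]]] by simp
  have R: "0 <= clip (\<tau> j) (\<tau> (Suc j)) a & clip (\<tau> j) (\<tau> (Suc j)) a <= clip (\<tau> j) (\<tau> (Suc j)) b' &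
    (%w. if a < \<tau> (Suc j) then m j w * \<xi> w else 0) : borel_measurable (F (clip (\<tau> j) (\<tau> (Suc j)) a)) &
    all_moments M (%w. if a < \<tau> (Suc j) then m j w * \<xi> w else 0)"
   if abx: "(a, b', \<xi>) : set (riemann_steps N)" for a b' \<xi>
  proof -
   have ab: "0 <= a" "a <= b'" "\<xi> : borel_measurable (F a)"
    using riemann_step_list[of N] abx by (auto simp: step_list_def)
   have c: "\<tau> j <= clip (\<tau> j) (\<tau> (Suc j)) a" "a < \<tau> (Suc j) ==> a <= clip (\<tau> j) (\<tau> (Suc j)) a"
    using \<tau>(2)[OF j] by (auto simp: clip_def)
   have "(%w. m j w * \<xi> w) : borel_measurable (F (clip (\<tau> j) (\<tau> (Suc j)) a))" if "a < \<tau> (Suc j)"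
    using F_mono[OF _ c(1) m(1)[OF j]] F_mono[OF ab(1) c(2)[OF that] ab(3)] \<tau>0[of j] j
    by (intro borel_measurable_times) auto
   moreover have "all_moments M (%w. m j w * \<xi> w)"
    using riemann_all_moments[OF abx] m j by (intro all_moments_mult) auto
   ultimately show ?thesis using ab c \<tau>0[of j] j all_moments_const[of 0]
    by (cases "a < \<tau> (Suc j)") (auto simp: clip_def)
  qed
  have "step_list F (restrict_steps (\<tau> j) (\<tau> (Suc j)) (m j) (riemann_steps N))"
   unfolding step_list_def restrict_steps_def using R by (auto 0 3)
  moreover have "all_moments M \<xi>" if "(s, t, \<xi>) : set (restrict_steps (\<tau> j) (\<tau> (Suc j)) (m j) (riemann_steps N))" for s t \<xi>
   using that R unfolding restrict_steps_def by auto
  ultimately show ?thesis using mw mw2 \<tau>(2)[OF j] \<tau>0[of j] j by (auto simp: B_def)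
 qed
 have Sl: "step_list F (S N)" for N
  unfolding S_def step_list_def set_concat using BS by (auto simp: step_list_def)
 have Sm: "all_moments M \<xi>" if "(s, t, \<xi>) : set (S N)" for N s t \<xi>
  using that BS unfolding S_def by auto
 have Sv: "simple_value (S N) r w = (\<Sum>j<n. simple_value (B N j) r w)" for N r w
  unfolding S_def simple_value_concat by (simp add: interv_sum_list_conv_sum_set_nat atLeast0LessThan)
 have SI: "simple_integral J (S N) (\<tau> n) w = (\<Sum>j<n. simple_integral J (B N j) (\<tau> n) w)" for N w
  unfolding S_def simple_integral_concat by (simp add: interv_sum_list_conv_sum_set_nat atLeast0LessThan)
 have Tn: "0 <= \<tau> n" using \<tau>0 by simp
 have IM: "I j : borel_measurable M" if "j <= n" for j
  using ito_integral_riemann(1)[OF I[OF that] \<tau>0[OF that]] .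
 have JM: "J (\<tau> j) : borel_measurable M" if "j <= n" for j using \<tau>0[OF that] by simp
 have ZM: "Z : borel_measurable M"
  unfolding Z_def using IM JM m(2) wt(2)
  by (intro borel_measurable_sum borel_measurable_times borel_measurable_diff) (auto intro: all_moments_meas)
 have SM: "simple_integral J (S N) (\<tau> n) : borel_measurable M" for N
  using simple_integral_meas[OF Sl Tn] .
 have lim: "vanish_in_prob M (%N w. simple_integral J (S N) (\<tau> n) w - Z w)"
 proof -
  have "vanish_in_prob M (%N w. \<Sum>j<n. m j w * ((simple_integral J (riemann_steps N) (\<tau> (Suc j)) w - I (Suc j) w) -
    (simple_integral J (riemann_steps N) (\<tau> j) w - I j w)))"
   by (intro vanish_in_prob_sum vanish_in_prob_mult bounded_in_prob_variable m vanish_in_prob_diff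
     ito_integral_riemann(2) I \<tau>0) auto
  moreover have "(\<Sum>j<n. m j w * ((simple_integral J (riemann_steps N) (\<tau> (Suc j)) w - I (Suc j) w) -
    (simple_integral J (riemann_steps N) (\<tau> j) w - I j w))) = simple_integral J (S N) (\<tau> n) w - Z w" for N w
   unfolding SI Z_def sum_subtractf[symmetric]
   by (intro sum.cong refl) (simp add: BI algebra_simps)
  ultimately show ?thesis by simp
 qed
 have le: "\<forall>\<^sub>F N in sequentially. integrable M (%w. (simple_integral J (S N) (\<tau> n) w)^2) &
   (LINT w|M. (simple_integral J (S N) (\<tau> n) w)^2) <= b * (\<tau> n - \<tau> 0)"
  using b eventually_ge_at_top[of "nat \<lceil>\<tau> n\<rceil>"]
 proof eventually_elim
  case (elim N)
  have z: "simple_value (S N) r w = 0" if "0 < r" "r <= \<tau> 0" for r w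
   unfolding Sv
  proof (intro sum.neutral ballI)
   fix j assume "j : {..<n}"
   then show "simple_value (B N j) r w = 0" using that \<tau>_mono[of 0 j] by (simp add: Bv)
  qed
  have bb: "(LINT w|M. (simple_value (S N) r w)^2) <= b" if r: "\<tau> 0 < r" "r <= \<tau> n" for r
  proof -
   \<comment> \<open>The blocks are disjoint and open on the left; \<open>k - 1\<close> is the only
     one active at time \<open>r\<close>, so the value there is a single term and no sum over blocks
     has to be estimated.\<close>
   define k where "k = (LEAST k. r <= \<tau> k)"
   have k: "r <= \<tau> k" "k <= n" unfolding k_def using r by (auto intro: LeastI Least_le)
   have "k ~= 0" using k r by (auto intro!: gr0I)
   then obtain i where i: "k = Suc i" by (cases k) auto
   have "\<not> r <= \<tau> i" using not_less_Least[of i "%k. r <= \<tau> k"] i unfolding k_def by auto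
   then have ri: "\<tau> i < r" "r <= \<tau> (Suc i)" "i < n" using k i by auto
   have other: "\<not> (\<tau> j < r & r <= \<tau> (Suc j))" if "j < n" "j ~= i" for j
    using \<tau>_mono[of "Suc j" i] \<tau>_mono[of "Suc i" j] that ri by (cases "j < i") auto
   have rN: "0 < r" "r <= real N" using r \<tau>(1) elim(2) by (auto simp: nat_le_iff ceiling_le_iff)
   have "simple_value (S N) r w = m i w * (g (X (left_grid N r) w) - wt i w)" for w
   proof -
    have "simple_value (S N) r w = simple_value (B N i) r w + (\<Sum>j\<in>{..<n} - {i}. simple_value (B N j) r w)"
     unfolding Sv using ri by (intro sum.remove) auto
    also have "(\<Sum>j\<in>{..<n} - {i}. simple_value (B N j) r w) = 0"
     using other by (intro sum.neutral) (auto simp: Bv)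
    finally show ?thesis using ri rN by (simp add: Bv riemann_value)
   qed
   then show ?thesis using elim(1) ri by simp
  qed
  show ?case
   using simple_integral_second_moment[OF Sl Sm \<tau>(1) \<tau>_mono[of 0 n] z bb] by simp
 qed
 show ?thesis
  using fatou_square_prob[OF SM ZM lim le] ZM by simp
qed

end

section \<open>Small-time estimates for the equation\<close>

text \<open>The nodes are right end points: the node of the cell containing \<open>r\<close> lies
  strictly to the right of \<open>r\<close> and tends to \<open>r\<close>, so right-continuity gives
  pointwise convergence and boundedness gives convergence of the integrals.\<close>

lemma right_continuous_riemann_sums:
 fixes f :: "real => real"
 assumes st: "s <= t" and rc: "!!r. s <= r ==> (f \<longlongrightarrow> f r) (at_right r)" and B: "!!r. s <= r ==> r <= t ==> abs (f r) <= B"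
 shows "set_integrable lborel {s..t} f"
  "(%N. \<Sum>i<N. (t - s) / real N * f (s + real (Suc i) * ((t - s) / real N))) \<longlonglongrightarrow> (LBINT r:{s..t}. f r)"
proof -
 define d where "d N = (t - s) / real (Suc N)" for N
 define \<phi> where "\<phi> N r = (\<Sum>i<Suc N. f (s + real (Suc i) * d N) * indicator {s + real i * d N ..< s + real (Suc i) * d N} r)" for N r
 define k where "k N r = nat \<lfloor>(r - s) / d N\<rfloor>" for N r
 have d0: "0 <= d N" "real (Suc N) * d N = t - s" for N using st by (simp_all add: d_def)
 have \<phi>: "\<phi> N r = f (s + real (Suc (k N r)) * d N)" "r < s + real (Suc (k N r)) * d N" "s + real (Suc (k N r)) * d N <= r + d N"
   "s + real (Suc (k N r)) * d N <= t" if r: "s <= r" "r < t" for N r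
 proof -
  have d: "0 < d N" using r by (simp add: d_def)
  have iff: "s + real i * d N <= r & r < s + real (Suc i) * d N \<longleftrightarrow> i = k N r" for i
  proof -
   have "s + real i * d N <= r & r < s + real (Suc i) * d N \<longleftrightarrow> \<lfloor>(r - s) / d N\<rfloor> = int i"
    unfolding floor_eq_iff using d by (simp add: pos_le_divide_eq pos_divide_less_eq algebra_simps)
   moreover have "0 <= \<lfloor>(r - s) / d N\<rfloor>" using d r by simp
   ultimately show ?thesis unfolding k_def by linarith
  qed
  from iff[of "k N r"] have a: "s + real (k N r) * d N <= r" "r < s + real (Suc (k N r)) * d N" by blast+
  have "real (k N r) * d N < real (Suc N) * d N" using a(1) r unfolding d0 by linarith
  then have l: "k N r < Suc N" using d by simp
  have "\<phi> N r = (\<Sum>i<Suc N. if i = k N r then f (s + real (Suc i) * d N) else 0)"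
   unfolding \<phi>_def by (intro sum.cong refl) (simp only: indicator_def atLeastLessThan_iff iff, simp)
  then show "\<phi> N r = f (s + real (Suc (k N r)) * d N)" using l by (simp add: sum.delta')
  show "r < s + real (Suc (k N r)) * d N" "s + real (Suc (k N r)) * d N <= r + d N" using a by (simp_all add: distrib_right)
  have "real (Suc (k N r)) * d N <= real (Suc N) * d N" using l d by (intro mult_right_mono) auto
  then show "s + real (Suc (k N r)) * d N <= t" unfolding d0 by simp
 qed
 have out: "\<phi> N r = 0" if "\<not> (s <= r & r < t)" for N r
 proof -
  have "\<not> (s + real i * d N <= r & r < s + real (Suc i) * d N)" if "i < Suc N" for i
  proof -
   have "real (Suc i) * d N <= real (Suc N) * d N" "0 <= real i * d N" using that d0(1) by (auto intro!: mult_right_mono simp del: of_nat_Suc)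
   then show ?thesis using \<open>\<not> (s <= r & r < t)\<close> d0(2)[of N] by linarith
  qed
  then show ?thesis unfolding \<phi>_def by (intro sum.neutral) (auto simp: indicator_def)
 qed
 \<comment> \<open>The half-open cells miss the end point \<open>t\<close>, which is added by hand
   for measurability and is negligible for the integral.\<close>
 have lim: "(%N. \<phi> N r + indicator {t} r * f r) \<longlonglongrightarrow> indicator {s..t} r * f r" for r
 proof (cases "s <= r & r < t")
  case True
  have g: "(%N. s + real (Suc (k N r)) * d N) \<longlonglongrightarrow> r"
  proof (rule tendsto_sandwich[of "%_. r" _ _ "%N. r + d N"])
   have "d \<longlonglongrightarrow> 0" unfolding d_def by (rule LIMSEQ_Suc[OF lim_const_over_n])
   then show "(%N. r + d N) \<longlonglongrightarrow> r" using tendsto_add[OF tendsto_const, of d 0 sequentially r] by simp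
  qed (use \<phi>[of r] True in "auto simp: less_imp_le simp del: of_nat_Suc")
  have "filterlim (%N. s + real (Suc (k N r)) * d N) (at_right r) sequentially"
   unfolding filterlim_at using \<phi>(2)[of r] True g by (auto simp: less_imp_neq[symmetric] simp del: of_nat_Suc)
  from filterlim_compose[OF rc this] show ?thesis using True \<phi>(1)[of r] by simp
 qed (use st out in "auto simp: indicator_def")
 have \<phi>m [measurable]: "\<phi> N : borel_measurable borel" for N unfolding \<phi>_def by measurable
 have it: "indicator {t} r * f r = indicator {t} r * f t" for r by (auto simp: indicator_def)
 have m: "(%r. indicator {s..t} r * f r) : borel_measurable borel"
  by (rule borel_measurable_LIMSEQ_real[OF lim]) (simp only: it, measurable)
 show "set_integrable lborel {s..t} f" by (rule set_integrable_bounded_Icc[OF m B])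
 have "(%N. integral\<^sup>L lborel (\<phi> N)) \<longlonglongrightarrow> (LBINT r:{s..t}. f r)"
  unfolding set_lebesgue_integral_def real_scaleR_def
 proof (rule integral_dominated_convergence[where w="%r. abs B * indicator {s..t} r"])
  have "AE r in lborel. r ~= t" by (rule AE_lborel_singleton)
  then show "AE r in lborel. (%N. \<phi> N r) \<longlonglongrightarrow> indicator {s..t} r * f r"
  proof eventually_elim
   case (elim r)
   then show ?case using lim[of r] by simp
  qed
  show "AE r in lborel. norm (\<phi> N r) <= abs B * indicator {s..t} r" for N
  proof (intro AE_I2)
   fix r
   show "norm (\<phi> N r) <= abs B * indicator {s..t} r"
   proof (cases "s <= r & r < t")
    case True
    then show ?thesis using \<phi>[of r N] B[of "s + real (Suc (k N r)) * d N"] by (simp del: of_nat_Suc)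
   qed (simp add: out)
  qed
 qed (use m in "auto simp: emeasure_lborel_Icc_eq intro!: integrable_real_indicator integrable_mult_right")
 moreover have "integral\<^sup>L lborel (\<phi> N) = (\<Sum>i<Suc N. d N * f (s + real (Suc i) * d N))" for N
 proof -
  have e: "emeasure lborel {s + real i * d N ..< s + real (Suc i) * d N} = ennreal (d N)" for i
   using d0(1)[of N] by (subst emeasure_lborel_Ico) (simp_all add: distrib_right)
  have "integrable lborel (%r. f (s + real (Suc i) * d N) * indicator {s + real i * d N ..< s + real (Suc i) * d N} r)" for i
   by (intro integrable_mult_right integrable_real_indicator) (simp_all add: e del: of_nat_Suc)
  then show ?thesis
   unfolding \<phi>_def using d0(1)[of N] by (subst Bochner_Integration.integral_sum) (auto simp: measure_def e simp del: of_nat_Suc sum.lessThan_Suc intro: sum.cong)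
 qed
 ultimately show "(%N. \<Sum>i<N. (t - s) / real N * f (s + real (Suc i) * ((t - s) / real N))) \<longlonglongrightarrow> (LBINT r:{s..t}. f r)"
  unfolding d_def by (subst filterlim_sequentially_Suc[symmetric]) simp
qed

context prob_space
begin

lemma second_moment_add:
 fixes Y Z :: "'a => real"
 assumes [measurable]: "Y : borel_measurable M" "Z : borel_measurable M"
  and i: "integrable M (%w. (Y w)^2)" "integrable M (%w. (Z w)^2)"
  and b: "(LINT w|M. (Y w)^2) <= b" "(LINT w|M. (Z w)^2) <= c" and V: "!!w. V w = Y w + Z w"
 shows "integrable M (%w. (V w)^2)" "(LINT w|M. (V w)^2) <= 2 * b + 2 * c"
proof -
 have i2: "integrable M (%w. 2 * (Y w)^2 + 2 * (Z w)^2)" using i by simp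
 have le: "(V w)^2 <= 2 * (Y w)^2 + 2 * (Z w)^2" for w
  using zero_le_power2[of "Y w - Z w"] by (simp add: V power2_sum power2_diff)
 show iV: "integrable M (%w. (V w)^2)"
  by (rule Bochner_Integration.integrable_bound[OF i2]) (use le in "auto simp: V")
 have "(LINT w|M. (V w)^2) <= (LINT w|M. 2 * (Y w)^2 + 2 * (Z w)^2)"
  by (rule integral_mono[OF iV i2 le])
 also have "... <= 2 * b + 2 * c" using i b by simp
 finally show "(LINT w|M. (V w)^2) <= 2 * b + 2 * c" .
qed

end

section \<open>Increments and Euler remainders of the solution\<close>

locale jump_sde = jump_process M F J X g L
 for M :: "'w measure" and F J X g L +
 fixes a0 :: "real => real" and La :: real
 assumes a0_lipschitz: "La-lipschitz_on UNIV a0"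
  and sde: "sde_solution M F J a0 g X"
begin

lemma a0_meas [measurable]: "a0 : borel_measurable borel"
 by (intro borel_measurable_continuous_onI lipschitz_on_continuous_on[OF a0_lipschitz])

lemma a0_diff_le: "abs (a0 x - a0 y) <= La * abs (x - y)"
 using lipschitz_onD[OF a0_lipschitz, of x y] by (simp add: dist_real_def)

lemma La_nonneg: "La >= 0"
 using a0_lipschitz by (simp add: lipschitz_on_def)

lemma a0X_moments: "moments_bounded M {0..} (%t w. a0 (X t w))"
proof (rule moments_bounded_mono[where K=1])
 show "moments_bounded M {0..} (%t w. abs (a0 0) + La * abs (X t w))"
  by (intro moments_bounded_add moments_bounded_mult moments_bounded_const moments_bounded_abs X_moments)
 show "abs (a0 (X t w)) <= 1 * abs (abs (a0 0) + La * abs (X t w))" for t w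
  using a0_diff_le[of "X t w" 0] by simp
qed measurable

lemma second_moment_bound:
 assumes "moments_bounded M {0..} Y"
 obtains C where "C >= 0" "!!t. 0 <= t ==> integrable M (%w. (Y t w)^2) & (LINT w|M. (Y t w)^2) <= C"
proof -
 obtain C where C: "!!t. 0 <= t ==> integrable M (%w. abs (Y t w) ^ 2) & (LINT w|M. abs (Y t w) ^ 2) <= C"
  using assms unfolding moments_bounded_def by (meson atLeast_iff)
 then show ?thesis by (intro that[of "max C 0"]) (auto simp: le_max_iff_disj)
qed

text \<open>The equation provides a stochastic integral for each time separately; choosing one for
  every time gives the martingale part as a process.\<close>

definition ito :: "real => 'w => real" where
 "ito t = (SOME I. has_ito_integral M F J t left_limit_integrand I &
   (AE w in M. X t w = X 0 w + (LBINT s:{0..t}. a0 (X s w)) + I w))"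

lemma ito:
 assumes "0 <= t"
 shows "has_ito_integral M F J t left_limit_integrand (ito t)"
  "AE w in M. X t w = X 0 w + (LBINT s:{0..t}. a0 (X s w)) + ito t w"
proof -
 have "left_limit_integrand = (%s w. g (Lim (at_left s) (%r. X r w)))"
  by (simp add: left_limit_integrand_def fun_eq_iff)
 then have "EX I. has_ito_integral M F J t left_limit_integrand I &
   (AE w in M. X t w = X 0 w + (LBINT s:{0..t}. a0 (X s w)) + I w)"
  using sde assms unfolding sde_solution_def by simp
 from someI_ex[OF this] show "has_ito_integral M F J t left_limit_integrand (ito t)"
  "AE w in M. X t w = X 0 w + (LBINT s:{0..t}. a0 (X s w)) + ito t w"
  unfolding ito_def by auto
qed

lemma ito_meas [measurable]: "0 <= t ==> ito t : borel_measurable M"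
 using ito_integral_riemann(1)[OF ito(1)] by simp

text \<open>No joint measurability in time and chance is involved: pathwise the drift integral is a
  limit of Riemann sums, their second moments are bounded by Cauchy-Schwarz over the
  \<open>N\<close> summands, and Fatou's lemma passes to the limit.\<close>

lemma drift_second_moment:
 assumes st: "0 <= s" "s <= t" and k [measurable]: "k : borel_measurable M"
  and b: "!!r. r : {s..t} ==> integrable M (%w. (a0 (X r w) - k w)^2) & (LINT w|M. (a0 (X r w) - k w)^2) <= b"
 defines "D \<equiv> %w. X t w - X s w - (ito t w - ito s w) - (t - s) * k w"
 shows "D : borel_measurable M" "integrable M (%w. (D w)^2)" "(LINT w|M. (D w)^2) <= (t - s)^2 * b"
proof -
 define x where "x N i = s + real (Suc i) * ((t - s) / real N)" for N i
 define y where "y N i w = a0 (X (x N i) w) - k w" for N i w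
 define R where "R N w = (\<Sum>i<N. (t - s) / real N * y N i w)" for N w
 have t: "0 <= t" using st by simp
 have x: "x N i : {s..t}" if "i < N" for N i
 proof -
  have "real (Suc i) / real N * (t - s) <= 1 * (t - s)" using that st by (intro mult_right_mono) auto
  then show ?thesis using st by (simp add: x_def mult.commute)
 qed
 have ym: "y N i : borel_measurable M" if "i < N" for N i
  unfolding y_def using x[OF that] st by (intro borel_measurable_diff k measurable_compose[OF _ a0_meas] X_meas) auto
 then have Rm: "R N : borel_measurable M" for N unfolding R_def by (intro borel_measurable_sum borel_measurable_times) auto
 show D: "D : borel_measurable M" unfolding D_def using st t by measurable
 have lim: "AE w in M. (%N. R N w) \<longlonglongrightarrow> D w"
  using ito(2)[OF st(1)] ito(2)[OF t] X_cadlag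
 proof eventually_elim
  case (elim w)
  let ?f = "%r. a0 (X r w)"
  obtain B where B: "ALL r:{0..t}. abs (X r w) <= B" using cadlag_bounded[OF elim(3)] by blast
  have bd: "abs (?f r) <= abs (a0 0) + La * B" if "0 <= r" "r <= t" for r
   using a0_diff_le[of "X r w" 0] mult_left_mono[of "abs (X r w)" B La] B that La_nonneg by fastforce
  have "isCont a0 z" for z using lipschitz_on_continuous_on[OF a0_lipschitz] by (simp add: continuous_on_eq_continuous_at)
  then have rc: "(?f \<longlongrightarrow> ?f r) (at_right r)" if "0 <= r" for r
   using elim(3) that by (intro isCont_tendsto_compose[of _ a0]) (auto simp: cadlag_def)
  have i: "set_integrable lborel {0..s} ?f" "set_integrable lborel {s..t} ?f"
   using st by (auto intro!: right_continuous_riemann_sums(1)[where B="abs (a0 0) + La * B"] rc bd)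
  have "(LBINT r:{0..s} \<union> {s..t}. ?f r) = (LBINT r:{0..s}. ?f r) + (LBINT r:{s..t}. ?f r)"
  proof (rule set_integral_Un_AE)
   have "AE r in lborel. r ~= s" by (rule AE_lborel_singleton)
   then show "AE r in lborel. \<not> (r : {0..s} & r : {s..t})" by eventually_elim auto
  qed (use i in auto)
  also have "{0..s} \<union> {s..t} = {0..t}" using st by auto
  finally have eq: "D w = (LBINT r:{s..t}. ?f r) - (t - s) * k w" using elim(1,2) by (simp add: D_def)
  have "(%N. (\<Sum>i<N. (t - s) / real N * ?f (x N i)) - (t - s) * k w) \<longlonglongrightarrow> D w"
   unfolding eq x_def using st by (intro tendsto_diff right_continuous_riemann_sums(2)[where B="abs (a0 0) + La * B"] rc bd) auto
  moreover have "\<forall>\<^sub>F N in sequentially. (\<Sum>i<N. (t - s) / real N * ?f (x N i)) - (t - s) * k w = R N w"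
   using eventually_gt_at_top[of 0] by eventually_elim (simp add: R_def y_def right_diff_distrib sum_subtractf)
  ultimately show ?case by (rule Lim_transform_eventually)
 qed
 have "\<forall>\<^sub>F N in sequentially. integrable M (%w. (R N w)^2) & (LINT w|M. (R N w)^2) <= (t - s)^2 * b"
  using eventually_gt_at_top[of 0]
 proof eventually_elim
  case (elim N)
  let ?d = "(t - s) / real N"
  have le: "(R N w)^2 <= ?d^2 * real N * (\<Sum>i<N. (y N i w)^2)" for w
   using mult_left_mono[OF sum_squared_le_sum_of_squares[of "%i. y N i w" "{..<N}"] zero_le_power2[of ?d]]
   unfolding R_def sum_distrib_left[symmetric] power_mult_distrib by (simp only: card_lessThan mult_ac)
  have i: "integrable M (%w. ?d^2 * real N * (\<Sum>i<N. (y N i w)^2))"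
   using b[OF x] by (intro integrable_mult_right Bochner_Integration.integrable_sum) (auto simp: y_def)
  have iR: "integrable M (%w. (R N w)^2)"
   by (rule Bochner_Integration.integrable_bound[OF i]) (use Rm le in "auto intro!: AE_I2 order_trans[OF _ abs_ge_self]")
  have "(LINT w|M. (R N w)^2) <= (LINT w|M. ?d^2 * real N * (\<Sum>i<N. (y N i w)^2))" by (rule integral_mono[OF iR i le])
  also have "... = ?d^2 * real N * (\<Sum>i<N. \<integral>w. (y N i w)^2 \<partial>M)"
   using b[OF x] by (subst Bochner_Integration.integral_mult_right_zero, subst Bochner_Integration.integral_sum) (auto simp: y_def)
  also have "... <= ?d^2 * real N * (\<Sum>i<N. b)" using b[OF x] by (intro mult_left_mono sum_mono) (auto simp: y_def)
  also have "... = (t - s)^2 * b" using elim by (simp add: power2_eq_square)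
  finally show ?case using iR by blast
 qed
 from fatou_square[OF Rm D lim this tendsto_const]
 show "integrable M (%w. (D w)^2)" "(LINT w|M. (D w)^2) <= (t - s)^2 * b" by blast+
qed

text \<open>One block with weight 1 and frozen coefficient 0 bounds the martingale part by the step
  length. The drift part is of squared order and is absorbed because the step is at most 1.\<close>

lemma X_increment_second_moment:
 "\<exists>C\<ge>0. ALL s t. 0 <= s --> s <= t --> t - s <= 1 --> (LINT w|M. (X t w - X s w)^2) <= C * (t - s)"
proof -
 obtain Ca where Ca: "Ca >= 0" "!!t. 0 <= t ==> integrable M (%w. (a0 (X t w))^2) & (LINT w|M. (a0 (X t w))^2) <= Ca"
  using second_moment_bound[OF a0X_moments] by blast
 obtain Cg where Cg: "Cg >= 0" "!!t. 0 <= t ==> integrable M (%w. (g (X t w))^2) & (LINT w|M. (g (X t w))^2) <= Cg"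
  using second_moment_bound[OF gX_moments] by blast
 have "(LINT w|M. (X t w - X s w)^2) <= (2 * Ca + 2 * Cg) * (t - s)" if st: "0 <= s" "s <= t" "t - s <= 1" for s t
 proof -
  have t: "0 <= t" using st by simp
  let ?\<tau> = "%j::nat. if j = 0 then s else t"
  have Z: "integrable M (%w. (\<Sum>j<1. 1 * (ito (?\<tau> (Suc j)) w - ito (?\<tau> j) w - 0 * (J (?\<tau> (Suc j)) w - J (?\<tau> j) w)))^2) &
   (LINT w|M. (\<Sum>j<1. 1 * (ito (?\<tau> (Suc j)) w - ito (?\<tau> j) w - 0 * (J (?\<tau> (Suc j)) w - J (?\<tau> j) w)))^2) <= Cg * (?\<tau> 1 - ?\<tau> 0) &
   (%w. \<Sum>j<1. 1 * (ito (?\<tau> (Suc j)) w - ito (?\<tau> j) w - 0 * (J (?\<tau> (Suc j)) w - J (?\<tau> j) w))) : borel_measurable M"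
  proof (rule ito_block_second_moment[where m="%_ _. 1" and wt="%_ _. 0" and \<tau>="?\<tau>" and n=1])
   show "\<forall>\<^sub>F N in sequentially. \<forall>j<1. ALL r. ?\<tau> j < r --> r <= ?\<tau> (Suc j) -->
     (LINT w|M. (1 * (g (X (left_grid N r) w) - 0))^2) <= Cg"
    using Cg(2) left_grid(3) st by (auto intro!: always_eventually)
  qed (use st t in "auto intro: ito all_moments_const")
  have Z': "integrable M (%w. (ito t w - ito s w)^2)" "(LINT w|M. (ito t w - ito s w)^2) <= Cg * (t - s)"
   using Z by simp_all
  have "integrable M (%w. (a0 (X r w) - 0)^2) & (LINT w|M. (a0 (X r w) - 0)^2) <= Ca" if "r : {s..t}" for r
   using Ca(2)[of r] st that by simp
  note D = drift_second_moment(1-3)[OF st(1,2) borel_measurable_const[of 0] this]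
  have "(LINT w|M. (X t w - X s w)^2) <= 2 * ((t - s)^2 * Ca) + 2 * (Cg * (t - s))"
   by (rule second_moment_add(2)[OF D(1) _ D(2) Z'(1) D(3) Z'(2)]) (use st t in auto)
  also have "(t - s)^2 * Ca <= (t - s) * Ca"
   using st Ca(1) by (intro mult_right_mono) (auto simp: power2_eq_square mult_left_le_one_le)
  finally show ?thesis by (simp add: algebra_simps)
 qed
 then show ?thesis using Ca(1) Cg(1) by (intro exI[of _ "2 * Ca + 2 * Cg"]) auto
qed

lemma X_shift_second_moment:
 "\<exists>C\<ge>0. ALL s t. 0 <= s --> 0 <= t --> abs (t - s) <= 1 --> (LINT w|M. (X t w - X s w)^2) <= C * abs (t - s)"
proof -
 obtain C where C: "C >= 0" "!!s t. 0 <= s ==> s <= t ==> t - s <= 1 ==> (LINT w|M. (X t w - X s w)^2) <= C * (t - s)"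
  using X_increment_second_moment by blast
 have "(LINT w|M. (X t w - X s w)^2) <= C * abs (t - s)" if "0 <= s" "0 <= t" "abs (t - s) <= 1" for s t
  using C(2)[of s t] C(2)[of t s] that by (cases "s <= t") (auto simp: power2_commute)
 then show ?thesis using C(1) by blast
qed

lemma X_diff_integrable: "0 <= s ==> 0 <= t ==> integrable M (%w. (X t w - X s w)^2)"
 using moments_bounded_all_moments[OF X_moments]
 by (intro all_moments_integrable all_moments_intros) auto

lemma lipschitz_X_second_moment:
 assumes f [measurable]: "f : borel_measurable borel" and l: "!!x y. abs (f x - f y) <= l * abs (x - y)"
  and st: "0 <= s" "0 <= t" and b: "(LINT w|M. (X t w - X s w)^2) <= b"
 shows "integrable M (%w. (f (X t w) - f (X s w))^2)" "(LINT w|M. (f (X t w) - f (X s w))^2) <= l^2 * b"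
proof -
 have le: "(f x - f y)^2 <= l^2 * (x - y)^2" for x y
 proof -
  have "(abs (f x - f y))^2 <= (l * abs (x - y))^2" by (intro power_mono l) auto
  then show ?thesis by (simp add: power_mult_distrib)
 qed
 have i: "integrable M (%w. l^2 * (X t w - X s w)^2)" using X_diff_integrable[OF st] by simp
 have [measurable]: "X t : borel_measurable M" "X s : borel_measurable M" using st by auto
 show i2: "integrable M (%w. (f (X t w) - f (X s w))^2)"
  by (rule Bochner_Integration.integrable_bound[OF i]) (use le in "auto intro!: AE_I2")
 have "(LINT w|M. (f (X t w) - f (X s w))^2) <= (LINT w|M. l^2 * (X t w - X s w)^2)"
  by (intro integral_mono i i2 le)
 also have "... <= l^2 * b" using b by (simp add: mult_left_mono)
 finally show "(LINT w|M. (f (X t w) - f (X s w))^2) <= l^2 * b" .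
qed

definition euler_drift_error :: "real => real => 'w => real" where
 "euler_drift_error s t w = X t w - X s w - (ito t w - ito s w) - (t - s) * a0 (X s w)"

text \<open>Two of the three powers come from the length of the time interval, squared by
  Cauchy-Schwarz, and the third from the increments of \<open>X\<close> through the Lipschitz
  drift.\<close>

lemma euler_drift_error:
 "\<exists>C\<ge>0. ALL s t. 0 <= s --> s <= t --> t - s <= 1 --> euler_drift_error s t : borel_measurable M &
   integrable M (%w. (euler_drift_error s t w)^2) & (LINT w|M. (euler_drift_error s t w)^2) <= C * (t - s) ^ 3"
proof -
 obtain C where C: "C >= 0" "!!s t. 0 <= s ==> s <= t ==> t - s <= 1 ==> (LINT w|M. (X t w - X s w)^2) <= C * (t - s)"
  using X_increment_second_moment by blast
 have "euler_drift_error s t : borel_measurable M &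
   integrable M (%w. (euler_drift_error s t w)^2) & (LINT w|M. (euler_drift_error s t w)^2) <= (La^2 * C) * (t - s) ^ 3"
  if st: "0 <= s" "s <= t" "t - s <= 1" for s t
 proof -
  have b: "integrable M (%w. (a0 (X r w) - a0 (X s w))^2) & (LINT w|M. (a0 (X r w) - a0 (X s w))^2) <= La^2 * (C * (t - s))"
   if r: "r : {s..t}" for r
  proof -
   have "C * (r - s) <= C * (t - s)" using r C(1) by (intro mult_left_mono) auto
   then have "(LINT w|M. (X r w - X s w)^2) <= C * (t - s)" using C(2)[of s r] r st by simp
   then show ?thesis using lipschitz_X_second_moment[OF a0_meas a0_diff_le, of s r] r st by auto
  qed
  have k: "(%w. a0 (X s w)) : borel_measurable M" using st by measurable
  have eq: "(t - s)^2 * (La^2 * (C * (t - s))) = (La^2 * C) * (t - s) ^ 3"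
   by (simp add: power2_eq_square power3_eq_cube mult_ac)
  show ?thesis using drift_second_moment[OF st(1,2) k b, unfolded eq] by (simp add: euler_drift_error_def[abs_def])
 qed
 then show ?thesis using C(1) by (intro exI[of _ "La^2 * C"]) auto
qed

definition euler_residual :: "real => real => 'w => real" where
 "euler_residual s t w = X t w - X s w - (t - s) * a0 (X s w) - g (X s w) * (J t w - J s w)"

text \<open>The martingale part determines the order: the Lipschitz difference
  \<open>g (X r) - g (X s)\<close> has second moment of order \<open>t - s\<close>, and the isometry
  contributes the other factor.\<close>

lemma euler_residual_second_moment:
 "\<exists>C\<ge>0. ALL s t. 0 <= s --> s < t --> t - s <= 1 -->
   integrable M (%w. (euler_residual s t w)^2) & (LINT w|M. (euler_residual s t w)^2) <= C * (t - s)^2"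
proof -
 obtain C where C: "C >= 0" "!!s t. 0 <= s ==> 0 <= t ==> abs (t - s) <= 1 ==> (LINT w|M. (X t w - X s w)^2) <= C * abs (t - s)"
  using X_shift_second_moment by blast
 obtain D where D: "D >= 0" "!!s t. 0 <= s ==> s <= t ==> t - s <= 1 ==> euler_drift_error s t : borel_measurable M &
   integrable M (%w. (euler_drift_error s t w)^2) & (LINT w|M. (euler_drift_error s t w)^2) <= D * (t - s) ^ 3"
  using euler_drift_error by blast
 have "integrable M (%w. (euler_residual s t w)^2) & (LINT w|M. (euler_residual s t w)^2) <= (2 * D + 2 * (L^2 * C)) * (t - s)^2"
  if st: "0 <= s" "s < t" "t - s <= 1" for s t
 proof -
  have t: "0 <= t" using st by simp
  let ?\<tau> = "%j::nat. if j = 0 then s else t"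
  let ?wt = "%w. g (X s w)"
  have Z: "integrable M (%w. (\<Sum>j<1. 1 * (ito (?\<tau> (Suc j)) w - ito (?\<tau> j) w - ?wt w * (J (?\<tau> (Suc j)) w - J (?\<tau> j) w)))^2) &
   (LINT w|M. (\<Sum>j<1. 1 * (ito (?\<tau> (Suc j)) w - ito (?\<tau> j) w - ?wt w * (J (?\<tau> (Suc j)) w - J (?\<tau> j) w)))^2) <= (L^2 * (C * (t - s))) * (?\<tau> 1 - ?\<tau> 0) &
   (%w. \<Sum>j<1. 1 * (ito (?\<tau> (Suc j)) w - ito (?\<tau> j) w - ?wt w * (J (?\<tau> (Suc j)) w - J (?\<tau> j) w))) : borel_measurable M"
  proof (rule ito_block_second_moment[where m="%_ _. 1" and wt="%_. ?wt" and \<tau>="?\<tau>" and n=1])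
   \<comment> \<open>A grid point to the left of \<open>r\<close> can precede \<open>s\<close>, but
     by at most \<open>(1/2) ^ N\<close>. For large \<open>N\<close> it stays within distance
     \<open>t - s\<close> of \<open>s\<close>, and the increment bound is applied in its symmetric
     form.\<close>
   have "(%N. (1/2 :: real) ^ N) \<longlonglongrightarrow> 0" by (intro LIMSEQ_power_zero) simp
   then have "\<forall>\<^sub>F N in sequentially. (1/2 :: real) ^ N < t - s" using st by (intro order_tendstoD(2)) auto
   then show "\<forall>\<^sub>F N in sequentially. \<forall>j<1. ALL r. ?\<tau> j < r --> r <= ?\<tau> (Suc j) -->
     (LINT w|M. (1 * (g (X (left_grid N r) w) - ?wt w))^2) <= L^2 * (C * (t - s))"
   proof eventually_elim
    case (elim N)
    have "(LINT w|M. (g (X (left_grid N r) w) - g (X s w))^2) <= L^2 * (C * (t - s))" if r: "s < r" "r <= t" for r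
    proof (rule lipschitz_X_second_moment(2)[OF g_meas g_diff_le])
     have r0: "0 < r" using r st by simp
     have lg: "abs (left_grid N r - s) <= t - s" using left_grid[OF r0, of N] r elim by auto
     have "(LINT w|M. (X (left_grid N r) w - X s w)^2) <= C * abs (left_grid N r - s)"
      using left_grid[OF r0] lg st by (intro C(2)) auto
     also have "... <= C * (t - s)" using lg C(1) by (intro mult_left_mono) auto
     finally show "(LINT w|M. (X (left_grid N r) w - X s w)^2) <= C * (t - s)" .
    qed (use left_grid(3) r st in auto)
    then show ?case by simp
   qed
  qed (use st t in "auto intro: ito all_moments_const gX_F gX_all_moments")
  have Z': "integrable M (%w. (ito t w - ito s w - g (X s w) * (J t w - J s w))^2)"
   "(LINT w|M. (ito t w - ito s w - g (X s w) * (J t w - J s w))^2) <= (L^2 * C) * (t - s)^2"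
   using Z by (simp_all add: power2_eq_square mult_ac)
  have E: "euler_drift_error s t : borel_measurable M" "integrable M (%w. (euler_drift_error s t w)^2)"
   "(LINT w|M. (euler_drift_error s t w)^2) <= D * (t - s)^2"
  proof -
   have "(t - s) ^ 3 <= (t - s)^2" using st by (intro power_decreasing) auto
   then have "D * (t - s) ^ 3 <= D * (t - s)^2" using D(1) by (rule mult_left_mono)
   then show "euler_drift_error s t : borel_measurable M" "integrable M (%w. (euler_drift_error s t w)^2)"
    "(LINT w|M. (euler_drift_error s t w)^2) <= D * (t - s)^2" using D(2)[of s t] st by auto
  qed
  have m: "(%w. ito t w - ito s w - g (X s w) * (J t w - J s w)) : borel_measurable M" using st t by measurable
  have eq: "euler_residual s t w = euler_drift_error s t w + (ito t w - ito s w - g (X s w) * (J t w - J s w))" for w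
   by (simp add: euler_residual_def euler_drift_error_def)
  show ?thesis
   using second_moment_add[OF E(1) m E(2) Z'(1) E(3) Z'(2) eq] by (simp add: algebra_simps)
 qed
 then show ?thesis using C(1) D(1) by (intro exI[of _ "2 * D + 2 * (L^2 * C)"]) auto
qed

text \<open>No conditional centring of the martingale part is needed: the isometry is applied to the whole
 weighted sum, which is itself a stochastic integral.\<close>

lemma weighted_increment_sum:
 fixes f :: "real => real"
 assumes f [measurable]: "f : borel_measurable borel" and fX: "moments_bounded M {0..} (%t w. f (X t w))"
 shows "\<exists>C\<ge>0. ALL n h. 0 < n --> 0 < h --> h <= 1 -->
   integrable M (%w. \<Sum>j<n. f (X (real j * h) w) * (X (real (Suc j) * h) w - X (real j * h) w - h * a0 (X (real j * h) w))) &
   (LINT w|M. abs (\<Sum>j<n. f (X (real j * h) w) * (X (real (Suc j) * h) w - X (real j * h) w - h * a0 (X (real j * h) w))))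
    <= C * (sqrt (real n * h) + real n * (h * sqrt h))"
proof -
 let ?t = "%(j :: nat) h :: real. real j * h"
 have tj: "0 <= ?t j h" "?t j h <= ?t (Suc j) h" "?t (Suc j) h - ?t j h = h" if "0 < h" for j h using that by (auto simp: algebra_simps)
 obtain D where D: "D >= 0" "!!s t. 0 <= s ==> s <= t ==> t - s <= 1 ==> euler_drift_error s t : borel_measurable M &
   integrable M (%w. (euler_drift_error s t w)^2) & (LINT w|M. (euler_drift_error s t w)^2) <= D * (t - s) ^ 3"
  using euler_drift_error by blast
 obtain Cf where Cf: "Cf >= 0" "!!t. 0 <= t ==> integrable M (%w. (f (X t w))^2) & (LINT w|M. (f (X t w))^2) <= Cf"
  using second_moment_bound[OF fX] by blast
 obtain Cf4 where Cf4: "Cf4 >= 0" "!!t. 0 <= t ==> integrable M (%w. ((f (X t w))^2)^2) & (LINT w|M. ((f (X t w))^2)^2) <= Cf4"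
  using second_moment_bound[OF moments_bounded_power[OF fX, of 2]] by blast
 obtain Cg4 where Cg4: "Cg4 >= 0" "!!t. 0 <= t ==> integrable M (%w. ((g (X t w))^2)^2) & (LINT w|M. ((g (X t w))^2)^2) <= Cg4"
  using second_moment_bound[OF moments_bounded_power[OF gX_moments, of 2]] by blast
 have fa: "all_moments M (%w. f (X t w))" if "0 <= t" for t
  by (rule moments_bounded_all_moments[OF fX]) (use that in simp)
 have ab: "(LINT w|M. (f (X t w) * (g (X u w) - 0))^2) <= Cf4 + Cg4" if "0 <= t" "0 <= u" for t u
 proof -
  have le: "(x * y :: real)^2 <= (x^2)^2 + (y^2)^2" for x y
   using sum_squares_bound[of "x^2" "y^2"] mult_nonneg_nonneg[OF zero_le_power2[of x] zero_le_power2[of y]] unfolding power_mult_distrib by linarith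
  have "(LINT w|M. (f (X t w) * (g (X u w) - 0))^2) <= (LINT w|M. ((f (X t w))^2)^2 + ((g (X u w))^2)^2)"
   by (intro integral_mono all_moments_integrable all_moments_intros fa gX_all_moments that) (simp only: diff_0_right le)
  then show ?thesis using Cf4(2)[OF that(1)] Cg4(2)[OF that(2)] by simp
 qed
 let ?E = "%j h. euler_drift_error (?t j h) (?t (Suc j) h)"
 have E: "?E j h : borel_measurable M" "integrable M (%w. (?E j h w)^2)" "(LINT w|M. (?E j h w)^2) <= D * (h * sqrt h)^2" if "0 < h" "h <= 1" for j h
  using D(2)[OF tj(1,2)[OF that(1)], of j] that unfolding tj(3)[OF that(1)]
  by (auto simp: power_mult_distrib power3_eq_cube power2_eq_square[of h])
 let ?fE = "%j h w. f (X (?t j h) w) * ?E j h w"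
 \<comment> \<open>The drift errors are summed by the triangle inequality, \<open>n\<close> terms of
   mean order \<open>h sqrt h\<close>. The martingale parts are kept together, with second moment of
   order \<open>n h\<close>.\<close>
 have "mean_order M {i. 0 < snd i & snd i <= 1} (%i. 1 * (snd i * sqrt (snd i))) (%i. ?fE (fst i) (snd i))"
 proof (rule mean_order_mult)
  show "mean_order M {i. 0 < snd i & snd i <= 1} (%i. 1^2) (%i w. (f (X (?t (fst i) (snd i)) w))^2)"
   unfolding mean_order_def using Cf(2)[OF tj(1)] by (intro exI[of _ Cf]) simp
  show "mean_order M {i. 0 < snd i & snd i <= 1} (%i. (snd i * sqrt (snd i))^2) (%i w. (?E (fst i) (snd i) w)^2)"
   unfolding mean_order_def using E(2,3) by (intro exI[of _ D]) simp
 qed (use fa[THEN all_moments_meas] tj(1) E(1) in auto)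
 then obtain A where A: "!!j h. 0 < h ==> h <= 1 ==> integrable M (?fE j h) & (LINT w|M. abs (?fE j h w)) <= A * (h * sqrt h)"
  unfolding mean_order_def by auto
 let ?Z = "%n h w. \<Sum>j<n. f (X (?t j h) w) * (ito (?t (Suc j) h) w - ito (?t j h) w - 0 * (J (?t (Suc j) h) w - J (?t j h) w))"
 have Z: "integrable M (%w. (?Z n h w)^2) & (LINT w|M. (?Z n h w)^2) <= (Cf4 + Cg4) * (?t n h - ?t 0 h) & ?Z n h : borel_measurable M" if h: "0 < h" for n h
 proof (rule ito_block_second_moment[where m="%j w. f (X (?t j h) w)" and wt="%_ _. 0" and \<tau>="%j. ?t j h"])
  show "\<forall>\<^sub>F N in sequentially. \<forall>j<n. ALL r. ?t j h < r --> r <= ?t (Suc j) h -->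
    (LINT w|M. (f (X (?t j h) w) * (g (X (left_grid N r) w) - 0))^2) <= Cf4 + Cg4"
   using ab[OF tj(1)[OF h]] left_grid(3) order_le_less_trans[OF tj(1)[OF h]] by (intro always_eventually allI impI) blast
  show "(%w. f (X (?t j h) w)) : borel_measurable (F (?t j h))" for j
   using X_F[OF tj(1)[OF h]] by (rule measurable_compose[OF _ f])
 qed (use tj[OF h] ito(1) fa all_moments_const in auto)
 have "mean_order M {i. 0 < fst i & 0 < snd i} (%i. 1 * sqrt (real (fst i) * snd i)) (%i w. 1 * ?Z (fst i) (snd i) w)"
 proof (rule mean_order_mult)
  show "mean_order M {i. 0 < fst i & 0 < snd i} (%i. 1^2) (%i w. 1^2)"
   unfolding mean_order_def by (intro exI[of _ 1]) (simp add: prob_space)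
  show "mean_order M {i. 0 < fst i & 0 < snd i} (%i. (sqrt (real (fst i) * snd i))^2) (%i w. (?Z (fst i) (snd i) w)^2)"
   unfolding mean_order_def using Z by (intro exI[of _ "Cf4 + Cg4"]) auto
 qed (use Z in auto)
 then obtain B where B: "!!n h. 0 < n ==> 0 < h ==> integrable M (?Z n h) & (LINT w|M. abs (?Z n h w)) <= B * sqrt (real n * h)"
  unfolding mean_order_def by auto
 let ?V = "%n h w. \<Sum>j<n. f (X (?t j h) w) * (X (?t (Suc j) h) w - X (?t j h) w - h * a0 (X (?t j h) w))"
 have "integrable M (?V n h) & (LINT w|M. abs (?V n h w)) <= max 0 (max A B) * (sqrt (real n * h) + real n * (h * sqrt h))" if n: "0 < n" "0 < h" "h <= 1" for n h
 proof -
  let ?S = "%w. \<Sum>j<n. ?fE j h w"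
  have V: "?V n h w = ?S w + ?Z n h w" for w
   unfolding sum.distrib[symmetric] euler_drift_error_def tj(3)[OF n(2)] by (simp add: algebra_simps)
  note fE = A[OF n(2,3)] and ZB = B[OF n(1,2)]
  have i: "integrable M (%w. (\<Sum>j<n. abs (?fE j h w)) + abs (?Z n h w))"
   by (rule Bochner_Integration.integrable_add[OF Bochner_Integration.integrable_sum[OF integrable_abs[OF conjunct1[OF fE]]] integrable_abs[OF conjunct1[OF ZB]]])
  have iV: "integrable M (?V n h)" unfolding V
   by (rule Bochner_Integration.integrable_add[OF Bochner_Integration.integrable_sum[OF conjunct1[OF fE]] conjunct1[OF ZB]])
  have "(LINT w|M. abs (?V n h w)) <= (LINT w|M. (\<Sum>j<n. abs (?fE j h w)) + abs (?Z n h w))"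
   by (intro integral_mono integrable_abs iV i) (unfold V, intro order_trans[OF abs_triangle_ineq] add_right_mono sum_abs)
  also have "... = (\<Sum>j<n. \<integral>w. abs (?fE j h w) \<partial>M) + (LINT w|M. abs (?Z n h w))"
   unfolding Bochner_Integration.integral_add[OF Bochner_Integration.integrable_sum[OF integrable_abs[OF conjunct1[OF fE]]] integrable_abs[OF conjunct1[OF ZB]]]
    Bochner_Integration.integral_sum[OF integrable_abs[OF conjunct1[OF fE]]] ..
  also have "... <= (\<Sum>j<n. max 0 (max A B) * (h * sqrt h)) + max 0 (max A B) * sqrt (real n * h)"
   using n by (intro add_mono sum_mono order_trans[OF conjunct2[OF fE]] order_trans[OF conjunct2[OF ZB]] mult_right_mono) auto
  finally show ?thesis using iV by (simp add: distrib_left mult.left_commute)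
 qed
 then show ?thesis by (intro exI[of _ "max 0 (max A B)"]) auto
qed

end

section \<open>Empirical means along the observations\<close>

text \<open>The weight \<open>1 + |y|\<close> is at least 1, so exponents may be raised freely. The
  constant \<open>A\<close> stays explicit because all later bounds have to be linear or quadratic
  in it, uniformly over functions.\<close>

definition poly_le :: "nat => real => (real => real) => bool" where
 "poly_le N A u \<longleftrightarrow> u : borel_measurable borel & (ALL y. abs (u y) <= A * (1 + abs y) ^ N)"

lemma poly_le_nonneg: "poly_le N A u ==> A >= 0"
 unfolding poly_le_def by (drule conjunct2, drule spec[of _ 0]) (simp add: order_trans[OF abs_ge_zero])

lemma one_plus_power_le:
 fixes x :: real
 assumes "N <= q"
 shows "(1 + abs x) ^ N <= 2 ^ q * (1 + abs x ^ q)"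
proof -
 have "(1 + abs x) ^ N <= (1 + abs x) ^ q" using assms by (intro power_increasing) auto
 also have "... <= (2 * max 1 (abs x)) ^ q" by (intro power_mono) auto
 also have "... <= 2 ^ q * (1 + abs x ^ q)" by (auto simp: power_mult_distrib max_def)
 finally show ?thesis .
qed

lemma (in prob_space) stability_moments:
 assumes st: "cond_stability M X P \<pi>0" and meas: "!!t. 0 <= t ==> X t : borel_measurable M"
 shows "moments_bounded M {0..} X"
 unfolding moments_bounded_def
proof (intro conjI ballI allI)
 fix q :: nat
 show "EX C. ALL t:{0..}. integrable M (%w. abs (X t w) ^ q) & (LINT w|M. abs (X t w) ^ q) <= C"
 proof (cases "q = 0")
  case True
  then show ?thesis by (intro exI[of _ 1]) (simp add: prob_space)
 next
  case False
  define B where "B = (SUP t\<in>{0..}. \<integral>\<^sup>+w. ennreal (abs (X t w) powr real q) \<partial>M)"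
  have "B < \<infinity>" using st False unfolding cond_stability_def B_def by simp
  then obtain C where C: "C >= 0" "B = ennreal C" by (cases B) auto
  have eq: "abs x powr real q = abs x ^ q" for x :: real
   using False by (cases "x = 0") (auto simp: powr_realpow)
  have "integrable M (%w. abs (X t w) ^ q) & (LINT w|M. abs (X t w) ^ q) <= C" if t: "0 <= t" for t
  proof -
   have le: "(\<integral>\<^sup>+w. ennreal (abs (X t w) ^ q) \<partial>M) <= ennreal C"
    using t unfolding C(2)[symmetric] B_def eq by (intro SUP_upper) auto
   have i: "integrable M (%w. abs (X t w) ^ q)"
   proof (rule integrableI_nonneg)
    show "(\<integral>\<^sup>+w. ennreal (abs (X t w) ^ q) \<partial>M) < \<infinity>" using le by (rule le_less_trans) simp
   qed (use meas[OF t] in auto)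
   have "(\<integral>\<^sup>+w. ennreal (abs (X t w) ^ q) \<partial>M) = ennreal (LINT w|M. abs (X t w) ^ q)"
    by (rule nn_integral_eq_integral[OF i]) simp
   then show ?thesis using le C(1) i by (simp add: ennreal_le_iff)
  qed
  then show ?thesis by auto
 qed
qed (use meas in auto)

section \<open>Transition kernel, decay of covariances and ergodic averages\<close>

locale ergodic_sde = jump_sde M F J X g L a0 La
 for M :: "'w measure" and F J X g L a0 La +
 fixes P :: "real => real => real measure" and \<pi>0 :: "real measure"
 assumes trans: "is_transition_probability M F X P" and stab: "cond_stability M X P \<pi>0"
begin

lemma \<pi>0: "prob_space \<pi>0" "sets \<pi>0 = sets borel"
 using stab by (auto simp: cond_stability_def)

lemma \<pi>0_borel [measurable_cong]: "sets \<pi>0 = sets borel" by (rule \<pi>0)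

lemma P_kernel: "0 <= t ==> P t : borel \<rightarrow>\<^sub>M prob_algebra borel"
 using trans by (simp add: is_transition_probability_def)

lemma P_sets: "0 <= t ==> sets (P t x) = sets borel"
 and P_prob: "0 <= t ==> prob_space (P t x)"
 using measurable_space[OF P_kernel, of t x] by (auto simp: space_prob_algebra)

lemma integrable_poly_bound:
 assumes "sets N = sets borel" "integrable N (%y. 1 + abs y ^ q)" "f : borel_measurable borel" "!!y. abs (f y) <= A * (1 + abs y ^ q)"
 shows "integrable N (f :: real => real)"
proof (rule Bochner_Integration.integrable_bound)
 show "integrable N (%y. A * (1 + abs y ^ q))" using assms(2) by simp
 show "f : borel_measurable N" using assms(1,3) by (simp cong: measurable_cong_sets)
 show "AE y in N. norm (f y) <= norm (A * (1 + abs y ^ q))"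
  unfolding real_norm_def by (intro AE_I2 order_trans[OF assms(4) abs_ge_self])
qed

text \<open>The weighted distance tests functions bounded by \<open>1 + |y|^q\<close>; dividing
  \<open>f\<close> by a multiple of \<open>A\<close> makes it admissible and gives a bound linear in
  \<open>A\<close>. The exponent is \<open>q = N + 1\<close> because stability is stated for
  positive exponents, and \<open>N\<close> may be 0.\<close>

lemma decay:
 obtains \<kappa> K where "\<kappa> > 0" "K > 0" "!!t x f A. 0 <= t ==> poly_le N A f ==> integrable (P t x) f"
  "!!f A. poly_le N A f ==> integrable \<pi>0 f"
  "!!t x f A. 0 <= t ==> poly_le N A f ==>
    abs ((LINT y|P t x. f y) - (LINT y|\<pi>0. f y)) <= A * (K * exp (- \<kappa> * t) * (1 + abs x) ^ Suc N)"
proof -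
 define q where "q = Suc N"
 let ?g = "%y :: real. 1 + abs y ^ q"
 have eq: "(%y. 1 + abs y powr real q) = ?g"
 proof
  fix y :: real show "1 + abs y powr real q = ?g y"
   using powr_realpow[of "abs y" q] by (cases "y = 0") (simp_all add: q_def del: of_nat_Suc power_Suc)
 qed
 have "real q > 0" by (simp add: q_def)
 then obtain \<kappa> K where \<kappa>: "\<kappa> > 0" "K > 0" and
  S: "!!x. (SUP t\<in>{0..}. ennreal (exp (\<kappa> * t)) * weighted_dist (%y. 1 + abs y powr real q) (P t x) \<pi>0)
     <= ennreal (K * (1 + abs x powr real q))"
  using stab unfolding cond_stability_def by meson
 have le: "ennreal (exp (\<kappa> * t)) * weighted_dist ?g (P t x) \<pi>0 <= ennreal (K * ?g x)" if "0 <= t" for t x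
  using that S[of x] unfolding eq fun_cong[OF eq, of x] by (intro order_trans[OF SUP_upper[of t]]) simp_all
 \<comment> \<open>\<open>weighted_dist\<close> is infinite unless both measures integrate the
   weight, so the finite stability bound yields integrability.\<close>
 have fin: "integrable (P t x) ?g & integrable \<pi>0 ?g" if "0 <= t" for t x
 proof (rule ccontr)
  assume "\<not> ?thesis"
  then have "weighted_dist ?g (P t x) \<pi>0 = \<infinity>" unfolding weighted_dist_def by (simp only: if_False)
  then show False using le[OF that, of x] by (simp add: ennreal_mult_top top_unique)
 qed
 have scale: "abs (f y) <= (A * 2 ^ q) * ?g y" if "poly_le N A f" for A f y
  using order_trans[OF that[unfolded poly_le_def, THEN conjunct2, rule_format] mult_left_mono[OF one_plus_power_le[of N q y] poly_le_nonneg[OF that]]]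
  by (simp add: q_def mult.assoc del: power_Suc)
 have bound: "abs ((LINT y|P t x. f y) - (LINT y|\<pi>0. f y)) <= A * ((2 * 2 ^ q * K) * exp (- \<kappa> * t) * (1 + abs x) ^ q)"
  if t: "0 <= t" and f: "poly_le N A f" for t x f A
 proof (cases "A = 0")
  case True
  then have "f = (%y. 0)" using f by (auto simp: poly_le_def fun_eq_iff)
  then show ?thesis using True by simp
 next
  case False
  define B where "B = A * 2 ^ q"
  have B: "B > 0" using False poly_le_nonneg[OF f] by (simp add: B_def)
  let ?d = "abs ((LINT y|P t x. f y / B) - (LINT y|\<pi>0. f y / B))"
  have "ennreal ?d <= weighted_dist ?g (P t x) \<pi>0"
   unfolding weighted_dist_def using fin[OF t] f scale[OF f] B
   by (auto intro!: SUP_upper2[of "%y. f y / B"] simp: poly_le_def divide_le_eq mult.commute simp flip: B_def)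
  then have "ennreal (exp (\<kappa> * t)) * ennreal ?d <= ennreal (K * ?g x)"
   using le[OF t, of x] by (meson mult_left_mono order_trans zero_le)
  then have "exp (\<kappa> * t) * ?d <= K * ?g x" using \<kappa> by (simp add: ennreal_le_iff flip: ennreal_mult)
  then have "exp (- \<kappa> * t) * (exp (\<kappa> * t) * ?d) <= exp (- \<kappa> * t) * (K * ?g x)" by (rule mult_left_mono) simp
  also have "exp (- \<kappa> * t) * (exp (\<kappa> * t) * ?d) = abs ((LINT y|P t x. f y) - (LINT y|\<pi>0. f y)) / B"
   using B by (simp flip: mult.assoc exp_add diff_divide_distrib)
  also have "exp (- \<kappa> * t) * (K * ?g x) <= exp (- \<kappa> * t) * (K * (2 * (1 + abs x) ^ q))"
  proof -
   have "1 <= (1 + abs x) ^ q" "abs x ^ q <= (1 + abs x) ^ q" by (auto intro: power_mono)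
   then have "?g x <= 2 * (1 + abs x) ^ q" by linarith
   then show ?thesis using \<kappa>(2) by (intro mult_left_mono) auto
  qed
  finally show ?thesis using B by (simp add: divide_le_eq B_def mult_ac)
 qed
 have int: "integrable (P t x) f" "integrable \<pi>0 f" if "0 <= t" "poly_le N A f" for t x f A
 proof -
  have fm: "f : borel_measurable borel" using that(2) by (simp add: poly_le_def)
  note b = integrable_poly_bound[OF _ _ fm scale[OF that(2)]]
  show "integrable (P t x) f" "integrable \<pi>0 f" using b[OF P_sets] b[OF \<pi>0(2)] fin that(1) by blast+
 qed
 show ?thesis
 proof (rule that[of \<kappa> "2 * 2 ^ q * K"], fold q_def)
  show "abs ((LINT y|P t x. f y) - (LINT y|\<pi>0. f y)) <= A * (2 * 2 ^ q * K * exp (- \<kappa> * t) * (1 + abs x) ^ q)" if "0 <= t" "poly_le N A f" for t x f A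
   using that by (rule bound)
 qed (use \<kappa> int int(2)[OF order_refl] in auto)
qed

lemma poly_\<pi>0_integrable: "poly_le N A f ==> integrable \<pi>0 f"
 by (rule decay) blast

lemma stationary_mean_bound:
 assumes f: "poly_le N A f"
 shows "abs (LINT y|\<pi>0. f y) <= A * (LINT y|\<pi>0. (1 + abs y) ^ N)"
proof -
 have i: "integrable \<pi>0 (%y. (1 + abs y) ^ N)" by (rule poly_\<pi>0_integrable[of N 1]) (simp add: poly_le_def)
 have "abs (LINT y|\<pi>0. f y) <= (LINT y|\<pi>0. abs (f y))" by (rule integral_abs_bound)
 also have "... <= (LINT y|\<pi>0. A * (1 + abs y) ^ N)"
  using f i poly_\<pi>0_integrable[OF f] by (intro integral_mono integrable_abs integrable_mult_right) (simp_all add: poly_le_def)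
 finally show ?thesis by simp
qed

lemma poly_X_moments:
 assumes "poly_le N A f"
 shows "moments_bounded M {0..} (%t w. f (X t w))"
proof (rule moments_bounded_mono[where K=A])
 have [measurable]: "f : borel_measurable borel" using assms by (simp add: poly_le_def)
 show "moments_bounded M {0..} (%t w. (1 + abs (X t w)) ^ N)"
  by (intro moments_bounded_power moments_bounded_add moments_bounded_const moments_bounded_abs X_moments)
 show "abs (f (X t w)) <= A * abs ((1 + abs (X t w)) ^ N)" for t w using assms by (simp add: poly_le_def)
 show "(%w. f (X t w)) : borel_measurable M" if "t : {0..}" for t using X_meas[of t] that by simp
qed

lemma all_moments_poly_X: "poly_le N A f ==> 0 <= t ==> all_moments M (%w. f (X t w))"
 by (rule moments_bounded_all_moments[OF poly_X_moments]) auto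

text \<open>The Markov property with a past weight. The weight becomes a density, which reduces the
  claim to the equality of two measures on the line; on Borel sets this is the defining property of
  the conditional expectation. Non-negative integrals avoid integrability questions for
  \<open>f\<close>.\<close>

lemma transition_nn_integral:
 fixes G :: "'w => real" and f :: "real => ennreal"
 assumes st: "0 <= s" "0 <= t" and G: "G : borel_measurable (F s)" "integrable M G" "!!w. 0 <= G w"
  and f [measurable]: "f : borel_measurable borel"
 shows "(\<integral>\<^sup>+w. ennreal (G w) * f (X (s + t) w) \<partial>M) = (\<integral>\<^sup>+w. ennreal (G w) * (\<integral>\<^sup>+y. f y \<partial>P t (X s w)) \<partial>M)"
proof -
 interpret S: finite_measure_subalgebra M "F s"
  using subalg[OF st(1)] by unfold_locales
 have [measurable]: "G : borel_measurable M" "X s : borel_measurable M" "X (s + t) : borel_measurable M"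
  using G(2) st by auto
 have Pk [measurable]: "P t : borel \<rightarrow>\<^sub>M subprob_algebra borel"
  using P_kernel[OF st(2)] by (rule measurable_prob_algebraD)
 let ?D = "density M (%w. ennreal (G w))"
 have "distr ?D borel (X (s + t)) = distr ?D borel (X s) \<bind> P t"
 proof (rule measure_eqI)
  show "sets (distr ?D borel (X (s + t))) = sets (distr ?D borel (X s) \<bind> P t)"
   by (subst sets_bind[where N=borel]) (auto simp: P_sets[OF st(2)])
  fix A assume "A : sets (distr ?D borel (X (s + t)))"
  then have A [measurable]: "A : sets borel" by simp
  let ?I = "%w. indicator A (X (s + t) w) :: real"
  have ae: "AE w in M. real_cond_exp M (F s) ?I w = measure (P t (X s w)) A"
   using trans st A unfolding is_transition_probability_def by blast
  have iGI: "integrable M (%w. G w * ?I w)"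
   by (rule Bochner_Integration.integrable_bound[OF G(2)]) (auto simp: indicator_def)
  have mP [measurable]: "(%x. measure (P t x) A) : borel_measurable borel"
   by (rule measurable_compose[OF Pk]) (rule measurable_measure_subprob_algebra, simp)
  have GP: "(LINT w|M. G w * measure (P t (X s w)) A) = (LINT w|M. G w * ?I w)"
  proof -
   have "(LINT w|M. G w * real_cond_exp M (F s) ?I w) = (LINT w|M. G w * ?I w)"
    by (rule S.real_cond_exp_intg(2)[OF iGI G(1)]) measurable
   moreover have "(LINT w|M. G w * real_cond_exp M (F s) ?I w) = (LINT w|M. G w * measure (P t (X s w)) A)"
    by (rule integral_cong_AE) (use ae in "auto elim: eventually_mono")
   ultimately show ?thesis by simp
  qed
  have iGP: "integrable M (%w. G w * measure (P t (X s w)) A)"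
  proof (rule Bochner_Integration.integrable_bound[OF G(2)])
   have "measure (P t x) A <= 1" for x using prob_space.prob_le_1[OF P_prob[OF st(2)]] .
   then show "AE w in M. norm (G w * measure (P t (X s w)) A) <= norm (G w)"
    by (intro AE_I2) (simp add: abs_mult mult_left_le)
  qed measurable
  have "emeasure (distr ?D borel (X (s + t))) A = (\<integral>\<^sup>+w. ennreal (G w) * indicator (X (s + t) -` A \<inter> space M) w \<partial>M)"
   by (subst emeasure_distr) (auto simp: emeasure_density)
  also have "... = (\<integral>\<^sup>+w. ennreal (G w * ?I w) \<partial>M)"
   by (intro nn_integral_cong) (auto simp: indicator_def)
  also have "... = ennreal (LINT w|M. G w * ?I w)"
   using G(3) by (intro nn_integral_eq_integral iGI) auto
  also have "... = ennreal (LINT w|M. G w * measure (P t (X s w)) A)" by (simp add: GP)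
  also have "... = (\<integral>\<^sup>+w. ennreal (G w * measure (P t (X s w)) A) \<partial>M)"
   using G(3) by (intro nn_integral_eq_integral[symmetric] iGP) auto
  also have "... = (\<integral>\<^sup>+w. ennreal (G w) * emeasure (P t (X s w)) A \<partial>M)"
  proof (intro nn_integral_cong)
   fix w
   interpret Q: prob_space "P t (X s w)" by (rule P_prob[OF st(2)])
   show "ennreal (G w * measure (P t (X s w)) A) = ennreal (G w) * emeasure (P t (X s w)) A"
    using G(3) by (simp add: Q.emeasure_eq_measure ennreal_mult)
  qed
  also have "... = emeasure (distr ?D borel (X s) \<bind> P t) A"
  proof -
   have [measurable]: "(%x. emeasure (P t x) A) : borel_measurable borel"
    by (rule measurable_compose[OF Pk]) (rule measurable_emeasure_subprob_algebra, simp)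
   have "emeasure (distr ?D borel (X s) \<bind> P t) A = (\<integral>\<^sup>+x. emeasure (P t x) A \<partial>distr ?D borel (X s))"
    by (rule emeasure_bind[where N=borel]) auto
   also have "... = (\<integral>\<^sup>+w. emeasure (P t (X s w)) A \<partial>?D)"
    by (rule nn_integral_distr) auto
   also have "... = (\<integral>\<^sup>+w. ennreal (G w) * emeasure (P t (X s w)) A \<partial>M)"
    by (rule nn_integral_density) measurable
   finally show ?thesis by simp
  qed
  finally show "emeasure (distr ?D borel (X (s + t))) A = emeasure (distr ?D borel (X s) \<bind> P t) A" .
 qed
 then have "(\<integral>\<^sup>+y. f y \<partial>distr ?D borel (X (s + t))) = (\<integral>\<^sup>+y. f y \<partial>(distr ?D borel (X s) \<bind> P t))" by simp
 moreover have "(\<integral>\<^sup>+y. f y \<partial>distr ?D borel (X (s + t))) = (\<integral>\<^sup>+w. ennreal (G w) * f (X (s + t) w) \<partial>M)"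
  by (subst nn_integral_distr) (auto simp: nn_integral_density)
 moreover have "(\<integral>\<^sup>+y. f y \<partial>(distr ?D borel (X s) \<bind> P t)) = (\<integral>\<^sup>+x. \<integral>\<^sup>+y. f y \<partial>P t x \<partial>distr ?D borel (X s))"
  by (rule nn_integral_bind[OF f]) simp
 moreover have "(\<integral>\<^sup>+x. \<integral>\<^sup>+y. f y \<partial>P t x \<partial>distr ?D borel (X s)) = (\<integral>\<^sup>+w. ennreal (G w) * (\<integral>\<^sup>+y. f y \<partial>P t (X s w)) \<partial>M)"
 proof -
  have [measurable]: "(%x. \<integral>\<^sup>+y. f y \<partial>P t x) : borel_measurable borel"
   by (rule measurable_compose[OF Pk nn_integral_measurable_subprob_algebra[OF f]])
  show ?thesis by (subst nn_integral_distr) (auto simp: nn_integral_density)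
 qed
 ultimately show ?thesis by simp
qed

text \<open>For non-negative factors the Markov property replaces the later value by its transition
  mean, which \<open>decay\<close> compares with the stationary mean. Splitting both factors into
  positive and negative parts gives the general case and doubles the constant.\<close>

lemma covariance_decay:
 obtains \<kappa> K where "\<kappa> > 0" "K > 0" "!!s t G f A. 0 <= s ==> 0 <= t ==> G : borel_measurable (F s) ==> all_moments M G ==> poly_le N A f ==>
  abs (LINT w|M. G w * (f (X (s + t) w) - (LINT y|\<pi>0. f y))) <= A * (K * exp (- \<kappa> * t) * (LINT w|M. abs (G w) * (1 + abs (X s w)) ^ Suc N))"
proof -
 obtain \<kappa> K where d: "\<kappa> > 0" "K > 0" "!!t x f A. 0 <= t ==> poly_le N A f ==> integrable (P t x) f"
  "!!f A. poly_le N A f ==> integrable \<pi>0 f"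
  "!!t x f A. 0 <= t ==> poly_le N A f ==>
    abs ((LINT y|P t x. f y) - (LINT y|\<pi>0. f y)) <= A * (K * exp (- \<kappa> * t) * (1 + abs x) ^ Suc N)"
  by (rule decay) blast
 note am = all_moments_integrable all_moments_intros
 have Xa: "all_moments M (X s)" if "0 <= s" for s using moments_bounded_all_moments[OF X_moments] that by simp
 have pos: "abs (LINT w|M. G w * (f (X (s + t) w) - (LINT y|\<pi>0. f y))) <= A * (K * exp (- \<kappa> * t) * (LINT w|M. G w * (1 + abs (X s w)) ^ Suc N))"
  if st: "0 <= s" "0 <= t" and G: "G : borel_measurable (F s)" "all_moments M G" "!!w. 0 <= G w" and f: "poly_le N A f" "!!y. 0 <= f y" for s t G f A
 proof -
  let ?c = "LINT y|\<pi>0. f y" and ?D = "%w. A * (K * exp (- \<kappa> * t) * (1 + abs (X s w)) ^ Suc N)" and ?p = "%x. \<integral>\<^sup>+y. ennreal (f y) \<partial>P t x"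
  have fm [measurable]: "f : borel_measurable borel" using f(1) by (simp add: poly_le_def)
  have c: "0 <= ?c" by (intro Bochner_Integration.integral_nonneg f(2))
  have D: "0 <= ?D w" for w using poly_le_nonneg[OF f(1)] d(2) by simp
  have p: "?p x = ennreal (LINT y|P t x. f y)" "0 <= (LINT y|P t x. f y)" for x
   using f(2) by (auto intro!: nn_integral_eq_integral d(3)[OF st(2) f(1)] Bochner_Integration.integral_nonneg)
  have pm [measurable]: "?p : borel_measurable borel"
   by (rule measurable_compose[OF measurable_prob_algebraD[OF P_kernel[OF st(2)]] nn_integral_measurable_subprob_algebra]) measurable
  have bd: "abs ((LINT y|P t (X s w). f y) - ?c) <= ?D w" for w by (rule d(5)[OF st(2) f(1)])
  have nn: "(\<integral>\<^sup>+w. ennreal (Y w) \<partial>M) = ennreal (LINT w|M. Y w)" if "all_moments M Y" "!!w. 0 <= Y w" for Y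
   using that by (intro nn_integral_eq_integral all_moments_integrable) auto
  have aD: "all_moments M (%w. G w * ?D w)" "all_moments M (%w. G w * ?c)" and aX: "all_moments M (%w. G w * f (X (s + t) w))"
   using st by (intro am G Xa all_moments_poly_X[OF f(1)]; simp)+
  have [measurable]: "G : borel_measurable M" "X s : borel_measurable M" using all_moments_meas G(2) Xa st by blast+
  let ?I = "\<integral>\<^sup>+w. ennreal (G w) * ?p (X s w) \<partial>M"
  have I: "ennreal (LINT w|M. G w * f (X (s + t) w)) = ?I"
   using transition_nn_integral[OF st G(1) all_moments_integrable[OF G(2)] G(3), of "%y. ennreal (f y)"] G(3) f(2)
   by (simp add: ennreal_mult flip: nn[OF aX])
  have "?I <= (\<integral>\<^sup>+w. ennreal (G w * ?c + G w * ?D w) \<partial>M)"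
   unfolding p(1) distrib_left[symmetric] ennreal_mult[OF G(3) p(2), symmetric]
   using bd by (intro nn_integral_mono ennreal_leI mult_left_mono G(3)) (smt (verit))
  also have "... = ennreal (LINT w|M. G w * ?c + G w * ?D w)" by (intro nn all_moments_add aD add_nonneg_nonneg mult_nonneg_nonneg G c D)
  finally have 1: "(LINT w|M. G w * f (X (s + t) w)) <= (LINT w|M. G w * ?c + G w * ?D w)"
   unfolding I[symmetric] using G(3) c D by (simp add: ennreal_le_iff Bochner_Integration.integral_nonneg)
  have "ennreal (LINT w|M. G w * ?c) = (\<integral>\<^sup>+w. ennreal (G w * ?c) \<partial>M)" by (intro nn[symmetric] aD mult_nonneg_nonneg G c)
  also have "... <= (\<integral>\<^sup>+w. ennreal (G w) * ?p (X s w) + ennreal (G w * ?D w) \<partial>M)"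
  proof (rule nn_integral_mono)
   fix w
   have "G w * ?c <= G w * ((LINT y|P t (X s w). f y) + ?D w)" using bd[of w] by (intro mult_left_mono G(3)) linarith
   from ennreal_leI[OF this] show "ennreal (G w * ?c) <= ennreal (G w) * ?p (X s w) + ennreal (G w * ?D w)"
    unfolding p(1) ennreal_mult[OF G(3) p(2), symmetric] distrib_left using G(3) D p(2) by (simp add: ennreal_plus)
  qed
  also have "... = ?I + ennreal (LINT w|M. G w * ?D w)"
   unfolding nn[OF aD(1) mult_nonneg_nonneg[OF G(3) D], symmetric] by (rule nn_integral_add) measurable
  also have "... = ennreal ((LINT w|M. G w * f (X (s + t) w)) + (LINT w|M. G w * ?D w))"
   unfolding I[symmetric] by (intro ennreal_plus[symmetric] Bochner_Integration.integral_nonneg mult_nonneg_nonneg[OF G(3) f(2)] mult_nonneg_nonneg[OF G(3) D])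
  finally have 2: "(LINT w|M. G w * ?c) <= (LINT w|M. G w * f (X (s + t) w)) + (LINT w|M. G w * ?D w)"
   by (subst (asm) ennreal_le_iff) (intro add_nonneg_nonneg Bochner_Integration.integral_nonneg mult_nonneg_nonneg[OF G(3) f(2)] mult_nonneg_nonneg[OF G(3) D])
  have "(LINT w|M. G w * ?c + G w * ?D w) = (LINT w|M. G w * ?c) + (LINT w|M. G w * ?D w)"
   "(LINT w|M. G w * (f (X (s + t) w) - ?c)) = (LINT w|M. G w * f (X (s + t) w)) - (LINT w|M. G w * ?c)"
   "(LINT w|M. G w * ?D w) = A * (K * exp (- \<kappa> * t) * (LINT w|M. G w * (1 + abs (X s w)) ^ Suc N))"
   unfolding right_diff_distrib using all_moments_integrable[OF aD(1)] all_moments_integrable[OF aD(2)] all_moments_integrable[OF aX]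
   by (auto simp: mult.left_commute[of "G _"] simp del: power_Suc)
  then show ?thesis using 1 2 by linarith
 qed
 have "abs (LINT w|M. G w * (f (X (s + t) w) - (LINT y|\<pi>0. f y))) <= A * ((2 * K) * exp (- \<kappa> * t) * (LINT w|M. abs (G w) * (1 + abs (X s w)) ^ Suc N))"
  if st: "0 <= s" "0 <= t" and G: "G : borel_measurable (F s)" "all_moments M G" and f: "poly_le N A f" for s t G f A
 proof -
  define Gs where "Gs b w = max (if b then G w else - G w) 0" for b w
  define fs where "fs b y = max (if b then f y else - f y) 0" for b y
  let ?W = "%w. (1 + abs (X s w)) ^ Suc N" and ?Y = "%b w. fs b (X (s + t) w) - (LINT y|\<pi>0. fs b y)"
  have fs: "poly_le N A (fs b)" "0 <= fs b y" for b y
   using f order_trans[OF abs_ge_zero] unfolding poly_le_def fs_def[abs_def] by (auto simp: abs_le_iff)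
  have Gs: "Gs b : borel_measurable (F s)" "all_moments M (Gs b)" "0 <= Gs b w" for b w
   using G all_moments_meas[OF G(2)] by (auto simp: Gs_def[abs_def] intro!: all_moments_bound[OF G(2)])
  have W: "all_moments M ?W" by (intro am Xa st)
  have Y: "all_moments M (?Y b)" for b using st by (intro am all_moments_poly_X[OF fs(1)]) auto
  have "(LINT y|\<pi>0. f y) = (LINT y|\<pi>0. fs True y - fs False y)" by (intro Bochner_Integration.integral_cong) (auto simp: fs_def)
  also have "... = (LINT y|\<pi>0. fs True y) - (LINT y|\<pi>0. fs False y)" by (intro Bochner_Integration.integral_diff poly_\<pi>0_integrable[OF fs(1)])
  finally have c: "(LINT y|\<pi>0. f y) = (LINT y|\<pi>0. fs True y) - (LINT y|\<pi>0. fs False y)" .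
  have "f y = fs True y - fs False y" "G w = Gs True w - Gs False w" for y w by (auto simp: fs_def Gs_def)
  note * = this(1)[of "X (s + t) _"] this(2)
  have "G w * (f (X (s + t) w) - (LINT y|\<pi>0. f y)) = (Gs True w - Gs False w) * (?Y True w - ?Y False w)" for w
   unfolding c * by (simp add: algebra_simps)
  moreover have "(LINT w|M. (Gs True w - Gs False w) * (?Y True w - ?Y False w)) =
   ((LINT w|M. Gs True w * ?Y True w) - (LINT w|M. Gs True w * ?Y False w)) - ((LINT w|M. Gs False w * ?Y True w) - (LINT w|M. Gs False w * ?Y False w))"
  proof -
   define T where "T b b' w = Gs b w * ?Y b' w" for b b' w
   have "integrable M (T b b')" for b b' unfolding T_def by (intro am Gs Y)
   moreover have "(Gs True w - Gs False w) * (?Y True w - ?Y False w) = (T True True w - T True False w) - (T False True w - T False False w)" for w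
    unfolding T_def by (simp add: algebra_simps)
   ultimately show ?thesis unfolding T_def[symmetric] by simp
  qed
  moreover have "(LINT w|M. abs (G w) * ?W w) = (LINT w|M. Gs True w * ?W w + Gs False w * ?W w)"
   by (intro Bochner_Integration.integral_cong) (auto simp: Gs_def max_def)
  moreover have "... = (LINT w|M. Gs True w * ?W w) + (LINT w|M. Gs False w * ?W w)"
   by (intro Bochner_Integration.integral_add all_moments_integrable all_moments_mult Gs W)
  moreover note pos[OF st Gs fs, of True True] pos[OF st Gs fs, of True False] pos[OF st Gs fs, of False True] pos[OF st Gs fs, of False False]
  ultimately show ?thesis by (simp only: distrib_left mult.assoc)
 qed
 with d(1,2) that[of \<kappa> "2 * K"] show ?thesis by simp
qed

text \<open>Covariances over \<open>k - i\<close> steps decay like \<open>\<rho> ^ (k - i)\<close>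
  with \<open>\<rho> = exp (- \<kappa> h)\<close>, and \<open>h\<close> times the geometric sum is
  at most \<open>1 / \<kappa>\<close> whatever \<open>h\<close> is. So the square of the sum is of
  order \<open>n h\<close> and not \<open>(n h)^2\<close>. The function enters only through
  \<open>A^2\<close>.\<close>

lemma ergodic_second_moment:
 "\<exists>C\<ge>0. ALL A f n h. poly_le N A f --> 0 < h -->  h <= 1 -->
   (LINT w|M. (\<Sum>j<n. h * (f (X (real j * h) w) - (LINT y|\<pi>0. f y)))^2) <= C * (A^2 * (real n * h))"
proof -
 obtain \<kappa> K where d: "\<kappa> > 0" "K > 0" "!!s t G f A. 0 <= s ==> 0 <= t ==> G : borel_measurable (F s) ==> all_moments M G ==> poly_le N A f ==>
  abs (LINT w|M. G w * (f (X (s + t) w) - (LINT y|\<pi>0. f y))) <= A * (K * exp (- \<kappa> * t) * (LINT w|M. abs (G w) * (1 + abs (X s w)) ^ Suc N))"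
  by (rule covariance_decay) blast
 note am = all_moments_integrable all_moments_intros
 define c where "c = (LINT y|\<pi>0. (1 + abs y) ^ N)"
 define V where "V t w = (1 + abs (X t w)) ^ Suc N + c" for t w
 have c: "c >= 0" unfolding c_def by (intro Bochner_Integration.integral_nonneg) auto
 have V: "moments_bounded M {0..} V"
  unfolding V_def[abs_def] by (intro moments_bounded_add moments_bounded_const moments_bounded_power moments_bounded_abs X_moments)
 obtain W where W: "!!t. 0 <= t ==> (LINT w|M. (V t w)^2) <= W" using moments_bounded_mean[OF moments_bounded_power[OF V, of 2]] by auto
 have W0: "W >= 0" using W[of 0] by (rule order_trans[rotated]) auto
 note Va = moments_bounded_all_moments[OF V]
 have "(LINT w|M. (\<Sum>j<n. h * (f (X (real j * h) w) - (LINT y|\<pi>0. f y)))^2) <= (W + 2 * (K * W) / \<kappa>) * (A^2 * (real n * h))"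
  if f: "poly_le N A f" and h: "0 < h" "h <= 1" for A f n h
 proof -
  note A = poly_le_nonneg[OF f]
  let ?t = "%j. real j * h"
  have t: "0 <= ?t j" for j using h by simp
  define \<rho> where "\<rho> = exp (- \<kappa> * h)"
  have \<rho>: "0 < \<rho>" "\<rho> < 1" using d(1) h by (auto simp: \<rho>_def)
  define Y where "Y k w = f (X (?t k) w) - (LINT y|\<pi>0. f y)" for k w
  have Y: "all_moments M (Y k)" for k unfolding Y_def by (intro am all_moments_poly_X[OF f] t)
  have YF: "Y k : borel_measurable (F (?t k))" for k unfolding Y_def[abs_def] using measurable_compose[OF X_F[OF t] conjunct1[OF f[unfolded poly_le_def]]] by (rule borel_measurable_diff) simp
  have YV: "abs (Y k w) <= A * V (?t k) w" for k w
  proof -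
   have "abs (LINT y|\<pi>0. f y) <= A * c" unfolding c_def by (rule stationary_mean_bound[OF f])
   moreover have "abs (f (X (?t k) w)) <= A * (1 + abs (X (?t k) w)) ^ Suc N"
    by (rule order_trans[OF f[unfolded poly_le_def, THEN conjunct2, rule_format]]) (intro mult_left_mono power_increasing A; simp)
   ultimately show ?thesis by (simp add: Y_def V_def distrib_left del: power_Suc)
  qed
  have V1: "(1 + abs (X (?t k) w)) ^ Suc N <= V (?t k) w" "0 <= V (?t k) w" for k w using c by (simp_all add: V_def del: power_Suc)
  have sq: "(LINT w|M. (Y k w)^2) <= A^2 * W" for k
  proof -
   have "(LINT w|M. (Y k w)^2) <= (LINT w|M. A^2 * (V (?t k) w)^2)"
   proof (intro integral_mono am Y Va)
    show "(Y k w)^2 <= A^2 * (V (?t k) w)^2" for w using power_mono[OF YV[of k w] abs_ge_zero, of 2] by (simp add: power_mult_distrib)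
   qed (use t in simp)
   also have "... <= A^2 * W" using W[OF t] by (simp add: mult_left_mono)
   finally show ?thesis .
  qed
  have cross: "abs (LINT w|M. Y i w * Y k w) <= A^2 * (K * W) * \<rho> ^ (k - i)" if ik: "i < k" for i k
  proof -
   have tk: "?t i + real (k - i) * h = ?t k" "0 <= real (k - i) * h" using ik h by (simp_all add: of_nat_diff algebra_simps)
   have er: "exp (- \<kappa> * (real (k - i) * h)) = \<rho> ^ (k - i)" unfolding \<rho>_def by (simp add: exp_of_nat_mult[symmetric] mult_ac)
   have "(LINT w|M. abs (Y i w) * (1 + abs (X (?t i) w)) ^ Suc N) <= (LINT w|M. A * (V (?t i) w)^2)"
   proof (intro integral_mono am Y Va moments_bounded_all_moments[OF X_moments])
    show "abs (Y i w) * (1 + abs (X (?t i) w)) ^ Suc N <= A * (V (?t i) w)^2" for w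
     using mult_mono[OF YV V1(1), of i w i w] A V1(2) by (simp add: power2_eq_square mult.assoc del: power_Suc)
   qed (use t in simp_all)
   also have "... <= A * W" using W[OF t] A by (simp add: mult_left_mono)
   finally have "A * (K * \<rho> ^ (k - i) * (LINT w|M. abs (Y i w) * (1 + abs (X (?t i) w)) ^ Suc N)) <= A * (K * \<rho> ^ (k - i) * (A * W))"
    using A d(2) \<rho> by (intro mult_left_mono) auto
   then show ?thesis using d(3)[OF t tk(2) YF Y f, of i] unfolding tk(1) er Y_def[symmetric] by (simp add: power2_eq_square mult_ac del: power_Suc)
  qed
  have geo: "(\<Sum>i<k. h * \<rho> ^ (k - i)) <= 1 / \<kappa>" for k
  proof -
   have "(\<Sum>i<k. h * \<rho> ^ (k - i)) = h * (\<Sum>i<k. \<rho> ^ (k - i))" by (simp add: sum_distrib_left)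
   also have "(\<Sum>i<k. \<rho> ^ (k - i)) = (\<Sum>i<k. \<rho> ^ Suc i)"
    by (rule sum.reindex_bij_witness[of _ "%i. k - 1 - i" "%i. k - 1 - i"]) (auto simp: Suc_diff_Suc)
   also have "... = \<rho> * ((1 - \<rho> ^ k) / (1 - \<rho>))"
    using \<rho> by (simp add: sum_gp_strict flip: sum_distrib_left)
   also have "h * ... <= h * (\<rho> * (1 / (1 - \<rho>)))"
    using \<rho> h by (intro mult_left_mono divide_right_mono) auto
   also have "... <= 1 / \<kappa>"
   proof -
    \<comment> \<open>Since \<open>\<rho>\<close> is the inverse of this exponential,
      \<open>\<rho> (1 + \<kappa> h) <= 1\<close>, which bounds
      \<open>h \<rho> / (1 - \<rho>)\<close> by \<open>1 / \<kappa>\<close>.\<close>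
    have "1 + \<kappa> * h <= exp (\<kappa> * h)" by (rule exp_ge_add_one_self)
    then have "\<rho> * (1 + \<kappa> * h) <= \<rho> * exp (\<kappa> * h)" using \<rho> by (intro mult_left_mono) auto
    also have "\<rho> * exp (\<kappa> * h) = 1" by (simp add: \<rho>_def flip: exp_add)
    finally have "\<rho> * (\<kappa> * h) <= 1 - \<rho>" by (simp add: algebra_simps)
    then show ?thesis using \<rho> d(1) by (simp add: field_simps)
   qed
   finally show ?thesis .
  qed
  have "(LINT w|M. (\<Sum>j<k. h * Y j w)^2) <= (W + 2 * (K * W) / \<kappa>) * (A^2 * (real k * h))" for k
  proof (induction k)
   case (Suc k)
   let ?S = "%w. \<Sum>j<k. h * Y j w"
   have i: "integrable M (%w. (?S w)^2)" "integrable M (%w. Y i w * Y k w)" "integrable M (%w. (Y k w)^2)" for i by (intro am Y)+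
   have "(LINT w|M. (\<Sum>j<Suc k. h * Y j w)^2) = (LINT w|M. (?S w)^2 + (2 * h * (\<Sum>i<k. h * (Y i w * Y k w)) + h^2 * (Y k w)^2))"
    by (simp add: power2_sum power_mult_distrib sum_distrib_left sum_distrib_right mult_ac add_ac)
   also have "... = (LINT w|M. (?S w)^2) + (2 * h * (\<Sum>i<k. h * (LINT w|M. Y i w * Y k w)) + h^2 * (LINT w|M. (Y k w)^2))"
    using i by simp
   also have "... <= (W + 2 * (K * W) / \<kappa>) * (A^2 * (real k * h)) + (2 * h * (A^2 * (K * W) * (1 / \<kappa>)) + h * (A^2 * W))"
   proof (intro add_mono Suc.IH mult_left_mono mult_mono sq)
    have "(\<Sum>i<k. h * (LINT w|M. Y i w * Y k w)) <= (\<Sum>i<k. h * (A^2 * (K * W) * \<rho> ^ (k - i)))"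
     using h order_trans[OF abs_ge_self cross] by (intro sum_mono mult_left_mono) auto
    also have "... = A^2 * (K * W) * (\<Sum>i<k. h * \<rho> ^ (k - i))" by (simp add: sum_distrib_left mult_ac)
    also have "... <= A^2 * (K * W) * (1 / \<kappa>)" using geo W0 d(2) by (intro mult_left_mono) auto
    finally show "(\<Sum>i<k. h * (LINT w|M. Y i w * Y k w)) <= A^2 * (K * W) * (1 / \<kappa>)" .
   qed (use h W0 in "auto simp: power2_eq_square mult_left_le")
   also have "... = (W + 2 * (K * W) / \<kappa>) * (A^2 * (real (Suc k) * h))" by (simp add: algebra_simps)
   finally show ?case .
  qed simp
  then show ?thesis by (simp only: Y_def)
 qed
 then show ?thesis using W0 d(1,2) by (intro exI[of _ "W + 2 * (K * W) / \<kappa>"]) auto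
qed

text \<open>All moments of order at least 2 are of order \<open>h\<close>, so a polynomial weight
  does not change the order of the squared increment.\<close>

lemma small_jump_moment:
 "\<exists>C\<ge>0. ALL h. 0 < h --> h <= 1 --> (LINT w|M. (J h w)^2 * (1 + abs (J h w)) ^ p) <= C * h"
proof -
 obtain C where C: "C >= 0" "!!s t. 0 <= s ==> s <= t ==> t - s <= 1 ==> (LINT w|M. abs (J t w - J s w) ^ (p + 2)) <= C * (t - s)"
  using increment_moment[of "p + 2"] by auto
 have "(LINT w|M. (J h w)^2 * (1 + abs (J h w)) ^ p) <= (2 ^ p * (1 + C)) * h" if h: "0 < h" "h <= 1" for h
 proof -
  have h0: "0 <= h" using h by simp
  have J2: "(LINT w|M. abs (J h w) ^ (p + 2)) <= C * h"
   using C(2)[of 0 h] h increment_integral(1)[of 0 h "%z. abs z ^ (p + 2)"] by simp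
  have "(LINT w|M. (J h w)^2 * (1 + abs (J h w)) ^ p) <= (LINT w|M. 2 ^ p * ((J h w)^2 + abs (J h w) ^ (p + 2)))"
  proof (rule integral_mono)
   show "integrable M (%w. (J h w)^2 * (1 + abs (J h w)) ^ p)" "integrable M (%w. 2 ^ p * ((J h w)^2 + abs (J h w) ^ (p + 2)))"
    by (intro all_moments_integrable all_moments_intros all_moments_J h0)+
   show "(J h w)^2 * (1 + abs (J h w)) ^ p <= 2 ^ p * ((J h w)^2 + abs (J h w) ^ (p + 2))" for w
    using mult_left_mono[OF one_plus_power_le[of p p "J h w"], of "(J h w)^2"] by (simp add: algebra_simps power2_eq_square)
  qed
  also have "... = 2 ^ p * (h + (LINT w|M. abs (J h w) ^ (p + 2)))"
  proof -
   have "integrable M (%w. abs (J h w) ^ (p + 2))" by (intro all_moments_integrable all_moments_intros all_moments_J h0)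
   then show ?thesis using J_integrable_power[OF h0, of 2] J_second_moment[OF h0]
    by (simp only: Bochner_Integration.integral_mult_right_zero Bochner_Integration.integral_add)
  qed
  also have "... <= 2 ^ p * (h + C * h)" using J2 by (intro mult_left_mono) auto
  finally show ?thesis by (simp add: algebra_simps)
 qed
 then show ?thesis using C(1) by (intro exI[of _ "2 ^ p * (1 + C)"]) auto
qed

text \<open>As \<open>\<psi>\<close> is quadratic near 0 with polynomial growth, its mean and its
  second moment along \<open>J h\<close> are both of order \<open>h\<close>. Orthogonality of the
  centred terms then makes the second moment of the sum of order \<open>n h\<close>.\<close>

lemma noise_second_moment:
 assumes [measurable]: "\<psi> : borel_measurable borel" and \<psi>: "!!z. abs (\<psi> z) <= B * (z^2 * (1 + abs z) ^ p)"
 defines "e \<equiv> %h. \<integral>w. \<psi> (J h w) \<partial>M"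
 shows "\<exists>C\<ge>0. ALL A f n h. poly_le N A f --> 0 < h --> h <= 1 -->
   integrable M (%w. (\<Sum>j<n. f (X (real j * h) w) * (\<psi> (J (real (Suc j) * h) w - J (real j * h) w) - e h))^2) &
   (LINT w|M. (\<Sum>j<n. f (X (real j * h) w) * (\<psi> (J (real (Suc j) * h) w - J (real j * h) w) - e h))^2) <= C * (A^2 * (real n * h))"
  and "\<exists>C\<ge>0. ALL h. 0 < h --> h <= 1 --> abs (e h) <= C * h"
proof -
 have \<psi>a: "all_moments M (%w. \<psi> (J h w))" if "0 < h" for h
 proof (rule all_moments_bound)
  show "all_moments M (%w. B * ((J h w)^2 * (1 + abs (J h w)) ^ p))" by (intro all_moments_intros all_moments_J less_imp_le[OF that])
  have [measurable]: "J h : borel_measurable M" by (rule J_meas[OF less_imp_le[OF that]])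
  show "(%w. \<psi> (J h w)) : borel_measurable M" by measurable
 qed (rule order_trans[OF \<psi> abs_ge_self])
 have B: "B >= 0" using order_trans[OF abs_ge_zero \<psi>[of 1]] by (simp add: zero_le_mult_iff not_le[THEN iffD2, OF zero_less_power])
 obtain C1 where C1: "C1 >= 0" "!!h. 0 < h ==> h <= 1 ==> (LINT w|M. (J h w)^2 * (1 + abs (J h w)) ^ p) <= C1 * h"
  using small_jump_moment by blast
 have "abs (e h) <= (B * C1) * h" if h: "0 < h" "h <= 1" for h
 proof -
  have "abs (e h) <= (LINT w|M. abs (\<psi> (J h w)))" unfolding e_def by (rule integral_abs_bound)
  also have "... <= (LINT w|M. B * ((J h w)^2 * (1 + abs (J h w)) ^ p))"
   using h by (intro integral_mono all_moments_integrable all_moments_intros \<psi>a all_moments_J \<psi>) auto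
  also have "... <= B * (C1 * h)" using C1(2)[OF h] B by (simp add: mult_left_mono)
  finally show ?thesis by simp
 qed
 then show "\<exists>C\<ge>0. ALL h. 0 < h --> h <= 1 --> abs (e h) <= C * h" using B C1(1) by (intro exI[of _ "B * C1"]) auto
 \<comment> \<open>Squaring \<open>\<psi>\<close> produces \<open>z^4\<close>; two of the powers
   stay as \<open>z^2\<close> and the other two go into the weight, whence the exponent
   \<open>2 p + 2\<close>.\<close>
 obtain C where C: "C >= 0" "!!h. 0 < h ==> h <= 1 ==> (LINT w|M. (J h w)^2 * (1 + abs (J h w)) ^ (2 * p + 2)) <= C * h"
  using small_jump_moment by blast
 have var: "(LINT w|M. (\<psi> (J h w) - e h)^2) <= B^2 * (C * h)" if h: "0 < h" "h <= 1" for h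
 proof -
  have "(LINT w|M. (\<psi> (J h w) - e h)^2) <= (LINT w|M. (\<psi> (J h w))^2)"
   using variance_eq[of "%w. \<psi> (J h w)"] all_moments_integrable[OF \<psi>a[OF h(1)]] all_moments_integrable[OF all_moments_power[OF \<psi>a[OF h(1)], of 2]]
   by (simp add: e_def)
  also have "... <= (LINT w|M. B^2 * ((J h w)^2 * (1 + abs (J h w)) ^ (2 * p + 2)))"
  proof (intro integral_mono all_moments_integrable all_moments_intros \<psi>a all_moments_J)
   fix w
   define z where "z = J h w"
   have "(\<psi> z)^2 <= (B * (z^2 * (1 + abs z) ^ p))^2" using power_mono[OF \<psi>[of z] abs_ge_zero, of 2] by simp
   also have "... = B^2 * (z^2 * ((abs z)^2 * (1 + abs z) ^ (2 * p)))" by (simp add: power_mult_distrib power2_eq_square mult_2 mult_2_right power_add mult_ac)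
   also have "... <= B^2 * (z^2 * ((1 + abs z)^2 * (1 + abs z) ^ (2 * p)))" by (intro mult_left_mono mult_right_mono power_mono) auto
   finally show "(\<psi> (J h w))^2 <= B^2 * ((J h w)^2 * (1 + abs (J h w)) ^ (2 * p + 2))" unfolding z_def by (simp only: power_add mult_ac)
  qed (use h in auto)
  also have "... <= B^2 * (C * h)" using C(2)[OF h] by (simp add: mult_left_mono)
  finally show ?thesis .
 qed
 have "moments_bounded M {0..} (%t w. (1 + abs (X t w)) ^ N)"
  by (intro moments_bounded_add moments_bounded_const moments_bounded_power moments_bounded_abs X_moments)
 from moments_bounded_mean[OF moments_bounded_power[OF this, of 2]]
 obtain W where W: "!!t. 0 <= t ==> integrable M (%w. ((1 + abs (X t w)) ^ N)^2) & (LINT w|M. ((1 + abs (X t w)) ^ N)^2) <= W" by auto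
 have W0: "W >= 0" using W[of 0] by (intro order_trans[OF _ conjunct2[OF W[of 0]]]) auto
 have "integrable M (%w. (\<Sum>j<n. f (X (real j * h) w) * (\<psi> (J (real (Suc j) * h) w - J (real j * h) w) - e h))^2) &
   (LINT w|M. (\<Sum>j<n. f (X (real j * h) w) * (\<psi> (J (real (Suc j) * h) w - J (real j * h) w) - e h))^2) <= (W * (B^2 * C)) * (A^2 * (real n * h))"
  if f: "poly_le N A f" and h: "0 < h" "h <= 1" for A f n h
 proof -
  let ?t = "%j. real j * h"
  have t: "0 <= ?t j" "?t j <= ?t (Suc j)" "?t (Suc j) - ?t j = h" for j using h by (auto simp: algebra_simps)
  have fF: "(%w. f (X (?t j) w)) : borel_measurable (F (?t j))" for j
   using measurable_compose[OF X_F[OF t(1)] conjunct1[OF f[unfolded poly_le_def]]] .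
  have i: "integrable M (%w. (f (X (?t j) w))^2)" for j by (intro all_moments_integrable all_moments_intros all_moments_poly_X[OF f] t)
  have \<psi>i: "integrable M (%w. \<psi> (J h w))" "integrable M (%w. (\<psi> (J h w) - e h)^2)"
   by (intro all_moments_integrable all_moments_intros \<psi>a h)+
  have "(LINT w|M. (f (X (?t j) w))^2) <= (LINT w|M. A^2 * ((1 + abs (X (?t j) w)) ^ N)^2)" for j
  proof (intro integral_mono i)
   show "(f (X (?t j) w))^2 <= A^2 * ((1 + abs (X (?t j) w)) ^ N)^2" for w
    using power_mono[of "abs (f (X (?t j) w))" _ 2] f by (force simp: poly_le_def power_mult_distrib)
  qed (use W t in simp)
  moreover have "(LINT w|M. A^2 * ((1 + abs (X (?t j) w)) ^ N)^2) <= A^2 * W" for j using W[OF t(1), of j] by (simp add: mult_left_mono)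
  ultimately have "(\<Sum>j<n. (LINT w|M. (f (X (?t j) w))^2) * (LINT w|M. (\<psi> (J h w) - e h)^2)) <= (\<Sum>j<n. (A^2 * W) * (B^2 * (C * h)))"
   using var[OF h] W0 by (intro sum_mono mult_mono) (auto intro: order_trans)
  then show ?thesis
   using increment_orthogonality[where p="?t" and \<psi>="%_ z. \<psi> z - e h" and v="%j w. f (X (?t j) w)" and m=n] t fF i \<psi>i
   unfolding t(3) by (simp add: e_def prob_space mult_ac)
 qed
 then show "\<exists>C\<ge>0. ALL A f n h. poly_le N A f --> 0 < h --> h <= 1 -->
   integrable M (%w. (\<Sum>j<n. f (X (real j * h) w) * (\<psi> (J (real (Suc j) * h) w - J (real j * h) w) - e h))^2) &
   (LINT w|M. (\<Sum>j<n. f (X (real j * h) w) * (\<psi> (J (real (Suc j) * h) w - J (real j * h) w) - e h))^2) <= C * (A^2 * (real n * h))"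
  using W0 B C(1) by (intro exI[of _ "W * (B^2 * C)"]) auto
qed

end

section \<open>Families of functions with polynomial weights\<close>

text \<open>An O-relation modulo powers of a weight, with constant and exponent hidden. In the
  application the index also carries the sample point, so the relation is pathwise; expectations are
  taken only at the end, where the moments of \<open>U\<close> absorb the power.\<close>

definition dominated :: "'i set => ('i => real) => ('i => real) => ('i => real) => bool" where
 "dominated S U Z Y \<longleftrightarrow> (EX K N. 0 <= K & (ALL i:S. 0 <= Z i & abs (Y i) <= K * U i ^ N * Z i))"

locale domination =
 fixes S :: "'i set" and U :: "'i => real"
 assumes U: "!!i. i : S ==> 1 <= U i"
begin

lemma dominated_trans:
 assumes "dominated S U Z Y" "dominated S U Z' Z"
 shows "dominated S U Z' Y"
proof -
 obtain K N where K: "0 <= K" "!!i. i : S ==> 0 <= Z i & abs (Y i) <= K * U i ^ N * Z i" using assms(1) unfolding dominated_def by blast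
 obtain L P where L: "0 <= L" "!!i. i : S ==> 0 <= Z' i & abs (Z i) <= L * U i ^ P * Z' i" using assms(2) unfolding dominated_def by blast
 have "0 <= Z' i & abs (Y i) <= (K * L) * U i ^ (N + P) * Z' i" if "i : S" for i
 proof -
  have "abs (Y i) <= K * U i ^ N * Z i" using K that by blast
  also have "... <= K * U i ^ N * (L * U i ^ P * Z' i)" using K L U that by (intro mult_left_mono) (force simp: abs_le_iff intro: order_trans[OF zero_le_one])+
  finally show ?thesis using L that by (simp add: power_add mult_ac)
 qed
 then show ?thesis using K(1) L(1) unfolding dominated_def by (metis mult_nonneg_nonneg)
qed

lemma dominated_le:
 assumes "dominated S U Z Y'" "!!i. i : S ==> abs (Y i) <= C * abs (Y' i)"
 shows "dominated S U Z Y"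
proof -
 obtain K N where K: "0 <= K" "!!i. i : S ==> 0 <= Z i & abs (Y' i) <= K * U i ^ N * Z i" using assms(1) unfolding dominated_def by blast
 have "0 <= Z i & abs (Y i) <= (abs C * K) * U i ^ N * Z i" if "i : S" for i
 proof -
  have "abs (Y i) <= abs C * abs (Y' i)" using assms(2)[OF that] abs_ge_self[of C] by (meson abs_ge_zero mult_right_mono order_trans)
  also have "... <= abs C * (K * U i ^ N * Z i)" using K(2)[OF that] by (intro mult_left_mono) auto
  finally show ?thesis using K(2)[OF that] by (simp add: mult.assoc)
 qed
 then show ?thesis using K(1) unfolding dominated_def by (intro exI[of _ "abs C * K"] exI[of _ N]) auto
qed

lemma dominated_self: "(!!i. i : S ==> 0 <= Z i & abs (Y i) <= C * Z i) ==> dominated S U Z Y"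
 unfolding dominated_def by (intro exI[of _ "abs C"] exI[of _ 0]) (auto, smt (verit) mult_right_mono)

lemma dominated_mono: "dominated S U Z Y ==> (!!i. i : S ==> 0 <= Z' i & abs (Z i) <= C * Z' i) ==> dominated S U Z' Y"
 by (rule dominated_trans[OF _ dominated_self])

lemma dominated_mult:
 assumes "dominated S U Z Y" "dominated S U Z' Y'"
 shows "dominated S U (%i. Z i * Z' i) (%i. Y i * Y' i)"
proof -
 obtain K N where K: "0 <= K" "!!i. i : S ==> 0 <= Z i & abs (Y i) <= K * U i ^ N * Z i" using assms(1) unfolding dominated_def by blast
 obtain L P where L: "0 <= L" "!!i. i : S ==> 0 <= Z' i & abs (Y' i) <= L * U i ^ P * Z' i" using assms(2) unfolding dominated_def by blast
 have "0 <= Z i * Z' i & abs (Y i * Y' i) <= (K * L) * U i ^ (N + P) * (Z i * Z' i)" if "i : S" for i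
 proof -
  have "abs (Y i) * abs (Y' i) <= (K * U i ^ N * Z i) * (L * U i ^ P * Z' i)"
   using K(2)[OF that] L(2)[OF that] order_trans[OF abs_ge_zero, of "Y i" "K * U i ^ N * Z i"] by (intro mult_mono) auto
  then show ?thesis using K(2)[OF that] L(2)[OF that] by (simp add: abs_mult power_add mult_ac)
 qed
 then show ?thesis using K(1) L(1) unfolding dominated_def by (metis mult_nonneg_nonneg)
qed

lemma dominated_add:
 assumes "dominated S U Z Y" "dominated S U Z Y'"
 shows "dominated S U Z (%i. Y i + Y' i)"
proof -
 obtain K N where K: "0 <= K" "!!i. i : S ==> 0 <= Z i & abs (Y i) <= K * U i ^ N * Z i" using assms(1) unfolding dominated_def by blast
 obtain L P where L: "0 <= L" "!!i. i : S ==> 0 <= Z i & abs (Y' i) <= L * U i ^ P * Z i" using assms(2) unfolding dominated_def by blast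
 have "0 <= Z i & abs (Y i + Y' i) <= (K + L) * U i ^ max N P * Z i" if "i : S" for i
 proof -
  have "U i ^ N <= U i ^ max N P" "U i ^ P <= U i ^ max N P" using U[OF that] by (auto intro: power_increasing)
  then have "K * U i ^ N * Z i <= K * U i ^ max N P * Z i" "L * U i ^ P * Z i <= L * U i ^ max N P * Z i"
   using K(1,2) L(1) that by (auto intro!: mult_right_mono mult_left_mono)
  then show ?thesis using K(2)[OF that] L(2)[OF that] unfolding distrib_right by linarith
 qed
 then show ?thesis using K(1) L(1) unfolding dominated_def by (metis add_nonneg_nonneg)
qed

lemma dominated_minus: "dominated S U Z Y ==> dominated S U Z (%i. - Y i)"
 by (rule dominated_le[where C=1]) auto

lemma dominated_diff: "dominated S U Z Y ==> dominated S U Z Y' ==> dominated S U Z (%i. Y i - Y' i)"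
 using dominated_add[OF _ dominated_minus, of Z Y Y'] by simp

lemma dominated_const: "dominated S U (%_. 1) (%_. c)"
 by (rule dominated_self[where C="abs c"]) simp

lemma dominated_unit: "dominated S U (%_. 1) U"
 unfolding dominated_def using U by (intro exI[of _ 1] exI[of _ 1]) force

lemma dominated_power: "dominated S U (%_. 1) Y ==> dominated S U (%_. 1) (%i. Y i ^ k)"
 by (induction k) (use dominated_const dominated_mult[of "%_. 1" Y "%_. 1"] in auto)

lemma dominated_scale: "dominated S U (%_. 1) Y ==> dominated S U Z Y' ==> dominated S U Z (%i. Y i * Y' i)"
 using dominated_mult[of "%_. 1" Y Z Y'] by simp

lemma dominated_sum: "(!!k. k : A ==> dominated S U Z (Y k)) ==> dominated S U Z (%_. 0) ==> dominated S U Z (%i. \<Sum>k\<in>A. Y k i)"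
 by (induction A rule: infinite_finite_induct) (auto intro: dominated_add)

end

text \<open>The class of parametric integrands: closed under sums, products and inverses of
  polynomially controlled functions, stable under extension to the closure, and fit for finite nets
  in the parameter.\<close>

definition poly_lipschitz :: "'b::metric_space set => (real => 'b => real) => bool" where
 "poly_lipschitz D f \<longleftrightarrow> (EX K N. K >= 0 & (ALL \<theta>:D. poly_le N K (%x. f x \<theta>)) &
   (ALL x. ALL \<theta>:D. ALL \<theta>':D. abs (f x \<theta> - f x \<theta>') <= K * (1 + abs x) ^ N * dist \<theta> \<theta>'))"

lemma poly_lipschitz_diff:
 assumes "ALL \<theta>:D. poly_le N K (%x. f x \<theta>)"
  "ALL x. ALL \<theta>:D. ALL \<theta>':D. abs (f x \<theta> - f x \<theta>') <= K * (1 + abs x) ^ N * dist \<theta> \<theta>'" "\<theta> : D" "\<theta>' : D"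
 shows "poly_le N (K * dist \<theta> \<theta>') (%x. f x \<theta> - f x \<theta>')"
 using assms unfolding poly_le_def by (auto simp: mult_ac intro!: borel_measurable_diff)

lemma poly_lipschitz_measurable: "poly_lipschitz D f ==> \<theta> : D ==> (%x. f x \<theta>) : borel_measurable borel"
 unfolding poly_lipschitz_def poly_le_def by blast

lemma poly_lipschitzI:
 assumes "!!\<theta>. \<theta> : D ==> (%x. f x \<theta>) : borel_measurable borel" "!!x \<theta>. \<theta> : D ==> abs (f x \<theta>) <= K * (1 + abs x) ^ N"
  "!!x \<theta> \<theta>'. \<theta> : D ==> \<theta>' : D ==> abs (f x \<theta> - f x \<theta>') <= L * (1 + abs x) ^ P * dist \<theta> \<theta>'"
 shows "poly_lipschitz D f"
 unfolding poly_lipschitz_def poly_le_def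
proof (intro exI conjI ballI allI)
 have K: "K * (1 + abs x) ^ N <= (abs K + abs L) * (1 + abs x) ^ (N + P)" "L * (1 + abs x) ^ P <= (abs K + abs L) * (1 + abs x) ^ (N + P)" for x :: real
  by (intro mult_mono power_increasing; simp)+
 show "abs (f x \<theta>) <= (abs K + abs L) * (1 + abs x) ^ (N + P)" if "\<theta> : D" for x \<theta>
  using assms(2)[OF that] K(1) by (rule order_trans)
 show "abs (f x \<theta> - f x \<theta>') <= (abs K + abs L) * (1 + abs x) ^ (N + P) * dist \<theta> \<theta>'" if "\<theta> : D" "\<theta>' : D" for x \<theta> \<theta>'
  using assms(3)[OF that] mult_right_mono[OF K(2) zero_le_dist] by (rule order_trans)
qed (use assms(1) in auto)

lemma (in domination) dominated_poly_lipschitz: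
 assumes "poly_lipschitz D f" "!!i. i : S ==> abs (x i) + 1 <= U i" "!!i. i : S ==> \<theta> i : D" "!!i. i : S ==> \<theta>' i : D"
 shows "dominated S U (%_. 1) (%i. f (x i) (\<theta> i))"
  "dominated S U (%i. dist (\<theta> i) (\<theta>' i)) (%i. f (x i) (\<theta> i) - f (x i) (\<theta>' i))"
proof -
 obtain K N where K: "0 <= K" "!!x \<theta>. \<theta> : D ==> abs (f x \<theta>) <= K * (1 + abs x) ^ N"
  "!!x \<theta> \<theta>'. \<theta> : D ==> \<theta>' : D ==> abs (f x \<theta> - f x \<theta>') <= K * (1 + abs x) ^ N * dist \<theta> \<theta>'"
  using assms(1) unfolding poly_lipschitz_def poly_le_def by blast
 have le: "K * (1 + abs (x i)) ^ N <= K * U i ^ N" if "i : S" for i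
  using assms(2)[OF that] K(1) by (intro mult_left_mono power_mono) auto
 have "abs (f (x i) (\<theta> i)) <= K * U i ^ N" if "i : S" for i
  using K(2)[OF assms(3)[OF that]] le[OF that] by (rule order_trans)
 then show "dominated S U (%_. 1) (%i. f (x i) (\<theta> i))"
  unfolding dominated_def using K(1) by (intro exI[of _ K] exI[of _ N]) auto
 have "abs (f (x i) (\<theta> i) - f (x i) (\<theta>' i)) <= K * U i ^ N * dist (\<theta> i) (\<theta>' i)" if "i : S" for i
  using K(3)[OF assms(3,4)[OF that]] mult_right_mono[OF le[OF that] zero_le_dist] by (rule order_trans)
 then show "dominated S U (%i. dist (\<theta> i) (\<theta>' i)) (%i. f (x i) (\<theta> i) - f (x i) (\<theta>' i))"
  unfolding dominated_def using K(1) by (intro exI[of _ K] exI[of _ N]) auto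
qed

text \<open>Read over triples of a state and two parameters, both bounds become instances of
  \<open>dominated\<close>, whose algebra then yields the closure properties.\<close>

lemma poly_lipschitz_dominated:
 "poly_lipschitz D f \<longleftrightarrow> (ALL \<theta>:D. (%x. f x \<theta>) : borel_measurable borel) &
  dominated (UNIV \<times> D \<times> D) (%i. 1 + abs (fst i)) (%_. 1) (%i. f (fst i) (fst (snd i))) &
  dominated (UNIV \<times> D \<times> D) (%i. 1 + abs (fst i)) (%i. dist (fst (snd i)) (snd (snd i))) (%i. f (fst i) (fst (snd i)) - f (fst i) (snd (snd i)))"
 (is "_ \<longleftrightarrow> ?m & ?A & ?B")
proof
 interpret domination "UNIV \<times> D \<times> D" "%i. 1 + abs (fst i) :: real" by unfold_locales auto
 assume f: "poly_lipschitz D f"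
 then show "?m & ?A & ?B"
  using dominated_poly_lipschitz[OF f, of fst "%i. fst (snd i)" "%i. snd (snd i)"] by (auto dest: poly_lipschitz_measurable)
next
 assume *: "?m & ?A & ?B"
 then obtain K N where A: "ALL i:UNIV \<times> D \<times> D. abs (f (fst i) (fst (snd i))) <= K * (1 + abs (fst i)) ^ N" unfolding dominated_def by auto
 obtain L P where B: "ALL i:UNIV \<times> D \<times> D. abs (f (fst i) (fst (snd i)) - f (fst i) (snd (snd i))) <= L * (1 + abs (fst i)) ^ P * dist (fst (snd i)) (snd (snd i))"
  using * unfolding dominated_def by auto
 have "abs (f x \<theta>) <= K * (1 + abs x) ^ N" "abs (f x \<theta> - f x \<theta>') <= L * (1 + abs x) ^ P * dist \<theta> \<theta>'" if "\<theta> : D" "\<theta>' : D" for x \<theta> \<theta>'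
  using A[rule_format, of "(x, \<theta>, \<theta>)"] B[rule_format, of "(x, \<theta>, \<theta>')"] that by auto
 with * show "poly_lipschitz D f" by (intro poly_lipschitzI) auto
qed

lemma poly_lipschitz_const:
 assumes "poly_le N K u"
 shows "poly_lipschitz D (%x \<theta>. u x)"
 using assms poly_le_nonneg[OF assms] unfolding poly_le_def by (intro poly_lipschitzI[where K=K and N=N and L=0 and P=0]) auto

lemma poly_lipschitz_add:
 assumes "poly_lipschitz D f" "poly_lipschitz D g"
 shows "poly_lipschitz D (%x \<theta>. f x \<theta> + g x \<theta>)"
proof -
 interpret domination "UNIV \<times> D \<times> D" "%i. 1 + abs (fst i) :: real" by unfold_locales auto
 show ?thesis
  using assms unfolding poly_lipschitz_dominated add_diff_add by (intro conjI ballI borel_measurable_add dominated_add) auto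
qed

lemma poly_lipschitz_mult:
 assumes f: "poly_lipschitz D f" and g: "poly_lipschitz D g"
 shows "poly_lipschitz D (%x \<theta>. f x \<theta> * g x \<theta>)"
proof -
 interpret domination "UNIV \<times> D \<times> D" "%i. 1 + abs (fst i) :: real" by unfold_locales auto
 have eq: "f x s * g x s - f x t * g x t = g x s * (f x s - f x t) + f x t * (g x s - g x t)" for x s t by (simp add: algebra_simps)
 have "dominated (UNIV \<times> D \<times> D) (%i. 1 + abs (fst i)) (%_. 1) (%i. f (fst i) (snd (snd i)))"
  using dominated_poly_lipschitz(1)[OF f, of fst "%i. snd (snd i)" "%i. snd (snd i)"] by auto
 then show ?thesis
  using f g unfolding poly_lipschitz_dominated eq by (intro conjI ballI borel_measurable_times dominated_add dominated_scale) auto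
qed

lemma poly_lipschitz_inverse:
 assumes f: "poly_lipschitz D f" and K: "!!x \<theta>. \<theta> : D ==> f x \<theta> ~= 0 & abs (inverse (f x \<theta>)) <= K * (1 + abs x) ^ N"
 shows "poly_lipschitz D (%x \<theta>. inverse (f x \<theta>))"
proof -
 interpret domination "UNIV \<times> D \<times> D" "%i. 1 + abs (fst i) :: real" by unfold_locales auto
 have 1: "dominated (UNIV \<times> D \<times> D) (%i. 1 + abs (fst i)) (%_. 1) (%i. inverse (f (fst i) (t (snd i))))" if "!!i. i : D \<times> D ==> t i : D" for t
  unfolding dominated_def
 proof (intro exI[of _ "abs K"] exI[of _ N] conjI ballI)
  fix i :: "real \<times> 'a \<times> 'a" assume "i : UNIV \<times> D \<times> D"
  then have "abs (inverse (f (fst i) (t (snd i)))) <= K * (1 + abs (fst i)) ^ N" using that K by auto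
  also have "... <= abs K * (1 + abs (fst i)) ^ N" by (intro mult_right_mono) auto
  finally show "abs (inverse (f (fst i) (t (snd i)))) <= abs K * (1 + abs (fst i)) ^ N * 1" by simp
 qed auto
 have "dominated (UNIV \<times> D \<times> D) (%i. 1 + abs (fst i)) (%i. dist (fst (snd i)) (snd (snd i)))
   (%i. inverse (f (fst i) (fst (snd i))) * (inverse (f (fst i) (snd (snd i))) * (f (fst i) (fst (snd i)) - f (fst i) (snd (snd i)))))"
  using f unfolding poly_lipschitz_dominated by (intro dominated_scale 1) auto
 then have "dominated (UNIV \<times> D \<times> D) (%i. 1 + abs (fst i)) (%i. dist (fst (snd i)) (snd (snd i)))
   (%i. inverse (f (fst i) (fst (snd i))) - inverse (f (fst i) (snd (snd i))))"
 proof (rule dominated_le[where C=1])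
  fix i :: "real \<times> 'a \<times> 'a" assume "i : UNIV \<times> D \<times> D"
  then have "f (fst i) (fst (snd i)) ~= 0" "f (fst i) (snd (snd i)) ~= 0" using K by auto
  then show "abs (inverse (f (fst i) (fst (snd i))) - inverse (f (fst i) (snd (snd i)))) <=
   1 * abs (inverse (f (fst i) (fst (snd i))) * (inverse (f (fst i) (snd (snd i))) * (f (fst i) (fst (snd i)) - f (fst i) (snd (snd i)))))"
   by (subst inverse_diff_inverse) (auto simp: abs_mult)
 qed
 then show ?thesis
  using f 1[of fst] unfolding poly_lipschitz_dominated by auto
qed

text \<open>McShane's extension in the parameter makes the composition with a random parameter a countable infimum.\<close>

lemma poly_lipschitz_compose_measurable:
 fixes D :: "'b::euclidean_space set"
 assumes f: "poly_lipschitz D f" and Y [measurable]: "Y : borel_measurable M" and \<theta> [measurable]: "\<theta> : borel_measurable M"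
  and D: "!!w. w : space M ==> \<theta> w : D"
 shows "(%w. f (Y w) (\<theta> w)) : borel_measurable M"
proof (cases "space M = {}")
 case True
 then show ?thesis by (auto simp: measurable_def)
next
 case False
 obtain K N where K: "K >= 0" and fK: "!!\<theta>. \<theta> : D ==> poly_le N K (%x. f x \<theta>)"
  and l: "!!x \<theta> \<theta>'. \<theta> : D ==> \<theta>' : D ==> abs (f x \<theta> - f x \<theta>') <= K * (1 + abs x) ^ N * dist \<theta> \<theta>'"
  using f unfolding poly_lipschitz_def by blast
 obtain T where T: "countable T" "T \<subseteq> D" "D \<subseteq> closure T" using separable by blast
 have T0: "T ~= {}" using False D T(3) by fastforce
 \<comment> \<open>The same number serves as Lipschitz constant in the parameter and as bound of
   \<open>f\<close>; the latter keeps the infimum finite.\<close>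
 define W where "W w = K * (1 + abs (Y w)) ^ N" for w
 have W: "W w >= 0" for w using K by (simp add: W_def)
 have bound: "- W w <= f (Y w) d + W w * dist (\<theta> w) d" if "d : T" for d w
 proof -
  have "abs (f (Y w) d) <= W w" using fK[of d] that T(2) by (auto simp: W_def poly_le_def)
  moreover have "0 <= W w * dist (\<theta> w) d" using W[of w] by simp
  ultimately show ?thesis by linarith
 qed
 then have bdd: "bdd_below ((%d. f (Y w) d + W w * dist (\<theta> w) d) ` T)" for w
  by (intro bdd_belowI2[of _ "- W w"])
 have "(%w. INF d\<in>T. f (Y w) d + W w * dist (\<theta> w) d) : borel_measurable M"
 proof (rule borel_measurable_cINF)
  fix d assume "d : T"
  then have [measurable]: "(%x. f x d) : borel_measurable borel" using poly_lipschitz_measurable[OF f] T(2) by blast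
  show "(%w. f (Y w) d + W w * dist (\<theta> w) d) : borel_measurable M" unfolding W_def by measurable
 qed (use T bdd in auto)
 also have "?this \<longleftrightarrow> (%w. f (Y w) (\<theta> w)) : borel_measurable M"
 proof (rule measurable_cong)
  fix w assume w: "w : space M"
  have le: "abs (f (Y w) (\<theta> w) - f (Y w) d) <= W w * dist (\<theta> w) d" if "d : T" for d
   using l[OF D[OF w], of d "Y w"] that T(2) by (auto simp: W_def)
  show "(INF d\<in>T. f (Y w) d + W w * dist (\<theta> w) d) = f (Y w) (\<theta> w)"
  proof (rule antisym)
   show "f (Y w) (\<theta> w) <= (INF d\<in>T. f (Y w) d + W w * dist (\<theta> w) d)"
    using le T0 by (intro cINF_greatest) (fastforce simp: abs_le_iff)+
   show "(INF d\<in>T. f (Y w) d + W w * dist (\<theta> w) d) <= f (Y w) (\<theta> w)"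
   proof (rule field_le_epsilon)
    fix e :: real assume e: "e > 0"
    have "\<theta> w : closure T" using D[OF w] T(3) by blast
    then obtain d where d: "d : T" "dist d (\<theta> w) < e / (2 * (W w + 1))"
     using e W[of w] unfolding closure_approachable by (metis add_nonneg_pos divide_pos_pos mult_pos_pos zero_less_numeral zero_less_one)
    have "(INF d\<in>T. f (Y w) d + W w * dist (\<theta> w) d) <= f (Y w) d + W w * dist (\<theta> w) d"
     by (rule cINF_lower[OF bdd d(1)])
    moreover have "dist (\<theta> w) d * (2 * (W w + 1)) <= e" using d(2) W[of w] e by (simp add: dist_commute field_simps)
    then have "2 * (W w * dist (\<theta> w) d) <= e" using zero_le_dist[of "\<theta> w" d] by (simp only: algebra_simps)
    ultimately show "(INF d\<in>T. f (Y w) d + W w * dist (\<theta> w) d) <= f (Y w) (\<theta> w) + e" using le[OF d(1)] by linarith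
   qed
  qed
 qed
 finally show ?thesis .
qed

section \<open>First-order expansion at a parameter\<close>

text \<open>An expansion at the single point \<open>c\<close> with some coefficients
  \<open>F\<close>. In this form it survives products and inverses and remains meaningful when the
  other parameter lies on the boundary of the set.\<close>

definition taylor_at :: "(real ^ 'n) set => real ^ 'n => (real => real ^ 'n::finite => real) => bool" where
 "taylor_at D c f \<longleftrightarrow> poly_lipschitz D f & (EX F. (ALL i. EX N A. poly_le N A (F i)) &
   dominated (UNIV \<times> D) (%p. 1 + abs (fst p)) (%p. (dist (snd p) c)^2)
    (%p. f (fst p) (snd p) - f (fst p) c - (\<Sum>i\<in>UNIV. (snd p - c) $ i * F i (fst p))))"

lemma poly_le_poly_lipschitz: "(EX N A. poly_le N A u) \<longleftrightarrow> poly_lipschitz (UNIV :: real set) (%x _. u x)"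
proof
 assume "poly_lipschitz (UNIV :: real set) (%x _. u x)"
 then show "EX N A. poly_le N A u" unfolding poly_lipschitz_def by blast
qed (auto intro: poly_lipschitz_const)

lemma poly_lipschitz_at: "poly_lipschitz D f ==> c : D ==> EX N A. poly_le N A (%x. f x c)"
 unfolding poly_lipschitz_def by blast

lemma poly_le_closed:
 assumes "EX N A. poly_le N A u" "EX N A. poly_le N A v"
 shows "EX N A. poly_le N A (%x. u x + v x)" "EX N A. poly_le N A (%x. u x * v x)"
 using assms unfolding poly_le_poly_lipschitz by (auto intro: poly_lipschitz_add poly_lipschitz_mult)

context
 fixes D :: "(real ^ 'n::finite) set" and c
 assumes c: "c : D"
begin

interpretation domination "UNIV \<times> D" "%p. 1 + abs (fst p)" by unfold_locales auto

abbreviation "dm \<equiv> dominated (UNIV \<times> D) (%p. 1 + abs (fst p))"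

lemma taylor_dominated:
 assumes f: "poly_lipschitz D f"
 shows "dm (%_. 1) (%p. f (fst p) (snd p))" "dm (%_. 1) (%p. f (fst p) c)" "dm (%p. dist (snd p) c) (%p. f (fst p) (snd p) - f (fst p) c)"
 using dominated_poly_lipschitz[OF f, of fst snd "%_. c"] dominated_poly_lipschitz(1)[OF f, of fst "%_. c" "%_. c"] c by auto

lemma taylor_at_const: "EX N A. poly_le N A u ==> taylor_at D c (%x _. u x)"
 unfolding taylor_at_def
 by (intro conjI exI[of _ "%_ _. 0"]) (auto intro: poly_lipschitz_const dominated_self[where C=0] intro!: exI[of _ 0] simp: poly_le_def)

lemma taylor_at_add:
 assumes "taylor_at D c f" "taylor_at D c g"
 shows "taylor_at D c (%x \<gamma>. f x \<gamma> + g x \<gamma>)"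
proof -
 obtain F where F: "ALL i. EX N A. poly_le N A (F i)" "dm (%p. (dist (snd p) c)^2) (%p. f (fst p) (snd p) - f (fst p) c - (\<Sum>i\<in>UNIV. (snd p - c) $ i * F i (fst p)))"
  using assms(1) unfolding taylor_at_def by blast
 obtain G where G: "ALL i. EX N A. poly_le N A (G i)" "dm (%p. (dist (snd p) c)^2) (%p. g (fst p) (snd p) - g (fst p) c - (\<Sum>i\<in>UNIV. (snd p - c) $ i * G i (fst p)))"
  using assms(2) unfolding taylor_at_def by blast
 show ?thesis
  unfolding taylor_at_def
 proof (intro conjI exI[of _ "%i x. F i x + G i x"] allI)
  show "dm (%p. (dist (snd p) c)^2) (%p. f (fst p) (snd p) + g (fst p) (snd p) - (f (fst p) c + g (fst p) c) - (\<Sum>i\<in>UNIV. (snd p - c) $ i * (F i (fst p) + G i (fst p))))"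
   by (rule dominated_le[OF dominated_add[OF F(2) G(2)], where C=1]) (simp add: algebra_simps sum.distrib sum_subtractf)
 qed (use assms F(1) G(1) in "auto simp: taylor_at_def intro: poly_lipschitz_add poly_le_closed")
qed

lemma taylor_at_mult:
 assumes "taylor_at D c f" "taylor_at D c g"
 shows "taylor_at D c (%x \<gamma>. f x \<gamma> * g x \<gamma>)"
proof -
 obtain F where F: "ALL i. EX N A. poly_le N A (F i)" "dm (%p. (dist (snd p) c)^2) (%p. f (fst p) (snd p) - f (fst p) c - (\<Sum>i\<in>UNIV. (snd p - c) $ i * F i (fst p)))"
  using assms(1) unfolding taylor_at_def by blast
 obtain G where G: "ALL i. EX N A. poly_le N A (G i)" "dm (%p. (dist (snd p) c)^2) (%p. g (fst p) (snd p) - g (fst p) c - (\<Sum>i\<in>UNIV. (snd p - c) $ i * G i (fst p)))"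
  using assms(2) unfolding taylor_at_def by blast
 have pl: "poly_lipschitz D f" "poly_lipschitz D g" using assms by (auto simp: taylor_at_def)
 note f = taylor_dominated[OF pl(1)] and g = taylor_dominated[OF pl(2)]
 show ?thesis
  unfolding taylor_at_def
 proof (intro conjI exI[of _ "%i x. f x c * G i x + g x c * F i x"] allI)
  have "dm (%p. (dist (snd p) c)^2) (%p. (f (fst p) c * (g (fst p) (snd p) - g (fst p) c - (\<Sum>i\<in>UNIV. (snd p - c) $ i * G i (fst p))) +
   g (fst p) c * (f (fst p) (snd p) - f (fst p) c - (\<Sum>i\<in>UNIV. (snd p - c) $ i * F i (fst p)))) + (f (fst p) (snd p) - f (fst p) c) * (g (fst p) (snd p) - g (fst p) c))"
   by (rule dominated_add[OF dominated_add[OF dominated_scale[OF f(2) G(2)] dominated_scale[OF g(2) F(2)]] dominated_mult[OF f(3) g(3), folded power2_eq_square]])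
  then show "dm (%p. (dist (snd p) c)^2) (%p. f (fst p) (snd p) * g (fst p) (snd p) - f (fst p) c * g (fst p) c -
   (\<Sum>i\<in>UNIV. (snd p - c) $ i * (f (fst p) c * G i (fst p) + g (fst p) c * F i (fst p))))"
   by (rule dominated_le[where C=1]) (simp add: algebra_simps sum.distrib sum_subtractf sum_distrib_left)
  show "EX N A. poly_le N A (%x. f x c * G i x + g x c * F i x)" for i
   using F(1) G(1) poly_lipschitz_at[OF pl(1) c] poly_lipschitz_at[OF pl(2) c] by (intro poly_le_closed) auto
 qed (intro poly_lipschitz_mult pl)
qed

lemma taylor_at_inverse:
 assumes f: "taylor_at D c f" and i: "poly_lipschitz D (%x \<gamma>. inverse (f x \<gamma>))" and f0: "!!x \<gamma>. \<gamma> : D ==> f x \<gamma> ~= 0"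
 shows "taylor_at D c (%x \<gamma>. inverse (f x \<gamma>))"
proof -
 let ?j = "%x \<gamma>. inverse (f x \<gamma>)"
 obtain F where F: "ALL i. EX N A. poly_le N A (F i)" "dm (%p. (dist (snd p) c)^2) (%p. f (fst p) (snd p) - f (fst p) c - (\<Sum>i\<in>UNIV. (snd p - c) $ i * F i (fst p)))"
  using f unfolding taylor_at_def by blast
 have pl: "poly_lipschitz D f" using f by (auto simp: taylor_at_def)
 note d = taylor_dominated[OF pl] and j = taylor_dominated[OF i]
 show ?thesis
  unfolding taylor_at_def
 proof (intro conjI exI[of _ "%i x. - 1 * (?j x c * ?j x c * F i x)"] allI i)
  have "dm (%p. (dist (snd p) c)^2) (%p. ?j (fst p) c * ((?j (fst p) (snd p) - ?j (fst p) c) * (f (fst p) (snd p) - f (fst p) c)) +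
   ?j (fst p) c * (?j (fst p) c * (f (fst p) (snd p) - f (fst p) c - (\<Sum>i\<in>UNIV. (snd p - c) $ i * F i (fst p)))))"
   by (rule dominated_add[OF dominated_scale[OF j(2) dominated_mult[OF j(3) d(3), folded power2_eq_square]] dominated_scale[OF j(2) dominated_scale[OF j(2) F(2)]]])
  then show "dm (%p. (dist (snd p) c)^2) (%p. ?j (fst p) (snd p) - ?j (fst p) c - (\<Sum>i\<in>UNIV. (snd p - c) $ i * (- 1 * (?j (fst p) c * ?j (fst p) c * F i (fst p)))))"
  proof (rule dominated_le[where C=1])
   fix p :: "real \<times> (real ^ 'n)" assume "p : UNIV \<times> D"
   then have nz: "f (fst p) (snd p) ~= 0" "f (fst p) c ~= 0" using f0 c by auto
   define L where "L = (\<Sum>i\<in>UNIV. (snd p - c) $ i * F i (fst p))"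
   have "(\<Sum>i\<in>UNIV. (snd p - c) $ i * (- 1 * (?j (fst p) c * ?j (fst p) c * F i (fst p)))) = - (?j (fst p) c * ?j (fst p) c * L)"
    by (simp add: L_def sum_distrib_left sum_negf mult_ac)
   moreover have "?j (fst p) (snd p) - ?j (fst p) c + ?j (fst p) c * ?j (fst p) c * L =
    - (?j (fst p) c * ((?j (fst p) (snd p) - ?j (fst p) c) * (f (fst p) (snd p) - f (fst p) c)) + ?j (fst p) c * (?j (fst p) c * (f (fst p) (snd p) - f (fst p) c - L)))"
    using nz by (simp add: field_simps)
   ultimately show "abs (?j (fst p) (snd p) - ?j (fst p) c - (\<Sum>i\<in>UNIV. (snd p - c) $ i * (- 1 * (?j (fst p) c * ?j (fst p) c * F i (fst p))))) <=
    1 * abs (?j (fst p) c * ((?j (fst p) (snd p) - ?j (fst p) c) * (f (fst p) (snd p) - f (fst p) c)) +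
    ?j (fst p) c * (?j (fst p) c * (f (fst p) (snd p) - f (fst p) c - (\<Sum>i\<in>UNIV. (snd p - c) $ i * F i (fst p)))))"
    unfolding L_def[symmetric] by simp
  qed
  show "EX N A. poly_le N A (%x. - 1 * (?j x c * ?j x c * F i x))" for i
   using F(1) poly_lipschitz_at[OF assms(2) c] by (intro poly_le_closed(2)) (auto intro!: exI[of _ 0] exI[of _ 1] simp: poly_le_def)
 qed
qed

end

section \<open>Fluctuations along estimated parameters\<close>

context prob_space
begin

text \<open>The error is an arbitrarily small multiple of a bounded sequence. The factor
  \<open>r\<close> is chosen after the bound of \<open>B\<close>, and \<open>V\<close> may depend on
  \<open>r\<close>, as it does when a net of mesh depending on \<open>r\<close> is used.\<close>

lemma vanish_in_prob_approx:
 assumes B: "bounded_in_prob M B"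
  and V: "!!r. r > 0 ==> EX V. vanish_in_prob M V & (\<forall>\<^sub>F n in sequentially. ALL w:space M. abs (Y n w) <= abs (V n w) + r * abs (B n w))"
 shows "vanish_in_prob M Y"
 unfolding vanish_in_prob_def
proof (intro allI impI)
 fix e :: real assume "e > 0"
 then have e: "e / 2 > 0" by simp
 obtain b where b: "\<forall>\<^sub>F n in sequentially. likely M (e / 2) (%w. abs (B n w) <= b)" using B e unfolding bounded_in_prob_def by blast
 define r where "r = e / 2 / (abs b + 1)"
 have r: "r > 0" "r * abs b <= e / 2" using e by (auto simp: r_def field_simps)
 obtain V where V: "vanish_in_prob M V" "\<forall>\<^sub>F n in sequentially. ALL w:space M. abs (Y n w) <= abs (V n w) + r * abs (B n w)" using V[OF r(1)] by blast
 have "\<forall>\<^sub>F n in sequentially. likely M (e / 2) (%w. abs (V n w) <= e / 2)" using V(1) e unfolding vanish_in_prob_def by blast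
 then show "\<forall>\<^sub>F n in sequentially. likely M e (%w. abs (Y n w) <= e)"
  using b V(2)
 proof eventually_elim
  case (elim n)
  show ?case
  proof (rule likely_mono[OF likely_conj[OF elim(1,2)]])
   fix w assume w: "w : space M" "abs (V n w) <= e / 2 & abs (B n w) <= b"
   then have "r * abs (B n w) <= r * abs b" using r(1) by (intro mult_left_mono) auto
   then show "abs (Y n w) <= e" using elim(3) w r(2) by fastforce
  qed simp
 qed
qed

section \<open>Linear fluctuations with mean-square order \<open>1 / v\<close>\<close>

context
 fixes Z :: "nat => (real => real) => 'a => real" and v :: "nat => real"
 assumes v: "filterlim v at_top sequentially"
  and lin': "ALL n N A N' B u wt c w. poly_le N A u --> poly_le N' B wt --> Z n (%y. u y + c * wt y) w = Z n u w + c * Z n wt w"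
  and L2: "!!N. EX C. \<forall>\<^sub>F n in sequentially. ALL A u. poly_le N A u -->
   integrable M (%w. (Z n u w)^2) & v n * (LINT w|M. (Z n u w)^2) <= C * A^2"
  and dom: "!!N. EX B. bounded_in_prob M B & (\<forall>\<^sub>F n in sequentially. ALL A u. ALL w:space M. poly_le N A u --> abs (Z n u w) <= A * abs (B n w))"
begin

lemmas lin = lin'[rule_format]

text \<open>The mean-square assumption \<open>L2\<close> concerns deterministic functions only and
  gives the rate for each of them. Functions that depend on the sample point are reached through
  linearity and the pathwise bound \<open>dom\<close>.\<close>

lemma fluctuation_bounded:
 assumes "EX N A. poly_le N A u"
 shows "bounded_in_prob M (%n w. sqrt (v n) * Z n u w)"
proof -
 obtain N A where u: "poly_le N A u" using assms by blast
 obtain C where C: "\<forall>\<^sub>F n in sequentially. ALL A u. poly_le N A u --> integrable M (%w. (Z n u w)^2) & v n * (LINT w|M. (Z n u w)^2) <= C * A^2"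
  using L2 by blast
 have v0: "\<forall>\<^sub>F n in sequentially. v n >= 0" using v by (auto simp: filterlim_at_top)
 have "bounded_in_prob M (%n w. 1 + v n * (Z n u w)^2)"
 proof (rule bounded_in_prob_L1[where C="1 + C * A^2"], use C v0 in eventually_elim)
  case (elim n)
  then have i: "integrable M (%w. (Z n u w)^2)" "v n * (LINT w|M. (Z n u w)^2) <= C * A^2" using u by blast+
  have "(LINT w|M. abs (1 + v n * (Z n u w)^2)) = (LINT w|M. 1 + v n * (Z n u w)^2)" using elim(2) by simp
  then show ?case using i by (simp add: prob_space)
 qed
 then show ?thesis
 proof (rule bounded_in_prob_mono, use v0 in eventually_elim, intro ballI)
  fix n w assume v: "v n >= 0"
  have "abs y <= 1 + y^2" for y :: real using sum_squares_bound[of "abs y" 1] zero_le_power2[of y] by simp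
  from this[of "sqrt (v n) * Z n u w"] show "abs (sqrt (v n) * Z n u w) <= abs (1 + v n * (Z n u w)^2)" using v by (simp add: power_mult_distrib)
 qed
qed

lemma fluctuation_vanish:
 assumes "EX N A. poly_le N A u"
 shows "vanish_in_prob M (%n w. Z n u w)"
proof -
 have "(%n. 1 / sqrt (v n)) \<longlonglongrightarrow> 0"
  by (intro tendsto_divide_0[OF tendsto_const] filterlim_at_top_imp_at_infinity filterlim_compose[OF sqrt_at_top v])
 note vm = vanish_in_prob_mult[OF fluctuation_bounded[OF assms] vanish_in_prob_tendsto[OF this]]
 have "\<forall>\<^sub>F n in sequentially. v n > 0" using v by (auto simp: filterlim_at_top_dense)
 then show ?thesis by (intro vanish_in_prob_mono[OF vm]) (auto elim!: eventually_mono)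
qed

text \<open>Finitely many balls cover the closure. At their centres, which lie in \<open>D\<close>,
  the fluctuation vanishes; the difference to a nearby parameter has polynomial size at most
  \<open>r\<close>, and \<open>dom\<close> controls it pathwise.\<close>

lemma uniform_law:
 fixes D :: "(real ^ 'n::finite) set"
 assumes f: "poly_lipschitz D f" and D: "bounded D" and \<gamma>: "!!n w. w : space M ==> \<gamma> n w : D"
 shows "vanish_in_prob M (%n w. Z n (%x. f x (\<gamma> n w)) w)"
proof -
 obtain K N where K: "K >= 0" and fK: "ALL \<theta>:D. poly_le N K (%x. f x \<theta>)"
  and l: "ALL x. ALL \<theta>:D. ALL \<theta>':D. abs (f x \<theta> - f x \<theta>') <= K * (1 + abs x) ^ N * dist \<theta> \<theta>'"
  using f unfolding poly_lipschitz_def by blast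
 obtain B where B: "bounded_in_prob M B" "\<forall>\<^sub>F n in sequentially. ALL A u. ALL w:space M. poly_le N A u --> abs (Z n u w) <= A * abs (B n w)" using dom by blast
 show ?thesis
 proof (rule vanish_in_prob_approx[OF B(1)])
  fix r :: real assume r: "r > 0"
  define s where "s = r / (K + 1)"
  have s: "s > 0" "K * s <= r" using r K by (auto simp: s_def field_simps)
  have "closure D \<subseteq> (\<Union>\<theta>\<in>D. ball \<theta> s)"
  proof
   fix x assume "x : closure D"
   then show "x : (\<Union>\<theta>\<in>D. ball \<theta> s)" using s(1) unfolding closure_approachable by (auto simp: dist_commute)
  qed
  moreover have "compact (closure D)" using D by (rule compact_closure[THEN iffD2])
  ultimately obtain T where T: "T \<subseteq> D" "finite T" "closure D \<subseteq> (\<Union>\<theta>\<in>T. ball \<theta> s)" by (elim compactE_image[of _ D "%\<theta>. ball \<theta> s"]) auto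
  let ?V = "%n w. \<Sum>\<theta>\<in>T. abs (Z n (%x. f x \<theta>) w)"
  have "\<forall>\<^sub>F n in sequentially. ALL w:space M. abs (Z n (%x. f x (\<gamma> n w)) w) <= abs (?V n w) + r * abs (B n w)"
   using B(2)
  proof (eventually_elim, intro ballI)
   fix n w assume d: "ALL A u. ALL w:space M. poly_le N A u --> abs (Z n u w) <= A * abs (B n w)" and w: "w : space M"
   note g = \<gamma>[OF w, of n]
   obtain \<theta> where \<theta>: "\<theta> : T" "dist \<theta> (\<gamma> n w) < s" using T(3) g closure_subset[of D] by fastforce
   then have \<theta>D: "\<theta> : D" using T(1) by blast
   note p = poly_lipschitz_diff[OF fK l g \<theta>D]
   have eq: "Z n (%x. f x (\<gamma> n w)) w = Z n (%x. f x \<theta>) w + Z n (%x. f x (\<gamma> n w) - f x \<theta>) w"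
    using lin[OF fK[rule_format, OF \<theta>D] p, of n 1 w] by simp
   have "abs (Z n (%x. f x (\<gamma> n w) - f x \<theta>) w) <= (K * dist (\<gamma> n w) \<theta>) * abs (B n w)" using d p w by blast
   also have "... <= r * abs (B n w)"
    using order_trans[OF mult_left_mono[OF less_imp_le[OF \<theta>(2)] K] s(2)] by (intro mult_right_mono) (auto simp: dist_commute)
   moreover have "abs (Z n (%x. f x \<theta>) w) <= ?V n w" using T(2) \<theta>(1) by (intro member_le_sum) auto
   ultimately show "abs (Z n (%x. f x (\<gamma> n w)) w) <= abs (?V n w) + r * abs (B n w)" unfolding eq by linarith
  qed
  moreover have "vanish_in_prob M ?V"
   using T(1) fK by (intro vanish_in_prob_sum vanish_in_prob_abs fluctuation_vanish) blast
  ultimately show "EX V. vanish_in_prob M V & (\<forall>\<^sub>F n in sequentially. ALL w:space M. abs (Z n (%x. f x (\<gamma> n w)) w) <= abs (V n w) + r * abs (B n w))" by blast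
 qed
qed

lemma lin_sum:
 assumes "finite I" "!!i. i : I ==> EX N A. poly_le N A (F i)" "poly_le N A u"
 shows "(EX N A. poly_le N A (%x. u x + (\<Sum>i\<in>I. c i * F i x))) & Z n (%x. u x + (\<Sum>i\<in>I. c i * F i x)) w = Z n u w + (\<Sum>i\<in>I. c i * Z n (F i) w)"
 using assms(1,2)
proof (induction I)
 case (insert i I)
 then obtain N A N' B where p: "poly_le N A (%x. u x + (\<Sum>i\<in>I. c i * F i x))" "poly_le N' B (F i)" by blast
 have eq: "(%x. u x + (\<Sum>i\<in>insert i I. c i * F i x)) = (%x. (u x + (\<Sum>i\<in>I. c i * F i x)) + c i * F i x)"
  using insert.hyps by (simp add: add_ac)
 have "EX N A. poly_le N A (%_. c i)" by (intro exI[of _ 0] exI[of _ "abs (c i)"]) (simp add: poly_le_def)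
 then have "EX N A. poly_le N A (%x. (u x + (\<Sum>i\<in>I. c i * F i x)) + c i * F i x)"
  by (rule poly_le_closed(1)[OF _ poly_le_closed(2), rotated]) (use p in blast)+
 moreover have "Z n (%x. (u x + (\<Sum>i\<in>I. c i * F i x)) + c i * F i x) w = Z n (%x. u x + (\<Sum>i\<in>I. c i * F i x)) w + c i * Z n (F i) w"
  by (rule lin[OF p])
 ultimately show ?case unfolding eq using insert by simp
qed (use assms(3) in auto)

text \<open>The linear part of the expansion contributes \<open>\<surd>v |\<gamma>\<^sub>n - c|\<close> times a vanishing factor, which the
 identifiability condition can absorb; so no control of the fluctuations uniformly in the parameter
 at rate \<open>\<surd>v\<close> is needed.\<close>

lemma taylor_fluctuation:
 fixes D :: "(real ^ 'n::finite) set"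
 assumes f: "taylor_at D c f" and c: "c : D" and \<gamma>: "!!n w. w : space M ==> \<gamma> n w : D" and d: "vanish_in_prob M (%n w. dist (\<gamma> n w) c)"
 shows "EX B V. bounded_in_prob M B & vanish_in_prob M V &
  (\<forall>\<^sub>F n in sequentially. ALL w:space M. abs (sqrt (v n) * Z n (%x. f x (\<gamma> n w)) w) <= abs (B n w) + abs (V n w) * (sqrt (v n) * dist (\<gamma> n w) c))"
proof -
 obtain F where F: "!!i. EX N A. poly_le N A (F i)" and
  R: "dominated (UNIV \<times> D) (%p. 1 + abs (fst p)) (%p. (dist (snd p) c)^2) (%p. f (fst p) (snd p) - f (fst p) c - (\<Sum>i\<in>UNIV. (snd p - c) $ i * F i (fst p)))"
  and pl: "poly_lipschitz D f" using f unfolding taylor_at_def by blast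
 obtain K N where K: "0 <= K" "!!x \<gamma>. \<gamma> : D ==> abs (f x \<gamma> - f x c - (\<Sum>i\<in>UNIV. (\<gamma> - c) $ i * F i x)) <= K * (1 + abs x) ^ N * (dist \<gamma> c)^2"
  using R unfolding dominated_def by auto
 obtain B where B: "bounded_in_prob M B" "\<forall>\<^sub>F n in sequentially. ALL A u. ALL w:space M. poly_le N A u --> abs (Z n u w) <= A * abs (B n w)" using dom by blast
 let ?f0 = "%x. f x c" and ?g = "%n w. dist (\<gamma> n w) c"
 let ?V = "%n w. (\<Sum>i\<in>UNIV. abs (Z n (F i) w)) + K * abs (B n w) * ?g n w"
 note f0 = poly_lipschitz_at[OF pl c]
 have V: "vanish_in_prob M ?V"
  by (intro vanish_in_prob_add vanish_in_prob_sum vanish_in_prob_abs fluctuation_vanish F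
   vanish_in_prob_mult[OF bounded_in_prob_mult[OF bounded_in_prob_const bounded_in_prob_abs[OF B(1)]] d])
 have "\<forall>\<^sub>F n in sequentially. v n >= 0" using v by (auto simp: filterlim_at_top)
 with B(2) have "\<forall>\<^sub>F n in sequentially. ALL w:space M. abs (sqrt (v n) * Z n (%x. f x (\<gamma> n w)) w) <= abs (sqrt (v n) * Z n ?f0 w) + abs (?V n w) * (sqrt (v n) * ?g n w)"
 proof (eventually_elim, intro ballI)
  fix n w assume dm: "ALL A u. ALL w:space M. poly_le N A u --> abs (Z n u w) <= A * abs (B n w)" and vn: "v n >= 0" and w: "w : space M"
  let ?\<gamma> = "\<gamma> n w"
  let ?a = "%i. (?\<gamma> - c) $ i"
  \<comment> \<open>\<open>S\<close> is the affine part of the expansion at the current parameter.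
    Its coefficients are random, but linearity takes them out pathwise; the rest has size quadratic
    in the distance and is left to \<open>dom\<close>.\<close>
  define S where "S x = ?f0 x + (\<Sum>i\<in>UNIV. ?a i * F i x)" for x
  obtain N' A where f0': "poly_le N' A ?f0" using f0 by blast
  note ls = lin_sum[where I=UNIV and F=F and c="?a" and n=n and w=w, OF finite F f0', folded S_def]
  then obtain N'' A' where Sp: "poly_le N'' A' S" by blast
  have "abs (f x ?\<gamma> - S x) <= K * (?g n w)^2 * (1 + abs x) ^ N" for x
   using K(2)[OF \<gamma>[OF w, of n], of x] unfolding S_def diff_diff_eq by (simp only: mult_ac)
  then have Rp: "poly_le N (K * (?g n w)^2) (%x. f x ?\<gamma> - S x)"
   using Sp poly_lipschitz_measurable[OF pl \<gamma>[OF w, of n]] by (auto simp: poly_le_def intro!: borel_measurable_diff)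
  have "Z n (%x. f x ?\<gamma>) w = Z n S w + Z n (%x. f x ?\<gamma> - S x) w" using lin[OF Sp Rp, of n 1 w] by simp
  also have "Z n S w = Z n ?f0 w + (\<Sum>i\<in>UNIV. ?a i * Z n (F i) w)" using ls by blast
  finally have "abs (Z n (%x. f x ?\<gamma>) w) <= abs (Z n ?f0 w) + abs (\<Sum>i\<in>UNIV. ?a i * Z n (F i) w) + abs (Z n (%x. f x ?\<gamma> - S x) w)" by linarith
  moreover have "abs (\<Sum>i\<in>UNIV. ?a i * Z n (F i) w) <= (\<Sum>i\<in>UNIV. ?g n w * abs (Z n (F i) w))"
   using component_le_norm_cart[of "?\<gamma> - c"] by (intro order_trans[OF sum_abs] sum_mono) (simp add: abs_mult dist_norm mult_right_mono)
  moreover have "abs (Z n (%x. f x ?\<gamma> - S x) w) <= K * (?g n w)^2 * abs (B n w)" using dm Rp w by blast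
  ultimately have "abs (Z n (%x. f x ?\<gamma>) w) <= abs (Z n ?f0 w) + ?V n w * ?g n w"
   by (simp add: distrib_left power2_eq_square mult_ac flip: sum_distrib_left)
  also have "... <= abs (Z n ?f0 w) + abs (?V n w) * ?g n w" by (intro add_left_mono mult_right_mono) auto
  finally show "abs (sqrt (v n) * Z n (%x. f x ?\<gamma>) w) <= abs (sqrt (v n) * Z n ?f0 w) + abs (?V n w) * (sqrt (v n) * ?g n w)"
   using mult_left_mono[of _ _ "sqrt (v n)"] vn by (fastforce simp: abs_mult distrib_left mult.left_commute)
 qed
 with V fluctuation_bounded[OF f0] show ?thesis by (intro exI[of _ "%n w. sqrt (v n) * Z n ?f0 w"] exI[of _ ?V]) blast
qed

end

end

locale sampled_sde = ergodic_sde M F J X g L a0 La P \<pi>0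
 for M :: "'w measure" and F J X g L a0 La P \<pi>0 +
 fixes h :: "nat => real"
 assumes h_pos: "!!n. h n > 0" and h_le: "\<forall>\<^sub>F n in sequentially. h n <= 1 & 1 <= real n * h n"

section \<open>Smooth coefficients and their boundary values\<close>

text \<open>The way from \<open>y\<close> to \<open>y'\<close> changes one coordinate after the
  other. It stays in \<open>B\<close> because \<open>B\<close> is a product of convex sets, so
  derivatives along the axes suffice.\<close>

lemma coordinate_lipschitz:
 fixes F :: "real ^ 'n::finite => real" and A :: "'n => real set"
 defines "B \<equiv> {y. ALL k. y $ k : A k}"
 assumes A: "!!k. convex (A k)"
  and der: "!!y i. y : B ==> ((%s. F (y + s *\<^sub>R axis i 1)) has_real_derivative P i y) (at 0)"
  and e: "!!y i. y : B ==> abs (P i y) <= e" and y: "y : B" "y' : B"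
 shows "abs (F y' - F y) <= e * (\<Sum>k\<in>UNIV. abs (y' $ k - y $ k))"
proof -
 define mix where "mix I = (\<chi> k. if k : I then y' $ k else y $ k)" for I
 have "abs (F (mix I) - F y) <= e * (\<Sum>k\<in>I. abs (y' $ k - y $ k))" if "finite I" for I
  using that
 proof (induction I)
  case empty
  show ?case by (simp add: mix_def)
 next
  case (insert i I)
  define d where "d = y' $ i - y $ i"
  have ax: "(axis i 1 :: real ^ 'n) $ k = (if k = i then 1 else 0)" for k by (simp add: axis_def)
  have step: "mix (insert i I) = mix I + d *\<^sub>R axis i 1"
   using insert.hyps by (auto simp: mix_def vec_eq_iff ax d_def)
  have inB: "mix I + s *\<^sub>R axis i 1 : B" if s: "s : closed_segment 0 d" for s
  proof -
   obtain u where u: "0 <= u" "u <= 1" "s = u * d" using s by (auto simp: closed_segment_def)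
   have "(1 - u) *\<^sub>R y $ i + u *\<^sub>R y' $ i : A i" using y u by (intro convexD A) (auto simp: B_def)
   then have "y $ i + s : A i" by (simp add: u d_def algebra_simps)
   then show ?thesis using y insert.hyps by (auto simp: B_def mix_def ax)
  qed
  have "norm (F (mix I + d *\<^sub>R axis i 1) - F (mix I + 0 *\<^sub>R axis i 1)) <= e * norm (d - 0)"
  proof (rule field_differentiable_bound[where S="closed_segment 0 d" and f'="%s. P i (mix I + s *\<^sub>R axis i 1)"])
   fix s assume s: "s : closed_segment 0 d"
   have "((%t. F ((mix I + s *\<^sub>R axis i 1) + t *\<^sub>R axis i 1)) has_real_derivative P i (mix I + s *\<^sub>R axis i 1)) (at 0)"
    by (rule der[OF inB[OF s]])
   then have "((%t. F (mix I + (t + s) *\<^sub>R axis i 1)) has_real_derivative P i (mix I + s *\<^sub>R axis i 1)) (at 0)"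
    by (simp add: scaleR_left_distrib add_ac)
   then have "((%s. F (mix I + s *\<^sub>R axis i 1)) has_real_derivative P i (mix I + s *\<^sub>R axis i 1)) (at s)"
    using DERIV_shift[of "%s. F (mix I + s *\<^sub>R axis i 1)" _ 0 s] by simp
   then show "((%s. F (mix I + s *\<^sub>R axis i 1)) has_real_derivative P i (mix I + s *\<^sub>R axis i 1)) (at s within closed_segment 0 d)"
    by (rule has_field_derivative_at_within)
   show "norm (P i (mix I + s *\<^sub>R axis i 1)) <= e" using e[OF inB[OF s]] by simp
  qed auto
  then have "abs (F (mix (insert i I)) - F (mix I)) <= e * abs d" by (simp add: step)
  then show ?case using insert by (simp add: d_def distrib_left)
 qed
 from this[of UNIV] show ?thesis by (simp add: mix_def)
qed

text \<open>After subtraction of the linear candidate, the partial derivatives are at most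
  \<open>e / CARD('n)\<close> on a small box. \<open>coordinate_lipschitz\<close> then bounds the
  remainder by that constant times the sum of the coordinate differences, itself at most
  \<open>CARD('n)\<close> times the norm.\<close>

lemma has_derivative_partials:
 fixes F :: "real ^ 'n::finite => real"
 assumes S: "open S" "\<theta> : S"
  and der: "!!y i. y : S ==> ((%s. F (y + s *\<^sub>R axis i 1)) has_real_derivative P i y) (at 0)"
  and cont: "!!i. continuous_on S (P i)"
 shows "(F has_derivative (%v. \<Sum>i\<in>UNIV. v $ i * P i \<theta>)) (at \<theta>)"
 unfolding has_derivative_at_alt
proof (intro conjI allI impI)
 show "bounded_linear (%v. \<Sum>i\<in>UNIV. v $ i * P i \<theta>)"
  by (intro bounded_linear_sum bounded_linear_mult_const bounded_linear_vec_nth)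
 fix e :: real assume e: "e > 0"
 let ?N = "real CARD('n)"
 have N: "?N > 0" by simp
 have "\<exists>d>0. ALL y. dist y \<theta> < d --> abs (P i y - P i \<theta>) < e / ?N" for i
 proof -
  have "isCont (P i) \<theta>" using cont S by (simp add: continuous_on_eq_continuous_at)
  then show ?thesis using e N unfolding continuous_at_eps_delta dist_real_def by (metis divide_pos_pos)
 qed
 then obtain d where d: "!!i. d i > 0" "!!i y. dist y \<theta> < d i ==> abs (P i y - P i \<theta>) < e / ?N" by metis
 obtain r where r: "r > 0" "ball \<theta> r \<subseteq> S" using S by (meson open_contains_ball)
 \<comment> \<open>The box of half-width \<open>\<delta>\<close> has to fit into all the balls; the
   Euclidean norm is at most the sum of the coordinates, hence the division by the
   dimension.\<close>
 define \<delta> where "\<delta> = min r (Min (range d)) / ?N"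
 have "Min (range d) > 0" using d(1) by simp
 then have \<delta>: "\<delta> > 0" using r N by (simp add: \<delta>_def)
 have \<delta>d: "?N * \<delta> <= d i" "?N * \<delta> <= r" for i
  using N Min_le[of "range d" "d i"] by (auto simp: \<delta>_def min_le_iff_disj)
 define A where "A k = {\<theta> $ k - \<delta> <..< \<theta> $ k + \<delta>}" for k
 have near: "dist y \<theta> < ?N * \<delta>" if "ALL k. y $ k : A k" for y
 proof -
  have "abs ((y - \<theta>) $ k) < \<delta>" for k using that[rule_format, of k] by (auto simp: A_def)
  note * = this
  have "norm (y - \<theta>) <= (\<Sum>k\<in>UNIV. abs ((y - \<theta>) $ k))" by (rule norm_le_l1_cart)
  also have "... < (\<Sum>k\<in>(UNIV :: 'n set). \<delta>)" using * by (intro sum_strict_mono) auto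
  finally show ?thesis by (simp add: dist_norm)
 qed
 show "\<exists>d>0. ALL y. norm (y - \<theta>) < d --> norm (F y - F \<theta> - (\<Sum>i\<in>UNIV. (y - \<theta>) $ i * P i \<theta>)) <= e * norm (y - \<theta>)"
 proof (intro exI[of _ \<delta>] conjI \<delta> allI impI)
  fix y assume y: "norm (y - \<theta>) < \<delta>"
  have yk: "abs ((y - \<theta>) $ k) < \<delta>" for k using component_le_norm_cart[of "y - \<theta>" k] y by linarith
  let ?G = "%z. F z - (\<Sum>i\<in>UNIV. z $ i * P i \<theta>)"
  have "abs (?G y - ?G \<theta>) <= e / ?N * (\<Sum>k\<in>UNIV. abs (y $ k - \<theta> $ k))"
  proof (rule coordinate_lipschitz[where A=A and P="%i z. P i z - P i \<theta>"])
   fix z i assume z: "z : {y. ALL k. y $ k : A k}"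
   then have zS: "z : S" using near[of z] r(2) \<delta>d(2) by (auto simp: dist_commute subset_eq)
   have eq: "(\<Sum>j\<in>UNIV. (z + s *\<^sub>R axis i 1) $ j * P j \<theta>) = (\<Sum>j\<in>UNIV. z $ j * P j \<theta>) + s * P i \<theta>" for s
   proof -
    have "(\<Sum>j\<in>UNIV. s * (axis i 1 :: real ^ 'n) $ j * P j \<theta>) = (\<Sum>j\<in>UNIV. if j = i then s * P i \<theta> else 0)"
     by (intro sum.cong) (auto simp: axis_def)
    then show ?thesis by (simp add: distrib_right sum.distrib)
   qed
   show "((%s. ?G (z + s *\<^sub>R axis i 1)) has_real_derivative P i z - P i \<theta>) (at 0)"
    using der[OF zS, of i] unfolding eq by (auto intro!: derivative_eq_intros)
   show "abs (P i z - P i \<theta>) <= e / ?N" using d(2)[of z i] near[of z] z \<delta>d(1)[of i] by force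
  next
   show "y : {y. ALL k. y $ k : A k}"
   proof (clarify)
    fix k show "y $ k : A k" using yk[of k] by (auto simp: A_def)
   qed
  qed (use \<delta> in "auto simp: A_def")
  also have "... <= e / ?N * (?N * norm (y - \<theta>))"
   using e component_le_norm_cart[of "y - \<theta>"] by (intro mult_left_mono sum_bounded_above[THEN order_trans]) auto
  also have "... = e * norm (y - \<theta>)" using N by simp
  finally show "norm (F y - F \<theta> - (\<Sum>i\<in>UNIV. (y - \<theta>) $ i * P i \<theta>)) <= e * norm (y - \<theta>)"
   by (simp add: sum_subtractf left_diff_distrib)
 qed
qed

lemma partials_mean_value:
 fixes F :: "real ^ 'n::finite => real"
 assumes S: "open S" "convex S" "\<theta> : S" "\<theta>' : S"
  and der: "!!y i. y : S ==> ((%s. F (y + s *\<^sub>R axis i 1)) has_real_derivative P i y) (at 0)"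
  and cont: "!!i. continuous_on S (P i)"
 obtains z where "z : S" "dist z \<theta> <= dist \<theta>' \<theta>" "F \<theta>' - F \<theta> = (\<Sum>i\<in>UNIV. (\<theta>' - \<theta>) $ i * P i z)"
proof -
 have mem: "\<theta> + s *\<^sub>R (\<theta>' - \<theta>) : S" if "0 <= s" "s <= 1" for s
  using convexD_alt[OF S(2-4) that] by (simp add: algebra_simps)
 have "((%s. F (\<theta> + s *\<^sub>R (\<theta>' - \<theta>))) has_real_derivative (\<Sum>i\<in>UNIV. (\<theta>' - \<theta>) $ i * P i (\<theta> + s *\<^sub>R (\<theta>' - \<theta>)))) (at s)"
  if s: "0 <= s" "s <= 1" for s
 proof -
  have "((%s. F (\<theta> + s *\<^sub>R (\<theta>' - \<theta>))) has_derivative (%t. \<Sum>i\<in>UNIV. (t *\<^sub>R (\<theta>' - \<theta>)) $ i * P i (\<theta> + s *\<^sub>R (\<theta>' - \<theta>)))) (at s)"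
  proof (rule has_derivative_compose[where f="%s. \<theta> + s *\<^sub>R (\<theta>' - \<theta>)" and g=F and g'="%v. \<Sum>i\<in>UNIV. v $ i * P i (\<theta> + s *\<^sub>R (\<theta>' - \<theta>))"])
   show "(F has_derivative (%v. \<Sum>i\<in>UNIV. v $ i * P i (\<theta> + s *\<^sub>R (\<theta>' - \<theta>)))) (at (\<theta> + s *\<^sub>R (\<theta>' - \<theta>)))"
    by (rule has_derivative_partials[OF S(1) mem[OF s] der cont])
  qed (auto intro!: derivative_eq_intros)
  then show ?thesis by (auto simp: has_field_derivative_def mult_ac sum_distrib_left elim!: has_derivative_eq_rhs)
 qed
 from MVT2[of 0 1, OF _ this] obtain s where s: "0 < s" "s < 1"
  "F (\<theta> + 1 *\<^sub>R (\<theta>' - \<theta>)) - F (\<theta> + 0 *\<^sub>R (\<theta>' - \<theta>)) = (1 - 0) * (\<Sum>i\<in>UNIV. (\<theta>' - \<theta>) $ i * P i (\<theta> + s *\<^sub>R (\<theta>' - \<theta>)))" by auto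
 show ?thesis
 proof (rule that[of "\<theta> + s *\<^sub>R (\<theta>' - \<theta>)"])
  show "dist (\<theta> + s *\<^sub>R (\<theta>' - \<theta>)) \<theta> <= dist \<theta>' \<theta>" using s by (simp add: dist_norm mult_left_le_one_le)
 qed (use s mem[of s] in auto)
qed

lemma sum_component_le:
 fixes v :: "real ^ 'n::finite"
 assumes "!!i. abs (p i) <= e"
 shows "abs (\<Sum>i\<in>UNIV. v $ i * p i) <= real CARD('n) * e * norm v"
proof -
 have "abs (\<Sum>i\<in>UNIV. v $ i * p i) <= (\<Sum>i\<in>(UNIV :: 'n set). norm v * e)"
  using component_le_norm_cart[of v] assms by (intro sum_abs[THEN order_trans] sum_mono) (auto simp: abs_mult intro!: mult_mono)
 then show ?thesis by (simp add: mult_ac)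
qed

lemma poly_lipschitz_partials:
 fixes F :: "real => real ^ 'n::finite => real"
 assumes S: "open S" "convex S"
  and der: "!!x y i. y : S ==> ((%s. F x (y + s *\<^sub>R axis i 1)) has_real_derivative P i x y) (at 0)"
  and cont: "!!x i. continuous_on S (P i x)"
  and meas: "!!\<theta>. \<theta> : S ==> (%x. F x \<theta>) : borel_measurable borel"
  and F: "!!x \<theta>. \<theta> : S ==> abs (F x \<theta>) <= K * (1 + abs x) ^ N"
  and P: "!!x \<theta> i. \<theta> : S ==> abs (P i x \<theta>) <= L * (1 + abs x) ^ Q"
 shows "poly_lipschitz S F"
proof (rule poly_lipschitzI[OF meas F])
 fix x \<theta> \<theta>' assume \<theta>: "\<theta> : S" "\<theta>' : S"
 obtain z where z: "z : S" "F x \<theta>' - F x \<theta> = (\<Sum>i\<in>UNIV. (\<theta>' - \<theta>) $ i * P i x z)"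
  using partials_mean_value[OF S \<theta> der cont] by metis
 show "abs (F x \<theta> - F x \<theta>') <= real CARD('n) * L * (1 + abs x) ^ Q * dist \<theta> \<theta>'"
  using sum_component_le[of "%i. P i x z" "L * (1 + abs x) ^ Q" "\<theta>' - \<theta>"] P[OF z(1)] z(2)
  by (simp add: abs_minus_commute dist_norm norm_minus_commute mult.assoc)
qed

text \<open>The mean value theorem evaluates the derivatives at an intermediate point. Moving that
  point to \<open>\<theta>\<close> costs their Lipschitz constant times the distance, which gives
  the square.\<close>

lemma partials_taylor:
 fixes F :: "real => real ^ 'n::finite => real"
 assumes S: "open S" "convex S"
  and der: "!!x y i. y : S ==> ((%s. F x (y + s *\<^sub>R axis i 1)) has_real_derivative P i x y) (at 0)"
  and cont: "!!x i. continuous_on S (P i x)"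
  and P: "!!i. poly_lipschitz S (P i)"
 shows "EX K N. K >= 0 & (ALL x. ALL \<theta>:S. ALL \<theta>':S. abs (F x \<theta>' - F x \<theta> - (\<Sum>i\<in>UNIV. (\<theta>' - \<theta>) $ i * P i x \<theta>)) <= K * (1 + abs x) ^ N * (dist \<theta>' \<theta>)^2)"
proof -
 \<comment> \<open>The intermediate point depends on the state and on both parameters; it is chosen
   as a function of the triple, as \<open>dominated\<close> compares functions of one index.\<close>
 have "ALL i:UNIV \<times> S \<times> S. EX z. z : S & dist z (fst (snd i)) <= dist (snd (snd i)) (fst (snd i)) &
   F (fst i) (snd (snd i)) - F (fst i) (fst (snd i)) = (\<Sum>k\<in>UNIV. (snd (snd i) - fst (snd i)) $ k * P k (fst i) z)"
 proof
  fix i :: "real \<times> (real ^ 'n) \<times> (real ^ 'n)" assume "i : UNIV \<times> S \<times> S"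
  then have "fst (snd i) : S" "snd (snd i) : S" by auto
  then obtain z where "z : S" "dist z (fst (snd i)) <= dist (snd (snd i)) (fst (snd i))"
   "F (fst i) (snd (snd i)) - F (fst i) (fst (snd i)) = (\<Sum>k\<in>UNIV. (snd (snd i) - fst (snd i)) $ k * P k (fst i) z)"
   by (rule partials_mean_value[OF S _ _ der cont])
  then show "EX z. z : S & dist z (fst (snd i)) <= dist (snd (snd i)) (fst (snd i)) &
   F (fst i) (snd (snd i)) - F (fst i) (fst (snd i)) = (\<Sum>k\<in>UNIV. (snd (snd i) - fst (snd i)) $ k * P k (fst i) z)" by blast
 qed
 from bchoice[OF this] obtain z where "ALL i:UNIV \<times> S \<times> S. z i : S & dist (z i) (fst (snd i)) <= dist (snd (snd i)) (fst (snd i)) &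
   F (fst i) (snd (snd i)) - F (fst i) (fst (snd i)) = (\<Sum>k\<in>UNIV. (snd (snd i) - fst (snd i)) $ k * P k (fst i) (z i))" ..
 note z = this[rule_format]
 interpret domination "UNIV \<times> S \<times> S" "%i. 1 + abs (fst i) :: real" by unfold_locales auto
 let ?dm = "dominated (UNIV \<times> S \<times> S) (%i. 1 + abs (fst i))" and ?d = "%i. dist (snd (snd i)) (fst (snd i))"
 have "?dm (%i. (?d i)^2) (%i. \<Sum>k\<in>UNIV. (snd (snd i) - fst (snd i)) $ k * (P k (fst i) (z i) - P k (fst i) (fst (snd i))))"
  unfolding power2_eq_square
 proof (intro dominated_sum dominated_mult)
  show "?dm ?d (%i. (snd (snd i) - fst (snd i)) $ k)" for k
   by (rule dominated_self[where C=1]) (simp add: dist_norm component_le_norm_cart flip: vector_minus_component)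
  show "?dm ?d (%i. P k (fst i) (z i) - P k (fst i) (fst (snd i)))" for k
   by (rule dominated_mono[OF dominated_poly_lipschitz(2)[OF P], where C=1]) (use z in auto)
  show "?dm (%i. ?d i * ?d i) (%_. 0)" by (rule dominated_self[where C=0]) auto
 qed
 then obtain K N where K: "0 <= K" "ALL i:UNIV \<times> S \<times> S.
   abs (\<Sum>k\<in>UNIV. (snd (snd i) - fst (snd i)) $ k * (P k (fst i) (z i) - P k (fst i) (fst (snd i)))) <= K * (1 + abs (fst i)) ^ N * (?d i)^2"
  unfolding dominated_def by auto
 have "abs (F x \<theta>' - F x \<theta> - (\<Sum>i\<in>UNIV. (\<theta>' - \<theta>) $ i * P i x \<theta>)) <= K * (1 + abs x) ^ N * (dist \<theta>' \<theta>)^2" if "\<theta> : S" "\<theta>' : S" for x \<theta> \<theta>'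
  using K(2)[rule_format, of "(x, \<theta>, \<theta>')"] z[of "(x, \<theta>, \<theta>')"] that by (simp add: right_diff_distrib sum_subtractf)
 with K(1) show ?thesis by blast
qed

section \<open>Continuous extension to the closure of the parameter set\<close>

lemma bval_unique:
 assumes "continuous_on (closure S) g" "!!\<theta>. \<theta> : S ==> g \<theta> = f \<theta>" "\<theta> : closure S"
 shows "bval S f \<theta> = g \<theta>"
proof (cases "\<theta> : S")
 case True
 then show ?thesis using assms by (simp add: bval_def)
next
 case False
 have "\<theta> islimpt S" using assms(3) False by (simp add: closure_def)
 then have "at \<theta> within S ~= bot" by (simp add: trivial_limit_within)
 moreover have "(g \<longlongrightarrow> g \<theta>) (at \<theta> within S)"
  by (rule tendsto_within_subset[OF assms(1)[unfolded continuous_on_def, rule_format, OF assms(3)] closure_subset])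
 then have "(f \<longlongrightarrow> g \<theta>) (at \<theta> within S)"
  by (rule Lim_transform_eventually) (auto simp: eventually_at_filter assms(2))
 ultimately show ?thesis using False by (simp add: bval_def tendsto_Lim)
qed

lemma bval_continuous:
 assumes "extends_to_closure S f"
 shows "continuous_on (closure S) (bval S f)"
proof -
 obtain g where "continuous_on (closure S) g" "!!\<theta>. \<theta> : S ==> g \<theta> = f \<theta>" using assms unfolding extends_to_closure_def by blast
 then show ?thesis using bval_unique[of S g f] by (simp cong: continuous_on_cong)
qed

lemma bval_interior: "\<theta> : S ==> bval S f \<theta> = f \<theta>"
 by (simp add: bval_def)

lemma closure_le:
 fixes f g :: "'a::topological_space => real"
 assumes "continuous_on (closure S) f" "continuous_on (closure S) g" "!!x. x : S ==> f x <= g x" "x : closure S"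
 shows "f x <= g x"
 using continuous_le_on_closure[of S "%x. f x - g x" x 0] assms by (auto intro: continuous_on_diff)

text \<open>At a boundary parameter, measurability in the state comes from a sequence of interior
  parameters. The Lipschitz bound is carried to the closure in one argument at a time.\<close>

lemma poly_lipschitz_bval:
 fixes f :: "real => real ^ 'n::finite => real"
 assumes f: "poly_lipschitz S f" and ext: "!!x. extends_to_closure S (f x)"
 shows "poly_lipschitz (closure S) (%x. bval S (f x))"
proof -
 let ?b = "%x. bval S (f x)"
 note b = bval_continuous[OF ext]
 obtain K N where K: "!!\<theta>. \<theta> : S ==> poly_le N K (%x. f x \<theta>)"
  and l: "!!x \<theta> \<theta>'. \<theta> : S ==> \<theta>' : S ==> abs (f x \<theta> - f x \<theta>') <= K * (1 + abs x) ^ N * dist \<theta> \<theta>'"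
  using f unfolding poly_lipschitz_def by blast
 show ?thesis
 proof (rule poly_lipschitzI)
  fix \<theta> assume \<theta>: "\<theta> : closure S"
  then obtain t where t: "!!k. t k : S" "t \<longlonglongrightarrow> \<theta>" unfolding closure_sequential by blast
  show "(%x. ?b x \<theta>) : borel_measurable borel"
  proof (rule borel_measurable_LIMSEQ_real)
   show "(%k. f x (t k)) \<longlonglongrightarrow> ?b x \<theta>" for x
   proof -
    have "(%k. ?b x (t k)) \<longlonglongrightarrow> ?b x \<theta>"
     by (rule continuous_on_tendsto_compose[OF b t(2) \<theta>]) (use t(1) closure_subset in "auto intro!: always_eventually")
    then show ?thesis by (simp add: bval_interior[OF t(1)])
   qed
   show "(%x. f x (t k)) : borel_measurable borel" for k using poly_lipschitz_measurable[OF f t(1)] .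
  qed
  show "abs (?b x \<theta>) <= K * (1 + abs x) ^ N" for x
   by (rule closure_le[OF _ _ _ \<theta>, where f="%\<theta>. abs (?b x \<theta>)"]) (use K in "auto intro!: continuous_intros b simp: bval_interior poly_le_def")
  fix x \<theta>' assume \<theta>': "\<theta>' : closure S"
  have *: "abs (?b x \<theta> - ?b x s) <= K * (1 + abs x) ^ N * dist \<theta> s" if "s : S" for s
   by (rule closure_le[OF _ _ _ \<theta>, where f="%\<theta>. abs (?b x \<theta> - ?b x s)"]) (use l that in "auto intro!: continuous_intros b simp: bval_interior")
  show "abs (?b x \<theta> - ?b x \<theta>') <= K * (1 + abs x) ^ N * dist \<theta> \<theta>'"
   by (rule closure_le[OF _ _ _ \<theta>', where f="%s. abs (?b x \<theta> - ?b x s)"]) (use * in "auto intro!: continuous_intros b")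
 qed
qed

text \<open>Derivatives up to order 3 carry the argument: those of order 2 are Lipschitz because
  order 3 is bounded, and an expansion of first derivatives with quadratic remainder requires
  Lipschitz second ones.\<close>

lemma smooth_coefficient:
 fixes f :: "real => real ^ 'n::finite => real"
 assumes S: "open S" "convex S"
  and ex: "mixed_partials_exist 2 5 S f" and ext: "ALL is x. length is <= 5 --> extends_to_closure S (mixed_partial 0 is f x)"
  and bd: "ALL is. length is <= 3 --> (EX K N. ALL x. ALL \<theta>:S. abs (partials is (f x) \<theta>) <= K * (1 + abs x) ^ N)"
 shows "length is <= 2 ==> poly_lipschitz S (%x. partials is (f x))"
  and "length is <= 5 ==> extends_to_closure S (partials is (f x))"
  and "length is <= 4 ==> \<theta> : S ==> ((%s. partials is (f x) (\<theta> + s *\<^sub>R axis i 1)) has_real_derivative partials (i # is) (f x) \<theta>) (at 0)"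
  and "length is <= 1 ==> EX K N. K >= 0 & (ALL x. ALL \<theta>:S. ALL \<theta>':S. abs (partials is (f x) \<theta>' - partials is (f x) \<theta> - (\<Sum>i\<in>UNIV. (\<theta>' - \<theta>) $ i * partials (i # is) (f x) \<theta>)) <= K * (1 + abs x) ^ N * (dist \<theta>' \<theta>)^2)"
proof -
 have mp: "mixed_partial 0 is f x = partials is (f x)" for "is" x by (simp add: mixed_partial_def fun_eq_iff)
 show ext': "extends_to_closure S (partials is (f x))" if "length is <= 5" for "is" x using ext that by (simp add: mp)
 have cont: "continuous_on S (partials is (f x))" if "length is <= 5" for "is" x
  using bval_continuous[OF ext'[OF that]] closure_subset[of S] continuous_on_subset
  by (metis bval_interior continuous_on_cong)
 show der: "((%s. partials is (f x) (\<theta> + s *\<^sub>R axis i 1)) has_real_derivative partials (i # is) (f x) \<theta>) (at 0)"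
  if "length is <= 4" "\<theta> : S" for "is" i x \<theta>
 proof -
  have "(%s. partials is (f x) (\<theta> + s *\<^sub>R axis i 1)) differentiable (at 0)"
   using ex that unfolding mixed_partials_exist_def by auto
  then have "(%s. partials is (f x) (\<theta> + s *\<^sub>R axis i 1)) field_differentiable (at 0)"
   by (auto simp: real_differentiable_def field_differentiable_def)
  then show ?thesis by (simp add: DERIV_deriv_iff_field_differentiable)
 qed
 have meas: "(%x. partials is (f x) \<theta>) : borel_measurable borel" if "length is <= 5" "\<theta> : S" for "is" \<theta>
 proof -
  have "(%y. mixed_partial 0 is f y \<theta>) differentiable (at x)" for x
   using ex that unfolding mixed_partials_exist_def by (meson le_eq_less_or_eq pos2)
  then have "continuous_on UNIV (%y. partials is (f y) \<theta>)"
   unfolding mp by (intro continuous_at_imp_continuous_on ballI differentiable_imp_continuous_within)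
  then show ?thesis by (rule borel_measurable_continuous_onI)
 qed
 show pl: "poly_lipschitz S (%x. partials is (f x))" if l: "length is <= 2" for "is"
 proof -
  obtain K N where K: "!!x \<theta>. \<theta> : S ==> abs (partials is (f x) \<theta>) <= K * (1 + abs x) ^ N" using bd l by force
  have "EX K N. ALL x. ALL \<theta>:S. abs (partials (i # is) (f x) \<theta>) <= K * (1 + abs x) ^ N" for i using bd[rule_format, of "i # is"] l by simp
  then obtain L Q where L: "!!i x \<theta>. \<theta> : S ==> abs (partials (i # is) (f x) \<theta>) <= L i * (1 + abs x) ^ Q i" by metis
  define L' where "L' = max 0 (Max (range L))"
  have L': "abs (partials (i # is) (f x) \<theta>) <= L' * (1 + abs x) ^ Max (range Q)" if "\<theta> : S" for i x \<theta>
  proof -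
   have "L i * (1 + abs x) ^ Q i <= L' * (1 + abs x) ^ Max (range Q)"
    by (intro mult_mono power_increasing) (auto simp: L'_def intro!: max.coboundedI2)
   then show ?thesis using L[OF that] order_trans by blast
  qed
  show ?thesis by (rule poly_lipschitz_partials[OF S der cont meas K L']) (use l in auto)
 qed
 show "EX K N. K >= 0 & (ALL x. ALL \<theta>:S. ALL \<theta>':S. abs (partials is (f x) \<theta>' - partials is (f x) \<theta> - (\<Sum>i\<in>UNIV. (\<theta>' - \<theta>) $ i * partials (i # is) (f x) \<theta>)) <= K * (1 + abs x) ^ N * (dist \<theta>' \<theta>)^2)" if "length is <= 1" for "is"
  using that by (intro partials_taylor[OF S der cont pl]) auto
qed

text \<open>Turns the real growth exponents of the hypotheses into the natural exponents of
  \<open>poly_le\<close>.\<close>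

lemma powr_le_power:
 fixes x C :: real
 assumes "C >= 0"
 shows "1 + abs x powr C <= 2 * (1 + abs x) ^ nat \<lceil>C\<rceil>"
proof -
 have "abs x powr C <= (1 + abs x) powr C" using assms by (intro powr_mono2) auto
 also have "... <= (1 + abs x) powr real (nat \<lceil>C\<rceil>)" using assms by (intro powr_mono) auto
 also have "... = (1 + abs x) ^ nat \<lceil>C\<rceil>" by (rule powr_realpow) (use abs_ge_zero[of x] in linarith)
 finally show ?thesis using one_le_power[of "1 + abs x" "nat \<lceil>C\<rceil>"] abs_ge_zero[of x] by linarith
qed

section \<open>Drift and scale coefficients on the closed parameter sets\<close>

context
 fixes \<Theta>\<^sub>\<alpha> :: "(real ^ 'pa::finite) set" and \<Theta>\<^sub>\<gamma> :: "(real ^ 'pg::finite) set"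
  and a :: "real => real ^ 'pa => real" and c :: "real => real ^ 'pg => real" and \<alpha>0 \<gamma>0
 assumes sm: "cond_smoothness \<Theta>\<^sub>\<alpha> \<Theta>\<^sub>\<gamma> a c \<alpha>0 \<gamma>0"
  and dom: "\<Theta>\<^sub>\<alpha> ~= {}" "open \<Theta>\<^sub>\<alpha>" "convex \<Theta>\<^sub>\<alpha>" "\<Theta>\<^sub>\<gamma> ~= {}" "open \<Theta>\<^sub>\<gamma>" "convex \<Theta>\<^sub>\<gamma>"
begin

text \<open>The three terms under the supremum are non-negative, so each is bounded by their sum,
  and a single partial derivative is bounded by the Euclidean norm of the derivative tensor.\<close>

lemma coefficient_bounds:
 assumes "k <= 5"
 shows "EX K N. ALL x. ALL \<alpha>:\<Theta>\<^sub>\<alpha>. ALL \<gamma>:\<Theta>\<^sub>\<gamma>. (ALL is. length is = k --> abs (partials is (a x) \<alpha>) <= K * (1 + abs x) ^ N) &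
   (ALL is. length is = k --> abs (partials is (c x) \<gamma>) <= K * (1 + abs x) ^ N) & abs (inverse (c x \<gamma>)) <= K * (1 + abs x) ^ N"
proof -
 obtain C where C: "C >= 0" "(SUP (x, \<alpha>, \<gamma>)\<in>UNIV \<times> \<Theta>\<^sub>\<alpha> \<times> \<Theta>\<^sub>\<gamma>. ereal (1 / (1 + abs x powr C) *
      (mixed_norm 0 k a x \<alpha> + mixed_norm 0 k c x \<gamma> + abs (inverse (c x \<gamma>))))) < \<infinity>" (is "?S < _")
  using sm assms unfolding cond_smoothness_def by (meson zero_le)
 obtain B where B: "?S <= ereal B" using C(2) by (cases ?S) auto
 have norm_ge: "abs (partials is (f x) \<theta>) <= mixed_norm 0 k f x \<theta>" "0 <= mixed_norm 0 k f x \<theta>" if "length is = k"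
  for "is" :: "'n::finite list" and f x \<theta>
 proof -
  have "finite {is :: 'n list. length is = k}" using finite_lists_length_eq[of "UNIV :: 'n set" k] by simp
  then have "abs (mixed_partial 0 is f x \<theta>) <= L2_set (%is. abs (mixed_partial 0 is f x \<theta>)) {is. length is = k}"
   using that by (intro member_le_L2_set) auto
  then show "abs (partials is (f x) \<theta>) <= mixed_norm 0 k f x \<theta>"
   by (simp add: mixed_norm_def mixed_partial_def L2_set_def)
  show "0 <= mixed_norm 0 k f x \<theta>" by (simp add: mixed_norm_def L2_set_nonneg)
 qed
 have pos: "0 <= mixed_norm 0 k f x \<theta>" for f :: "real => real ^ 'n::finite => real" and x \<theta>
  by (simp add: mixed_norm_def L2_set_nonneg)
 have le: "mixed_norm 0 k a x \<alpha> + mixed_norm 0 k c x \<gamma> + abs (inverse (c x \<gamma>)) <= (2 * max 0 B) * (1 + abs x) ^ nat \<lceil>C\<rceil>"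
  if "\<alpha> : \<Theta>\<^sub>\<alpha>" "\<gamma> : \<Theta>\<^sub>\<gamma>" for x \<alpha> \<gamma>
 proof -
  let ?m = "mixed_norm 0 k a x \<alpha> + mixed_norm 0 k c x \<gamma> + abs (inverse (c x \<gamma>))"
  have "ereal (1 / (1 + abs x powr C) * ?m) <= ?S" using that by (intro SUP_upper2[of "(x, \<alpha>, \<gamma>)"]) auto
  from order_trans[OF this B] have "1 / (1 + abs x powr C) * ?m <= B" by (simp only: ereal_less_eq(3))
  moreover have p: "1 + abs x powr C > 0" by (simp add: add_pos_nonneg)
  ultimately have "?m <= B * (1 + abs x powr C)" by (simp add: field_simps)
  also have "... <= max 0 B * (2 * (1 + abs x) ^ nat \<lceil>C\<rceil>)" using p powr_le_power[OF C(1), of x] by (intro mult_mono) auto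
  finally show ?thesis by simp
 qed
 show ?thesis
 proof (intro exI[of _ "2 * max 0 B"] exI[of _ "nat \<lceil>C\<rceil>"] allI ballI conjI impI)
  fix x \<alpha> \<gamma> assume \<theta>: "\<alpha> : \<Theta>\<^sub>\<alpha>" "\<gamma> : \<Theta>\<^sub>\<gamma>"
  note l = le[OF \<theta>, of x] pos[of a x \<alpha>] pos[of c x \<gamma>]
  show "abs (inverse (c x \<gamma>)) <= 2 * max 0 B * (1 + abs x) ^ nat \<lceil>C\<rceil>" using l by linarith
  show "abs (partials is (a x) \<alpha>) <= 2 * max 0 B * (1 + abs x) ^ nat \<lceil>C\<rceil>" if "length is = k" for "is"
   using norm_ge(1)[OF that, of a x \<alpha>] abs_ge_zero[of "inverse (c x \<gamma>)"] l by linarith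
  show "abs (partials is (c x) \<gamma>) <= 2 * max 0 B * (1 + abs x) ^ nat \<lceil>C\<rceil>" if "length is = k" for "is"
   using norm_ge(1)[OF that, of c x \<gamma>] abs_ge_zero[of "inverse (c x \<gamma>)"] l by linarith
 qed
qed

lemma drift_smooth:
 "poly_lipschitz (closure \<Theta>\<^sub>\<alpha>) (%x. bval \<Theta>\<^sub>\<alpha> (a x))" "poly_lipschitz \<Theta>\<^sub>\<alpha> (%x. partials [i] (a x))"
 "\<theta> : \<Theta>\<^sub>\<alpha> ==> gradient (a x) \<theta> = (\<chi> i. partials [i] (a x) \<theta>)"
proof -
 have ex: "mixed_partials_exist 2 5 \<Theta>\<^sub>\<alpha> a" and ext: "ALL is x. length is <= 5 --> extends_to_closure \<Theta>\<^sub>\<alpha> (mixed_partial 0 is a x)"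
  using sm unfolding cond_smoothness_def by auto
 have bd: "ALL is. length is <= 3 --> (EX K N. ALL x. ALL \<alpha>:\<Theta>\<^sub>\<alpha>. abs (partials is (a x) \<alpha>) <= K * (1 + abs x) ^ N)"
 proof (intro allI impI)
  fix "is" :: "'pa list" assume "length is <= 3"
  \<comment> \<open>The joint bound is uniform in both parameters; any point of the other set may be
    inserted, which is where its non-emptiness enters.\<close>
  obtain p where p: "p : \<Theta>\<^sub>\<gamma>" using dom(4) by blast
  have "length is <= 5" using \<open>length is <= 3\<close> by simp
  from coefficient_bounds[OF this] show "EX K N. ALL x. ALL \<theta>:\<Theta>\<^sub>\<alpha>. abs (partials is (a x) \<theta>) <= K * (1 + abs x) ^ N" using p by (elim exE) (rule exI, rule exI, blast)
 qed
 note s = smooth_coefficient[OF dom(2,3) ex ext bd]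
 show "poly_lipschitz (closure \<Theta>\<^sub>\<alpha>) (%x. bval \<Theta>\<^sub>\<alpha> (a x))" using poly_lipschitz_bval[OF s(1)[of "[]"] s(2)[of "[]"]] by simp
 show "poly_lipschitz \<Theta>\<^sub>\<alpha> (%x. partials [i] (a x))" using s(1)[of "[i]"] by simp
qed (simp add: gradient_def)

text \<open>Everything later sections use about the scale coefficient. Boundary values of gradients
  of powers of \<open>c\<close> are identified by exhibiting continuous functions that agree with
  them in the interior.\<close>

lemma scale_smooth:
 defines "cb \<equiv> %x. bval \<Theta>\<^sub>\<gamma> (c x)" and "gb \<equiv> %i x. bval \<Theta>\<^sub>\<gamma> (partials [i] (c x))"
 shows "poly_lipschitz (closure \<Theta>\<^sub>\<gamma>) cb" "poly_lipschitz (closure \<Theta>\<^sub>\<gamma>) (gb i)"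
  "\<gamma> : closure \<Theta>\<^sub>\<gamma> ==> cb x \<gamma> ~= 0" "poly_lipschitz (closure \<Theta>\<^sub>\<gamma>) (%x \<gamma>. inverse (cb x \<gamma>))"
  "\<gamma> : closure \<Theta>\<^sub>\<gamma> ==> bval \<Theta>\<^sub>\<gamma> (gradient (c x)) \<gamma> = (\<chi> i. gb i x \<gamma>)"
  "\<gamma> : closure \<Theta>\<^sub>\<gamma> ==> bval \<Theta>\<^sub>\<gamma> (gradient (%\<gamma>'. 1 / (c x \<gamma>')^2)) \<gamma> = (\<chi> i. - 2 * gb i x \<gamma> / cb x \<gamma> ^ 3)"
  "\<gamma> : closure \<Theta>\<^sub>\<gamma> ==> bval \<Theta>\<^sub>\<gamma> (gradient (%\<gamma>'. (c x \<gamma>')^2)) \<gamma> = (\<chi> i. 2 * cb x \<gamma> * gb i x \<gamma>)"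
  "EX K N. K >= 0 & (ALL x. ALL \<gamma>:closure \<Theta>\<^sub>\<gamma>. ALL \<gamma>':\<Theta>\<^sub>\<gamma>. abs (cb x \<gamma>' - cb x \<gamma> - (\<Sum>i\<in>UNIV. (\<gamma>' - \<gamma>) $ i * gb i x \<gamma>)) <= K * (1 + abs x) ^ N * (dist \<gamma>' \<gamma>)^2)"
  "p : \<Theta>\<^sub>\<gamma> ==> taylor_at (closure \<Theta>\<^sub>\<gamma>) p cb" "p : \<Theta>\<^sub>\<gamma> ==> taylor_at (closure \<Theta>\<^sub>\<gamma>) p (gb i)"
proof -
 have ex: "mixed_partials_exist 2 5 \<Theta>\<^sub>\<gamma> c" and ext: "ALL is x. length is <= 5 --> extends_to_closure \<Theta>\<^sub>\<gamma> (mixed_partial 0 is c x)"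
  and c0: "!!x \<gamma>. \<gamma> : \<Theta>\<^sub>\<gamma> ==> c x \<gamma> ~= 0"
  using sm unfolding cond_smoothness_def by auto
 have bd: "ALL is. length is <= 3 --> (EX K N. ALL x. ALL \<gamma>:\<Theta>\<^sub>\<gamma>. abs (partials is (c x) \<gamma>) <= K * (1 + abs x) ^ N)"
 proof (intro allI impI)
  fix "is" :: "'pg list" assume "length is <= 3"
  obtain p where p: "p : \<Theta>\<^sub>\<alpha>" using dom(1) by blast
  have "length is <= 5" using \<open>length is <= 3\<close> by simp
  from coefficient_bounds[OF this] show "EX K N. ALL x. ALL \<theta>:\<Theta>\<^sub>\<gamma>. abs (partials is (c x) \<theta>) <= K * (1 + abs x) ^ N" using p by (elim exE) (rule exI, rule exI, blast)
 qed
 note s = smooth_coefficient[OF dom(5,6) ex ext bd]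
 show cb: "poly_lipschitz (closure \<Theta>\<^sub>\<gamma>) cb" unfolding cb_def using poly_lipschitz_bval[OF s(1)[of "[]"] s(2)[of "[]"]] by simp
 show gb: "poly_lipschitz (closure \<Theta>\<^sub>\<gamma>) (gb i)" for i unfolding gb_def using poly_lipschitz_bval[OF s(1)[of "[i]"] s(2)[of "[i]"]] by simp
 have cbc: "continuous_on (closure \<Theta>\<^sub>\<gamma>) (cb x)" for x unfolding cb_def using bval_continuous[OF s(2)[of "[]"]] by simp
 have gbc: "continuous_on (closure \<Theta>\<^sub>\<gamma>) (gb i x)" for i x unfolding gb_def using bval_continuous[OF s(2)[of "[i]"]] by simp
 have cbi: "cb x \<gamma> = c x \<gamma>" "gb i x \<gamma> = partials [i] (c x) \<gamma>" if "\<gamma> : \<Theta>\<^sub>\<gamma>" for i x \<gamma>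
  using that by (auto simp: cb_def gb_def bval_def)
 obtain K N where K: "!!x \<gamma>. \<gamma> : \<Theta>\<^sub>\<gamma> ==> abs (inverse (c x \<gamma>)) <= K * (1 + abs x) ^ N"
  using coefficient_bounds[of 0] dom(1) by (meson all_not_in_conv zero_le)
 \<comment> \<open>The bound on the inverse is written without division: in this form it passes to
   the closure by continuity, and only then is \<open>cb\<close> known to be nonzero on the
   boundary.\<close>
 have ge: "1 <= (K * (1 + abs x) ^ N) * abs (cb x \<gamma>)" if "\<gamma> : closure \<Theta>\<^sub>\<gamma>" for x \<gamma>
 proof (rule closure_le[OF _ _ _ that])
  show "1 <= (K * (1 + abs x) ^ N) * abs (cb x \<gamma>)" if "\<gamma> : \<Theta>\<^sub>\<gamma>" for \<gamma>
   using mult_right_mono[OF K[OF that, of x], of "abs (c x \<gamma>)"] c0[OF that, of x] by (simp add: cbi that flip: abs_mult)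
 qed (intro continuous_intros cbc)+
 show cb0: "cb x \<gamma> ~= 0" if "\<gamma> : closure \<Theta>\<^sub>\<gamma>" for x \<gamma> using ge[OF that, of x] by auto
 show "poly_lipschitz (closure \<Theta>\<^sub>\<gamma>) (%x \<gamma>. inverse (cb x \<gamma>))"
 proof (rule poly_lipschitz_inverse[OF cb])
  show "cb x \<gamma> ~= 0 & abs (inverse (cb x \<gamma>)) <= K * (1 + abs x) ^ N" if "\<gamma> : closure \<Theta>\<^sub>\<gamma>" for x \<gamma>
   using cb0[OF that, of x] ge[OF that, of x] by (simp add: field_simps)
 qed
 have vec: "continuous_on A (%\<gamma>. \<chi> i. f i \<gamma>)" if "!!i. continuous_on A (f i)" for A :: "(real ^ 'pg) set" and f :: "'pg => _ => real"
  using that by (intro continuous_on_vec_lambda)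
 have der: "((%s. c x (\<gamma> + s *\<^sub>R axis i 1)) has_real_derivative partials [i] (c x) \<gamma>) (at 0)" if "\<gamma> : \<Theta>\<^sub>\<gamma>" for x \<gamma> i
  using s(3)[of "[]"] that by simp
 show "bval \<Theta>\<^sub>\<gamma> (gradient (c x)) \<gamma> = (\<chi> i. gb i x \<gamma>)" if "\<gamma> : closure \<Theta>\<^sub>\<gamma>" for x \<gamma>
  using that by (intro bval_unique vec gbc) (auto simp: gradient_def cbi)
 show "bval \<Theta>\<^sub>\<gamma> (gradient (%\<gamma>'. 1 / (c x \<gamma>')^2)) \<gamma> = (\<chi> i. - 2 * gb i x \<gamma> / cb x \<gamma> ^ 3)" if "\<gamma> : closure \<Theta>\<^sub>\<gamma>" for x \<gamma>
 proof (rule bval_unique[OF vec _ that])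
  show "continuous_on (closure \<Theta>\<^sub>\<gamma>) (%\<gamma>. - 2 * gb i x \<gamma> / cb x \<gamma> ^ 3)" for i using cb0 by (intro continuous_intros gbc cbc) auto
  fix \<gamma> assume \<gamma>: "\<gamma> : \<Theta>\<^sub>\<gamma>"
  have "((%s. 1 / (c x (\<gamma> + s *\<^sub>R axis i 1))^2) has_real_derivative - 2 * partials [i] (c x) \<gamma> / c x \<gamma> ^ 3) (at 0)" for i
   using c0[OF \<gamma>, of x] by (auto intro!: derivative_eq_intros der[OF \<gamma>] simp: field_simps power2_eq_square power3_eq_cube)
  then show "(\<chi> i. - 2 * gb i x \<gamma> / cb x \<gamma> ^ 3) = gradient (%\<gamma>'. 1 / (c x \<gamma>')^2) \<gamma>"
   by (simp only: gradient_def cbi[OF \<gamma>] vec_eq_iff vec_lambda_beta partials.simps) (blast intro: DERIV_imp_deriv[symmetric])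
 qed
 show "bval \<Theta>\<^sub>\<gamma> (gradient (%\<gamma>'. (c x \<gamma>')^2)) \<gamma> = (\<chi> i. 2 * cb x \<gamma> * gb i x \<gamma>)" if "\<gamma> : closure \<Theta>\<^sub>\<gamma>" for x \<gamma>
 proof (rule bval_unique[OF vec _ that])
  show "continuous_on (closure \<Theta>\<^sub>\<gamma>) (%\<gamma>. 2 * cb x \<gamma> * gb i x \<gamma>)" for i by (intro continuous_intros gbc cbc)
  fix \<gamma> assume \<gamma>: "\<gamma> : \<Theta>\<^sub>\<gamma>"
  have "((%s. (c x (\<gamma> + s *\<^sub>R axis i 1))^2) has_real_derivative 2 * c x \<gamma> * partials [i] (c x) \<gamma>) (at 0)" for i
   by (auto intro!: derivative_eq_intros der[OF \<gamma>])
  then show "(\<chi> i. 2 * cb x \<gamma> * gb i x \<gamma>) = gradient (%\<gamma>'. (c x \<gamma>')^2) \<gamma>"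
   by (simp only: gradient_def cbi[OF \<gamma>] vec_eq_iff vec_lambda_beta partials.simps) (blast intro: DERIV_imp_deriv[symmetric])
 qed
 obtain K N where K: "K >= 0" "!!x \<theta> \<theta>'. \<theta> : \<Theta>\<^sub>\<gamma> ==> \<theta>' : \<Theta>\<^sub>\<gamma> ==> abs (c x \<theta>' - c x \<theta> - (\<Sum>i\<in>UNIV. (\<theta>' - \<theta>) $ i * partials [i] (c x) \<theta>)) <= K * (1 + abs x) ^ N * (dist \<theta>' \<theta>)^2"
  using s(4)[of "[]", unfolded list.size(3) partials.simps(1), OF le0] by blast
 \<comment> \<open>The expansion is around a possibly boundary point, later the estimate, and is
   evaluated at an interior one, later the true parameter.\<close>
 have "abs (cb x \<gamma>' - cb x \<gamma> - (\<Sum>i\<in>UNIV. (\<gamma>' - \<gamma>) $ i * gb i x \<gamma>)) <= K * (1 + abs x) ^ N * (dist \<gamma>' \<gamma>)^2"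
  if "\<gamma> : closure \<Theta>\<^sub>\<gamma>" "\<gamma>' : \<Theta>\<^sub>\<gamma>" for x \<gamma> \<gamma>'
  by (rule closure_le[OF _ _ _ that(1), where f="%\<gamma>. abs (cb x \<gamma>' - cb x \<gamma> - (\<Sum>i\<in>UNIV. (\<gamma>' - \<gamma>) $ i * gb i x \<gamma>))"])
   (use K(2) that(2) in "auto intro!: continuous_intros cbc gbc simp: cbi")
 then show "EX K N. K >= 0 & (ALL x. ALL \<gamma>:closure \<Theta>\<^sub>\<gamma>. ALL \<gamma>':\<Theta>\<^sub>\<gamma>. abs (cb x \<gamma>' - cb x \<gamma> - (\<Sum>i\<in>UNIV. (\<gamma>' - \<gamma>) $ i * gb i x \<gamma>)) <= K * (1 + abs x) ^ N * (dist \<gamma>' \<gamma>)^2)"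
  using K(1) by blast
 have T: "taylor_at (closure \<Theta>\<^sub>\<gamma>) p (%x. bval \<Theta>\<^sub>\<gamma> (partials is (c x)))" if l: "length is <= 1" and p: "p : \<Theta>\<^sub>\<gamma>" for "is" p
  unfolding taylor_at_def
 proof (intro conjI exI[of _ "%i x. partials (i # is) (c x) p"] allI)
  let ?b = "%x. bval \<Theta>\<^sub>\<gamma> (partials is (c x))"
  show "poly_lipschitz (closure \<Theta>\<^sub>\<gamma>) ?b" using l by (intro poly_lipschitz_bval s(1,2)) auto
  show "EX N A. poly_le N A (%x. partials (i # is) (c x) p)" for i using l by (intro poly_lipschitz_at[OF s(1) p]) simp
  have bc: "continuous_on (closure \<Theta>\<^sub>\<gamma>) (?b x)" for x using l by (intro bval_continuous s(2)) simp
  obtain K N where K: "K >= 0" "!!x \<theta>'. \<theta>' : \<Theta>\<^sub>\<gamma> ==> abs (partials is (c x) \<theta>' - partials is (c x) p - (\<Sum>i\<in>UNIV. (\<theta>' - p) $ i * partials (i # is) (c x) p)) <= K * (1 + abs x) ^ N * (dist \<theta>' p)^2"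
   using s(4)[OF l] p by blast
  have "abs (?b x \<theta> - ?b x p - (\<Sum>i\<in>UNIV. (\<theta> - p) $ i * partials (i # is) (c x) p)) <= K * (1 + abs x) ^ N * (dist \<theta> p)^2" if "\<theta> : closure \<Theta>\<^sub>\<gamma>" for x \<theta>
   by (rule closure_le[OF _ _ _ that]) (use K(2) p in "auto intro!: continuous_intros bc simp: bval_interior")
  then show "dominated (UNIV \<times> closure \<Theta>\<^sub>\<gamma>) (%p. 1 + abs (fst p)) (%q. (dist (snd q) p)^2)
    (%q. ?b (fst q) (snd q) - ?b (fst q) p - (\<Sum>i\<in>UNIV. (snd q - p) $ i * partials (i # is) (c (fst q)) p))"
   unfolding dominated_def using K(1) by (intro exI[of _ K] exI[of _ N]) auto
 qed
 show "taylor_at (closure \<Theta>\<^sub>\<gamma>) p cb" "taylor_at (closure \<Theta>\<^sub>\<gamma>) p (gb i)" if "p : \<Theta>\<^sub>\<gamma>" for p i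
  using T[of "[]"] T[of "[i]"] that by (simp_all add: cb_def gb_def del: partials.simps(2))
qed

end

section \<open>Pointwise expansion of the residuals\<close>

text \<open>On the segment between \<open>z\<close> and \<open>y\<close> absolute values are at most
  \<open>|y| + |z|\<close>, so one polynomial weight bounds the second derivative there; both claims
  follow by the mean value inequality.\<close>

lemma poly_second_derivative:
 fixes f f' f'' :: "real => real"
 assumes f: "!!z. (f has_real_derivative f' z) (at z)" and f': "!!z. (f' has_real_derivative f'' z) (at z)"
  and b: "!!z. abs (f'' z) <= K * (1 + abs z) ^ N"
 shows "abs (f' y - f' z) <= K * (1 + abs y + abs z) ^ N * abs (y - z)"
  and "abs (f y - f z - f' z * (y - z)) <= K * (1 + abs y + abs z) ^ N * (y - z)^2"
proof -
 have K: "K >= 0" using order_trans[OF abs_ge_zero b[of 0]] by simp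
 have seg: "abs t <= abs y + abs z" "abs (t - z) <= abs (y - z)" if "t : closed_segment z y" for t y
  using that by (auto simp: closed_segment_eq_real_ivl split: if_splits)
 have lip: "abs (f' t - f' z) <= K * (1 + abs y + abs z) ^ N * abs (t - z)" if t: "abs t <= abs y + abs z" "t : closed_segment z y" for t
 proof -
  have "norm (f' t - f' z) <= K * (1 + abs y + abs z) ^ N * norm (t - z)"
  proof (rule field_differentiable_bound[where S="closed_segment z y" and f'=f''])
   fix s assume "s : closed_segment z y"
   then have "K * (1 + abs s) ^ N <= K * (1 + abs y + abs z) ^ N" using seg(1)[of s y] K by (intro mult_left_mono power_mono) auto
   then show "norm (f'' s) <= K * (1 + abs y + abs z) ^ N" using b[of s] by simp
  qed (use f' t in "auto intro: has_field_derivative_at_within")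
  then show ?thesis by simp
 qed
 show "abs (f' y - f' z) <= K * (1 + abs y + abs z) ^ N * abs (y - z)" by (rule lip) auto
 have "norm ((f y - f' z * y) - (f z - f' z * z)) <= (K * (1 + abs y + abs z) ^ N * abs (y - z)) * norm (y - z)"
 proof (rule field_differentiable_bound[where S="closed_segment z y" and f'="%t. f' t - f' z" and f="%t. f t - f' z * t"])
  fix t assume t: "t : closed_segment z y"
  have "K * (1 + abs y + abs z) ^ N * abs (t - z) <= K * (1 + abs y + abs z) ^ N * abs (y - z)" using seg(2)[OF t] K by (intro mult_left_mono) auto
  then show "norm (f' t - f' z) <= K * (1 + abs y + abs z) ^ N * abs (y - z)" using lip[OF seg(1)[OF t] t] by simp
  show "((%t. f t - f' z * t) has_real_derivative f' t - f' z) (at t within closed_segment z y)"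
   by (auto intro!: derivative_eq_intros has_field_derivative_at_within[OF f])
 qed auto
 moreover have "(f y - f' z * y) - (f z - f' z * z) = f y - f z - f' z * (y - z)" by (simp add: algebra_simps)
 ultimately show "abs (f y - f z - f' z * (y - z)) <= K * (1 + abs y + abs z) ^ N * (y - z)^2"
  by (simp add: power2_eq_square mult.assoc)
qed

section \<open>Deterministic bounds for a single residual\<close>

locale residual_bounds =
 fixes S :: "'i set" and x wt r h :: "'i => real" and \<alpha> :: "'i => 'a::metric_space" and \<gamma> :: "'i => real ^ 'p::finite"
  and D\<alpha> :: "'a set" and D\<gamma> :: "(real ^ 'p) set" and ab :: "real => 'a => real" and cb :: "real => real ^ 'p => real"
  and gb :: "'p => real => real ^ 'p => real" and \<alpha>0 \<gamma>0
 assumes h: "!!i. i : S ==> 0 < h i & h i <= 1" and \<alpha>: "!!i. i : S ==> \<alpha> i : D\<alpha>" and \<gamma>: "!!i. i : S ==> \<gamma> i : D\<gamma>"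
  and \<theta>0: "\<alpha>0 : D\<alpha>" "\<gamma>0 : D\<gamma>" and bdd: "bounded D\<gamma>"
  and ab: "poly_lipschitz D\<alpha> ab" and cb: "poly_lipschitz D\<gamma> cb" and gb: "!!k. poly_lipschitz D\<gamma> (gb k)"
  and cb0: "!!x \<gamma>. \<gamma> : D\<gamma> ==> cb x \<gamma> ~= 0" and icb: "poly_lipschitz D\<gamma> (%x \<gamma>. inverse (cb x \<gamma>))"
  and taylor: "EX K N. K >= 0 & (ALL x. ALL \<gamma>:D\<gamma>. abs (cb x \<gamma>0 - cb x \<gamma> - (\<Sum>k\<in>UNIV. (\<gamma>0 - \<gamma>) $ k * gb k x \<gamma>)) <= K * (1 + abs x) ^ N * (dist \<gamma>0 \<gamma>)^2)"
begin

text \<open>Here \<open>x\<close> is the state, \<open>wt\<close> the increment of the noise,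
  \<open>r\<close> the Euler remainder and \<open>h\<close> the step. \<open>err\<close> adds the
  error of the estimated drift to \<open>r\<close>, \<open>lin\<close> is the first-order relative
  error of the scale, and \<open>small\<close> collects the products that vanish after summation
  over \<open>sqrt (n h)\<close>.\<close>

definition U :: "'i => real" where "U i = 1 + abs (x i) + abs (wt i) + abs (r i)"
definition g :: "'i => real" where "g i = dist (\<gamma> i) \<gamma>0"
definition err :: "'i => real" where "err i = r i + h i * (ab (x i) \<alpha>0 - ab (x i) (\<alpha> i))"
definition resid :: "'i => real" where "resid i = (cb (x i) \<gamma>0 * wt i + err i) / cb (x i) (\<gamma> i)"
definition lin :: "'i => real" where "lin i = (\<Sum>k\<in>UNIV. gb k (x i) (\<gamma> i) / cb (x i) (\<gamma> i) * (\<gamma> i - \<gamma>0) $ k)"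
definition small :: "'i => real" where "small i = (r i)^2 + (h i)^2 + abs (wt i) * (abs (r i) + h i)"

abbreviation "dmd \<equiv> dominated S U"

lemma U1: "i : S ==> 1 <= U i" by (simp add: U_def)

sublocale domination S U by unfold_locales (rule U1)

lemma xU: "i : S ==> abs (x i) + 1 <= U i" by (simp add: U_def)

lemma small_nonneg: "i : S ==> 0 <= small i" using h[of i] by (simp add: small_def)

lemmas pl = dominated_poly_lipschitz[where x=x, OF _ xU]

lemma dom_coeff:
 "dmd (%_. 1) (%i. cb (x i) (\<gamma> i))" "dmd (%_. 1) (%i. cb (x i) \<gamma>0)" "dmd (%_. 1) (%i. gb k (x i) (\<gamma> i))"
 "dmd (%_. 1) (%i. inverse (cb (x i) (\<gamma> i)))" "dmd (%_. 1) (%i. inverse (cb (x i) \<gamma>0))"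
 "dmd (%_. 1) (%i. ab (x i) \<alpha>0 - ab (x i) (\<alpha> i))" "dmd g (%i. cb (x i) (\<gamma> i) - cb (x i) \<gamma>0)"
 "dmd g (%i. gb k (x i) (\<gamma> i) * inverse (cb (x i) (\<gamma> i)) - gb k (x i) \<gamma>0 * inverse (cb (x i) \<gamma>0))"
 using pl(1)[OF cb, of \<gamma> \<gamma>] pl(1)[OF cb, of "%_. \<gamma>0" \<gamma>] pl(1)[OF gb, of \<gamma> \<gamma> k] pl(1)[OF icb, of \<gamma> \<gamma>] pl(1)[OF icb, of "%_. \<gamma>0" \<gamma>]
  dominated_diff[OF pl(1)[OF ab, of "%_. \<alpha>0" \<alpha>] pl(1)[OF ab, of \<alpha> \<alpha>]] pl(2)[OF cb, of \<gamma> "%_. \<gamma>0"]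
  pl(2)[OF poly_lipschitz_mult[OF gb icb], of \<gamma> "%_. \<gamma>0" k] \<alpha> \<gamma> \<theta>0
 unfolding g_def[abs_def] by auto

lemma dom_err: "dmd (%i. abs (r i) + h i) err"
proof -
 have "dmd (%i. abs (r i) + h i) r" by (intro dominated_self[where C=1]) (auto dest!: h)
 moreover have "dmd (%i. abs (r i) + h i) (%i. (ab (x i) \<alpha>0 - ab (x i) (\<alpha> i)) * h i)"
  by (intro dominated_scale dom_coeff dominated_self[where C=1]) (auto dest!: h)
 ultimately show ?thesis unfolding err_def[abs_def] by (subst mult.commute) (rule dominated_add)
qed

lemma resid_eq: "i : S ==> cb (x i) (\<gamma> i) * resid i = cb (x i) \<gamma>0 * wt i + err i"
 using cb0[OF \<gamma>] by (simp add: resid_def)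

lemma dom_resid: "dmd (%i. abs (wt i) + abs (r i) + h i) resid"
proof -
 have wt: "dmd (%i. abs (wt i) + abs (r i) + h i) wt" by (intro dominated_self[where C=1]) (auto dest!: h)
 have e: "dmd (%i. abs (wt i) + abs (r i) + h i) err" by (intro dominated_mono[OF dom_err, where C=1]) (auto dest!: h)
 have "dmd (%i. abs (wt i) + abs (r i) + h i) (%i. inverse (cb (x i) (\<gamma> i)) * (cb (x i) \<gamma>0 * wt i + err i))"
  by (intro dominated_scale dominated_add dom_coeff wt e)
 then show ?thesis unfolding resid_def[abs_def] by (simp add: divide_inverse mult.commute)
qed

text \<open>Up to the factor \<open>1 / cb (x i) (\<gamma> i)\<close> the difference is
  \<open>err\<close> minus the change of the scale times \<open>wt\<close>.\<close>

lemma dom_diff: "dmd (%i. g i * abs (wt i) + abs (r i) + h i) (%i. resid i - wt i)"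
proof -
 let ?Z = "%i. g i * abs (wt i) + abs (r i) + h i"
 have gw: "0 <= g i * abs (wt i)" for i by (simp add: g_def)
 have "dmd (%i. g i * abs (wt i)) (%i. (cb (x i) (\<gamma> i) - cb (x i) \<gamma>0) * wt i)"
  by (rule dominated_mult[OF dom_coeff(7) dominated_self[where C=1]]) auto
 then have 1: "dmd ?Z (%i. (cb (x i) (\<gamma> i) - cb (x i) \<gamma>0) * wt i)"
  by (rule dominated_mono[where C=1]) (use gw in "auto dest!: h")
 have 2: "dmd ?Z err" using gw by (intro dominated_mono[OF dom_err, where C=1]) (auto dest!: h)
 have "dmd ?Z (%i. inverse (cb (x i) (\<gamma> i)) * (err i - (cb (x i) (\<gamma> i) - cb (x i) \<gamma>0) * wt i))"
  by (intro dominated_scale dominated_diff dom_coeff 1 2)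
 then show ?thesis
 proof (rule dominated_le[where C=1])
  show "abs (resid i - wt i) <= 1 * abs (inverse (cb (x i) (\<gamma> i)) * (err i - (cb (x i) (\<gamma> i) - cb (x i) \<gamma>0) * wt i))" if "i : S" for i
   using cb0[OF \<gamma>[OF that], of "x i"] by (simp add: resid_def field_simps)
 qed
qed

lemma dom_diff_square: "dmd (%i. (g i)^2 * (wt i)^2 + small i) (%i. (resid i - wt i)^2)"
 unfolding power2_eq_square[of "resid _ - wt _"]
proof (rule dominated_mono[OF dominated_mult[OF dom_diff dom_diff], where C=3])
 fix i assume i: "i : S"
 define p q where "p = g i * abs (wt i)" and "q = abs (r i)"
 have pq: "0 <= p" "0 <= q" "0 < h i" "p^2 = (g i)^2 * (wt i)^2" "q^2 = (r i)^2" using h[OF i] by (auto simp: p_def q_def g_def power_mult_distrib)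
 have "(p + q + h i) * (p + q + h i) <= 3 * (p^2 + q^2 + (h i)^2)"
  using zero_le_power2[of "p - q"] zero_le_power2[of "p - h i"] zero_le_power2[of "q - h i"]
  by (simp add: power2_eq_square algebra_simps)
 also have "p^2 + q^2 + (h i)^2 <= (g i)^2 * (wt i)^2 + small i" using pq h[OF i] by (simp add: small_def)
 finally have "(p + q + h i) * (p + q + h i) <= 3 * ((g i)^2 * (wt i)^2 + small i)" by simp
 moreover have "0 <= (p + q + h i) * (p + q + h i)" using pq by simp
 ultimately show "0 <= (g i)^2 * (wt i)^2 + small i &
   abs ((g i * abs (wt i) + abs (r i) + h i) * (g i * abs (wt i) + abs (r i) + h i)) <= 3 * ((g i)^2 * (wt i)^2 + small i)"
  using small_nonneg[OF i] by (simp add: p_def q_def)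
qed

text \<open>Gradient and denominator in \<open>lin\<close> are taken at the estimated parameter, as
  in the bias matrix. Two quadratic errors arise: the Taylor remainder \<open>\<tau>\<close>, and
  the exchange of \<open>1 / cb\<close> at \<open>\<gamma>0\<close> for its value at the estimate in
  the linear term \<open>s\<close>.\<close>

lemma dom_lin: "dmd (%i. (g i)^2) (%i. 1 - cb (x i) (\<gamma> i) / cb (x i) \<gamma>0 + lin i)"
proof -
 define s where "s i = (\<Sum>k\<in>UNIV. (\<gamma> i - \<gamma>0) $ k * gb k (x i) (\<gamma> i))" for i
 define \<tau> where "\<tau> i = cb (x i) \<gamma>0 - cb (x i) (\<gamma> i) + s i" for i
 have g: "0 <= g i" for i by (simp add: g_def)
 obtain K N where K: "K >= 0" "!!x \<gamma>. \<gamma> : D\<gamma> ==> abs (cb x \<gamma>0 - cb x \<gamma> - (\<Sum>k\<in>UNIV. (\<gamma>0 - \<gamma>) $ k * gb k x \<gamma>)) <= K * (1 + abs x) ^ N * (dist \<gamma>0 \<gamma>)^2"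
  using taylor by blast
 have "abs (\<tau> i) <= K * U i ^ N * (g i)^2" if "i : S" for i
 proof -
  have "(\<Sum>k\<in>UNIV. (\<gamma>0 - \<gamma> i) $ k * gb k (x i) (\<gamma> i)) = - s i" unfolding s_def by (simp add: left_diff_distrib sum_subtractf)
  then have "abs (\<tau> i) <= K * (1 + abs (x i)) ^ N * (g i)^2" using K(2)[OF \<gamma>[OF that], of "x i"] by (simp add: \<tau>_def g_def dist_commute)
  also have "... <= K * U i ^ N * (g i)^2" using K(1) xU[OF that] by (intro mult_right_mono mult_left_mono power_mono) auto
  finally show ?thesis .
 qed
 then have \<tau>: "dmd (%i. (g i)^2) \<tau>" unfolding dominated_def using K(1) by (intro exI[of _ K] exI[of _ N]) auto
 have "dmd g (%i. gb k (x i) (\<gamma> i) * (\<gamma> i - \<gamma>0) $ k)" for k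
  by (intro dominated_scale dom_coeff dominated_self[where C=1]) (auto simp: g_def dist_norm component_le_norm_cart simp del: vector_minus_component)
 then have "dmd g (%i. \<Sum>k\<in>UNIV. gb k (x i) (\<gamma> i) * (\<gamma> i - \<gamma>0) $ k)"
  by (rule dominated_sum) (use g in "auto intro!: dominated_self[where C=1]")
 then have "dmd g s" unfolding s_def[abs_def] by (simp only: mult.commute)
 then have "dmd (%i. g i * g i) (%i. s i * (cb (x i) (\<gamma> i) - cb (x i) \<gamma>0))" by (rule dominated_mult[OF _ dom_coeff(7)])
 then have sc: "dmd (%i. (g i)^2) (%i. s i * (cb (x i) (\<gamma> i) - cb (x i) \<gamma>0))" by (simp add: power2_eq_square)
 have "dmd (%i. (g i)^2) (%i. inverse (cb (x i) \<gamma>0) * (\<tau> i - inverse (cb (x i) (\<gamma> i)) * (s i * (cb (x i) (\<gamma> i) - cb (x i) \<gamma>0))))"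
  by (intro dominated_scale dominated_diff dom_coeff \<tau> sc)
 then show ?thesis
 proof (rule dominated_le[where C=1])
  fix i assume i: "i : S"
  have "lin i = s i / cb (x i) (\<gamma> i)" unfolding lin_def s_def by (simp add: sum_divide_distrib mult_ac)
  moreover have "1 - cb (x i) (\<gamma> i) / cb (x i) \<gamma>0 + s i / cb (x i) (\<gamma> i) =
    inverse (cb (x i) \<gamma>0) * (\<tau> i - inverse (cb (x i) (\<gamma> i)) * (s i * (cb (x i) (\<gamma> i) - cb (x i) \<gamma>0)))"
   using cb0[OF \<gamma>[OF i], of "x i"] cb0[OF \<theta>0(2), of "x i"] by (simp add: \<tau>_def field_simps)
  ultimately show "abs (1 - cb (x i) (\<gamma> i) / cb (x i) \<gamma>0 + lin i) <=
    1 * abs (inverse (cb (x i) \<gamma>0) * (\<tau> i - inverse (cb (x i) (\<gamma> i)) * (s i * (cb (x i) (\<gamma> i) - cb (x i) \<gamma>0))))"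
   by simp
 qed
qed

section \<open>Functions of the residuals\<close>

context
 fixes f f' f'' :: "real => real" and K N
 assumes f: "!!z. (f has_real_derivative f' z) (at z)" and f': "!!z. (f' has_real_derivative f'' z) (at z)"
  and b: "!!z. abs (f'' z) <= K * (1 + abs z) ^ N" and f'0: "f' 0 = 0"
begin

lemma K_nonneg: "K >= 0" using order_trans[OF abs_ge_zero b[of 0]] by simp

lemma f'_le: "abs (f' z) <= K * (1 + abs z) ^ N * abs z"
 using poly_second_derivative(1)[OF f f' b, of z 0] f'0 by simp

lemma dom_one: "dmd (%_. 1) resid" "dmd (%_. 1) wt"
proof -
 have "dmd (%_. 1) U" by (rule dominated_unit)
 then show "dmd (%_. 1) resid"
  by (rule dominated_trans[OF dominated_mono[OF dom_resid, where C=2 and Z'=U], rotated]) (use h in "auto simp: U_def", smt (verit))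
 show "dmd (%_. 1) wt" by (rule dominated_le[OF dominated_unit, where C=1]) (auto simp: U_def)
qed

lemma dom_weight: "dmd (%_. 1) (%i. K * (1 + abs (resid i) + abs (wt i)) ^ N)"
proof (intro dominated_scale dominated_power dominated_add dominated_const)
 show "dmd (%_. 1) (%i. abs (resid i))" by (rule dominated_le[OF dom_one(1), where C=1]) simp
 show "dmd (%_. 1) (%i. abs (wt i))" by (rule dominated_le[OF dom_one(2), where C=1]) simp
qed

lemma dom_f': "dmd (%i. abs (wt i) + abs (r i) + h i) (%i. f' (resid i))"
proof (rule dominated_le[OF dominated_scale[OF dom_weight dom_resid], where C=1])
 fix i
 have "(1 + abs (resid i)) ^ N <= (1 + abs (resid i) + abs (wt i)) ^ N" by (intro power_mono) auto
 then have "K * (1 + abs (resid i)) ^ N * abs (resid i) <= K * (1 + abs (resid i) + abs (wt i)) ^ N * abs (resid i)"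
  using K_nonneg by (intro mult_right_mono mult_left_mono) auto
 then show "abs (f' (resid i)) <= 1 * abs (K * (1 + abs (resid i) + abs (wt i)) ^ N * resid i)"
  using f'_le[of "resid i"] K_nonneg by (simp add: abs_mult)
qed

lemma expansion:
 "dmd (%i. (g i)^2 * ((wt i)^2 + small i) + small i) (%i. f (resid i) - f (wt i) + resid i * f' (resid i) * lin i)"
proof -
 let ?Z = "%i. (g i)^2 * ((wt i)^2 + small i) + small i"
 let ?R = "%i. f (wt i) - f (resid i) - f' (resid i) * (wt i - resid i)"
 let ?m = "%i. abs (wt i) + abs (r i) + h i"
 have sq: "0 <= ?m i" "(?m i)^2 <= 3 * ((wt i)^2 + small i)" "?m i * (abs (r i) + h i) <= 2 * small i" if "i : S" for i
 proof -
  have hp: "0 <= h i" using h[OF that] by simp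
  then show "0 <= ?m i" by simp
  have "(?m i)^2 <= 3 * ((wt i)^2 + ((abs (r i))^2 + (h i)^2))" "(abs (r i) + h i)^2 <= 2 * ((abs (r i))^2 + (h i)^2)"
   using zero_le_power2[of "abs (wt i) - abs (r i)"] zero_le_power2[of "abs (wt i) - h i"] zero_le_power2[of "abs (r i) - h i"]
   by (simp_all add: power2_eq_square algebra_simps)
  moreover have "0 <= abs (wt i) * (abs (r i) + h i)" using hp by simp
  ultimately show "(?m i)^2 <= 3 * ((wt i)^2 + small i)" "?m i * (abs (r i) + h i) <= 2 * small i"
   by (simp_all add: small_def power2_eq_square algebra_simps)
 qed
 have 1: "dmd ?Z (%i. f' (resid i) * (resid i * (1 - cb (x i) (\<gamma> i) / cb (x i) \<gamma>0 + lin i)))"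
 proof (rule dominated_mono[OF dominated_mult[OF dom_f' dominated_mult[OF dom_resid dom_lin]], where C=3])
  fix i assume i: "i : S"
  have "(g i)^2 * (?m i)^2 <= (g i)^2 * (3 * ((wt i)^2 + small i))" using sq(2)[OF i] by (intro mult_left_mono) auto
  note that = this
  show "0 <= ?Z i & abs (?m i * (?m i * (g i)^2)) <= 3 * ?Z i"
  proof -
   define A B where "A = (g i)^2 * (?m i)^2" and "B = (g i)^2 * ((wt i)^2 + small i)"
   have eq: "?m i * (?m i * (g i)^2) = A" unfolding A_def by (simp add: power2_eq_square mult_ac)
   have "0 <= A" "0 <= B" using small_nonneg[OF i] by (simp_all add: A_def B_def)
   moreover have "A <= 3 * B" using that by (simp only: A_def B_def mult.left_commute)
   ultimately show ?thesis unfolding eq B_def[symmetric] using small_nonneg[OF i] by simp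
  qed
 qed
 have 2: "dmd ?Z (%i. f' (resid i) * (inverse (cb (x i) \<gamma>0) * err i))"
 proof (rule dominated_mono[OF dominated_mult[OF dom_f' dominated_scale[OF dom_coeff(5) dom_err]], where C=2])
  have aux: "0 <= b + s & abs a <= 2 * (b + s)" if "0 <= b" "0 <= a" "a <= 2 * s" "0 <= s" for a b s :: real using that by simp
  fix i assume i: "i : S"
  have "0 <= (g i)^2 * ((wt i)^2 + small i)" using small_nonneg[OF i] by simp
  moreover have "0 <= ?m i * (abs (r i) + h i)" using h[OF i] by simp
  ultimately show "0 <= ?Z i & abs (?m i * (abs (r i) + h i)) <= 2 * ?Z i" using sq(3)[OF i] small_nonneg[OF i]
   by (intro aux)
 qed
 have 3: "dmd ?Z ?R"
 proof (rule dominated_mono[OF dominated_le[OF dominated_scale[OF dom_weight dom_diff_square], where C=1], where C=1])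
  fix i
  show "abs (?R i) <= 1 * abs (K * (1 + abs (resid i) + abs (wt i)) ^ N * (resid i - wt i)^2)"
   using poly_second_derivative(2)[OF f f' b, of "wt i" "resid i"] K_nonneg by (simp add: abs_mult power2_commute[of "wt i"] add_ac)
 next
  fix i assume i: "i : S"
  show "0 <= ?Z i & abs ((g i)^2 * (wt i)^2 + small i) <= 1 * ?Z i"
   using small_nonneg[OF i] by (simp add: distrib_left)
 qed
 show ?thesis
 proof (rule dominated_le[OF dominated_diff[OF dominated_add[OF 1 2] 3], where C=1])
  fix i assume i: "i : S"
  have "resid i - wt i = resid i * (1 - cb (x i) (\<gamma> i) / cb (x i) \<gamma>0) + inverse (cb (x i) \<gamma>0) * err i"
   using cb0[OF \<theta>0(2), of "x i"] resid_eq[OF i] by (simp add: field_simps)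
  then have "f (resid i) - f (wt i) + resid i * f' (resid i) * lin i =
   f' (resid i) * (resid i * (1 - cb (x i) (\<gamma> i) / cb (x i) \<gamma>0 + lin i)) + f' (resid i) * (inverse (cb (x i) \<gamma>0) * err i) - ?R i"
   by (simp add: algebra_simps)
  then show "abs (f (resid i) - f (wt i) + resid i * f' (resid i) * lin i) <= 1 *
   abs (f' (resid i) * (resid i * (1 - cb (x i) (\<gamma> i) / cb (x i) \<gamma>0 + lin i)) + f' (resid i) * (inverse (cb (x i) \<gamma>0) * err i) - ?R i)" by simp
 qed
qed

text \<open>First order in \<open>g\<close> is enough, since these terms are later divided by
  \<open>n h\<close> and not by its root. The products of \<open>g\<close> with
  \<open>|wt| (|r| + h)\<close> go into \<open>small\<close> because \<open>g\<close> is bounded on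
  a bounded parameter set.\<close>

lemma dom_zeta_diff: "dmd (%i. g i * (wt i)^2 + small i) (%i. resid i * f' (resid i) - wt i * f' (wt i))"
proof -
 let ?d = "%i. g i * abs (wt i) + abs (r i) + h i" and ?m = "%i. abs (wt i) + abs (r i) + h i"
 obtain B where B: "B >= 1" "!!i. i : S ==> g i <= B"
 proof -
  obtain B where "!!x y. x : D\<gamma> ==> y : D\<gamma> ==> dist x y <= B" using bdd unfolding bounded_two_points by blast
  then show ?thesis using \<gamma> \<theta>0 by (intro that[of "max 1 B"]) (auto simp: g_def intro: max.coboundedI2)
 qed
 have wt: "dmd ?m (%i. abs (wt i))" by (intro dominated_self[where C=1]) (auto dest!: h)
 have rs: "dmd ?m (%i. abs (resid i) + abs (wt i))"
  by (rule dominated_add[OF dominated_le[OF dom_resid, where C=1] wt]) simp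
 have "dmd (%i. g i * (wt i)^2 + small i) (%i. (K * (1 + abs (resid i) + abs (wt i)) ^ N) * ((resid i - wt i) * (abs (resid i) + abs (wt i))))"
 proof (rule dominated_mono[OF dominated_scale[OF dom_weight dominated_mult[OF dom_diff rs]], where C="2 + B"])
  fix i assume i: "i : S"
  define p q z where "p = abs (wt i)" and "q = abs (r i)" and "z = g i"
  have pq: "0 <= p" "0 <= q" "0 < h i" "0 <= z" "z <= B" using h[OF i] B(2)[OF i] by (auto simp: p_def q_def z_def g_def)
  have s: "small i = q^2 + (h i)^2 + p * (q + h i)" "(wt i)^2 = p^2" by (simp_all add: small_def p_def q_def)
  have "(z * p + q + h i) * (p + q + h i) = z * p^2 + z * (p * (q + h i)) + p * (q + h i) + (q + h i)^2"
   by (simp add: power2_eq_square algebra_simps)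
  also have "... <= z * p^2 + B * (p * (q + h i)) + p * (q + h i) + 2 * (q^2 + (h i)^2)"
   using pq zero_le_power2[of "q - h i"] mult_right_mono[OF pq(5), of "p * (q + h i)"] by (simp add: power2_eq_square algebra_simps)
  also have "... <= (2 + B) * (z * p^2 + small i)"
  proof -
   have n: "0 <= z * p^2" "0 <= p * (q + h i)" "0 <= q^2 + (h i)^2" using pq by auto
   then have "0 <= (1 + B) * (z * p^2)" "0 <= B * (q^2 + (h i)^2)" using B(1) by auto
   then show ?thesis using n unfolding s by (simp add: algebra_simps)
  qed
  finally have "(z * p + q + h i) * (p + q + h i) <= (2 + B) * (z * p^2 + small i)" .
  moreover have "0 <= (z * p + q + h i) * (p + q + h i)" "0 <= z * p^2 + small i" using pq small_nonneg[OF i] by auto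
  ultimately show "0 <= g i * (wt i)^2 + small i & abs (?d i * ?m i) <= (2 + B) * (g i * (wt i)^2 + small i)"
   by (simp add: p_def q_def z_def)
 qed
 then show ?thesis
 proof (rule dominated_le[where C=1])
  fix i
  let ?W = "K * (1 + abs (resid i) + abs (wt i)) ^ N"
  have "(1 + abs (resid i)) ^ N <= (1 + abs (resid i) + abs (wt i)) ^ N" by (intro power_mono) auto
  then have "K * (1 + abs (resid i)) ^ N * abs (resid i) <= ?W * abs (resid i)" using K_nonneg by (intro mult_right_mono mult_left_mono) auto
  then have a: "abs (f' (resid i)) <= ?W * abs (resid i)" using f'_le[of "resid i"] by linarith
  have c: "abs (f' (resid i) - f' (wt i)) <= ?W * abs (resid i - wt i)" using poly_second_derivative(1)[OF f f' b, of "resid i" "wt i"] .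
  have eq: "resid i * f' (resid i) - wt i * f' (wt i) = (resid i - wt i) * f' (resid i) + wt i * (f' (resid i) - f' (wt i))" by (simp add: algebra_simps)
  have "abs (resid i * f' (resid i) - wt i * f' (wt i)) <= abs (resid i - wt i) * (?W * abs (resid i)) + abs (wt i) * (?W * abs (resid i - wt i))"
   unfolding eq using a c by (intro abs_triangle_ineq[THEN order_trans] add_mono) (auto simp: abs_mult intro!: mult_left_mono)
  also have "... = ?W * (abs (resid i - wt i) * (abs (resid i) + abs (wt i)))" by (simp add: algebra_simps)
  finally show "abs (resid i * f' (resid i) - wt i * f' (wt i)) <= 1 * abs (?W * ((resid i - wt i) * (abs (resid i) + abs (wt i))))"
   using K_nonneg by (simp add: abs_mult)
 qed
qed

lemma dom_zeta: "dmd (%i. (wt i)^2) (%i. wt i * f' (wt i))"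
proof (rule dominated_le[OF dominated_scale[OF dom_weight dominated_self[where Y="%i. (wt i)^2" and C=1]], where C=1])
 fix i
 have "(1 + abs (wt i)) ^ N <= (1 + abs (resid i) + abs (wt i)) ^ N" by (intro power_mono) auto
 then have "K * (1 + abs (wt i)) ^ N * (wt i)^2 <= K * (1 + abs (resid i) + abs (wt i)) ^ N * (wt i)^2"
  using K_nonneg by (intro mult_right_mono mult_left_mono) auto
 moreover have "abs (wt i) * abs (f' (wt i)) <= K * (1 + abs (wt i)) ^ N * (wt i)^2"
  using mult_left_mono[OF f'_le[of "wt i"] abs_ge_zero[of "wt i"]] by (simp add: power2_eq_square mult_ac)
 ultimately show "abs (wt i * f' (wt i)) <= 1 * abs (K * (1 + abs (resid i) + abs (wt i)) ^ N * (wt i)^2)"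
  using K_nonneg by (simp add: abs_mult)
qed auto

end

text \<open>In the squared drift increment these are the cross term and the squared error, that is,
  all that remains beside the squared true scale times \<open>wt^2\<close>.\<close>

lemma dom_contrast: "dmd small (%i. (2 * gb k (x i) (\<gamma> i) * inverse (cb (x i) (\<gamma> i)) ^ 3) * (2 * cb (x i) \<gamma>0 * wt i * err i + (err i)^2))"
proof -
 have wt: "dmd (%i. abs (wt i)) wt" by (rule dominated_self[where C=1]) auto
 have c: "dmd (%_. 1) (%i. 2 * gb k (x i) (\<gamma> i) * inverse (cb (x i) (\<gamma> i)) ^ 3)" "dmd (%_. 1) (%i. 2 * cb (x i) \<gamma>0)"
  by (intro dominated_scale dominated_power dominated_const dom_coeff)+
 have 1: "dmd small (%i. 2 * cb (x i) \<gamma>0 * wt i * err i)"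
  unfolding mult.assoc[of _ "wt _"]
 proof (intro dominated_scale[OF c(2)] dominated_mono[OF dominated_mult[OF wt dom_err], where C=1])
  fix i assume "i : S"
  then have "0 <= abs (wt i) * (abs (r i) + h i)" using h[of i] by simp
  then show "0 <= small i & abs (abs (wt i) * (abs (r i) + h i)) <= 1 * small i" by (simp add: small_def)
 qed
 have 2: "dmd small (%i. (err i)^2)"
  unfolding power2_eq_square[of "err _"]
 proof (rule dominated_mono[OF dominated_mult[OF dom_err dom_err], where C=2])
  fix i assume i: "i : S"
  have "(abs (r i) + h i) * (abs (r i) + h i) <= 2 * ((abs (r i))^2 + (h i)^2)"
   using zero_le_power2[of "abs (r i) - h i"] by (simp add: power2_eq_square algebra_simps)
  moreover have "0 <= abs (wt i) * (abs (r i) + h i)" "0 <= (abs (r i) + h i) * (abs (r i) + h i)" using h[OF i] by auto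
  ultimately show "0 <= small i & abs ((abs (r i) + h i) * (abs (r i) + h i)) <= 2 * small i"
   using small_nonneg[OF i] by (simp add: small_def)
 qed
 show ?thesis by (intro dominated_scale[OF c(1)] dominated_add[OF 1 2])
qed

end

section \<open>Orders of magnitude along the observations\<close>

context prob_space
begin

lemma moments_bounded_reindex:
 assumes "moments_bounded M T Y" "!!i. i : I ==> t i : T"
 shows "moments_bounded M I (%i. Y (t i))"
 using assms unfolding moments_bounded_def by meson

lemma mean_order_scale:
 assumes "mean_order M I (%_. 1) Y" "!!i. i : I ==> 0 <= c i"
 shows "mean_order M I c (%i w. c i * Y i w)"
proof -
 obtain C where C: "!!i. i : I ==> integrable M (Y i) & (LINT w|M. abs (Y i w)) <= C" using assms(1) unfolding mean_order_def by auto
 have "(LINT w|M. abs (c i * Y i w)) <= C * c i" if "i : I" for i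
  using mult_left_mono[OF conjunct2[OF C[OF that]] assms(2)[OF that]] assms(2)[OF that] by (simp add: abs_mult mult.commute)
 then show ?thesis using C unfolding mean_order_def by (intro exI[of _ C]) auto
qed

lemma moments_bounded_bounded:
 assumes "!!i. i : I ==> abs (c i) <= 1"
 shows "moments_bounded M I (%i w. c i)"
 by (rule moments_bounded_mono[OF moments_bounded_const[of _ 1], where K=1]) (use assms in auto)

end

context sampled_sde
begin

definition n0 :: nat where "n0 = (SOME n0. \<forall>n\<ge>n0. h n <= 1 & 1 <= real n * h n)"

lemma n0: "n0 <= n ==> h n <= 1 & 1 <= real n * h n"
 using someI_ex[OF h_le[unfolded eventually_sequentially]] unfolding n0_def by blast

text \<open>The index is a row \<open>n\<close> with a position \<open>j\<close>; the state is taken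
  at the left end point of the \<open>j\<close>-th interval. The natural subtraction is harmless
  because \<open>j >= 1\<close> on \<open>rows\<close>.\<close>

definition obs_x :: "nat \<times> nat => 'w => real" where "obs_x i w = X (real (snd i - 1) * h (fst i)) w"
definition obs_w :: "nat \<times> nat => 'w => real" where
 "obs_w i w = J (real (snd i) * h (fst i)) w - J (real (snd i - 1) * h (fst i)) w"
definition obs_r :: "nat \<times> nat => 'w => real" where
 "obs_r i w = euler_residual (real (snd i - 1) * h (fst i)) (real (snd i) * h (fst i)) w"
definition obs_u :: "nat \<times> nat => 'w => real" where "obs_u i w = 1 + abs (obs_x i w) + abs (obs_w i w) + abs (obs_r i w)"

lemma row_times:
 assumes "i : rows n0"
 shows "0 < h (fst i)" "h (fst i) <= 1" "0 <= real (snd i - 1) * h (fst i)"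
  "real (snd i) * h (fst i) - real (snd i - 1) * h (fst i) = h (fst i)" "real (snd i - 1) * h (fst i) <= real (snd i) * h (fst i)"
proof -
 obtain n j where i: "i = (n, j)" "n0 <= n" "1 <= j" "j <= n" using assms by (cases i) auto
 then have "real (j - 1) = real j - 1" by simp
 then show "real (snd i) * h (fst i) - real (snd i - 1) * h (fst i) = h (fst i)" unfolding i(1) fst_conv snd_conv by (simp only: left_diff_distrib)
qed (use assms n0[of "fst i"] h_pos[of "fst i"] in "auto simp: rows_def intro!: mult_right_mono")

lemma obs_moments: "moments_bounded M (rows n0) obs_x" "moments_bounded M (rows n0) obs_w"
  "moments_bounded M (rows n0) obs_r" "moments_bounded M (rows n0) obs_u"
proof -
 show x: "moments_bounded M (rows n0) obs_x"
  unfolding obs_x_def[abs_def] by (rule moments_bounded_reindex[OF X_moments]) (use row_times(3) in simp)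
 have wa: "all_moments M (obs_w i)" if "i : rows n0" for i
  unfolding obs_w_def using row_times[OF that] by (intro all_moments_increment)
 show wt: "moments_bounded M (rows n0) obs_w"
  unfolding moments_bounded_def
 proof (intro conjI ballI allI)
  fix q :: nat
  obtain C where C: "C >= 0" "!!s t. 0 <= s ==> s <= t ==> t - s <= 1 ==> (LINT w|M. abs (J t w - J s w) ^ (q + 2)) <= C * (t - s)"
   using increment_moment[of "q + 2"] by auto
  have "integrable M (%w. abs (obs_w i w) ^ q) & (LINT w|M. abs (obs_w i w) ^ q) <= 1 + C" if i: "i : rows n0" for i
  proof -
   have int: "integrable M (%w. abs (obs_w i w) ^ k)" for k by (intro all_moments_integrable all_moments_intros wa i)
   have "abs y ^ q <= 1 + abs y ^ (q + 2)" for y :: real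
    using power_increasing[of q "q + 2" "abs y"] power_le_one[of "abs y" q] by (cases "abs y <= 1") (auto simp: add_increasing add_increasing2 simp del: power_add)
   then have "(LINT w|M. abs (obs_w i w) ^ q) <= (LINT w|M. 1 + abs (obs_w i w) ^ (q + 2))"
    using int[of q] int[of "q + 2"] by (intro integral_mono Bochner_Integration.integrable_add integrable_const) blast+
   also have "... = 1 + (LINT w|M. abs (obs_w i w) ^ (q + 2))" using int[of "q + 2"] by (subst Bochner_Integration.integral_add) (auto simp: prob_space)
   also have "... <= 1 + C * h (fst i)" using C(2)[OF row_times(3,5)[OF i]] row_times(2,4)[OF i] by (simp add: obs_w_def)
   also have "... <= 1 + C" using C(1) row_times[OF i] by (simp add: mult_left_le)
   finally show ?thesis using int by blast
  qed
  then show "EX C. ALL i:rows n0. integrable M (%w. abs (obs_w i w) ^ q) & (LINT w|M. abs (obs_w i w) ^ q) <= C" by blast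
 qed (use all_moments_meas[OF wa] in auto)
 have "moments_bounded M (rows n0) (%i w. X (real (snd i) * h (fst i)) w - obs_x i w - h (fst i) * a0 (obs_x i w) - g (obs_x i w) * obs_w i w)"
 proof (intro moments_bounded_diff moments_bounded_mult wt x moments_bounded_bounded)
  show "moments_bounded M (rows n0) (%i. X (real (snd i) * h (fst i)))"
   by (rule moments_bounded_reindex[OF X_moments]) (use row_times(1) in "simp add: less_imp_le")
  show "moments_bounded M (rows n0) (%i w. a0 (obs_x i w))" "moments_bounded M (rows n0) (%i w. g (obs_x i w))"
   unfolding obs_x_def using row_times(3) by (intro moments_bounded_reindex[OF a0X_moments] moments_bounded_reindex[OF gX_moments]; simp)+
  show "abs (h (fst i)) <= 1" if "i : rows n0" for i using row_times[OF that] by simp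
 qed
 moreover have "obs_r i = (%w. X (real (snd i) * h (fst i)) w - obs_x i w - h (fst i) * a0 (obs_x i w) - g (obs_x i w) * obs_w i w)"
  if "i : rows n0" for i
  using row_times(4)[OF that] by (simp add: fun_eq_iff obs_r_def euler_residual_def obs_x_def obs_w_def)
 ultimately show r: "moments_bounded M (rows n0) obs_r" unfolding moments_bounded_def by simp
 show "moments_bounded M (rows n0) obs_u"
  unfolding obs_u_def[abs_def] by (intro moments_bounded_add moments_bounded_abs moments_bounded_const x wt r)
qed

lemma obs_r_order: "mean_order M (rows n0) (%i. (h (fst i))^2) (%i w. (obs_r i w)^2)"
proof -
 obtain C where C: "!!s t. 0 <= s ==> s < t ==> t - s <= 1 ==> integrable M (%w. (euler_residual s t w)^2) &
   (LINT w|M. (euler_residual s t w)^2) <= C * (t - s)^2"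
  using euler_residual_second_moment by blast
 show ?thesis
  unfolding mean_order_def
 proof (intro exI[of _ C] ballI)
  fix i assume i: "i : rows n0"
  note t = row_times[OF i]
  have "real (snd i - 1) * h (fst i) < real (snd i) * h (fst i)" using t(1,4) by linarith
  from C[OF t(3) this] t(2,4)
  show "integrable M (%w. (obs_r i w)^2) & (LINT w|M. abs ((obs_r i w)^2)) <= C * (h (fst i))^2" by (simp add: obs_r_def)
 qed
qed

lemma obs_rU: "mean_order M (rows n0) (%i. h (fst i) * sqrt (h (fst i))) (%i w. (obs_r i w)^2 * obs_u i w ^ p)"
 by (rule mean_order_square_weight[OF obs_r_order obs_moments(3) moments_bounded_power[OF obs_moments(4)] row_times(1)])

lemma obs_hU: "mean_order M (rows n0) (%i. (h (fst i))^2) (%i w. (h (fst i))^2 * obs_u i w ^ p)"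
 using moments_bounded_mean_order[OF moments_bounded_power[OF obs_moments(4)], of p 1]
 by (intro mean_order_scale) (simp_all add: obs_u_def)

lemma sqrt_le1: "0 <= x ==> x <= 1 ==> x * sqrt x <= x" by (simp add: mult_left_le)

text \<open>The weight contains the Euler remainder, which is not independent of the increment, so
  the expectation does not factor. The bound \<open>u <= (1 + x) (1 + wt) + r\<close> separates the
  two: the product factors by independence and has order \<open>h\<close>, while
  \<open>wt^2 r^(p+2)\<close> is exchanged for \<open>r^2 u^(p+2)\<close>, of higher order by
  \<open>obs_rU\<close>. The exponent \<open>p + 2\<close> leaves room for this exchange.\<close>

lemma obs_wU: "mean_order M (rows n0) (%i. h (fst i)) (%i w. (obs_w i w)^2 * obs_u i w ^ p)"
proof -
 let ?q = "p + 2"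
 let ?V = "%i w. (1 + abs (obs_x i w)) ^ ?q * ((obs_w i w)^2 * (1 + abs (obs_w i w)) ^ ?q)"
 obtain C where C: "C >= 0" "!!h. 0 < h ==> h <= 1 ==> (LINT w|M. (J h w)^2 * (1 + abs (J h w)) ^ ?q) <= C * h"
  using small_jump_moment by blast
 have mb: "moments_bounded M (rows n0) (%i w. (1 + abs (obs_x i w)) ^ ?q)"
  by (intro moments_bounded_add moments_bounded_const moments_bounded_power moments_bounded_abs obs_moments)
 then obtain B where B: "!!i. i : rows n0 ==> integrable M (%w. (1 + abs (obs_x i w)) ^ ?q) & (LINT w|M. abs ((1 + abs (obs_x i w)) ^ ?q)) <= B"
  using moments_bounded_mean by blast
 have V: "mean_order M (rows n0) (%i. h (fst i)) ?V"
  unfolding mean_order_def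
 proof (intro exI[of _ "B * C"] ballI)
  fix i assume i: "i : rows n0"
  note t = row_times[OF i]
  have G: "(%w. (1 + abs (obs_x i w)) ^ ?q) : borel_measurable (F (real (snd i - 1) * h (fst i)))"
   unfolding obs_x_def using X_F[OF t(3)] by measurable
  have "integrable M (%w. (J (h (fst i)) w)^2 * (1 + abs (J (h (fst i)) w)) ^ ?q)"
   using t(1) by (intro all_moments_integrable all_moments_intros all_moments_J) auto
  note f = increment_factor[OF t(3,5) G conjunct1[OF B[OF i]], of "%z. z^2 * (1 + abs z) ^ ?q", unfolded t(4), OF _ this]
  have "(LINT w|M. abs (?V i w)) = (LINT w|M. ?V i w)" by simp
  also have "... = (LINT w|M. (1 + abs (obs_x i w)) ^ ?q) * (LINT w|M. (J (h (fst i)) w)^2 * (1 + abs (J (h (fst i)) w)) ^ ?q)"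
   using f(2) by (simp add: obs_w_def)
  also have "... <= B * (C * h (fst i))" using B[OF i] C(2)[OF t(1,2)] order_trans[OF Bochner_Integration.integral_nonneg conjunct2[OF B[OF i]]]
   by (intro mult_mono) (auto intro!: Bochner_Integration.integral_nonneg)
  finally show "integrable M (?V i) & (LINT w|M. abs (?V i w)) <= B * C * h (fst i)" using f(1) by (simp add: obs_w_def mult.assoc)
 qed
 have "mean_order M (rows n0) (%i. h (fst i)) (%i w. ?V i w + (obs_r i w)^2 * obs_u i w ^ ?q)"
  using row_times by (intro mean_order_add V mean_order_weaken[OF obs_rU, where K=1]) (auto intro!: sqrt_le1 simp: less_imp_le)
 then show ?thesis
 proof (rule mean_order_mono[where K="2 ^ ?q"])
  show "(%w. (obs_w i w)^2 * obs_u i w ^ p) : borel_measurable M" if "i : rows n0" for i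
   using moments_boundedD[OF obs_moments(2) that] moments_boundedD[OF obs_moments(4) that] by measurable
  fix i w
  define x wt r u where "x = abs (obs_x i w)" and "wt = abs (obs_w i w)" and "r = abs (obs_r i w)" and "u = obs_u i w"
  have n: "0 <= x" "0 <= wt" "0 <= r" "1 <= u" "wt <= u" "r <= u" "u = 1 + x + wt + r" by (auto simp: x_def wt_def r_def u_def obs_u_def)
  have "u <= (1 + x) * (1 + wt) + r" using n by (simp add: n(7) algebra_simps)
  also have "... <= 2 * max ((1 + x) * (1 + wt)) r" by simp
  finally have "u ^ ?q <= (2 * max ((1 + x) * (1 + wt)) r) ^ ?q" using n by (intro power_mono) auto
  also have "... <= 2 ^ ?q * (((1 + x) * (1 + wt)) ^ ?q + r ^ ?q)" using n by (auto simp: power_mult_distrib max_def)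
  finally have "wt^2 * u ^ ?q <= wt^2 * (2 ^ ?q * (((1 + x) * (1 + wt)) ^ ?q + r ^ ?q))" by (intro mult_left_mono) auto
  also have "... = 2 ^ ?q * ((1 + x) ^ ?q * (wt^2 * (1 + wt) ^ ?q) + wt^2 * (r^2 * r ^ p))"
   unfolding power_mult_distrib[of "1 + x" "1 + wt" ?q] power_add[of r] distrib_left[of "2 ^ ?q"] distrib_left[of "wt^2"] by (simp only: mult_ac)
  also have "wt^2 * (r^2 * r ^ p) <= u^2 * (r^2 * u ^ p)" using n by (intro mult_mono power_mono) auto
  also have "u^2 * (r^2 * u ^ p) = r^2 * u ^ ?q" by (simp only: power_add mult_ac)
  finally have "wt^2 * u ^ ?q <= 2 ^ ?q * ((1 + x) ^ ?q * (wt^2 * (1 + wt) ^ ?q) + r^2 * u ^ ?q)" by simp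
  moreover have "wt^2 * u ^ p <= wt^2 * u ^ ?q" using n by (intro mult_left_mono power_increasing) auto
  ultimately have "wt^2 * u ^ p <= 2 ^ ?q * ((1 + x) ^ ?q * (wt^2 * (1 + wt) ^ ?q) + r^2 * u ^ ?q)" by linarith
  moreover have "0 <= wt^2 * u ^ p" "0 <= (1 + x) ^ ?q * (wt^2 * (1 + wt) ^ ?q) + r^2 * u ^ ?q" using n by auto
  ultimately show "abs ((obs_w i w)^2 * obs_u i w ^ p) <= 2 ^ ?q * abs (?V i w + (obs_r i w)^2 * obs_u i w ^ ?q)"
   unfolding x_def wt_def r_def u_def power2_abs by (simp only: abs_of_nonneg)
 qed
qed

definition obs_small :: "nat \<times> nat => 'w => real" where
 "obs_small i w = (obs_r i w)^2 + (h (fst i))^2 + abs (obs_w i w) * (abs (obs_r i w) + h (fst i))"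

text \<open>Each product pairs the weighted increment, of order \<open>sqrt h\<close> in mean
  square, with the remainder or the step, of order \<open>h\<close>. The squares are of order
  \<open>h^(3/2)\<close> by \<open>obs_rU\<close> and \<open>obs_hU\<close>.\<close>

lemma obs_small_order: "mean_order M (rows n0) (%i. h (fst i) * sqrt (h (fst i))) (%i w. obs_small i w * obs_u i w ^ p)"
proof -
 let ?s = "%i. h (fst i) * sqrt (h (fst i))"
 note [measurable] = moments_boundedD[OF obs_moments(2)] moments_boundedD[OF obs_moments(3)] moments_boundedD[OF obs_moments(4)]
 have W: "mean_order M (rows n0) (%i. (sqrt (h (fst i)))^2) (%i w. (abs (obs_w i w) * obs_u i w ^ p)^2)"
  by (rule mean_order_cong_order[OF mean_order_mono[OF obs_wU[of "2 * p"], where K=1]])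
   (use row_times(1) in "auto simp: power_mult_distrib less_imp_le power_mult mult.commute[of 2]")
 have 1: "mean_order M (rows n0) ?s (%i w. (abs (obs_w i w) * obs_u i w ^ p) * abs (obs_r i w))"
  using row_times(1) obs_r_order by (intro mean_order_cong_order[OF mean_order_mult[OF W]]) (auto simp: mult.commute)
 have "mean_order M (rows n0) (%i. (h (fst i))^2) (%i w. (h (fst i))^2)"
  by (auto simp: mean_order_def prob_space intro!: exI[of _ 1])
 then have 2: "mean_order M (rows n0) ?s (%i w. (abs (obs_w i w) * obs_u i w ^ p) * h (fst i))"
  using row_times(1) by (intro mean_order_cong_order[OF mean_order_mult[OF W]]) (auto simp: mult.commute)
 have 3: "mean_order M (rows n0) ?s (%i w. (h (fst i))^2 * obs_u i w ^ p)"
 proof (rule mean_order_weaken[OF obs_hU, where K=1])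
  fix i assume "i : rows n0"
  then have "h (fst i) <= sqrt (h (fst i))" "0 <= h (fst i)" using row_times(1,2)[of i] by (auto intro!: real_le_rsqrt simp: power2_eq_square mult_left_le)
  then show "(h (fst i))^2 <= 1 * ?s i" by (simp add: power2_eq_square mult_left_mono)
 qed simp
 have "mean_order M (rows n0) ?s (%i w. (obs_r i w)^2 * obs_u i w ^ p + ((h (fst i))^2 * obs_u i w ^ p +
   ((abs (obs_w i w) * obs_u i w ^ p) * abs (obs_r i w) + (abs (obs_w i w) * obs_u i w ^ p) * h (fst i))))"
  by (intro mean_order_add obs_rU 1 2 3)
 then show ?thesis by (simp add: obs_small_def algebra_simps)
qed

lemma bounded_in_prob_w:
 "bounded_in_prob M (%n w. 1 / (real n * h n) * (\<Sum>j=1..n. (obs_w (n, j) w)^2 * obs_u (n, j) w ^ p))"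
 by (rule bounded_in_prob_rows[OF obs_wU, where B=1]) (auto intro!: always_eventually)

lemma bounded_in_prob_u: "bounded_in_prob M (%n w. 1 / real n * (\<Sum>j=1..n. obs_u (n, j) w ^ p))"
proof (rule bounded_in_prob_rows[where r="%_. 1" and B=1 and Y="%i w. obs_u i w ^ p"])
 show "mean_order M (rows n0) (%i. 1) (%i w. obs_u i w ^ p)"
  using moments_bounded_mean_order[OF moments_bounded_power[OF obs_moments(4)], of 1 p] by (simp add: obs_u_def)
qed (auto intro!: always_eventually)

lemma vanish_in_prob_small:
 assumes "(%n. real n * (h n)^2) \<longlonglongrightarrow> 0"
 shows "vanish_in_prob M (%n w. 1 / sqrt (real n * h n) * (\<Sum>j=1..n. obs_small (n, j) w * obs_u (n, j) w ^ p))"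
proof (rule vanish_in_prob_rows[OF obs_small_order])
 have "(%n. sqrt (real n * (h n)^2)) \<longlonglongrightarrow> 0" using tendsto_real_sqrt[OF assms] by simp
 moreover have "1 / sqrt (real n * h n) * (real n * (h n * sqrt (h n))) = sqrt (real n * (h n)^2)" for n
  using h_pos[of n] by (cases "n = 0") (auto simp: real_sqrt_mult field_simps)
 ultimately show "(%n. 1 / sqrt (real n * h n) * (real n * (h n * sqrt (h n)))) \<longlonglongrightarrow> 0" by (simp only:)
qed

end

section \<open>Rate of the scale estimator and expansion of the statistic\<close>

text \<open>On the event where the vanishing factor is at most 1/2, the term containing
  \<open>Y\<close> itself is absorbed on the left and \<open>Y\<close> is at most twice the bound of
  \<open>B\<close>.\<close>

lemma (in prob_space) bounded_in_prob_absorb: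
 assumes B: "bounded_in_prob M B" and V: "vanish_in_prob M V"
  and Y: "\<forall>\<^sub>F n in sequentially. ALL w:space M. 0 <= Y n w & Y n w <= abs (B n w) + abs (V n w) * Y n w"
 shows "bounded_in_prob M Y"
 unfolding bounded_in_prob_def
proof (intro allI impI)
 fix e :: real assume "e > 0"
 then have e: "e / 2 > 0" "min (e / 2) (1 / 2) > 0" by auto
 obtain b where b: "\<forall>\<^sub>F n in sequentially. likely M (e / 2) (%w. abs (B n w) <= b)" using B e unfolding bounded_in_prob_def by blast
 have "\<forall>\<^sub>F n in sequentially. likely M (min (e / 2) (1 / 2)) (%w. abs (V n w) <= min (e / 2) (1 / 2))" using V e unfolding vanish_in_prob_def by blast
 with b Y have "\<forall>\<^sub>F n in sequentially. likely M e (%w. abs (Y n w) <= 2 * b)"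
 proof eventually_elim
  case (elim n)
  show ?case
  proof (rule likely_mono[OF likely_conj[OF elim(1,3)]])
   fix w assume w: "w : space M" "abs (B n w) <= b & abs (V n w) <= min (e / 2) (1 / 2)"
   then have "abs (V n w) * Y n w <= 1 / 2 * Y n w" using elim(2) by (intro mult_right_mono) auto
   then show "abs (Y n w) <= 2 * b" using elim(2) w by fastforce
  qed simp
 qed
 then show "EX K. \<forall>\<^sub>F n in sequentially. likely M e (%w. abs (Y n w) <= K)" by blast
qed

section \<open>Estimating functions of the parametric model\<close>

locale parametric_sde = sampled_sde M F J X "%x. cb x \<gamma>0" L "%x. ab x \<alpha>0" La P \<pi>0 h
 for M :: "'w measure" and F J X and cb :: "real => real ^ 'p::finite => real" and \<gamma>0 L
  and ab :: "real => real ^ 'd::finite => real" and \<alpha>0 La P \<pi>0 h +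
 fixes D\<alpha> D\<gamma> and gb :: "'p => real => real ^ 'p => real"
 assumes \<theta>0: "\<alpha>0 : D\<alpha>" "\<gamma>0 : D\<gamma>" and bdd: "bounded D\<gamma>"
  and ab: "poly_lipschitz D\<alpha> ab" and cb: "poly_lipschitz D\<gamma> cb" and gb: "!!k. poly_lipschitz D\<gamma> (gb k)"
  and cb0: "!!x \<gamma>. \<gamma> : D\<gamma> ==> cb x \<gamma> ~= 0" and icb: "poly_lipschitz D\<gamma> (%x \<gamma>. inverse (cb x \<gamma>))"
  and taylor: "EX K N. K >= 0 & (ALL x. ALL \<gamma>:D\<gamma>. abs (cb x \<gamma>0 - cb x \<gamma> - (\<Sum>k\<in>UNIV. (\<gamma>0 - \<gamma>) $ k * gb k x \<gamma>)) <= K * (1 + abs x) ^ N * (dist \<gamma>0 \<gamma>)^2)"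
  and tay: "taylor_at D\<gamma> \<gamma>0 cb" "!!k. taylor_at D\<gamma> \<gamma>0 (gb k)"
  and nh2: "(%n. real n * (h n)^2) \<longlonglongrightarrow> 0" and nh: "filterlim (%n. real n * h n) at_top sequentially"
begin

definition drift_inc :: "nat => nat => real ^ 'd => 'w => real" where
 "drift_inc n j \<alpha> w = X (real j * h n) w - X (real (j - 1) * h n) w - h n * ab (obs_x (n, j) w) \<alpha>"

text \<open>The \<open>k\<close>-th coordinate of the negative gradient of \<open>1 / c^2\<close> in
  the scale parameter.\<close>

definition weight :: "'p => real => real ^ 'p => real" where "weight k y \<gamma> = 2 * gb k y \<gamma> * inverse (cb y \<gamma>) ^ 3"

text \<open>The \<open>k\<close>-th coordinate of the scale estimating function. Both of its terms
  share the factor \<open>weight\<close>, because the gradient of \<open>c^2\<close> divided by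
  \<open>c^2\<close> equals \<open>weight\<close> times \<open>c^2\<close>.\<close>

definition contrast :: "'p => nat => real ^ 'd => real ^ 'p => 'w => real" where
 "contrast k n \<alpha> \<gamma> w = 1 / (real n * h n) *
   (\<Sum>j=1..n. weight k (obs_x (n, j) w) \<gamma> * ((drift_inc n j \<alpha> w)^2 - h n * (cb (obs_x (n, j) w) \<gamma>)^2))"

definition contrast_limit :: "'p => real ^ 'p => real" where
 "contrast_limit k \<gamma> = (LINT y|\<pi>0. weight k y \<gamma> * ((cb y \<gamma>0)^2 - (cb y \<gamma>)^2))"

definition score :: "(real => real) => nat => 'w => real" where
 "score u n w = 1 / (real n * h n) * (\<Sum>j=1..n. u (obs_x (n, j) w) * drift_inc n j \<alpha>0 w)"

lemma N_ev: "\<forall>\<^sub>F n in sequentially. n0 <= n & 0 < real n * h n"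
 using eventually_ge_at_top[of n0] by eventually_elim (use n0 in force)

lemma sqrt_ratio: "0 < x ==> sqrt x * (1 / x * y) = 1 / sqrt x * (y :: real)"
 using sqrt_divide_self_eq[of x] by (simp add: divide_inverse mult.assoc[symmetric])

lemma noise_cb: "poly_lipschitz D\<gamma> (%x \<gamma>. cb x \<gamma>0)"
proof -
 obtain N K where "poly_le N K (%x. cb x \<gamma>0)" using cb \<theta>0 unfolding poly_lipschitz_def by blast
 then show ?thesis by (rule poly_lipschitz_const)
qed

lemma weight_pl: "poly_lipschitz D\<gamma> (weight k)"
proof -
 have "poly_lipschitz D\<gamma> (%x \<gamma>. 2 * gb k x \<gamma> * (inverse (cb x \<gamma>) * (inverse (cb x \<gamma>) * inverse (cb x \<gamma>))))"
  by (intro poly_lipschitz_mult icb gb poly_lipschitz_const[where N=0 and K=2]) (auto simp: poly_le_def)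
 then show ?thesis by (simp add: weight_def[abs_def] power3_eq_cube mult.assoc)
qed

lemma square_diff_pl: "poly_lipschitz D\<gamma> (%x \<gamma>. (cb x \<gamma>0)^2 - (cb x \<gamma>)^2)"
proof -
 have "poly_lipschitz D\<gamma> (%x \<gamma>. cb x \<gamma>0 * cb x \<gamma>0 + (-1) * (cb x \<gamma> * cb x \<gamma>))"
  by (intro poly_lipschitz_add poly_lipschitz_mult noise_cb cb poly_lipschitz_const[where N=0 and K=1]) (auto simp: poly_le_def)
 then show ?thesis by (simp add: power2_eq_square)
qed

lemma drift_inc_eq: "drift_inc n j \<alpha> w = cb (obs_x (n, j) w) \<gamma>0 * obs_w (n, j) w +
  (obs_r (n, j) w + h n * (ab (obs_x (n, j) w) \<alpha>0 - ab (obs_x (n, j) w) \<alpha>))" if "(n, j) : rows n0"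
 using row_times(4)[OF that] by (simp add: drift_inc_def obs_w_def obs_r_def euler_residual_def obs_x_def right_diff_distrib)

text \<open>The second term of the bound in \<open>weighted_increment_sum\<close> is
  \<open>n h sqrt h = sqrt (n h) sqrt (n h^2)\<close>, hence at most \<open>sqrt (n h)\<close> for
  large \<open>n\<close>.\<close>

lemma score_bounded:
 assumes u: "poly_le N A u"
 shows "bounded_in_prob M (%n w. sqrt (real n * h n) * score u n w)"
proof -
 have um: "u : borel_measurable borel" "moments_bounded M {0..} (%t w. u (X t w))"
  using u poly_X_moments[OF u] by (simp_all add: poly_le_def)
 let ?T = "%n w. \<Sum>j<n. u (X (real j * h n) w) * (X (real (Suc j) * h n) w - X (real j * h n) w - h n * ab (X (real j * h n) w) \<alpha>0)"
 obtain C where C: "C >= 0" "!!n. 0 < n ==> h n <= 1 ==> integrable M (?T n) & (LINT w|M. abs (?T n w)) <= C * (sqrt (real n * h n) + real n * (h n * sqrt (h n)))"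
  using weighted_increment_sum[OF um] h_pos by blast
 have "\<forall>\<^sub>F n in sequentially. real n * (h n)^2 < 1" using nh2 by (rule order_tendstoD) simp
 then have "\<forall>\<^sub>F n in sequentially. integrable M (%w. sqrt (real n * h n) * score u n w) &
   (LINT w|M. abs (sqrt (real n * h n) * score u n w)) <= C * 2"
  using N_ev
 proof eventually_elim
  case (elim n)
  have N: "0 < real n * h n" "h n <= 1" "0 < n" using elim n0 by (auto simp: zero_less_mult_iff)
  have eq: "sqrt (real n * h n) * score u n w = 1 / sqrt (real n * h n) * ?T n w" for w
   unfolding score_def sqrt_ratio[OF N(1)] by (simp only: One_nat_def sum.atLeast1_atMost_eq obs_x_def drift_inc_def fst_conv snd_conv diff_Suc_Suc diff_zero)
  have "real n * (h n * sqrt (h n)) = sqrt (real n * h n) * sqrt (real n * (h n)^2)"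
   using h_pos[of n] by (simp add: real_sqrt_mult)
  also have "... <= sqrt (real n * h n) * 1" using elim N by (intro mult_left_mono) auto
  finally have "C * (sqrt (real n * h n) + real n * (h n * sqrt (h n))) <= C * (2 * sqrt (real n * h n))" using C(1) by (intro mult_left_mono) auto
  then have "(LINT w|M. abs (?T n w)) <= C * (2 * sqrt (real n * h n))" using C(2)[OF N(3,2)] by linarith
  then have "1 / sqrt (real n * h n) * (LINT w|M. abs (?T n w)) <= 1 / sqrt (real n * h n) * (C * (2 * sqrt (real n * h n)))"
   by (rule mult_left_mono) (use N in simp)
  also have "... = C * 2" using N by (auto simp: zero_less_mult_iff)
  finally show ?case unfolding eq using C(2)[OF N(3,2)] N by (simp add: abs_mult)
 qed
 then show ?thesis by (rule bounded_in_prob_L1)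
qed

lemma inv_sqrt_vanish: "vanish_in_prob M (%n w. 1 / sqrt (real n * h n))"
proof (rule vanish_in_prob_tendsto)
 have "filterlim (%n. sqrt (real n * h n)) at_top sequentially" using filterlim_compose[OF sqrt_at_top nh] .
 then show "(%n. 1 / sqrt (real n * h n)) \<longlonglongrightarrow> 0" by (intro tendsto_divide_0[OF tendsto_const] filterlim_at_top_imp_at_infinity)
qed

lemma sqrt_scaled_vanish:
 assumes "bounded_in_prob M (%n w. sqrt (real n * h n) * Y n w)"
 shows "vanish_in_prob M Y"
 by (rule vanish_in_prob_mono[OF vanish_in_prob_mult[OF assms inv_sqrt_vanish]]) (use N_ev in "auto elim!: eventually_mono simp: zero_less_mult_iff")

section \<open>The two fluctuations: centred noise and ergodic averages\<close>

definition noise :: "(real => real) => nat => (real => real) => 'w => real" where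
 "noise \<psi> n u w = 1 / (real n * h n) * (\<Sum>j=1..n. u (obs_x (n, j) w) * (\<psi> (obs_w (n, j) w) - (LINT w|M. \<psi> (J (h n) w))))"

definition ergodic :: "nat => (real => real) => 'w => real" where
 "ergodic n u w = 1 / (real n * h n) * (\<Sum>j=1..n. h n * (u (obs_x (n, j) w) - (LINT y|\<pi>0. u y)))"

lemmas row_simps = One_nat_def sum.atLeast1_atMost_eq obs_x_def obs_w_def fst_conv snd_conv diff_Suc_Suc diff_zero

lemma scaled_second_moment:
 assumes "integrable M (%w. (S w)^2) & (LINT w|M. (S w)^2) <= C * (A^2 * v)" "0 < (v :: real)"
 shows "integrable M (%w. (1 / v * S w)^2) & v * (LINT w|M. (1 / v * S w)^2) <= C * A^2"
proof -
 have "v * (LINT w|M. (1 / v * S w)^2) = 1 / v * (LINT w|M. (S w)^2)"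
  using assms(2) by (simp add: power_divide power2_eq_square)
 also have "... <= 1 / v * (C * (A^2 * v))" using assms by (intro mult_left_mono) auto
 finally show ?thesis using assms by (simp add: power_divide)
qed

lemma poly_le_obs:
 assumes "poly_le N A u"
 shows "abs (u (obs_x i w)) <= A * obs_u i w ^ N"
 using assms order_trans[OF _ mult_left_mono[OF power_mono[of "1 + abs (obs_x i w)" "obs_u i w" N] poly_le_nonneg[OF assms]]]
 by (simp add: poly_le_def obs_u_def)

context
 fixes \<psi> :: "real => real" and B p
 assumes \<psi>m: "\<psi> : borel_measurable borel" and \<psi>: "!!z. abs (\<psi> z) <= B * (z^2 * (1 + abs z) ^ p)"
begin

text \<open>The assumptions of the abstract fluctuation lemmas with \<open>v = n h\<close>. For the
  pathwise bound the terms are summed in absolute value: without any cancellation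
  \<open>\<psi>\<close> of the increments and its means are both of total order
  \<open>n h\<close>.\<close>

lemma noise_fluctuation:
 "ALL n N A N' A' u wt c w. poly_le N A u --> poly_le N' A' wt --> noise \<psi> n (%y. u y + c * wt y) w = noise \<psi> n u w + c * noise \<psi> n wt w"
 "EX C. \<forall>\<^sub>F n in sequentially. ALL A u. poly_le N A u --> integrable M (%w. (noise \<psi> n u w)^2) & real n * h n * (LINT w|M. (noise \<psi> n u w)^2) <= C * A^2"
 "EX B. bounded_in_prob M B & (\<forall>\<^sub>F n in sequentially. ALL A u. ALL w:space M. poly_le N A u --> abs (noise \<psi> n u w) <= A * abs (B n w))"
proof -
 show "ALL n N A N' A' u wt c w. poly_le N A u --> poly_le N' A' wt --> noise \<psi> n (%y. u y + c * wt y) w = noise \<psi> n u w + c * noise \<psi> n wt w"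
  by (intro allI impI) (simp only: noise_def distrib_right sum.distrib mult.assoc flip: sum_distrib_left, simp only: distrib_left mult.left_commute)
 show "EX C. \<forall>\<^sub>F n in sequentially. ALL A u. poly_le N A u --> integrable M (%w. (noise \<psi> n u w)^2) & real n * h n * (LINT w|M. (noise \<psi> n u w)^2) <= C * A^2" for N
 proof -
  obtain C where C: "!!A f n h. poly_le N A f ==> 0 < h ==> h <= 1 ==>
   integrable M (%w. (\<Sum>j<n. f (X (real j * h) w) * (\<psi> (J (real (Suc j) * h) w - J (real j * h) w) - (LINT w|M. \<psi> (J h w))))^2) &
   (\<integral>w. (\<Sum>j<n. f (X (real j * h) w) * (\<psi> (J (real (Suc j) * h) w - J (real j * h) w) - (LINT w|M. \<psi> (J h w))))^2 \<partial>M) <= C * (A^2 * (real n * h))"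
   using noise_second_moment(1)[OF \<psi>m \<psi>, of N] by blast
  show ?thesis
  proof (rule exI[of _ C], use N_ev in eventually_elim, intro allI impI)
   fix n A u assume n: "n0 <= n & 0 < real n * h n" and u: "poly_le N A u"
   show "integrable M (%w. (noise \<psi> n u w)^2) & real n * h n * (LINT w|M. (noise \<psi> n u w)^2) <= C * A^2"
    unfolding noise_def row_simps using n n0[of n] h_pos by (intro scaled_second_moment C u) auto
  qed
 qed
 show "EX B. bounded_in_prob M B & (\<forall>\<^sub>F n in sequentially. ALL A u. ALL w:space M. poly_le N A u --> abs (noise \<psi> n u w) <= A * abs (B n w))" for N
 proof -
  obtain C where C: "C >= 0" "!!h. 0 < h ==> h <= 1 ==> abs (LINT w|M. \<psi> (J h w)) <= C * h" using noise_second_moment(2)[OF \<psi>m \<psi>] by blast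
  have B0: "B >= 0" using order_trans[OF abs_ge_zero \<psi>[of 1]] by (simp add: zero_le_mult_iff not_le[THEN iffD2, OF zero_less_power])
  let ?B = "%n w. B * (1 / (real n * h n) * (\<Sum>j=1..n. (obs_w (n, j) w)^2 * obs_u (n, j) w ^ (N + p))) + C * (1 / real n * (\<Sum>j=1..n. obs_u (n, j) w ^ N))"
  have "bounded_in_prob M ?B" by (intro bounded_in_prob_add bounded_in_prob_mult bounded_in_prob_const bounded_in_prob_w bounded_in_prob_u)
  moreover have "\<forall>\<^sub>F n in sequentially. ALL A u. ALL w:space M. poly_le N A u --> abs (noise \<psi> n u w) <= A * abs (?B n w)"
   using N_ev
  proof (eventually_elim, intro allI ballI impI)
   fix n A u w assume n: "n0 <= n & 0 < real n * h n" and u: "poly_le N A u"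
   let ?e = "\<integral>w. \<psi> (J (h n) w) \<partial>M" and ?wt = "%j. obs_w (n, j) w" and ?U = "%j. obs_u (n, j) w"
   note A = poly_le_nonneg[OF u]
   have "abs (u (obs_x (n, j) w) * (\<psi> (?wt j) - ?e)) <= A * (B * ((?wt j)^2 * ?U j ^ (N + p)) + h n * (C * ?U j ^ N))" for j
   proof -
    have U: "1 + abs (?wt j) <= ?U j" by (simp add: obs_u_def)
    have "abs (\<psi> (?wt j) - ?e) <= B * ((?wt j)^2 * (1 + abs (?wt j)) ^ p) + C * h n"
     using \<psi>[of "?wt j"] C(2)[of "h n"] n0[of n] n h_pos[of n] by (intro order_trans[OF abs_triangle_ineq4] add_mono) auto
    also have "... <= B * ((?wt j)^2 * ?U j ^ p) + C * h n" using U B0 by (intro add_right_mono mult_left_mono power_mono) auto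
    finally have "abs (u (obs_x (n, j) w)) * abs (\<psi> (?wt j) - ?e) <= (A * ?U j ^ N) * (B * ((?wt j)^2 * ?U j ^ p) + C * h n)"
     by (intro mult_mono poly_le_obs[OF u]) (use A in "auto simp: obs_u_def")
    then show ?thesis by (simp only: abs_mult power_add) (simp add: algebra_simps)
   qed
   then have "abs (\<Sum>j=1..n. u (obs_x (n, j) w) * (\<psi> (?wt j) - ?e)) <= (\<Sum>j=1..n. A * (B * ((?wt j)^2 * ?U j ^ (N + p)) + h n * (C * ?U j ^ N)))"
    by (intro order_trans[OF sum_abs] sum_mono)
   then have "abs (noise \<psi> n u w) <= 1 / (real n * h n) * (\<Sum>j=1..n. A * (B * ((?wt j)^2 * ?U j ^ (N + p)) + h n * (C * ?U j ^ N)))"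
    unfolding noise_def abs_mult using n by (simp add: divide_right_mono)
   also have "... = A * ?B n w" unfolding sum_distrib_left[symmetric] sum.distrib using n by (auto simp: distrib_left zero_less_mult_iff)
   also have "... <= A * abs (?B n w)" using A by (intro mult_left_mono abs_ge_self)
   finally show "abs (noise \<psi> n u w) <= A * abs (?B n w)" .
  qed
  ultimately show ?thesis by blast
 qed
qed

lemmas noise_bounded = fluctuation_bounded[OF nh noise_fluctuation]
 and noise_law = uniform_law[OF nh noise_fluctuation]
 and noise_taylor = taylor_fluctuation[OF nh noise_fluctuation]

end

lemma ergodic_fluctuation:
 "ALL n N A N' A' u wt c w. poly_le N A u --> poly_le N' A' wt --> ergodic n (%y. u y + c * wt y) w = ergodic n u w + c * ergodic n wt w"
 "EX C. \<forall>\<^sub>F n in sequentially. ALL A u. poly_le N A u --> integrable M (%w. (ergodic n u w)^2) & real n * h n * (LINT w|M. (ergodic n u w)^2) <= C * A^2"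
 "EX B. bounded_in_prob M B & (\<forall>\<^sub>F n in sequentially. ALL A u. ALL w:space M. poly_le N A u --> abs (ergodic n u w) <= A * abs (B n w))"
proof -
 show "ALL n N A N' A' u wt c w. poly_le N A u --> poly_le N' A' wt --> ergodic n (%y. u y + c * wt y) w = ergodic n u w + c * ergodic n wt w"
 proof (intro allI impI)
  fix n N A N' A' u wt c w assume "poly_le N A u" "poly_le N' A' wt"
  then have "(LINT y|\<pi>0. u y + c * wt y) = (LINT y|\<pi>0. u y) + c * (LINT y|\<pi>0. wt y)" using poly_\<pi>0_integrable by simp
  then have "h n * (u x + c * wt x - (LINT y|\<pi>0. u y + c * wt y)) = h n * (u x - (LINT y|\<pi>0. u y)) + c * (h n * (wt x - (LINT y|\<pi>0. wt y)))" for x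
   by (simp add: algebra_simps)
  then show "ergodic n (%y. u y + c * wt y) w = ergodic n u w + c * ergodic n wt w"
   unfolding ergodic_def by (simp only: sum.distrib distrib_left sum_distrib_left[of c, symmetric] mult.left_commute)
 qed
 show "EX C. \<forall>\<^sub>F n in sequentially. ALL A u. poly_le N A u --> integrable M (%w. (ergodic n u w)^2) & real n * h n * (LINT w|M. (ergodic n u w)^2) <= C * A^2" for N
 proof -
  obtain C where C: "!!A f n h. poly_le N A f ==> 0 < h ==> h <= 1 ==>
   (LINT w|M. (\<Sum>j<n. h * (f (X (real j * h) w) - (LINT y|\<pi>0. f y)))^2) <= C * (A^2 * (real n * h))"
   using ergodic_second_moment by blast
  show ?thesis
  proof (rule exI[of _ C], use N_ev in eventually_elim, intro allI impI)
   fix n A u assume n: "n0 <= n & 0 < real n * h n" and u: "poly_le N A u"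
   have "integrable M (%w. (\<Sum>j<n. h n * (u (X (real j * h n) w) - (LINT y|\<pi>0. u y)))^2)"
    using h_pos[of n] by (intro all_moments_integrable all_moments_intros all_moments_poly_X[OF u]) auto
   then show "integrable M (%w. (ergodic n u w)^2) & real n * h n * (LINT w|M. (ergodic n u w)^2) <= C * A^2"
    unfolding ergodic_def row_simps using n n0[of n] h_pos by (intro scaled_second_moment conjI C u) auto
  qed
 qed
 show "EX B. bounded_in_prob M B & (\<forall>\<^sub>F n in sequentially. ALL A u. ALL w:space M. poly_le N A u --> abs (ergodic n u w) <= A * abs (B n w))" for N
 proof -
  define c where "c = (LINT y|\<pi>0. (1 + abs y) ^ N)"
  let ?B = "%n w. (1 / real n * (\<Sum>j=1..n. obs_u (n, j) w ^ N)) + c"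
  have "bounded_in_prob M ?B" by (intro bounded_in_prob_add bounded_in_prob_const bounded_in_prob_u)
  moreover have "\<forall>\<^sub>F n in sequentially. ALL A u. ALL w:space M. poly_le N A u --> abs (ergodic n u w) <= A * abs (?B n w)"
   using N_ev
  proof (eventually_elim, intro allI ballI impI)
   fix n A u w assume n: "n0 <= n & 0 < real n * h n" and u: "poly_le N A u"
   have "abs (LINT y|\<pi>0. u y) <= A * c" unfolding c_def by (rule stationary_mean_bound[OF u])
   then have "abs (h n * (u (obs_x (n, j) w) - (LINT y|\<pi>0. u y))) <= h n * (A * (obs_u (n, j) w ^ N + c))" for j
    using poly_le_obs[OF u, of "(n, j)" w] h_pos[of n] unfolding abs_mult distrib_left[of A] by (intro mult_mono order_trans[OF abs_triangle_ineq4] add_mono) auto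
   then have "abs (\<Sum>j=1..n. h n * (u (obs_x (n, j) w) - (LINT y|\<pi>0. u y))) <= (\<Sum>j=1..n. h n * (A * (obs_u (n, j) w ^ N + c)))"
    by (intro order_trans[OF sum_abs] sum_mono)
   also have "... = h n * (A * ((\<Sum>j=1..n. obs_u (n, j) w ^ N) + real n * c))"
    by (simp add: sum.distrib distrib_left flip: sum_distrib_left)
   finally have "1 / (real n * h n) * abs (\<Sum>j=1..n. h n * (u (obs_x (n, j) w) - (LINT y|\<pi>0. u y))) <=
     1 / (real n * h n) * (h n * (A * ((\<Sum>j=1..n. obs_u (n, j) w ^ N) + real n * c)))"
    by (rule mult_left_mono) (use n in auto)
   then have "abs (ergodic n u w) <= 1 / (real n * h n) * (h n * (A * ((\<Sum>j=1..n. obs_u (n, j) w ^ N) + real n * c)))"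
    unfolding ergodic_def abs_mult using n by simp
   also have "... = A * ?B n w" using n by (simp add: zero_less_mult_iff add_divide_distrib distrib_left)
   also have "... <= A * abs (?B n w)" using poly_le_nonneg[OF u] by (intro mult_left_mono abs_ge_self)
   finally show "abs (ergodic n u w) <= A * abs (?B n w)" .
  qed
  ultimately show ?thesis by blast
 qed
qed

lemmas ergodic_law = uniform_law[OF nh ergodic_fluctuation]
 and ergodic_taylor = taylor_fluctuation[OF nh ergodic_fluctuation]

text \<open>Integrands of the two fluctuations of the contrast: \<open>wn\<close> multiplies the
  centred squared increments, while the stationary mean of \<open>wd\<close> is the limit
  contrast.\<close>

abbreviation "wn \<equiv> %k x \<gamma>. weight k x \<gamma> * (cb x \<gamma>0 * cb x \<gamma>0)"
abbreviation "wd \<equiv> %k x \<gamma>. weight k x \<gamma> * ((cb x \<gamma>0)^2 - (cb x \<gamma>)^2)"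

lemma contrast_taylor: "taylor_at D\<gamma> \<gamma>0 (wn k)" "taylor_at D\<gamma> \<gamma>0 (wd k)"
proof -
 note c = taylor_at_const[OF \<theta>0(2)] and m = taylor_at_mult[OF \<theta>0(2)]
 have i: "taylor_at D\<gamma> \<gamma>0 (%x \<gamma>. inverse (cb x \<gamma>))" by (rule taylor_at_inverse[OF \<theta>0(2) tay(1) icb cb0])
 have 2: "EX N A. poly_le N A (%_. b)" for b by (intro exI[of _ 0] exI[of _ "abs b"]) (simp add: poly_le_def)
 have wt: "taylor_at D\<gamma> \<gamma>0 (weight k)"
  using m[OF m[OF c[OF 2[of 2]] tay(2)[of k]] m[OF i m[OF i i]]] by (simp add: weight_def[abs_def] power3_eq_cube mult.assoc)
 have c0: "taylor_at D\<gamma> \<gamma>0 (%x \<gamma>. cb x \<gamma>0)" by (rule c[OF poly_lipschitz_at[OF cb \<theta>0(2)]])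
 show "taylor_at D\<gamma> \<gamma>0 (wn k)" by (rule m[OF wt m[OF c0 c0]])
 show "taylor_at D\<gamma> \<gamma>0 (wd k)"
  using m[OF wt taylor_at_add[OF \<theta>0(2) m[OF c0 c0] m[OF c[OF 2[of "- 1"]] m[OF tay(1) tay(1)]]]] by (simp add: power2_eq_square)
qed

section \<open>Inserting selected parameters\<close>

context
 fixes \<alpha>s :: "nat => 'w => real ^ 'd" and \<gamma>s :: "nat => 'w => real ^ 'p"
 assumes sel: "!!n w. w : space M ==> \<alpha>s n w : D\<alpha>" "!!n w. w : space M ==> \<gamma>s n w : D\<gamma>"
begin

text \<open>The index pairs a row entry with a sample point, so that the deterministic bounds hold
  along all paths with common constants and exponents.\<close>

interpretation rb: residual_bounds "rows n0 \<times> space M" "%p. obs_x (fst p) (snd p)" "%p. obs_w (fst p) (snd p)" "%p. obs_r (fst p) (snd p)"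
  "%p. h (fst (fst p))" "%p. \<alpha>s (fst (fst p)) (snd p)" "%p. \<gamma>s (fst (fst p)) (snd p)" D\<alpha> D\<gamma> ab cb gb \<alpha>0 \<gamma>0
 by unfold_locales (use sel \<theta>0 bdd ab cb gb cb0 icb taylor row_times(1,2) in auto)

lemma rb_simps: "rb.U ((n, j), w) = obs_u (n, j) w" "rb.small ((n, j), w) = obs_small (n, j) w" "rb.g ((n, j), w) = dist (\<gamma>s n w) \<gamma>0"
 by (simp_all add: rb.U_def obs_u_def rb.small_def obs_small_def rb.g_def)

lemma rb_resid: "(n, j) : rows n0 ==> rb.resid ((n, j), w) = drift_inc n j (\<alpha>s n w) w / cb (obs_x (n, j) w) (\<gamma>s n w)"
 by (simp add: rb.resid_def rb.err_def drift_inc_eq)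

lemma dominated_row_sum:
 assumes "rb.dmd Z Y"
 obtains K p where "K >= 0" "!!n w c. n0 <= n ==> w : space M ==> 0 <= c ==>
  abs (c * (\<Sum>j=1..n. Y ((n, j), w))) <= K * (c * (\<Sum>j=1..n. Z ((n, j), w) * obs_u (n, j) w ^ p))"
proof -
 obtain K p where K: "0 <= K" "!!i. i : rows n0 \<times> space M ==> abs (Y i) <= K * rb.U i ^ p * Z i"
  using assms unfolding dominated_def by blast
 have "abs (c * (\<Sum>j=1..n. Y ((n, j), w))) <= K * (c * (\<Sum>j=1..n. Z ((n, j), w) * obs_u (n, j) w ^ p))"
  if n: "n0 <= n" "w : space M" and c: "0 <= c" for n w c
 proof -
  have "abs (\<Sum>j=1..n. Y ((n, j), w)) <= (\<Sum>j=1..n. K * obs_u (n, j) w ^ p * Z ((n, j), w))"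
   using K(2) n by (intro sum_abs[THEN order_trans] sum_mono) (auto simp: rb_simps[symmetric])
  then have "c * abs (\<Sum>j=1..n. Y ((n, j), w)) <= c * (\<Sum>j=1..n. K * obs_u (n, j) w ^ p * Z ((n, j), w))" using c by (rule mult_left_mono)
  also have "(\<Sum>j=1..n. K * obs_u (n, j) w ^ p * Z ((n, j), w)) = K * (\<Sum>j=1..n. Z ((n, j), w) * obs_u (n, j) w ^ p)"
   by (simp only: sum_distrib_left mult_ac)
  finally show ?thesis unfolding abs_mult abs_of_nonneg[OF c] by (simp only: mult.left_commute)
 qed
 with K(1) show ?thesis by (rule that)
qed

lemma small_sum:
 assumes "rb.dmd rb.small Y"
 shows "vanish_in_prob M (%n w. 1 / sqrt (real n * h n) * (\<Sum>j=1..n. Y ((n, j), w)))"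
proof -
 obtain K p where K: "K >= 0" "!!n w c. n0 <= n ==> w : space M ==> 0 <= c ==>
  abs (c * (\<Sum>j=1..n. Y ((n, j), w))) <= K * (c * (\<Sum>j=1..n. rb.small ((n, j), w) * obs_u (n, j) w ^ p))"
  using dominated_row_sum[OF assms] by blast
 show ?thesis
 proof (rule vanish_in_prob_mono[OF vanish_in_prob_mult[OF bounded_in_prob_const[of K] vanish_in_prob_small[OF nh2, of p]]], use N_ev in eventually_elim, intro ballI)
  fix n w assume n: "n0 <= n & 0 < real n * h n" and w: "w : space M"
  show "abs (1 / sqrt (real n * h n) * (\<Sum>j=1..n. Y ((n, j), w))) <= abs (K * (1 / sqrt (real n * h n) * (\<Sum>j=1..n. obs_small (n, j) w * obs_u (n, j) w ^ p)))"
   using K(2)[of n w "1 / sqrt (real n * h n)"] n w unfolding rb_simps by (intro order_trans[OF _ abs_ge_self]) simp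
 qed
qed

text \<open>Inserting \<open>drift_inc_eq\<close> and squaring, the main term is the squared true
  scale times the squared increment. Centring the latter by its mean \<open>h\<close> gives the
  noise fluctuation, the difference of squared scales against its stationary mean gives the ergodic
  one, and \<open>Y\<close> is the part with \<open>err\<close>.\<close>

lemma contrast_decomposition:
 fixes k
 defines "Y \<equiv> %i. 2 * gb k (obs_x (fst i) (snd i)) (\<gamma>s (fst (fst i)) (snd i)) * inverse (cb (obs_x (fst i) (snd i)) (\<gamma>s (fst (fst i)) (snd i))) ^ 3 *
   (2 * cb (obs_x (fst i) (snd i)) \<gamma>0 * obs_w (fst i) (snd i) * rb.err i + (rb.err i)^2)"
 shows "\<forall>\<^sub>F n in sequentially. ALL w:space M. contrast k n (\<alpha>s n w) (\<gamma>s n w) w - contrast_limit k (\<gamma>s n w) =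
  noise power2 n (%x. wn k x (\<gamma>s n w)) w + ergodic n (%x. wd k x (\<gamma>s n w)) w + 1 / (real n * h n) * (\<Sum>j=1..n. Y ((n, j), w))"
  and "vanish_in_prob M (%n w. 1 / sqrt (real n * h n) * (\<Sum>j=1..n. Y ((n, j), w)))"
proof -
 show "\<forall>\<^sub>F n in sequentially. ALL w:space M. contrast k n (\<alpha>s n w) (\<gamma>s n w) w - contrast_limit k (\<gamma>s n w) =
  noise power2 n (%x. wn k x (\<gamma>s n w)) w + ergodic n (%x. wd k x (\<gamma>s n w)) w + 1 / (real n * h n) * (\<Sum>j=1..n. Y ((n, j), w))"
  using N_ev
 proof (eventually_elim, intro ballI)
  fix n w assume n: "n0 <= n & 0 < real n * h n" and w: "w : space M"
  have e: "(LINT w|M. (J (h n) w)^2) = h n" using J_second_moment[of "h n"] h_pos[of n] by simp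
  have "contrast_limit k (\<gamma>s n w) = 1 / (real n * h n) * (\<Sum>j=1..n. h n * contrast_limit k (\<gamma>s n w))" using n by (auto simp: zero_less_mult_iff)
  then have "contrast k n (\<alpha>s n w) (\<gamma>s n w) w - contrast_limit k (\<gamma>s n w) = 1 / (real n * h n) *
   (\<Sum>j=1..n. weight k (obs_x (n, j) w) (\<gamma>s n w) * ((drift_inc n j (\<alpha>s n w) w)^2 - h n * (cb (obs_x (n, j) w) (\<gamma>s n w))^2) - h n * contrast_limit k (\<gamma>s n w))"
   unfolding contrast_def sum_subtractf right_diff_distrib[of "1 / _"] by simp
  also have "... = 1 / (real n * h n) * (\<Sum>j=1..n. wn k (obs_x (n, j) w) (\<gamma>s n w) * ((obs_w (n, j) w)^2 - h n) +
    h n * (wd k (obs_x (n, j) w) (\<gamma>s n w) - contrast_limit k (\<gamma>s n w)) + Y ((n, j), w))"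
  proof (intro arg_cong2[where f="(*)"] refl sum.cong)
   fix j assume "j : {1..n}"
   then have j: "(n, j) : rows n0" using n by simp
   show "weight k (obs_x (n, j) w) (\<gamma>s n w) * ((drift_inc n j (\<alpha>s n w) w)^2 - h n * (cb (obs_x (n, j) w) (\<gamma>s n w))^2) - h n * contrast_limit k (\<gamma>s n w) =
    wn k (obs_x (n, j) w) (\<gamma>s n w) * ((obs_w (n, j) w)^2 - h n) + h n * (wd k (obs_x (n, j) w) (\<gamma>s n w) - contrast_limit k (\<gamma>s n w)) + Y ((n, j), w)"
    unfolding Y_def drift_inc_eq[OF j] rb.err_def fst_conv snd_conv weight_def[symmetric]
    by (simp add: power2_eq_square algebra_simps)
  qed
  finally show "contrast k n (\<alpha>s n w) (\<gamma>s n w) w - contrast_limit k (\<gamma>s n w) =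
   noise power2 n (%x. wn k x (\<gamma>s n w)) w + ergodic n (%x. wd k x (\<gamma>s n w)) w + 1 / (real n * h n) * (\<Sum>j=1..n. Y ((n, j), w))"
   unfolding noise_def ergodic_def e contrast_limit_def[symmetric] sum.distrib distrib_left by simp
 qed
 show "vanish_in_prob M (%n w. 1 / sqrt (real n * h n) * (\<Sum>j=1..n. Y ((n, j), w)))"
  unfolding Y_def by (rule small_sum[OF rb.dom_contrast])
qed

lemma power2_noise: "(power2 :: real => real) : borel_measurable borel" "!!z :: real. abs (z^2) <= 1 * (z^2 * (1 + abs z) ^ 0)"
 by auto

lemma contrast_vanish: "vanish_in_prob M (%n w. contrast k n (\<alpha>s n w) (\<gamma>s n w) w - contrast_limit k (\<gamma>s n w))"
proof -
 note pl = conjunct1[OF contrast_taylor(1)[unfolded taylor_at_def]] conjunct1[OF contrast_taylor(2)[unfolded taylor_at_def]]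
 obtain Y where Y: "\<forall>\<^sub>F n in sequentially. ALL w:space M. contrast k n (\<alpha>s n w) (\<gamma>s n w) w - contrast_limit k (\<gamma>s n w) =
  noise power2 n (%x. wn k x (\<gamma>s n w)) w + ergodic n (%x. wd k x (\<gamma>s n w)) w + 1 / (real n * h n) * (\<Sum>j=1..n. Y ((n, j), w))"
  "vanish_in_prob M (%n w. 1 / sqrt (real n * h n) * (\<Sum>j=1..n. Y ((n, j), w)))" by (rule that[OF contrast_decomposition[of k]])
 have "vanish_in_prob M (%n w. noise power2 n (%x. wn k x (\<gamma>s n w)) w + ergodic n (%x. wd k x (\<gamma>s n w)) w +
   1 / sqrt (real n * h n) * (1 / sqrt (real n * h n) * (\<Sum>j=1..n. Y ((n, j), w))))"
  by (intro vanish_in_prob_add vanish_in_prob_mult[OF vanish_imp_bounded_in_prob[OF inv_sqrt_vanish] Y(2)]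
   noise_law[OF power2_noise pl(1) bdd] ergodic_law[OF pl(2) bdd] sel(2))
 then show ?thesis
  by (rule vanish_in_prob_mono) (use Y(1) N_ev in "eventually_elim, simp add: zero_less_mult_iff")
qed

text \<open>For a sequence already known to be consistent, the Taylor form of the fluctuation bounds
  applies to both parts and yields the rate up to a vanishing multiple of the scaled
  distance.\<close>

lemma contrast_rate:
 assumes "vanish_in_prob M (%n w. dist (\<gamma>s n w) \<gamma>0)"
 shows "EX B V. bounded_in_prob M B & vanish_in_prob M V & (\<forall>\<^sub>F n in sequentially. ALL w:space M.
  abs (sqrt (real n * h n) * (contrast k n (\<alpha>s n w) (\<gamma>s n w) w - contrast_limit k (\<gamma>s n w))) <=
   B n w + V n w * (sqrt (real n * h n) * dist (\<gamma>s n w) \<gamma>0))"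
proof -
 let ?s = "%n. sqrt (real n * h n)"
 obtain Y where Y: "\<forall>\<^sub>F n in sequentially. ALL w:space M. contrast k n (\<alpha>s n w) (\<gamma>s n w) w - contrast_limit k (\<gamma>s n w) =
  noise power2 n (%x. wn k x (\<gamma>s n w)) w + ergodic n (%x. wd k x (\<gamma>s n w)) w + 1 / (real n * h n) * (\<Sum>j=1..n. Y ((n, j), w))"
  "vanish_in_prob M (%n w. 1 / ?s n * (\<Sum>j=1..n. Y ((n, j), w)))" by (rule that[OF contrast_decomposition[of k]])
 obtain B V where 1: "bounded_in_prob M B" "vanish_in_prob M V" "\<forall>\<^sub>F n in sequentially. ALL w:space M.
   abs (?s n * noise power2 n (%x. wn k x (\<gamma>s n w)) w) <= abs (B n w) + abs (V n w) * (?s n * dist (\<gamma>s n w) \<gamma>0)"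
  using noise_taylor[OF power2_noise contrast_taylor(1) \<theta>0(2) sel(2) assms] by blast
 obtain B' V' where 2: "bounded_in_prob M B'" "vanish_in_prob M V'" "\<forall>\<^sub>F n in sequentially. ALL w:space M.
   abs (?s n * ergodic n (%x. wd k x (\<gamma>s n w)) w) <= abs (B' n w) + abs (V' n w) * (?s n * dist (\<gamma>s n w) \<gamma>0)"
  using ergodic_taylor[OF contrast_taylor(2) \<theta>0(2) sel(2) assms] by blast
 let ?Y = "%n w. abs (1 / ?s n * (\<Sum>j=1..n. Y ((n, j), w)))"
 show ?thesis
 proof (rule exI[of _ "%n w. abs (B n w) + abs (B' n w) + ?Y n w"], rule exI[of _ "%n w. abs (V n w) + abs (V' n w)"], intro conjI)
  show "\<forall>\<^sub>F n in sequentially. ALL w:space M. abs (?s n * (contrast k n (\<alpha>s n w) (\<gamma>s n w) w - contrast_limit k (\<gamma>s n w))) <=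
   abs (B n w) + abs (B' n w) + ?Y n w + (abs (V n w) + abs (V' n w)) * (?s n * dist (\<gamma>s n w) \<gamma>0)"
   using Y(1) 1(3) 2(3) N_ev
  proof (eventually_elim, intro ballI, goal_cases)
   case elim: (1 n w)
   have "?s n * (contrast k n (\<alpha>s n w) (\<gamma>s n w) w - contrast_limit k (\<gamma>s n w)) =
    ?s n * noise power2 n (%x. wn k x (\<gamma>s n w)) w + ?s n * ergodic n (%x. wd k x (\<gamma>s n w)) w + 1 / ?s n * (\<Sum>j=1..n. Y ((n, j), w))"
    using bspec[OF elim(1,9)] sqrt_ratio[OF conjunct2[OF elim(4)]] by (simp only: distrib_left)
   then show ?case using bspec[OF elim(2,9)] bspec[OF elim(3,9)] unfolding distrib_right by linarith
  qed
 qed (intro bounded_in_prob_add vanish_in_prob_add bounded_in_prob_abs vanish_in_prob_abs vanish_imp_bounded_in_prob 1 2 Y)+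
qed

lemma row_sum_bounded:
 assumes d: "rb.dmd Z Y" and c: "!!n. 0 <= c n" and b: "!!p. bounded_in_prob M (%n w. c n * (\<Sum>j=1..n. Z ((n, j), w) * obs_u (n, j) w ^ p))"
 shows "bounded_in_prob M (%n w. c n * (\<Sum>j=1..n. Y ((n, j), w)))"
proof -
 obtain K p where K: "K >= 0" "!!n w c. n0 <= n ==> w : space M ==> 0 <= c ==>
  abs (c * (\<Sum>j=1..n. Y ((n, j), w))) <= K * (c * (\<Sum>j=1..n. Z ((n, j), w) * obs_u (n, j) w ^ p))"
  using dominated_row_sum[OF d] by blast
 show ?thesis
  by (rule bounded_in_prob_mono[OF bounded_in_prob_mult[OF bounded_in_prob_const[of K] b[of p]]], use N_ev in eventually_elim, intro ballI)
   (use K(2)[OF _ _ c] in "intro order_trans[OF _ abs_ge_self], simp")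
qed

lemma row_sum_vanish:
 assumes d: "rb.dmd Z Y" and c: "!!n. 0 <= c n" and b: "!!p. vanish_in_prob M (%n w. c n * (\<Sum>j=1..n. Z ((n, j), w) * obs_u (n, j) w ^ p))"
 shows "vanish_in_prob M (%n w. c n * (\<Sum>j=1..n. Y ((n, j), w)))"
proof -
 obtain K p where K: "K >= 0" "!!n w c. n0 <= n ==> w : space M ==> 0 <= c ==>
  abs (c * (\<Sum>j=1..n. Y ((n, j), w))) <= K * (c * (\<Sum>j=1..n. Z ((n, j), w) * obs_u (n, j) w ^ p))"
  using dominated_row_sum[OF d] by blast
 show ?thesis
  by (rule vanish_in_prob_mono[OF vanish_in_prob_mult[OF bounded_in_prob_const[of K] b[of p]]], use N_ev in eventually_elim, intro ballI)
   (use K(2)[OF _ _ c] in "intro order_trans[OF _ abs_ge_self], simp")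
qed

section \<open>Expansion of the residual statistic, given the rate of the scale estimator\<close>

context
 fixes f f' f'' :: "real => real" and K N
 assumes f: "!!z. (f has_real_derivative f' z) (at z)" and f': "!!z. (f' has_real_derivative f'' z) (at z)"
  and b: "!!z. abs (f'' z) <= K * (1 + abs z) ^ N" and f'0: "f' 0 = 0"
  and rate: "bounded_in_prob M (%n w. sqrt (real n * h n) * dist (\<gamma>s n w) \<gamma>0)"
begin

lemma dist_vanish: "vanish_in_prob M (%n w. dist (\<gamma>s n w) \<gamma>0)"
 by (rule sqrt_scaled_vanish[OF rate])

lemma w_sum: "rb.dmd (%i. (obs_w (fst i) (snd i))^2) Y ==> bounded_in_prob M (%n w. 1 / (real n * h n) * (\<Sum>j=1..n. Y ((n, j), w)))"
 by (erule row_sum_bounded) (use h_pos in "simp add: less_imp_le", simp only: fst_conv snd_conv bounded_in_prob_w)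

lemma unit_sum: "rb.dmd (%i. 1) Y ==> bounded_in_prob M (%n w. 1 / real n * (\<Sum>j=1..n. Y ((n, j), w)))"
 by (erule row_sum_bounded) (simp, simp only: mult_1 bounded_in_prob_u)

lemma g_sum:
 assumes "rb.dmd rb.g Y"
 shows "vanish_in_prob M (%n w. 1 / real n * (\<Sum>j=1..n. Y ((n, j), w)))"
 using assms
proof (rule row_sum_vanish)
 show "vanish_in_prob M (%n w. 1 / real n * (\<Sum>j=1..n. rb.g ((n, j), w) * obs_u (n, j) w ^ p))" for p
  using vanish_in_prob_mult[OF bounded_in_prob_u dist_vanish, of p] by (simp add: rb_simps mult_ac flip: sum_distrib_left)
qed simp

lemma gw_sum:
 assumes "rb.dmd (%i. rb.g i * (obs_w (fst i) (snd i))^2 + rb.small i) Y"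
 shows "vanish_in_prob M (%n w. 1 / (real n * h n) * (\<Sum>j=1..n. Y ((n, j), w)))"
 using assms
proof (rule row_sum_vanish)
 fix p
 have "vanish_in_prob M (%n w. 1 / (real n * h n) * (\<Sum>j=1..n. (obs_w (n, j) w)^2 * obs_u (n, j) w ^ p) * dist (\<gamma>s n w) \<gamma>0 +
  1 / sqrt (real n * h n) * (\<Sum>j=1..n. obs_small (n, j) w * obs_u (n, j) w ^ p) * (1 / sqrt (real n * h n)))"
  by (intro vanish_in_prob_add vanish_in_prob_mult[OF bounded_in_prob_w dist_vanish]
   vanish_in_prob_mult[OF vanish_imp_bounded_in_prob[OF vanish_in_prob_small[OF nh2]] inv_sqrt_vanish])
 then show "vanish_in_prob M (%n w. 1 / (real n * h n) * (\<Sum>j=1..n. (rb.g ((n, j), w) * (obs_w (fst ((n, j), w)) (snd ((n, j), w)))^2 + rb.small ((n, j), w)) * obs_u (n, j) w ^ p))"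
 proof (rule vanish_in_prob_mono, use N_ev in eventually_elim, intro ballI)
  fix n w assume n: "n0 <= n & 0 < real n * h n"
  have s: "1 / sqrt (real n * h n) * S * (1 / sqrt (real n * h n)) = 1 / (real n * h n) * S" for S using n by (simp add: mult_ac)
  show "abs (1 / (real n * h n) * (\<Sum>j=1..n. (rb.g ((n, j), w) * (obs_w (fst ((n, j), w)) (snd ((n, j), w)))^2 + rb.small ((n, j), w)) * obs_u (n, j) w ^ p)) <=
   abs (1 / (real n * h n) * (\<Sum>j=1..n. (obs_w (n, j) w)^2 * obs_u (n, j) w ^ p) * dist (\<gamma>s n w) \<gamma>0 +
  1 / sqrt (real n * h n) * (\<Sum>j=1..n. obs_small (n, j) w * obs_u (n, j) w ^ p) * (1 / sqrt (real n * h n)))"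
   unfolding s rb_simps fst_conv snd_conv distrib_right sum.distrib distrib_left mult.assoc[of "dist _ _"] sum_distrib_left[symmetric] by (simp only: mult_ac)
 qed
qed (use h_pos in "simp add: less_imp_le")

text \<open>The function \<open>\<zeta>\<close> of the bias term for one coordinate, centred by its
  mean along \<open>J t\<close>.\<close>

definition \<xi> :: "real => real => real" where "\<xi> t z = z * f' z - (LINT w|M. J t w * f' (J t w))"

lemma noise_sum:
 assumes "poly_lipschitz D\<gamma> q"
 shows "bounded_in_prob M (%n w. 1 / sqrt (real n * h n) * (\<Sum>j=1..n. q (obs_x (n, j) w) \<gamma>0 * \<xi> (h n) (obs_w (n, j) w)))"
proof -
 have "continuous_on UNIV f'" using f' DERIV_isCont by (blast intro: continuous_at_imp_continuous_on)
 then have [measurable]: "f' : borel_measurable borel" by (rule borel_measurable_continuous_onI)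
 have "abs (z * f' z) <= K * (z^2 * (1 + abs z) ^ N)" for z
  using mult_left_mono[OF rb.f'_le[OF f f' b f'0, of z] abs_ge_zero[of z]] by (simp add: abs_mult power2_eq_square mult_ac)
 note nb = noise_bounded[of "%z. z * f' z", OF _ this poly_lipschitz_at[OF assms \<theta>0(2)]]
 have "bounded_in_prob M (%n w. sqrt (real n * h n) * noise (%z. z * f' z) n (%x. q x \<gamma>0) w)" by (rule nb) measurable
 then show ?thesis
  by (rule bounded_in_prob_mono) (use N_ev in "eventually_elim, simp only: noise_def \<xi>_def sqrt_ratio order_refl ball_triv simp_thms")
qed

text \<open>The pointwise expansion leaves the mean of the products of
  \<open>\<zeta>(\<delta>)\<close> with the relative gradient of the scale, whereas the bias matrix
  contains the product of the means. Their difference \<open>W k\<close> vanishes, and the scaled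
  estimation error multiplying it is bounded.\<close>

lemma statistic_expansion:
 defines "\<delta> \<equiv> %n j w. drift_inc n j (\<alpha>s n w) w / cb (obs_x (n, j) w) (\<gamma>s n w)"
 shows "vanish_in_prob M (%n w. sqrt (real n * h n) * (1 / (real n * h n) * (\<Sum>j=1..n. f (\<delta> n j w)) - 1 / (real n * h n) * (\<Sum>j=1..n. f (obs_w (n, j) w))) +
  1 / (real n * h n) * (\<Sum>j=1..n. \<delta> n j w * f' (\<delta> n j w)) *
  (\<Sum>k\<in>UNIV. 1 / real n * (\<Sum>j=1..n. gb k (obs_x (n, j) w) (\<gamma>s n w) * inverse (cb (obs_x (n, j) w) (\<gamma>s n w))) * (sqrt (real n * h n) * (\<gamma>s n w - \<gamma>0) $ k)))"
proof -
 let ?s = "%n. sqrt (real n * h n)" and ?N = "%n. real n * h n"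
 define q where "q k n j w = gb k (obs_x (n, j) w) (\<gamma>s n w) * inverse (cb (obs_x (n, j) w) (\<gamma>s n w))" for k n j w
 define q0 where "q0 k n j w = gb k (obs_x (n, j) w) \<gamma>0 * inverse (cb (obs_x (n, j) w) \<gamma>0)" for k n j w
 define z where "z n j w = obs_w (n, j) w * f' (obs_w (n, j) w)" for n j w
 define d where "d n j w = rb.resid ((n, j), w) * f' (rb.resid ((n, j), w)) - z n j w" for n j w
 define T where "T i = f (rb.resid i) - f (obs_w (fst i) (snd i)) + rb.resid i * f' (rb.resid i) * rb.lin i" for i
 define A where "A k n w = 1 / real n * (\<Sum>j=1..n. q k n j w)" for k n w
 define A0 where "A0 k n w = 1 / real n * (\<Sum>j=1..n. q0 k n j w)" for k n w
 define e where "e n = (LINT w|M. J (h n) w * f' (J (h n) w))" for n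
 \<comment> \<open>This is the mean of the products minus the product of the means, as verified in
   \<open>WN\<close>. The first two terms exchange residuals for increments, the next two the
   estimated parameter for the true one; the last two are sums of centred noise, of order
   \<open>1 / sqrt (n h)\<close>.\<close>
 define W where "W k n w = 1 / ?N n * (\<Sum>j=1..n. d n j w * q k n j w) - A k n w * (1 / ?N n * (\<Sum>j=1..n. d n j w)) +
  1 / ?N n * (\<Sum>j=1..n. z n j w * (q k n j w - q0 k n j w)) - 1 / ?N n * (\<Sum>j=1..n. z n j w) * (1 / real n * (\<Sum>j=1..n. q k n j w - q0 k n j w)) +
  1 / ?s n * (\<Sum>j=1..n. q0 k n j w * \<xi> (h n) (obs_w (n, j) w)) * (1 / ?s n) - A0 k n w * (1 / ?s n * (\<Sum>j=1..n. \<xi> (h n) (obs_w (n, j) w))) * (1 / ?s n)" for k n w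
 note zd = rb.dom_zeta_diff[OF f f' b f'0] and zw = rb.dom_zeta[OF f f' b f'0]
 have qd: "rb.dmd (%_. 1) (%i. gb k (obs_x (fst i) (snd i)) (\<gamma>s (fst (fst i)) (snd i)) * inverse (cb (obs_x (fst i) (snd i)) (\<gamma>s (fst (fst i)) (snd i))))"
  "rb.dmd (%_. 1) (%i. gb k (obs_x (fst i) (snd i)) \<gamma>0 * inverse (cb (obs_x (fst i) (snd i)) \<gamma>0))" for k
  using rb.pl(1)[OF poly_lipschitz_mult[OF gb icb], of "%_. \<gamma>0" "%_. \<gamma>0" k] \<theta>0 by (auto intro!: rb.dominated_scale rb.dom_coeff)
 have 1: "vanish_in_prob M (%n w. 1 / ?N n * (\<Sum>j=1..n. d n j w * q k n j w))" for k
  using gw_sum[OF rb.dominated_scale[OF qd(1) zd], of k] by (simp add: d_def z_def q_def mult.commute)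
 have 2: "vanish_in_prob M (%n w. 1 / ?N n * (\<Sum>j=1..n. d n j w))"
  using gw_sum[OF zd] by (simp add: d_def z_def)
 have A: "bounded_in_prob M (A k)" "bounded_in_prob M (A0 k)" for k
  using unit_sum[OF qd(1), of k] unit_sum[OF qd(2), of k] by (simp_all add: A_def[abs_def] A0_def[abs_def] q_def q0_def)
 have 3: "vanish_in_prob M (%n w. 1 / ?N n * (\<Sum>j=1..n. z n j w * (q k n j w - q0 k n j w)))" for k
 proof -
  have "rb.dmd (%i. rb.g i * (obs_w (fst i) (snd i))^2 + rb.small i) (%i. obs_w (fst i) (snd i) * f' (obs_w (fst i) (snd i)) *
   (gb k (obs_x (fst i) (snd i)) (\<gamma>s (fst (fst i)) (snd i)) * inverse (cb (obs_x (fst i) (snd i)) (\<gamma>s (fst (fst i)) (snd i))) -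
    gb k (obs_x (fst i) (snd i)) \<gamma>0 * inverse (cb (obs_x (fst i) (snd i)) \<gamma>0)))"
   by (rule rb.dominated_mono[OF rb.dominated_mult[OF zw rb.dom_coeff(8)], where C=1]) (auto simp: rb.g_def rb.small_nonneg mult.commute)
  from gw_sum[OF this] show ?thesis by (simp add: z_def q_def q0_def)
 qed
 have 4: "vanish_in_prob M (%n w. 1 / real n * (\<Sum>j=1..n. q k n j w - q0 k n j w))" for k
  using g_sum[OF rb.dom_coeff(8)] by (simp add: q_def q0_def)
 have zb: "bounded_in_prob M (%n w. 1 / ?N n * (\<Sum>j=1..n. z n j w))" using w_sum[OF zw] by (simp add: z_def)
 have 5: "bounded_in_prob M (%n w. 1 / ?s n * (\<Sum>j=1..n. q0 k n j w * \<xi> (h n) (obs_w (n, j) w)))" for k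
  using noise_sum[OF poly_lipschitz_mult[OF gb icb]] by (simp add: q0_def)
 have 6: "bounded_in_prob M (%n w. 1 / ?s n * (\<Sum>j=1..n. \<xi> (h n) (obs_w (n, j) w)))"
  using noise_sum[OF poly_lipschitz_const[where N=0 and K=1 and u="%_. 1"]] by (simp add: poly_le_def)
 have W: "vanish_in_prob M (W k)" for k
  unfolding W_def[abs_def]
  by (intro vanish_in_prob_add vanish_in_prob_diff 1 3 vanish_in_prob_mult[OF A(1) 2] vanish_in_prob_mult[OF zb 4]
   vanish_in_prob_mult[OF 5 inv_sqrt_vanish] vanish_in_prob_mult[OF bounded_in_prob_mult[OF A(2) 6] inv_sqrt_vanish])
 have T: "vanish_in_prob M (%n w. 1 / ?s n * (\<Sum>j=1..n. T ((n, j), w)))"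
 proof (rule row_sum_vanish)
  show "rb.dmd (%i. (rb.g i)^2 * ((obs_w (fst i) (snd i))^2 + rb.small i) + rb.small i) T"
   unfolding T_def[abs_def] by (rule rb.expansion[OF f f' b f'0])
  fix p
  let ?wt = "%n w. \<Sum>j=1..n. (obs_w (n, j) w)^2 * obs_u (n, j) w ^ p" and ?m = "%n w. \<Sum>j=1..n. obs_small (n, j) w * obs_u (n, j) w ^ p"
  note g2 = vanish_in_prob_mult[OF vanish_imp_bounded_in_prob[OF dist_vanish] dist_vanish]
  have "vanish_in_prob M (%n w. (1 / ?N n * ?wt n w) * (?s n * dist (\<gamma>s n w) \<gamma>0) * dist (\<gamma>s n w) \<gamma>0 +
   (dist (\<gamma>s n w) \<gamma>0 * dist (\<gamma>s n w) \<gamma>0 + 1) * (1 / ?s n * ?m n w))"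
   by (intro vanish_in_prob_add vanish_in_prob_mult[OF bounded_in_prob_mult[OF bounded_in_prob_w rate] dist_vanish]
    vanish_in_prob_mult[OF bounded_in_prob_add[OF vanish_imp_bounded_in_prob[OF g2] bounded_in_prob_const] vanish_in_prob_small[OF nh2]])
  then show "vanish_in_prob M (%n w. 1 / ?s n * (\<Sum>j=1..n. ((rb.g ((n, j), w))^2 * ((obs_w (fst ((n, j), w)) (snd ((n, j), w)))^2 + rb.small ((n, j), w)) + rb.small ((n, j), w)) * obs_u (n, j) w ^ p))"
  proof (rule vanish_in_prob_mono, use N_ev in eventually_elim, intro ballI)
   fix n w assume n: "n0 <= n & 0 < ?N n"
   let ?g = "dist (\<gamma>s n w) \<gamma>0"
   have eq1: "(\<Sum>j=1..n. ((rb.g ((n, j), w))^2 * ((obs_w (fst ((n, j), w)) (snd ((n, j), w)))^2 + rb.small ((n, j), w)) + rb.small ((n, j), w)) * obs_u (n, j) w ^ p) =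
    ?g^2 * ?wt n w + (?g^2 + 1) * ?m n w"
    unfolding rb_simps fst_conv snd_conv by (simp add: distrib_left distrib_right sum.distrib sum_distrib_left mult_ac)
   have eq2: "1 / ?N n * y * (?s n * ?g) * ?g = 1 / ?s n * (?g^2 * y)" for y
    using sqrt_ratio[of "?N n" "y * ?g^2"] n by (simp only: power2_eq_square mult_ac)
   show "abs (1 / ?s n * (\<Sum>j=1..n. ((rb.g ((n, j), w))^2 * ((obs_w (fst ((n, j), w)) (snd ((n, j), w)))^2 + rb.small ((n, j), w)) + rb.small ((n, j), w)) * obs_u (n, j) w ^ p)) <=
    abs ((1 / ?N n * ?wt n w) * (?s n * ?g) * ?g + (?g * ?g + 1) * (1 / ?s n * ?m n w))"
    unfolding eq1 eq2 unfolding power2_eq_square distrib_left[of "1 / ?s n"] by (simp only: mult.left_commute order_refl)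
  qed
 qed (use h_pos in "simp add: less_imp_le")
 have sg: "bounded_in_prob M (%n w. ?s n * (\<gamma>s n w - \<gamma>0) $ k)" for k
 proof (rule bounded_in_prob_mono[OF rate], intro always_eventually allI ballI)
  fix n w
  show "abs (?s n * (\<gamma>s n w - \<gamma>0) $ k) <= abs (?s n * dist (\<gamma>s n w) \<gamma>0)"
   unfolding abs_mult dist_norm using component_le_norm_cart[of "\<gamma>s n w - \<gamma>0" k] by (intro mult_left_mono) auto
 qed
 have "vanish_in_prob M (%n w. 1 / ?s n * (\<Sum>j=1..n. T ((n, j), w)) - (\<Sum>k\<in>UNIV. ?s n * (\<gamma>s n w - \<gamma>0) $ k * W k n w))"
  by (intro vanish_in_prob_diff T vanish_in_prob_sum vanish_in_prob_mult sg W)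
 then show ?thesis
 proof (rule vanish_in_prob_mono, use N_ev in eventually_elim, intro ballI)
  fix n w assume n: "n0 <= n & 0 < ?N n" and w: "w : space M"
  then have N: "0 < ?N n" "real n ~= 0" by (auto simp: zero_less_mult_iff)
  have ss: "1 / ?s n * y * (1 / ?s n) = 1 / ?N n * y" for y using N by (simp add: mult_ac)
  let ?y = "%j. \<delta> n j w * f' (\<delta> n j w)"
  have r: "rb.resid ((n, j), w) = \<delta> n j w" if "j : {1..n}" for j
   using that n by (simp add: \<delta>_def rb_resid)
  have y: "?y j = d n j w + z n j w" if "j : {1..n}" for j using r[OF that] by (simp add: d_def)
  have \<xi>: "\<xi> (h n) (obs_w (n, j) w) = z n j w - e n" for j by (simp add: \<xi>_def z_def e_def)
  have nA: "(\<Sum>j=1..n. q k n j w) = real n * A k n w" "(\<Sum>j=1..n. q0 k n j w) = real n * A0 k n w" for k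
   using N by (simp_all add: A_def A0_def)
  have WN: "W k n w = 1 / ?N n * (\<Sum>j=1..n. ?y j * q k n j w) - 1 / ?N n * (\<Sum>j=1..n. ?y j) * A k n w" for k
  proof -
   define a where "a = 1 / ?N n"
   have 1: "(\<Sum>j=1..n. ?y j * q k n j w) = (\<Sum>j=1..n. d n j w * q k n j w) + (\<Sum>j=1..n. z n j w * q k n j w)"
    "(\<Sum>j=1..n. ?y j) = (\<Sum>j=1..n. d n j w) + (\<Sum>j=1..n. z n j w)"
    unfolding sum.distrib[symmetric] using y by (auto intro!: sum.cong simp: distrib_right)
   have 2: "(\<Sum>j=1..n. z n j w * (q k n j w - q0 k n j w)) = (\<Sum>j=1..n. z n j w * q k n j w) - (\<Sum>j=1..n. z n j w * q0 k n j w)"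
    by (simp add: right_diff_distrib sum_subtractf)
   have 3: "(\<Sum>j=1..n. q0 k n j w * (z n j w - e n)) = (\<Sum>j=1..n. z n j w * q0 k n j w) - real n * A0 k n w * e n"
    unfolding nA(2)[symmetric] by (simp add: right_diff_distrib sum_subtractf sum_distrib_left mult.commute)
   have 4: "(\<Sum>j=1..n. z n j w - e n) = (\<Sum>j=1..n. z n j w) - real n * e n" by (simp add: sum_subtractf)
   have 5: "1 / real n * (\<Sum>j=1..n. q k n j w - q0 k n j w) = A k n w - A0 k n w"
    by (simp add: sum_subtractf A_def A0_def right_diff_distrib)
   have 6: "A0 k n w * (1 / ?s n * y) * (1 / ?s n) = A0 k n w * (a * y)" for y using ss[of y] by (simp only: mult.assoc a_def)
   show ?thesis
    unfolding W_def \<xi> 1 2 3 4 5 6 ss a_def[symmetric] by (simp add: algebra_simps)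
  qed
  show "abs (?s n * (1 / ?N n * (\<Sum>j=1..n. f (\<delta> n j w)) - 1 / ?N n * (\<Sum>j=1..n. f (obs_w (n, j) w))) + 1 / ?N n * (\<Sum>j=1..n. ?y j) *
   (\<Sum>k\<in>UNIV. 1 / real n * (\<Sum>j=1..n. gb k (obs_x (n, j) w) (\<gamma>s n w) * inverse (cb (obs_x (n, j) w) (\<gamma>s n w))) * (?s n * (\<gamma>s n w - \<gamma>0) $ k))) <=
   abs (1 / ?s n * (\<Sum>j=1..n. T ((n, j), w)) - (\<Sum>k\<in>UNIV. ?s n * (\<gamma>s n w - \<gamma>0) $ k * W k n w))"
  proof -
   have T: "T ((n, j), w) = f (\<delta> n j w) - f (obs_w (n, j) w) + (\<Sum>k\<in>UNIV. (\<gamma>s n w - \<gamma>0) $ k * (?y j * q k n j w))" if "j : {1..n}" for j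
    using r[OF that] by (simp add: T_def rb.lin_def sum_distrib_left q_def divide_inverse mult_ac)
   have "(\<Sum>j=1..n. T ((n, j), w)) = (\<Sum>j=1..n. f (\<delta> n j w)) - (\<Sum>j=1..n. f (obs_w (n, j) w)) + (\<Sum>j=1..n. \<Sum>k\<in>UNIV. (\<gamma>s n w - \<gamma>0) $ k * (?y j * q k n j w))"
    unfolding sum_subtractf[symmetric] sum.distrib[symmetric] using T by (intro sum.cong) auto
   also have "(\<Sum>j=1..n. \<Sum>k\<in>UNIV. (\<gamma>s n w - \<gamma>0) $ k * (?y j * q k n j w)) = (\<Sum>k\<in>UNIV. (\<gamma>s n w - \<gamma>0) $ k * (\<Sum>j=1..n. ?y j * q k n j w))"
    by (subst sum.swap) (simp add: sum_distrib_left)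
   finally have "1 / ?s n * (\<Sum>j=1..n. T ((n, j), w)) = ?s n * (1 / ?N n * ((\<Sum>j=1..n. f (\<delta> n j w)) - (\<Sum>j=1..n. f (obs_w (n, j) w)) +
     (\<Sum>k\<in>UNIV. (\<gamma>s n w - \<gamma>0) $ k * (\<Sum>j=1..n. ?y j * q k n j w))))"
    unfolding sqrt_ratio[OF N(1)] by simp
   note T = this
   define a G Y Q where "a = 1 / ?N n" and "G k = (\<gamma>s n w - \<gamma>0) $ k" and "Y = (\<Sum>j=1..n. ?y j)" and "Q k = (\<Sum>j=1..n. ?y j * q k n j w)" for k
   have "(\<Sum>k\<in>UNIV. ?s n * G k * (a * Q k - a * Y * A k n w)) = ?s n * (a * (\<Sum>k\<in>UNIV. G k * Q k)) - a * Y * (\<Sum>k\<in>UNIV. A k n w * (?s n * G k))"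
    by (simp only: right_diff_distrib sum_subtractf sum_distrib_left mult_ac)
   then show ?thesis
    unfolding q_def[symmetric] A_def[symmetric] WN T a_def[symmetric] G_def[symmetric] Y_def[symmetric] Q_def[symmetric]
    by (simp add: algebra_simps)
  qed
 qed
qed

end

end

end

text \<open>Serves to extend the identifiability inequality from the open parameter set to its
  closure.\<close>

lemma (in ergodic_sde) stationary_mean_continuous:
 assumes f: "poly_lipschitz D f"
 shows "continuous_on D (%\<theta>. LINT y|\<pi>0. f y \<theta>)"
proof -
 obtain K N where K: "K >= 0" and fK: "ALL \<theta>:D. poly_le N K (%x. f x \<theta>)"
  and l: "ALL x. ALL \<theta>:D. ALL \<theta>':D. abs (f x \<theta> - f x \<theta>') <= K * (1 + abs x) ^ N * dist \<theta> \<theta>'"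
  using f unfolding poly_lipschitz_def by blast
 have i: "integrable \<pi>0 (%y. f y \<theta>)" if "\<theta> : D" for \<theta>
  using fK that poly_\<pi>0_integrable by blast
 have i1: "integrable \<pi>0 (%y. K * (1 + abs y) ^ N)" by (rule poly_\<pi>0_integrable[where A=K and N=N]) (use K in "auto simp: poly_le_def")
 have "(LINT y|\<pi>0. K * (1 + abs y) ^ N)-lipschitz_on D (%\<theta>. LINT y|\<pi>0. f y \<theta>)"
 proof (rule lipschitz_onI)
  fix \<theta> \<theta>' assume \<theta>: "\<theta> : D" "\<theta>' : D"
  have "abs ((LINT y|\<pi>0. f y \<theta>) - (LINT y|\<pi>0. f y \<theta>')) = abs (LINT y|\<pi>0. f y \<theta> - f y \<theta>')" using i \<theta> by simp
  also have "... <= (LINT y|\<pi>0. abs (f y \<theta> - f y \<theta>'))" by (rule integral_abs_bound)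
  also have "... <= (LINT y|\<pi>0. K * (1 + abs y) ^ N * dist \<theta> \<theta>')" using i i1 l \<theta> by (intro integral_mono) auto
  finally show "dist (LINT y|\<pi>0. f y \<theta>) (LINT y|\<pi>0. f y \<theta>') <= (LINT y|\<pi>0. K * (1 + abs y) ^ N) * dist \<theta> \<theta>'"
   by (simp add: dist_real_def)
 qed (use K in "auto intro: Bochner_Integration.integral_nonneg")
 then show ?thesis by (rule lipschitz_on_continuous_on)
qed

lemma (in parametric_sde) estimator_rate:
 fixes u :: "'e::finite => real => real"
 assumes sel: "!!n w. w : space M ==> \<alpha>s n w : D\<alpha>" "!!n w. w : space M ==> \<gamma>s n w : D\<gamma>"
  and u: "!!i. EX N A. poly_le N A (u i)"
  and est: "!!n w k. w : space M ==> abs (contrast k n (\<alpha>s n w) (\<gamma>s n w) w) <=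
   (\<Sum>i\<in>UNIV. abs (score (u i) n w)) + (\<Sum>k\<in>UNIV. abs (contrast k n \<alpha>0 \<gamma>0 w))"
  and \<eta>: "\<eta> > 0" "!!\<gamma>. \<gamma> : D\<gamma> ==> \<eta> * dist \<gamma> \<gamma>0 <= (\<Sum>k\<in>UNIV. abs (contrast_limit k \<gamma>))"
 shows "bounded_in_prob M (%n w. sqrt (real n * h n) * dist (\<gamma>s n w) \<gamma>0)"
proof -
 let ?s = "%n. sqrt (real n * h n)" and ?d = "%n w. dist (\<gamma>s n w) \<gamma>0"
 let ?R = "%k n w. contrast k n (\<alpha>s n w) (\<gamma>s n w) w - contrast_limit k (\<gamma>s n w)"
 let ?Q = "%k n w. contrast k n \<alpha>0 \<gamma>0 w - contrast_limit k \<gamma>0"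
 define S where "S n w = (\<Sum>i\<in>UNIV. abs (score (u i) n w)) + (\<Sum>k\<in>UNIV. abs (?Q k n w))" for n w
 have Q0: "contrast_limit k \<gamma>0 = 0" for k by (simp add: contrast_limit_def)
 have sb: "bounded_in_prob M (%n w. ?s n * score (u i) n w)" for i using score_bounded u by blast
 \<comment> \<open>The constant true parameter is itself a selection, so the fluctuation lemmas also
   bound the contrast there, where its limit is 0.\<close>
 have c0: "!!n w. (%_ _. \<alpha>0) n w : D\<alpha>" "!!n w. (%_ _. \<gamma>0) n w : D\<gamma>" using \<theta>0 by auto
 have le: "?d n w <= 1 / \<eta> * (\<Sum>k\<in>(UNIV :: 'p set). abs (?R k n w) + S n w)" if w: "w : space M" for n w
 proof -
  have "abs (contrast_limit k (\<gamma>s n w)) <= abs (?R k n w) + S n w" for k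
   using est[OF w, of k n] unfolding S_def Q0 diff_0_right by linarith
  then have "\<eta> * ?d n w <= (\<Sum>k\<in>(UNIV :: 'p set). abs (?R k n w) + S n w)"
   by (intro order_trans[OF \<eta>(2)[OF sel(2)[OF w]]] sum_mono)
  then show ?thesis using \<eta>(1) by (simp add: field_simps)
 qed
 have "vanish_in_prob M (%n w. 1 / \<eta> * (\<Sum>k\<in>(UNIV :: 'p set). abs (?R k n w) + S n w))"
  unfolding S_def by (intro vanish_in_prob_mult[OF bounded_in_prob_const] vanish_in_prob_sum vanish_in_prob_add vanish_in_prob_abs
   sqrt_scaled_vanish[OF sb] contrast_vanish[OF c0] contrast_vanish[OF sel])
 then have dv: "vanish_in_prob M ?d"
  by (rule vanish_in_prob_mono) (intro always_eventually allI ballI, simp only: abs_of_nonneg[OF zero_le_dist] order_trans[OF le abs_ge_self])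
 have "bounded_in_prob M (%n w. ?s n * ?Q k n w)" for k
 proof -
  have "vanish_in_prob M (%n w. dist \<gamma>0 \<gamma>0)" by (rule vanish_in_prob_tendsto) simp
  then obtain B V where B: "bounded_in_prob M B" "\<forall>\<^sub>F n in sequentially. ALL w:space M. abs (?s n * ?Q k n w) <= B n w + V n w * (?s n * dist \<gamma>0 \<gamma>0)"
   using contrast_rate[OF c0, where k=k] by blast
  show ?thesis by (rule bounded_in_prob_mono[OF B(1)]) (use B(2) in "eventually_elim, fastforce")
 qed
 moreover have "bounded_in_prob M (%n w. ?s n * abs (Y n w))" if "bounded_in_prob M (%n w. ?s n * Y n w)" for Y :: "nat => 'w => real"
  by (rule bounded_in_prob_mono[OF that]) (simp add: abs_mult)
 ultimately have Sb: "bounded_in_prob M (%n w. ?s n * S n w)"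
  unfolding S_def distrib_left sum_distrib_left using sb by (intro bounded_in_prob_add bounded_in_prob_sum) auto
 define Q where "Q k B V \<longleftrightarrow> bounded_in_prob M B & vanish_in_prob M V &
  (\<forall>\<^sub>F n in sequentially. ALL w:space M. abs (?s n * ?R k n w) <= B n w + V n w * (?s n * ?d n w))" for k B V
 have "EX B V. Q k B V" for k unfolding Q_def by (rule contrast_rate[OF _ _ dv]) (use sel in auto)
 then obtain B V where "!!k. Q k (B k) (V k)" by metis
 then have BV: "!!k. bounded_in_prob M (B k)" "!!k. vanish_in_prob M (V k)"
  "!!k. \<forall>\<^sub>F n in sequentially. ALL w:space M. abs (?s n * ?R k n w) <= B k n w + V k n w * (?s n * ?d n w)"
  by (simp_all add: Q_def)
 have ev: "\<forall>\<^sub>F n in sequentially. ALL k. ALL w:space M. abs (?s n * ?R k n w) <= B k n w + V k n w * (?s n * ?d n w)"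
  using BV(3) by (rule eventually_all_finite)
 show ?thesis
 proof (rule bounded_in_prob_absorb[where B="%n w. 1 / \<eta> * (\<Sum>k\<in>UNIV. B k n w + ?s n * S n w)" and V="%n w. 1 / \<eta> * (\<Sum>k\<in>UNIV. V k n w)"])
  show "\<forall>\<^sub>F n in sequentially. ALL w:space M. 0 <= ?s n * ?d n w &
    ?s n * ?d n w <= abs (1 / \<eta> * (\<Sum>k\<in>UNIV. B k n w + ?s n * S n w)) + abs (1 / \<eta> * (\<Sum>k\<in>UNIV. V k n w)) * (?s n * ?d n w)"
   using ev
  proof (eventually_elim, intro ballI)
   fix n w assume e: "ALL k. ALL w:space M. abs (?s n * ?R k n w) <= B k n w + V k n w * (?s n * ?d n w)" and w: "w : space M"
   have s: "0 <= ?s n" and p: "0 <= ?s n * ?d n w" using h_pos[of n] by simp_all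
   have "?s n * ?d n w <= ?s n * (1 / \<eta> * (\<Sum>k\<in>(UNIV :: 'p set). abs (?R k n w) + S n w))" using le[OF w] s by (rule mult_left_mono)
   also have "... = 1 / \<eta> * (\<Sum>k\<in>(UNIV :: 'p set). abs (?s n * ?R k n w) + ?s n * S n w)"
    unfolding mult.left_commute[of "?s n"] sum_distrib_left[of "?s n"] distrib_left[of "?s n"] abs_mult abs_of_nonneg[OF s] ..
   also have "... <= 1 / \<eta> * (\<Sum>k\<in>UNIV. (B k n w + V k n w * (?s n * ?d n w)) + ?s n * S n w)"
    using e w \<eta>(1) by (intro mult_left_mono sum_mono add_right_mono) auto
   also have "... = 1 / \<eta> * (\<Sum>k\<in>UNIV. B k n w + ?s n * S n w) + 1 / \<eta> * (\<Sum>k\<in>UNIV. V k n w) * (?s n * ?d n w)"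
    by (simp only: sum.distrib sum_distrib_right distrib_left mult.assoc)
   also have "... <= abs (1 / \<eta> * (\<Sum>k\<in>UNIV. B k n w + ?s n * S n w)) + abs (1 / \<eta> * (\<Sum>k\<in>UNIV. V k n w)) * (?s n * ?d n w)"
    by (intro add_mono mult_right_mono p abs_ge_self)
   finally show "0 <= ?s n * ?d n w & ?s n * ?d n w <= abs (1 / \<eta> * (\<Sum>k\<in>UNIV. B k n w + ?s n * S n w)) + abs (1 / \<eta> * (\<Sum>k\<in>UNIV. V k n w)) * (?s n * ?d n w)"
    using p by simp
  qed
 qed (intro bounded_in_prob_mult bounded_in_prob_const bounded_in_prob_sum bounded_in_prob_add BV Sb vanish_in_prob_mult vanish_in_prob_sum)+
qed

section \<open>Moment-fitting function and sampling design\<close>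

lemma vderiv_power2: "(vderiv ^^ 2) f = vderiv (vderiv f)"
 by (simp add: numeral_2_eq_2)

text \<open>The limsup condition at 0 bounds the derivative of \<open>\<phi>\<close> by a multiple
  of \<open>|z|\<close>, so by continuity it vanishes at 0; this makes \<open>\<zeta>\<close>
  quadratic near 0. The growth bound of the second derivative is a supremum over the whole line and
  carries over directly.\<close>

lemma moment_fitting_derivatives:
 fixes \<phi> :: "real => real ^ 'q::finite"
 assumes "\<phi> : moment_fitting_class \<rho>"
 shows "((%z. \<phi> z $ k) has_real_derivative vderiv \<phi> z $ k) (at z)"
  "((%z. vderiv \<phi> z $ k) has_real_derivative (vderiv ^^ 2) \<phi> z $ k) (at z)"
  "EX K N. ALL z. abs ((vderiv ^^ 2) \<phi> z $ k) <= K * (1 + abs z) ^ N" "vderiv \<phi> 0 = 0"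
proof -
 have d: "(vderiv ^^ i) \<phi> differentiable (at z)" if "i < 5" for i z using assms that by (simp add: moment_fitting_class_def)
 have v: "(f has_vector_derivative vderiv f z) (at z)" if "f differentiable (at z)" for f :: "real => real ^ 'q" and z
  using that vector_derivative_works unfolding vderiv_def by blast
 have c: "((%z. f z $ k) has_real_derivative vderiv f z $ k) (at z)" if "f differentiable (at z)" for f :: "real => real ^ 'q" and z
  using bounded_linear.has_vector_derivative[OF bounded_linear_vec_nth v[OF that], of k] by (simp add: has_real_derivative_iff_has_vector_derivative)
 show "((%z. \<phi> z $ k) has_real_derivative vderiv \<phi> z $ k) (at z)" using c d[of 0] by simp
 show "((%z. vderiv \<phi> z $ k) has_real_derivative (vderiv ^^ 2) \<phi> z $ k) (at z)" using c d[of 1] by (simp add: vderiv_power2)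
 obtain C :: "nat => real" where C: "C 2 >= 0" "Limsup (at 0) (%z. ereal (abs z powr (- \<rho>) * norm (\<phi> z) + norm (vderiv \<phi> z) / abs z)) < \<infinity>" (is "?L < _")
   "(SUP z. ereal (norm ((vderiv ^^ 2) \<phi> z) / (1 + abs z powr C 2))) < \<infinity>" (is "?S < _")
  using assms unfolding moment_fitting_class_def mem_Collect_eq
  by (elim conjE exE) (drule bspec[of "{2..5}" _ "2 :: nat"], simp, rule that, simp_all)
 obtain B where B: "?S <= ereal B" using C(3) by (cases ?S) auto
 have "abs ((vderiv ^^ 2) \<phi> z $ k) <= (2 * max 0 B) * (1 + abs z) ^ nat \<lceil>C 2\<rceil>" for z
 proof -
  have "ereal (norm ((vderiv ^^ 2) \<phi> z) / (1 + abs z powr C 2)) <= ereal B" by (rule order_trans[OF SUP_upper B]) simp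
  moreover have p: "1 + abs z powr C 2 > 0" by (simp add: add_pos_nonneg)
  ultimately have "norm ((vderiv ^^ 2) \<phi> z) <= B * (1 + abs z powr C 2)" by (simp add: divide_le_eq)
  also have "... <= max 0 B * (2 * (1 + abs z) ^ nat \<lceil>C 2\<rceil>)" using p powr_le_power[of "C 2" z] C(1) by (intro mult_mono) auto
  finally show ?thesis using component_le_norm_cart[of "(vderiv ^^ 2) \<phi> z" k] by simp
 qed
 then show "EX K N. ALL z. abs ((vderiv ^^ 2) \<phi> z $ k) <= K * (1 + abs z) ^ N" by blast
 obtain L where "?L < ereal L" using less_PInf_Ex_of_nat[THEN iffD1, of ?L] C(2) by auto
 then have ev: "\<forall>\<^sub>F z in at 0. ereal (abs z powr (- \<rho>) * norm (\<phi> z) + norm (vderiv \<phi> z) / abs z) < ereal L" by (rule Limsup_lessD)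
 have "((%z. norm (vderiv \<phi> z)) \<longlongrightarrow> 0) (at 0)"
 proof (rule tendsto_sandwich[where f="%_. 0" and h="%z. L * abs z"])
  show "\<forall>\<^sub>F z in at 0. norm (vderiv \<phi> z) <= L * abs z"
   using ev eventually_neq_at_within[of 0 0 UNIV]
  proof (eventually_elim)
   case (elim z)
   have "norm (vderiv \<phi> z) / abs z <= abs z powr (- \<rho>) * norm (\<phi> z) + norm (vderiv \<phi> z) / abs z" by simp
   also have "... < L" using elim(1) by simp
   finally show ?case using elim(2) by (simp add: divide_less_eq less_imp_le)
  qed
 qed (auto intro!: tendsto_eq_intros)
 then have "(vderiv \<phi> \<longlongrightarrow> 0) (at 0)" by (rule tendsto_norm_zero_cancel)
 moreover have "isCont (vderiv \<phi>) 0" using d[of 1 0] by (simp add: differentiable_imp_continuous_within)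
 ultimately show "vderiv \<phi> 0 = 0" using tendsto_unique[OF at_neq_bot] unfolding isCont_def by blast
qed

text \<open>Eventually \<open>n h^2 < 1\<close>, which forces \<open>h < 1\<close>. Then
  \<open>h powr (1 + \<epsilon>) <= h\<close>, so \<open>n h\<close> dominates a divergent
  sequence.\<close>

lemma sampling_design:
 fixes h :: "nat => real"
 assumes h: "!!n. h n > 0" and A1: "(%n. real n * (h n)^2) \<longlonglongrightarrow> 0" "0 < \<epsilon>" "filterlim (%n. real n * h n powr (1 + \<epsilon>)) at_top sequentially"
 shows "filterlim (%n. real n * h n) at_top sequentially" "\<forall>\<^sub>F n in sequentially. h n <= 1 & 1 <= real n * h n"
proof -
 have "\<forall>\<^sub>F n in sequentially. real n * (h n)^2 < 1" using A1(1) by (rule order_tendstoD) simp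
 then have h1: "\<forall>\<^sub>F n in sequentially. h n <= 1"
  using eventually_ge_at_top[of 1]
 proof eventually_elim
  case (elim n)
  have "1 * (h n)^2 <= real n * (h n)^2" using elim(2) by (intro mult_right_mono) auto
  then have "(h n)^2 < 1^2" using elim(1) by simp
  from power_less_imp_less_base[OF this] show ?case by simp
 qed
 show N: "filterlim (%n. real n * h n) at_top sequentially"
 proof (rule filterlim_at_top_mono[OF A1(3)], use h1 in eventually_elim)
  fix n assume "h n <= 1"
  then have "h n powr (1 + \<epsilon>) <= h n powr 1" using h[of n] A1(2) by (intro powr_mono') auto
  then show "real n * h n powr (1 + \<epsilon>) <= real n * h n" using h[of n] by (simp add: mult_left_mono)
 qed
 have "\<forall>\<^sub>F n in sequentially. 1 <= real n * h n" using N by (simp add: filterlim_at_top)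
 with h1 show "\<forall>\<^sub>F n in sequentially. h n <= 1 & 1 <= real n * h n" by eventually_elim simp
qed

theorem theorem3p1:
  fixes M :: "'w measure" and F :: "real \<Rightarrow> 'w measure"
    and J X :: "real \<Rightarrow> 'w \<Rightarrow> real" and \<nu>0 \<pi>0 :: "real measure"
    and P :: "real \<Rightarrow> real \<Rightarrow> real measure"
    and \<Theta>\<^sub>\<alpha> :: "(real ^ 'pa::finite) set" and \<Theta>\<^sub>\<gamma> :: "(real ^ 'pg::finite) set"
    and a :: "real \<Rightarrow> real ^ 'pa \<Rightarrow> real" and c :: "real \<Rightarrow> real ^ 'pg \<Rightarrow> real"
    and \<alpha>0 :: "real ^ 'pa" and \<gamma>0 :: "real ^ 'pg"
    and h :: "nat \<Rightarrow> real" and \<epsilon>0 \<rho> :: real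
    and \<phi> :: "real \<Rightarrow> real ^ 'q::finite"
    and \<alpha>hat :: "nat \<Rightarrow> 'w \<Rightarrow> real ^ 'pa" and \<gamma>hat :: "nat \<Rightarrow> 'w \<Rightarrow> real ^ 'pg"
  defines "obs \<equiv> (\<lambda>n \<omega> j. X (real j * h n) \<omega>)"
  defines "u \<equiv> (\<lambda>n \<omega>. u_stat \<phi> \<nu>0 n (h n)
      (\<lambda>j. J (real j * h n) \<omega> - J (real (j - 1) * h n) \<omega>))"
  defines "uhat \<equiv> (\<lambda>n \<omega>. u_stat \<phi> \<nu>0 n (h n)
      (residual \<Theta>\<^sub>\<alpha> \<Theta>\<^sub>\<gamma> a c (h n) (obs n \<omega>) (\<alpha>hat n \<omega>) (\<gamma>hat n \<omega>)))"
  defines "bhat \<equiv> (\<lambda>n \<omega>. b_hat \<Theta>\<^sub>\<alpha> \<Theta>\<^sub>\<gamma> a c \<phi> n (h n) (obs n \<omega>) (\<alpha>hat n \<omega>) (\<gamma>hat n \<omega>))"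
  defines "what \<equiv> (\<lambda>n \<omega>. sqrt (real n * h n) *\<^sub>R (\<gamma>hat n \<omega> - \<gamma>0))"
  assumes filt: "complete_filtered_prob_space M F"
    and levy: "pure_jump_levy_process M F \<nu>0 J"
    and init: "process_indep_var M J (X 0)"
    and dom_\<alpha>: "\<Theta>\<^sub>\<alpha> \<noteq> {}" "open \<Theta>\<^sub>\<alpha>" "convex \<Theta>\<^sub>\<alpha>" "bounded \<Theta>\<^sub>\<alpha>"
    and dom_\<gamma>: "\<Theta>\<^sub>\<gamma> \<noteq> {}" "open \<Theta>\<^sub>\<gamma>" "convex \<Theta>\<^sub>\<gamma>" "bounded \<Theta>\<^sub>\<gamma>"
    and true_par: "\<alpha>0 \<in> \<Theta>\<^sub>\<alpha>" "\<gamma>0 \<in> \<Theta>\<^sub>\<gamma>"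
    and sde: "sde_solution M F J (\<lambda>x. a x \<alpha>0) (\<lambda>x. c x \<gamma>0) X"
    and step_pos: "\<And>n. h n > 0"
    and A1: "(\<lambda>n. real n * (h n)\<^sup>2) \<longlonglongrightarrow> 0" "0 < \<epsilon>0" "\<epsilon>0 < 1"
      "filterlim (\<lambda>n. real n * h n powr (1 + \<epsilon>0)) at_top sequentially"
    and A2: "(LINT \<omega>|M. J 1 \<omega>) = 0" "(LINT \<omega>|M. (J 1 \<omega>)\<^sup>2) = 1"
      "\<And>r. r > 0 \<Longrightarrow> integrable M (\<lambda>\<omega>. \<bar>J 1 \<omega>\<bar> powr r)"
    and A3: "cond_smoothness \<Theta>\<^sub>\<alpha> \<Theta>\<^sub>\<gamma> a c \<alpha>0 \<gamma>0"
    and A4: "is_transition_probability M F X P" "cond_stability M X P \<pi>0"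
    and A5: "cond_identifiability \<Theta>\<^sub>\<alpha> \<Theta>\<^sub>\<gamma> a c \<pi>0 \<alpha>0 \<gamma>0"
    and A6: "invertible (info_alpha a c \<pi>0 \<alpha>0 \<gamma>0)" "invertible (info_gamma c \<pi>0 \<gamma>0)"
    and A7: "\<rho> > max (1 - \<epsilon>0) (blumenthal_getoor \<nu>0)" "\<phi> \<in> moment_fitting_class \<rho>"
    and est_meas: "\<And>n. \<alpha>hat n \<in> borel_measurable M" "\<And>n. \<gamma>hat n \<in> borel_measurable M"
    and est: "\<And>n \<omega>. \<omega> \<in> space M \<Longrightarrow>
      is_arg_min
        (\<lambda>(\<alpha>, \<gamma>). norm (G_alpha \<Theta>\<^sub>\<alpha> \<Theta>\<^sub>\<gamma> a c n (h n) (obs n \<omega>) \<alpha> \<gamma>,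
                        G_gamma \<Theta>\<^sub>\<alpha> \<Theta>\<^sub>\<gamma> a c n (h n) (obs n \<omega>) \<alpha> \<gamma>))
        (\<lambda>\<theta>. \<theta> \<in> closure (\<Theta>\<^sub>\<alpha> \<times> \<Theta>\<^sub>\<gamma>)) (\<alpha>hat n \<omega>, \<gamma>hat n \<omega>)"
  shows "small_in_prob M (\<lambda>n \<omega>. uhat n \<omega> - (u n \<omega> + bhat n \<omega> *v what n \<omega>))"
proof -
 interpret prob_space M using filt by (simp add: complete_filtered_prob_space_def)
 note partials.simps [simp del]
 let ?cb = "%x. bval \<Theta>\<^sub>\<gamma> (c x)" and ?ab = "%x. bval \<Theta>\<^sub>\<alpha> (a x)" and ?gb = "%k x. bval \<Theta>\<^sub>\<gamma> (partials [k] (c x))"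
 let ?D\<alpha> = "closure \<Theta>\<^sub>\<alpha>" and ?D\<gamma> = "closure \<Theta>\<^sub>\<gamma>"
 note sc = scale_smooth[OF A3 dom_\<alpha>(1-3) dom_\<gamma>(1-3)] and dr = drift_smooth[OF A3 dom_\<alpha>(1-3) dom_\<gamma>(1-3)]
 have cl: "\<alpha>0 : ?D\<alpha>" "\<gamma>0 : ?D\<gamma>" using true_par closure_subset by blast+
 have ti: "?cb x \<gamma>0 = c x \<gamma>0" "?ab x \<alpha>0 = a x \<alpha>0" for x using true_par by (simp_all add: bval_interior)
 obtain L where L: "L-lipschitz_on UNIV (%x. c x \<gamma>0)" using A3 unfolding cond_smoothness_def by blast
 obtain La where La: "La-lipschitz_on UNIV (%x. a x \<alpha>0)" using A3 unfolding cond_smoothness_def by blast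
 have sub: "!!t. 0 <= t ==> subalgebra M (F t)" and mono: "!!s t. 0 <= s ==> s <= t ==> sets (F s) \<subseteq> sets (F t)"
  using filt unfolding complete_filtered_prob_space_def by auto
 have lp: "levy_process M F J" using levy by (simp add: pure_jump_levy_process_def)
 have X: "adapted F X" "AE w in M. cadlag (%t. X t w)" using sde by (auto simp: sde_solution_def)
 have "X t : borel_measurable M" if "0 <= t" for t
  by (rule measurable_from_subalg[OF sub[OF that]]) (use X(1) that in "simp add: adapted_def")
 note Xm = stability_moments[OF A4(2) this]
 have taylor: "EX K N. K >= 0 & (ALL x. ALL \<gamma>:?D\<gamma>. abs (?cb x \<gamma>0 - ?cb x \<gamma> - (\<Sum>k\<in>UNIV. (\<gamma>0 - \<gamma>) $ k * ?gb k x \<gamma>)) <= K * (1 + abs x) ^ N * (dist \<gamma>0 \<gamma>)^2)"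
  using sc(8) true_par(2) by blast
 interpret parametric_sde M F J X ?cb \<gamma>0 L ?ab \<alpha>0 La P \<pi>0 h ?D\<alpha> ?D\<gamma> ?gb
  by unfold_locales (use sub mono lp A2 X Xm L La sde A4 step_pos sampling_design[OF step_pos A1(1,2,4)] cl dr(1) sc(1-4) taylor sc(9,10)[OF true_par(2)] A1(1) dom_\<gamma>(4)
   in "simp_all add: ti bounded_closure")
 have sel: "!!n w. w : space M ==> \<alpha>hat n w : ?D\<alpha>" "!!n w. w : space M ==> \<gamma>hat n w : ?D\<gamma>"
  using est by (auto simp: is_arg_min_def closure_Times)
 have ob: "obs_x (n, j) w = obs n w (j - 1)" for n j w by (simp add: obs_x_def obs_def)
 have di: "drift_increment \<Theta>\<^sub>\<alpha> a (h n) (obs n w) \<alpha> j = drift_inc n j \<alpha> w" for n j \<alpha> w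
  by (simp add: drift_increment_def drift_inc_def ob) (simp add: obs_def)
 have Gg: "G_gamma \<Theta>\<^sub>\<alpha> \<Theta>\<^sub>\<gamma> a c n (h n) (obs n w) \<alpha> \<gamma> $ k = contrast k n \<alpha> \<gamma> w" if \<gamma>: "\<gamma> : ?D\<gamma>" for n w \<alpha> \<gamma> k
 proof -
  have "h n / (?cb x \<gamma>)^2 * (2 * ?cb x \<gamma> * ?gb k x \<gamma>) = weight k x \<gamma> * (h n * (?cb x \<gamma>)^2)"
   "2 * ?gb k x \<gamma> / ?cb x \<gamma> ^ 3 = weight k x \<gamma>" for x
   using sc(3)[OF \<gamma>, of x] by (simp_all add: weight_def divide_simps power2_eq_square power3_eq_cube)
  then show ?thesis
   by (simp add: G_gamma_def contrast_def sc(6,7)[OF \<gamma>] ob di right_diff_distrib mult.commute)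
 qed
 \<comment> \<open>Coordinates of the drift gradient divided by the squared scale, all at the true
   parameter: the drift estimating function is evaluated only there.\<close>
 let ?u = "%i x. partials [i] (a x) \<alpha>0 * (inverse (?cb x \<gamma>0) * inverse (?cb x \<gamma>0))"
 have Ga: "G_alpha \<Theta>\<^sub>\<alpha> \<Theta>\<^sub>\<gamma> a c n (h n) (obs n w) \<alpha>0 \<gamma>0 $ i = score (?u i) n w" for n w i
  using true_par by (simp add: G_alpha_def score_def di ob bval_interior gradient_def divide_inverse[of _ "_ * _"] power2_eq_square mult_ac)
 have u: "EX N A. poly_le N A (?u i)" for i
 proof -
  obtain N A where "poly_le N A (%x. partials [i] (a x) \<alpha>0)" using dr(2)[of i] true_par(1) unfolding poly_lipschitz_def by blast
  then have "poly_lipschitz ?D\<gamma> (%x \<gamma>. partials [i] (a x) \<alpha>0 * (inverse (?cb x \<gamma>) * inverse (?cb x \<gamma>)))"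
   by (intro poly_lipschitz_mult poly_lipschitz_const icb)
  then show ?thesis using cl(2) unfolding poly_lipschitz_def by blast
 qed
 have ineq: "abs (contrast k n (\<alpha>hat n w) (\<gamma>hat n w) w) <= (\<Sum>i\<in>UNIV. abs (score (?u i) n w)) + (\<Sum>k\<in>UNIV. abs (contrast k n \<alpha>0 \<gamma>0 w))"
  if w: "w : space M" for n w k
 proof -
  let ?A = "%\<alpha> \<gamma>. G_alpha \<Theta>\<^sub>\<alpha> \<Theta>\<^sub>\<gamma> a c n (h n) (obs n w) \<alpha> \<gamma>" and ?G = "%\<alpha> \<gamma>. G_gamma \<Theta>\<^sub>\<alpha> \<Theta>\<^sub>\<gamma> a c n (h n) (obs n w) \<alpha> \<gamma>"
  let ?a = "\<alpha>hat n w" and ?g = "\<gamma>hat n w"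
  have "abs (?G ?a ?g $ k) <= norm (?G ?a ?g)" by (rule component_le_norm_cart)
  also have "... <= norm (?A ?a ?g, ?G ?a ?g)" by (simp add: norm_Pair)
  \<comment> \<open>The true parameter competes in the minimisation. On the side of the estimator
    only the scale block of the estimating function is retained.\<close>
  also have "... <= norm (?A \<alpha>0 \<gamma>0, ?G \<alpha>0 \<gamma>0)"
   using est[OF w, of n] cl by (force simp: is_arg_min_def closure_Times not_less)
  also have "... <= norm (?A \<alpha>0 \<gamma>0) + norm (?G \<alpha>0 \<gamma>0)" by (rule norm_Pair_le)
  also have "... <= (\<Sum>i\<in>UNIV. abs (?A \<alpha>0 \<gamma>0 $ i)) + (\<Sum>k\<in>UNIV. abs (?G \<alpha>0 \<gamma>0 $ k))" by (intro add_mono norm_le_l1_cart)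
  finally show ?thesis by (simp only: Ga Gg[OF cl(2)] Gg[OF sel(2)[OF w]])
 qed
 obtain \<eta> where \<eta>: "\<eta> > 0" "!!\<gamma>. \<gamma> : \<Theta>\<^sub>\<gamma> ==> \<eta> * norm (\<gamma> - \<gamma>0) <= norm (G_inf_gamma c \<pi>0 \<gamma>0 \<gamma>)"
  using A5 true_par(1) unfolding cond_identifiability_def by metis
 have cont: "continuous_on ?D\<gamma> (contrast_limit k)" for k
  unfolding contrast_limit_def[abs_def] by (intro stationary_mean_continuous poly_lipschitz_mult weight_pl square_diff_pl)
 have Gi: "G_inf_gamma c \<pi>0 \<gamma>0 \<gamma> $ k = contrast_limit k \<gamma>" if \<gamma>: "\<gamma> : \<Theta>\<^sub>\<gamma>" for \<gamma> k
 proof -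
  have \<gamma>c: "\<gamma> : ?D\<gamma>" using \<gamma> closure_subset by blast
  let ?f = "%k x. weight k x \<gamma> * ((?cb x \<gamma>0)^2 - (?cb x \<gamma>)^2)"
  have i: "integrable \<pi>0 (?f k)" for k
  proof -
   have "poly_lipschitz ?D\<gamma> (%x \<gamma>. weight k x \<gamma> * ((?cb x \<gamma>0)^2 - (?cb x \<gamma>)^2))" by (intro poly_lipschitz_mult weight_pl square_diff_pl)
   then show ?thesis using \<gamma>c poly_\<pi>0_integrable unfolding poly_lipschitz_def by blast
  qed
  \<comment> \<open>The vector-valued integral is split along the standard basis, so that
    integrability of the scalar coordinates suffices.\<close>
  have ax: "(\<Sum>k\<in>UNIV. r k *\<^sub>R axis k 1) = (\<chi> k. r k)" for r :: "'pg => real"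
   using basis_expansion[of "\<chi> k. r k"] by (simp add: scalar_mult_eq_scaleR)
  have "((c x \<gamma>0)^2 - (c x \<gamma>)^2) / c x \<gamma> ^ 3 * partials [k] (c x) \<gamma> = ?f k x / 2" for x k
   using \<gamma> true_par by (simp add: weight_def bval_interior divide_inverse[of _ "c x \<gamma> ^ 3"] power_inverse)
  then have "(((c x \<gamma>0)^2 - (c x \<gamma>)^2) / c x \<gamma> ^ 3) *\<^sub>R gradient (c x) \<gamma> = (\<Sum>k\<in>UNIV. (?f k x / 2) *\<^sub>R axis k 1)" for x
   unfolding ax by (simp add: vec_eq_iff gradient_def)
  then have "G_inf_gamma c \<pi>0 \<gamma>0 \<gamma> = 2 *\<^sub>R (\<Sum>k\<in>UNIV. ((LINT x|\<pi>0. ?f k x) / 2) *\<^sub>R axis k 1)"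
   unfolding G_inf_gamma_def using i by (simp only:) (simp add: Bochner_Integration.integral_sum)
  then show ?thesis unfolding ax by (simp add: contrast_limit_def)
 qed
 \<comment> \<open>Identifiability is given on the open set, but the estimator ranges over the
   closure; continuity of the limit contrast closes the gap.\<close>
 have ident: "\<eta> * dist \<gamma> \<gamma>0 <= (\<Sum>k\<in>UNIV. abs (contrast_limit k \<gamma>))" if "\<gamma> : ?D\<gamma>" for \<gamma>
 proof (rule closure_le[OF _ _ _ that])
  show "\<eta> * dist \<gamma> \<gamma>0 <= (\<Sum>k\<in>UNIV. abs (contrast_limit k \<gamma>))" if "\<gamma> : \<Theta>\<^sub>\<gamma>" for \<gamma>
   using \<eta>(2)[OF that] norm_le_l1_cart[of "G_inf_gamma c \<pi>0 \<gamma>0 \<gamma>"] by (simp add: dist_norm Gi[OF that])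
 qed (intro continuous_intros cont)+
 note rate = estimator_rate[OF sel u ineq \<eta>(1) ident]
 define R where "R n w = uhat n w - (u n w + bhat n w *v what n w)" for n w
 define \<delta> where "\<delta> n j w = drift_inc n j (\<alpha>hat n w) w / ?cb (obs_x (n, j) w) (\<gamma>hat n w)" for n j w
 have res: "residual \<Theta>\<^sub>\<alpha> \<Theta>\<^sub>\<gamma> a c (h n) (obs n w) (\<alpha>hat n w) (\<gamma>hat n w) j = \<delta> n j w" for n j w
  by (simp add: residual_def \<delta>_def di ob)
 let ?E = "%k n w. sqrt (real n * h n) * (1 / (real n * h n) * (\<Sum>j=1..n. \<phi> (\<delta> n j w) $ k) - 1 / (real n * h n) * (\<Sum>j=1..n. \<phi> (obs_w (n, j) w) $ k)) +
  1 / (real n * h n) * (\<Sum>j=1..n. \<delta> n j w * vderiv \<phi> (\<delta> n j w) $ k) *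
  (\<Sum>i\<in>UNIV. 1 / real n * (\<Sum>j=1..n. ?gb i (obs_x (n, j) w) (\<gamma>hat n w) * inverse (?cb (obs_x (n, j) w) (\<gamma>hat n w))) * (sqrt (real n * h n) * (\<gamma>hat n w - \<gamma>0) $ i))"
 have RE: "R n w $ k = ?E k n w" if w: "w : space M" for n w k
 proof -
  define v where "v = 1 / (real n * h n) * (\<Sum>j=1..n. \<delta> n j w * vderiv \<phi> (\<delta> n j w) $ k)"
  define m where "m i = 1 / real n * (\<Sum>j=1..n. ?gb i (obs_x (n, j) w) (\<gamma>hat n w) * inverse (?cb (obs_x (n, j) w) (\<gamma>hat n w)))" for i
  have "bhat n w $ k $ i = - (v * m i)" for i
   by (simp add: bhat_def b_hat_def outer_def res Let_def v_def m_def sc(5)[OF sel(2)[OF w]] ob divide_inverse[of _ "bval _ _ _"] mult.commute)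
  then have "(bhat n w *v what n w) $ k = - (v * (\<Sum>i\<in>UNIV. m i * (sqrt (real n * h n) * (\<gamma>hat n w - \<gamma>0) $ i)))"
   by (simp add: matrix_vector_mult_def what_def sum_distrib_left sum_negf mult_ac)
  \<comment> \<open>The centring by the integral of \<open>\<phi>\<close> is the same in both
    statistics and cancels.\<close>
  moreover have "(uhat n w - u n w) $ k = sqrt (real n * h n) * (1 / (real n * h n) * (\<Sum>j=1..n. \<phi> (\<delta> n j w) $ k) - 1 / (real n * h n) * (\<Sum>j=1..n. \<phi> (obs_w (n, j) w) $ k))"
   by (simp add: uhat_def u_def u_stat_def res obs_w_def algebra_simps)
  ultimately show ?thesis unfolding R_def v_def[symmetric] m_def[symmetric] by simp
 qed
 have E: "vanish_in_prob M (?E k)" for k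
 proof -
  note md = moment_fitting_derivatives[OF A7(2)]
  obtain K N where "!!z. abs ((vderiv ^^ 2) \<phi> z $ k) <= K * (1 + abs z) ^ N" using md(3) by blast
  then show ?thesis unfolding \<delta>_def by (intro statistic_expansion[OF sel md(1,2) _ _ rate]) (simp_all add: md(4))
 qed
 have "R n : borel_measurable M" for n
  unfolding borel_measurable_euclidean_space[of "R n"]
 proof
  fix b :: "real ^ 'q" assume "b : Basis"
  then obtain k where b: "b = axis k 1" by (auto simp: Basis_vec_def)
  note md = moment_fitting_derivatives(1,2)[OF A7(2), of k]
  have "continuous_on UNIV (%z. \<phi> z $ k)" "continuous_on UNIV (%z. vderiv \<phi> z $ k)"
   using md(1,2) DERIV_isCont by (blast intro: continuous_at_imp_continuous_on)+
  then have [measurable]: "(%z. \<phi> z $ k) : borel_measurable borel" "(%z. vderiv \<phi> z $ k) : borel_measurable borel"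
   by (auto intro: borel_measurable_continuous_onI)
  have t: "0 <= real j * h n" for j using step_pos[of n] by simp
  note [measurable] = X_meas[OF t] J_meas[OF t] est_meas
  have ox [measurable]: "obs_x (n, j) : borel_measurable M" "obs_w (n, j) : borel_measurable M" for j
   unfolding obs_x_def obs_w_def fst_conv snd_conv by measurable
  \<comment> \<open>Coefficients are evaluated at a random state and a random parameter at once;
    Lipschitz dependence on the parameter makes the composition measurable.\<close>
  note cm = poly_lipschitz_compose_measurable[OF _ ox(1) est_meas(1) sel(1)] poly_lipschitz_compose_measurable[OF _ ox(1) est_meas(2) sel(2)]
  note [measurable] = cm(1)[OF ab] cm(2)[OF cb] cm(2)[OF icb] cm(2)[OF gb]
  have [measurable]: "\<delta> n j : borel_measurable M" for j unfolding \<delta>_def drift_inc_def by measurable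
  have [measurable]: "(%w. (\<gamma>hat n w - \<gamma>0) $ i) : borel_measurable M" for i
   by (rule measurable_compose[OF _ borel_measurable_continuous_onI[OF linear_continuous_on[OF bounded_linear_vec_nth]]]) measurable
  have "?E k n : borel_measurable M" by measurable
  then show "(%w. R n w \<bullet> b) : borel_measurable M"
   by (rule measurable_cong[THEN iffD1, rotated]) (simp add: b inner_axis RE)
 qed
 moreover have "vanish_in_prob M (%n w. norm (R n w))"
 proof (rule vanish_in_prob_mono[OF vanish_in_prob_sum[of UNIV "%k n w. abs (?E k n w)"]], goal_cases)
  case (1 k)
  show ?case by (rule vanish_in_prob_mono[OF E[of k]]) (auto intro!: always_eventually)
 next
  case 2
  show ?case
  proof (intro always_eventually allI ballI)
   fix n w assume "w : space M"
   then show "abs (norm (R n w)) <= abs (\<Sum>k\<in>UNIV. abs (?E k n w))"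
    using norm_le_l1_cart[of "R n w"] by (simp only: RE[symmetric] abs_norm_cancel order_trans[OF _ abs_ge_self])
  qed
 qed
 ultimately show ?thesis unfolding R_def by (rule small_in_probI)
qed

end
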